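(* (PAGE+EXTRA, online scenario.) Assume (A1)–(A3) of the context and that $W$ is symmetric, doubly stochastic, primitive and positive semidefinite. Run DAMA with the EXTRA matrices $\mathcal A_x=I$, $\mathcal B_x=(I-W\otimes I_{d_1})^{1/2}$, $\mathcal C_x=W\otimes I_{d_1}$ (and the same with $d_2$ for $y$), $\beta_x=\beta_y=0$, and $$B=\mathcal O\Big(\frac{(1-\lambda)^{1.5}T}K\Big),\ b=b_0=\mathcal O\Big(\frac{(1-\lambda)^{3/4}T^{1/2}}K\Big),\ p=\mathcal O\Big(\frac1{(1-\lambda)^{3/4}T^{1/2}}\Big),\ \mu_x=\Theta\Big(\frac{(1-\lambda)^{1.5}}{\kappa^2}\Big),\ \mu_y=\Theta((1-\lambda)^{1.5}).$$ Then for sufficiently large $T$ and small $1-\lambda$, $$\frac1T\sum_{i=0}^{T-1}\big(\mathbb E\|\nabla_xJ(x_{c,i},y_{c,i})\|^2+\mathbb E\|\nabla_yJ(x_{c,i},y_{c,i})\|^2\big)\le\mathcal O\Big(\frac{\kappa^2\mathbb EG_{p,0}}{T(1-\lambda)^{1.5}}+\frac{\kappa^2\mathbb E\Delta_{c,0}}{T(1-\lambda)^{1.5}}+\frac{\kappa^2\sigma^2}{T(1-\lambda)^{1.5}}+\frac{\kappa^2\zeta_0^2(1-\lambda)}T+\frac{\kappa^2\sigma^2}T+\frac{\kappa^2K\sigma^2}{(1-\lambda)^{9/4}T^{3/2}}+\frac{\kappa^2K(1-\lambda)^{5/4}\zeta_0^2}{T^{3/2}}\Big).$$ The communication complexity and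 sample complexity for achieving an $\varepsilon$-stationary point are $$T=\mathcal O\Big(\frac{\kappa^2\varepsilon^{-2}}{(1-\lambda)^{1.5}}+\kappa^2\varepsilon^{-2}+\kappa^2\varepsilon^{-2}(1-\lambda)\Big)=\mathcal O\Big(\frac{\kappa^2\varepsilon^{-2}}{(1-\lambda)^{1.5}}\Big)\quad\text{and}\quad\mathcal O\Big(\frac{\kappa^3\varepsilon^{-3}}{(1-\lambda)^{1.5}K}+\frac{\kappa\varepsilon^{-1}}K\Big).$$
   Context: Problem. $K$ agents solve $\min_{x\in\mathbb R^{d_1}}\max_{y\in\mathbb R^{d_2}}J(x,y)$, $J=\frac1K\sum_{k=1}^KJ_k$, with $J_k(x,y)=\mathbb E[Q_k(x,y;\zeta_k)]$ (online scenario). $P(x)=\max_yJ(x,y)$. Assumptions. (A1) For each $x$ the maximum is attained, $\|\nabla_yJ(x,y)\|^2\ge2\nu(P(x)-J(x,y))$ for all $x,y$ ($\nu>0$), and $P^\star=\inf_xP(x)>-\infty$. (A2) For each $k$ and $w\in\{x,y\}$, $\mathbb E\|\nabla_wQ_k(x_1,y_1;\xi)-\nabla_wQ_k(x_2,y_2;\xi)\|^2\le L_f^2(\|x_1-x_2\|^2+\|y_1-y_2\|^2)$ with $\xi$ a random local sample. (A3) Samples are i.i.d., independent over agents and iterations; conditionally on the past, sample gradients $\nabla_wQ_k$ at the current iterate are unbiased for $\nabla_wJ_k$ with variance at most $\sigma^2$. Algorithm DAMA. Stack $\mathcal X_i=\mathrm{col}\{x_{1,i},\dots,x_{K,i}\}$,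 $\mathcal Y_i=\mathrm{col}\{y_{k,i}\}$, gradient estimates $\mathcal G_{x,i}=\mathrm{col}\{g^x_{k,i}\}$, $\mathcal G_{y,i}=\mathrm{col}\{g^y_{k,i}\}$. For $i\ge0$: $\mathcal X_{i+1}=\mathcal A_x(\mathcal C_x\mathcal X_i-\mu_x\mathcal G_{x,i})-\mathcal B_x\mathcal D_{x,i}$, $\mathcal Y_{i+1}=\mathcal A_y(\mathcal C_y\mathcal Y_i+\mu_y\mathcal G_{y,i})-\mathcal B_y\mathcal D_{y,i}$, $\mathcal D_{x,i+1}=\mathcal D_{x,i}+\mathcal B_x\mathcal X_{i+1}$, $\mathcal D_{y,i+1}=\mathcal D_{y,i}+\mathcal B_y\mathcal Y_{i+1}$; all agents start from identical $x_{k,0}=x_0$, $y_{k,0}=y_0$ and identical dual blocks. Estimator (GRACE): $g^w_{k,0}$ is a minibatch gradient with $b_0$ i.i.d. samples; for $i\ge1$, with $\pi_i\sim\mathrm{Bernoulli}(p)$ independent of everything else and shared by all agents: if $\pi_i=1$, $g^w_{k,i}$ is the average of $\nabla_wQ_k(x_{k,i},y_{k,i};\xi)$ over $B$ i.i.d. samples; if $\pi_i=0$, with $b$ i.i.d. samples $\mathcal E'_{k,i}$, $g^w_{k,i}=(1-\beta_w)\big(g^w_{k,i-1}-\frac1b\sum_{\xi\in\mathcal E'_{k,i}}\nabla_wQ_k(x_{k,i-1},y_{k,i-1};\xi)\big)+\frac1b\sum_{\xi\in\mathcal E'_{k,i}}\nabla_wQ_k(x_{k,i},y_{k,i};\xi)$.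 Notation. $x_{c,i}=\frac1K\sum_kx_{k,i}$, $y_{c,i}=\frac1K\sum_ky_{k,i}$; $\kappa=L_f/\nu$; $G_{p,0}=P(x_{c,0})-P^\star$; $\Delta_{c,0}=P(x_{c,0})-J(x_{c,0},y_{c,0})$; $\zeta_0^2=\frac1K\mathbb E\|(\mathcal A_x-\frac1K\mathbf 1\mathbf 1^\top\otimes I)\mathcal G_{x,0}\|^2+\frac1K\mathbb E\|(\mathcal A_y-\frac1K\mathbf 1\mathbf 1^\top\otimes I)\mathcal G_{y,0}\|^2$; $\lambda$ is the largest eigenvalue of $W$ other than the simple eigenvalue $1$. Order conventions. Hyperparameters prescribed by $\mathcal O(\cdot)$ or $\Theta(\cdot)$ are set equal to suitable constant multiples of the given expression (batch sizes rounded to integers). Constants may depend on $L_f$ and on the smallest nonzero eigenvalue of $W$, but not on $T,K,\lambda,\kappa,\sigma,\zeta_0,\varepsilon$. "Small $1-\lambda$" may depend on $\kappa$ and these constants, "sufficiently large $T$" on all problem parameters. An $\varepsilon$-stationary point is reached when the left-hand average is at most $\varepsilon^2$; communication complexity is the number $T$ of rounds needed and sample complexity the corresponding expected number of samples per agent, of order $T(1-p)b+TpB+b_0$ (for sufficiently large $T$); here $\mathbb EG_{p,0},\mathbb E\Delta_{c,0},\sigma^2,\zeta_0^2$ are treated as constants. *)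

theory Defs
  imports "HOL-Probability.Probability" "Jordan_Normal_Form.Char_Poly"
begin

text \<open>
  The spaces $R^{d_1}$ and $R^{d_2}$ are arbitrary finite-dimensional subspaces of inner product
  spaces.  They are sets and not types, so that one choice of constants can serve problems of
  every dimension; for a Euclidean type the subspace may be the whole type.
\<close>

definition fin_dim_subspace :: "'a::real_inner set \<Rightarrow> bool" where
  "fin_dim_subspace S \<longleftrightarrow> (\<exists>A. finite A \<and> S = span A)"

definition grad :: "'a::real_inner set \<Rightarrow> ('a \<Rightarrow> real) \<Rightarrow> 'a \<Rightarrow> 'a" where
  "grad S f x = (THE g. g \<in> S \<and> (f has_derivative (\<lambda>h. inner g h)) (at x within S))"

record ('a, 'b, 'z) minimax =
  agents :: nat
  xspace :: "'a set"
  yspace :: "'b set"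
  sample_law :: "nat \<Rightarrow> 'z measure"
  loss :: "nat \<Rightarrow> 'a \<Rightarrow> 'b \<Rightarrow> 'z \<Rightarrow> real"

definition local_risk :: "('a, 'b, 'z) minimax \<Rightarrow> nat \<Rightarrow> 'a \<Rightarrow> 'b \<Rightarrow> real" where
  "local_risk pb k x y = (LINT z|sample_law pb k. loss pb k x y z)"

definition risk :: "('a, 'b, 'z) minimax \<Rightarrow> 'a \<Rightarrow> 'b \<Rightarrow> real" where
  "risk pb x y = (\<Sum>k<agents pb. local_risk pb k x y) / real (agents pb)"

definition primal :: "('a, 'b, 'z) minimax \<Rightarrow> 'a \<Rightarrow> real" where
  "primal pb x = (SUP y\<in>yspace pb. risk pb x y)"

definition primal_opt :: "('a, 'b, 'z) minimax \<Rightarrow> real" where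
  "primal_opt pb = (INF x\<in>xspace pb. primal pb x)"

definition grad_x_loss :: "('a::real_inner, 'b, 'z) minimax \<Rightarrow> nat \<Rightarrow> 'a \<Rightarrow> 'b \<Rightarrow> 'z \<Rightarrow> 'a" where
  "grad_x_loss pb k x y z = grad (xspace pb) (\<lambda>u. loss pb k u y z) x"

definition grad_y_loss :: "('a, 'b::real_inner, 'z) minimax \<Rightarrow> nat \<Rightarrow> 'a \<Rightarrow> 'b \<Rightarrow> 'z \<Rightarrow> 'b" where
  "grad_y_loss pb k x y z = grad (yspace pb) (\<lambda>v. loss pb k x v z) y"

definition grad_x_local :: "('a::real_inner, 'b, 'z) minimax \<Rightarrow> nat \<Rightarrow> 'a \<Rightarrow> 'b \<Rightarrow> 'a" where
  "grad_x_local pb k x y = grad (xspace pb) (\<lambda>u. local_risk pb k u y) x"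

definition grad_y_local :: "('a, 'b::real_inner, 'z) minimax \<Rightarrow> nat \<Rightarrow> 'a \<Rightarrow> 'b \<Rightarrow> 'b" where
  "grad_y_local pb k x y = grad (yspace pb) (\<lambda>v. local_risk pb k x v) y"

definition grad_x_risk :: "('a::real_inner, 'b, 'z) minimax \<Rightarrow> 'a \<Rightarrow> 'b \<Rightarrow> 'a" where
  "grad_x_risk pb x y = grad (xspace pb) (\<lambda>u. risk pb u y) x"

definition grad_y_risk :: "('a, 'b::real_inner, 'z) minimax \<Rightarrow> 'a \<Rightarrow> 'b \<Rightarrow> 'b" where
  "grad_y_risk pb x y = grad (yspace pb) (\<lambda>v. risk pb x v) y"

text \<open>
  The last two conjuncts follow from the others when the losses are differentiable and measurable in
  the sample; they are listed because random iterates are substituted into the gradients.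
\<close>

definition well_posed ::
  "('a::{real_inner,second_countable_topology}, 'b::{real_inner,second_countable_topology}, 'z) minimax \<Rightarrow> bool"
where
  "well_posed pb \<longleftrightarrow>
     0 < agents pb \<and> fin_dim_subspace (xspace pb) \<and> fin_dim_subspace (yspace pb) \<and>
     (\<forall>k<agents pb.
        prob_space (sample_law pb k) \<and>
        (\<forall>x\<in>xspace pb. \<forall>y\<in>yspace pb.
           integrable (sample_law pb k) (loss pb k x y) \<and>
           (\<forall>z\<in>space (sample_law pb k).
              (\<lambda>u. loss pb k u y z) differentiable (at x within xspace pb) \<and>
              (\<lambda>v. loss pb k x v z) differentiable (at y within yspace pb)) \<and>
           (\<lambda>u. local_risk pb k u y) differentiable (at x within xspace pb) \<and>
           (\<lambda>v. local_risk pb k x v) differentiable (at y within yspace pb)) \<and>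
        (\<lambda>(x, y, z). grad_x_loss pb k x y z) \<in>
          borel_measurable (restrict_space borel (xspace pb) \<Otimes>\<^sub>M
            (restrict_space borel (yspace pb) \<Otimes>\<^sub>M sample_law pb k)) \<and>
        (\<lambda>(x, y, z). grad_y_loss pb k x y z) \<in>
          borel_measurable (restrict_space borel (xspace pb) \<Otimes>\<^sub>M
            (restrict_space borel (yspace pb) \<Otimes>\<^sub>M sample_law pb k)))"

definition PL_condition :: "('a, 'b::real_inner, 'z) minimax \<Rightarrow> real \<Rightarrow> bool" where
  "PL_condition pb \<nu> \<longleftrightarrow>
     (\<forall>x\<in>xspace pb. \<exists>y\<in>yspace pb. \<forall>y'\<in>yspace pb. risk pb x y' \<le> risk pb x y) \<and>
     (\<forall>x\<in>xspace pb. \<forall>y\<in>yspace pb.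
        2 * \<nu> * (primal pb x - risk pb x y) \<le> (norm (grad_y_risk pb x y))\<^sup>2) \<and>
     bdd_below (primal pb ` xspace pb)"

definition mean_square_smooth :: "('a::real_inner, 'b::real_inner, 'z) minimax \<Rightarrow> real \<Rightarrow> bool" where
  "mean_square_smooth pb L \<longleftrightarrow>
     (\<forall>k<agents pb. \<forall>x1\<in>xspace pb. \<forall>x2\<in>xspace pb. \<forall>y1\<in>yspace pb. \<forall>y2\<in>yspace pb.
        (\<integral>\<^sup>+z. ennreal ((norm (grad_x_loss pb k x1 y1 z - grad_x_loss pb k x2 y2 z))\<^sup>2) \<partial>sample_law pb k)
          \<le> ennreal (L\<^sup>2 * ((norm (x1 - x2))\<^sup>2 + (norm (y1 - y2))\<^sup>2)) \<and>
        (\<integral>\<^sup>+z. ennreal ((norm (grad_y_loss pb k x1 y1 z - grad_y_loss pb k x2 y2 z))\<^sup>2) \<partial>sample_law pb k)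
          \<le> ennreal (L\<^sup>2 * ((norm (x1 - x2))\<^sup>2 + (norm (y1 - y2))\<^sup>2)))"

definition psd_mat :: "nat \<Rightarrow> real mat \<Rightarrow> bool" where
  "psd_mat n A \<longleftrightarrow> A \<in> carrier_mat n n \<and> transpose_mat A = A \<and>
     (\<forall>v\<in>carrier_vec n. 0 \<le> scalar_prod v (A *\<^sub>v v))"

definition mixing_mat :: "nat \<Rightarrow> real mat \<Rightarrow> bool" where
  "mixing_mat n W \<longleftrightarrow> psd_mat n W \<and>
     (\<forall>i<n. \<forall>j<n. 0 \<le> W $$ (i, j)) \<and>
     (\<forall>i<n. (\<Sum>j<n. W $$ (i, j)) = 1) \<and>
     (\<forall>j<n. (\<Sum>i<n. W $$ (i, j)) = 1) \<and>
     (\<exists>m>0. \<forall>i<n. \<forall>j<n. 0 < (W ^\<^sub>m m) $$ (i, j))"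

definition psd_sqrt :: "nat \<Rightarrow> real mat \<Rightarrow> real mat \<Rightarrow> bool" where
  "psd_sqrt n A R \<longleftrightarrow> psd_mat n R \<and> R * R = A"

definition second_eig :: "real mat \<Rightarrow> real" where
  "second_eig W = Max {e. eigenvalue W e \<and> e \<noteq> 1}"

definition least_nonzero_eig :: "real mat \<Rightarrow> real" where
  "least_nonzero_eig W = Min {e. eigenvalue W e \<and> e \<noteq> 0}"

definition avg_mat :: "nat \<Rightarrow> real mat" where
  "avg_mat n = mat n n (\<lambda>_. 1 / real n)"

text \<open>
  A stacked vector is the family of its blocks, and \<open>block_mult n A v\<close> is the product of the
  Kronecker product of \<open>A\<close> and the identity with \<open>v\<close>.
\<close>

definition block_mult :: "nat \<Rightarrow> real mat \<Rightarrow> (nat \<Rightarrow> 'a::real_vector) \<Rightarrow> nat \<Rightarrow> 'a" where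
  "block_mult n A v k = (\<Sum>l<n. A $$ (k, l) *\<^sub>R v l)"

definition centroid :: "nat \<Rightarrow> (nat \<Rightarrow> 'a::real_vector) \<Rightarrow> 'a" where
  "centroid n v = (\<Sum>k<n. v k) /\<^sub>R real n"

record dama_config =
  mat_Ax :: "real mat"
  mat_Bx :: "real mat"
  mat_Cx :: "real mat"
  mat_Ay :: "real mat"
  mat_By :: "real mat"
  mat_Cy :: "real mat"
  step_x :: real
  step_y :: real
  beta_x :: real
  beta_y :: real
  coin_prob :: real
  big_batch :: nat
  small_batch :: nat
  init_batch :: nat

text \<open>
  In a run, \<open>draw r k i j\<close> is the \<open>j\<close>-th sample that agent \<open>k\<close> may use at iteration \<open>i\<close>: the first
  \<open>init_batch\<close> of them for \<open>i = 0\<close>, afterwards the first \<open>big_batch\<close> or \<open>small_batch\<close> of them according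
  to the coin, which all agents share.  The remaining processes are indexed by agent and iteration.
\<close>

record ('w, 'a, 'b, 'z) dama_run =
  prob_sp :: "'w measure"
  coin :: "nat \<Rightarrow> 'w \<Rightarrow> bool"
  draw :: "nat \<Rightarrow> nat \<Rightarrow> nat \<Rightarrow> 'w \<Rightarrow> 'z"
  xit :: "nat \<Rightarrow> nat \<Rightarrow> 'w \<Rightarrow> 'a"
  yit :: "nat \<Rightarrow> nat \<Rightarrow> 'w \<Rightarrow> 'b"
  dual_x :: "nat \<Rightarrow> nat \<Rightarrow> 'w \<Rightarrow> 'a"
  dual_y :: "nat \<Rightarrow> nat \<Rightarrow> 'w \<Rightarrow> 'b"
  est_x :: "nat \<Rightarrow> nat \<Rightarrow> 'w \<Rightarrow> 'a"
  est_y :: "nat \<Rightarrow> nat \<Rightarrow> 'w \<Rightarrow> 'b"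

definition minibatch :: "nat \<Rightarrow> ('z \<Rightarrow> 'a::real_vector) \<Rightarrow> (nat \<Rightarrow> 'z) \<Rightarrow> 'a" where
  "minibatch n f s = (\<Sum>j<n. f (s j)) /\<^sub>R real n"

definition grace_step ::
  "real \<Rightarrow> nat \<Rightarrow> nat \<Rightarrow> bool \<Rightarrow> 'a::real_vector \<Rightarrow> ('z \<Rightarrow> 'a) \<Rightarrow> ('z \<Rightarrow> 'a) \<Rightarrow> (nat \<Rightarrow> 'z) \<Rightarrow> 'a"
where
  "grace_step \<beta> B b c g f_prev f_cur s =
     (if c then minibatch B f_cur s
      else (1 - \<beta>) *\<^sub>R (g - minibatch b f_prev s) + minibatch b f_cur s)"

definition dama_start :: "('a, 'b, 'z) minimax \<Rightarrow> ('w, 'a, 'b, 'z) dama_run \<Rightarrow> bool" where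
  "dama_start pb r \<longleftrightarrow>
     (\<forall>\<omega>\<in>space (prob_sp r).
        xit r 0 0 \<omega> \<in> xspace pb \<and> yit r 0 0 \<omega> \<in> yspace pb \<and>
        dual_x r 0 0 \<omega> \<in> xspace pb \<and> dual_y r 0 0 \<omega> \<in> yspace pb \<and>
        (\<forall>k<agents pb.
           xit r k 0 \<omega> = xit r 0 0 \<omega> \<and> yit r k 0 \<omega> = yit r 0 0 \<omega> \<and>
           dual_x r k 0 \<omega> = dual_x r 0 0 \<omega> \<and> dual_y r k 0 \<omega> = dual_y r 0 0 \<omega>))"

definition dama_updates ::
  "('a::real_inner, 'b::real_inner, 'z) minimax \<Rightarrow> dama_config \<Rightarrow> ('w, 'a, 'b, 'z) dama_run \<Rightarrow> bool"
where
  "dama_updates pb c r \<longleftrightarrow>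
     (\<forall>\<omega>\<in>space (prob_sp r). \<forall>i. \<forall>k<agents pb.
        (let n = agents pb;
             X = (\<lambda>i k. xit r k i \<omega>); Y = (\<lambda>i k. yit r k i \<omega>);
             DX = (\<lambda>i k. dual_x r k i \<omega>); DY = (\<lambda>i k. dual_y r k i \<omega>);
             GX = (\<lambda>i k. est_x r k i \<omega>); GY = (\<lambda>i k. est_y r k i \<omega>)
         in
           X (Suc i) k = block_mult n (mat_Ax c) (\<lambda>l. block_mult n (mat_Cx c) (X i) l - step_x c *\<^sub>R GX i l) k
                         - block_mult n (mat_Bx c) (DX i) k \<and>
           Y (Suc i) k = block_mult n (mat_Ay c) (\<lambda>l. block_mult n (mat_Cy c) (Y i) l + step_y c *\<^sub>R GY i l) k
                         - block_mult n (mat_By c) (DY i) k \<and>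
           DX (Suc i) k = DX i k + block_mult n (mat_Bx c) (X (Suc i)) k \<and>
           DY (Suc i) k = DY i k + block_mult n (mat_By c) (Y (Suc i)) k))"

definition grace_estimates ::
  "('a::real_inner, 'b::real_inner, 'z) minimax \<Rightarrow> dama_config \<Rightarrow> ('w, 'a, 'b, 'z) dama_run \<Rightarrow> bool"
where
  "grace_estimates pb c r \<longleftrightarrow>
     (\<forall>\<omega>\<in>space (prob_sp r). \<forall>k<agents pb.
        est_x r k 0 \<omega> = minibatch (init_batch c)
          (grad_x_loss pb k (xit r k 0 \<omega>) (yit r k 0 \<omega>)) (\<lambda>j. draw r k 0 j \<omega>) \<and>
        est_y r k 0 \<omega> = minibatch (init_batch c)
          (grad_y_loss pb k (xit r k 0 \<omega>) (yit r k 0 \<omega>)) (\<lambda>j. draw r k 0 j \<omega>) \<and>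
        (\<forall>i.
           est_x r k (Suc i) \<omega> =
             grace_step (beta_x c) (big_batch c) (small_batch c) (coin r (Suc i) \<omega>) (est_x r k i \<omega>)
               (grad_x_loss pb k (xit r k i \<omega>) (yit r k i \<omega>))
               (grad_x_loss pb k (xit r k (Suc i) \<omega>) (yit r k (Suc i) \<omega>))
               (\<lambda>j. draw r k (Suc i) j \<omega>) \<and>
           est_y r k (Suc i) \<omega> =
             grace_step (beta_y c) (big_batch c) (small_batch c) (coin r (Suc i) \<omega>) (est_y r k i \<omega>)
               (grad_y_loss pb k (xit r k i \<omega>) (yit r k i \<omega>))
               (grad_y_loss pb k (xit r k (Suc i) \<omega>) (yit r k (Suc i) \<omega>))
               (\<lambda>j. draw r k (Suc i) j \<omega>)))"

text \<open>
  The independent sources of randomness: the common initial point, the coin of each iteration and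
  the individual samples.  They have different types, so independence is stated for the generated
  families of events.
\<close>

datatype source = Start | Coin nat | Draw nat nat nat

definition source_events ::
  "('a::topological_space, 'b::topological_space, 'z) minimax \<Rightarrow> ('w, 'a, 'b, 'z) dama_run \<Rightarrow> source \<Rightarrow> 'w set set"
where
  "source_events pb r s =
     (case s of
        Start \<Rightarrow> {(\<lambda>\<omega>. (xit r 0 0 \<omega>, yit r 0 0 \<omega>)) -` A \<inter> space (prob_sp r) |A. A \<in> sets borel}
      | Coin i \<Rightarrow> {coin r i -` A \<inter> space (prob_sp r) |A. True}
      | Draw k i j \<Rightarrow> {draw r k i j -` A \<inter> space (prob_sp r) |A. A \<in> sets (sample_law pb k)})"

definition random_model ::
  "('a::topological_space, 'b::topological_space, 'z) minimax \<Rightarrow> dama_config \<Rightarrow> ('w, 'a, 'b, 'z) dama_run \<Rightarrow> bool"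
where
  "random_model pb c r \<longleftrightarrow>
     prob_space (prob_sp r) \<and>
     (\<lambda>\<omega>. (xit r 0 0 \<omega>, yit r 0 0 \<omega>)) \<in> borel_measurable (prob_sp r) \<and>
     (\<forall>i. coin r i \<in> measurable (prob_sp r) (count_space UNIV) \<and>
          distr (prob_sp r) (count_space UNIV) (coin r i) = measure_pmf (bernoulli_pmf (coin_prob c))) \<and>
     (\<forall>k<agents pb. \<forall>i j.
          draw r k i j \<in> measurable (prob_sp r) (sample_law pb k) \<and>
          distr (prob_sp r) (sample_law pb k) (draw r k i j) = sample_law pb k) \<and>
     prob_space.indep_sets (prob_sp r) (source_events pb r)
       ({Start} \<union> range Coin \<union> {Draw k i j |k i j. k < agents pb})"

definition past ::
  "('a::topological_space, 'b::topological_space, 'z) minimax \<Rightarrow> ('w, 'a, 'b, 'z) dama_run \<Rightarrow> nat \<Rightarrow> 'w measure"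
where
  "past pb r i = sigma (space (prob_sp r))
     (\<Union>s\<in>{Start} \<union> {Coin l |l. l < i} \<union> {Draw k l j |k l j. k < agents pb \<and> l < i}. source_events pb r s)"

text \<open>
  The conditional expectations are taken of the centred sample gradient, componentwise because the
  library provides them for real-valued functions.  The variance bound makes its components
  integrable, even when the gradients at a random iterate are not known to be.
\<close>

definition conditionally_unbiased ::
  "'w measure \<Rightarrow> 'w measure \<Rightarrow> 'a::real_inner set \<Rightarrow> ('w \<Rightarrow> 'a) \<Rightarrow> bool" where
  "conditionally_unbiased M F S e \<longleftrightarrow>
     (\<forall>h\<in>S. AE \<omega> in M. real_cond_exp M F (\<lambda>\<omega>. inner (e \<omega>) h) \<omega> = 0)"

definition conditional_variance_le ::
  "'w measure \<Rightarrow> 'w measure \<Rightarrow> real \<Rightarrow> ('w \<Rightarrow> 'a::real_inner) \<Rightarrow> bool" where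
  "conditional_variance_le M F v e \<longleftrightarrow>
     (AE \<omega> in M. nn_cond_exp M F (\<lambda>\<omega>. ennreal ((norm (e \<omega>))\<^sup>2)) \<omega> \<le> ennreal v)"

definition noise_condition ::
  "('a::real_inner, 'b::real_inner, 'z) minimax \<Rightarrow> real \<Rightarrow> nat \<Rightarrow> ('w, 'a, 'b, 'z) dama_run \<Rightarrow> bool"
where
  "noise_condition pb \<sigma> T r \<longleftrightarrow>
     (\<forall>i<T. \<forall>k<agents pb. \<forall>j.
        (let M = prob_sp r; F = past pb r i;
             ex = (\<lambda>\<omega>. grad_x_loss pb k (xit r k i \<omega>) (yit r k i \<omega>) (draw r k i j \<omega>)
                        - grad_x_local pb k (xit r k i \<omega>) (yit r k i \<omega>));
             ey = (\<lambda>\<omega>. grad_y_loss pb k (xit r k i \<omega>) (yit r k i \<omega>) (draw r k i j \<omega>)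
                        - grad_y_local pb k (xit r k i \<omega>) (yit r k i \<omega>))
         in conditionally_unbiased M F (xspace pb) ex \<and> conditional_variance_le M F (\<sigma>\<^sup>2) ex \<and>
            conditionally_unbiased M F (yspace pb) ey \<and> conditional_variance_le M F (\<sigma>\<^sup>2) ey))"

definition xc :: "('a::real_vector, 'b, 'z) minimax \<Rightarrow> ('w, 'a, 'b, 'z) dama_run \<Rightarrow> nat \<Rightarrow> 'w \<Rightarrow> 'a" where
  "xc pb r i \<omega> = centroid (agents pb) (\<lambda>k. xit r k i \<omega>)"

definition yc :: "('a, 'b::real_vector, 'z) minimax \<Rightarrow> ('w, 'a, 'b, 'z) dama_run \<Rightarrow> nat \<Rightarrow> 'w \<Rightarrow> 'b" where
  "yc pb r i \<omega> = centroid (agents pb) (\<lambda>k. yit r k i \<omega>)"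

definition primal_gap :: "('a::real_vector, 'b, 'z) minimax \<Rightarrow> ('w, 'a, 'b, 'z) dama_run \<Rightarrow> 'w \<Rightarrow> real" where
  "primal_gap pb r \<omega> = primal pb (xc pb r 0 \<omega>) - primal_opt pb"

definition dual_gap ::
  "('a::real_vector, 'b::real_vector, 'z) minimax \<Rightarrow> ('w, 'a, 'b, 'z) dama_run \<Rightarrow> 'w \<Rightarrow> real" where
  "dual_gap pb r \<omega> = primal pb (xc pb r 0 \<omega>) - risk pb (xc pb r 0 \<omega>) (yc pb r 0 \<omega>)"

definition sq_norm_stack :: "nat \<Rightarrow> (nat \<Rightarrow> 'a::real_normed_vector) \<Rightarrow> real" where
  "sq_norm_stack n v = (\<Sum>k<n. (norm (v k))\<^sup>2)"

definition zeta_x ::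
  "('a::real_inner, 'b, 'z) minimax \<Rightarrow> dama_config \<Rightarrow> ('w, 'a, 'b, 'z) dama_run \<Rightarrow> 'w \<Rightarrow> real" where
  "zeta_x pb c r \<omega> =
     sq_norm_stack (agents pb) (block_mult (agents pb) (mat_Ax c - avg_mat (agents pb)) (\<lambda>k. est_x r k 0 \<omega>))"

definition zeta_y ::
  "('a, 'b::real_inner, 'z) minimax \<Rightarrow> dama_config \<Rightarrow> ('w, 'a, 'b, 'z) dama_run \<Rightarrow> 'w \<Rightarrow> real" where
  "zeta_y pb c r \<omega> =
     sq_norm_stack (agents pb) (block_mult (agents pb) (mat_Ay c - avg_mat (agents pb)) (\<lambda>k. est_y r k 0 \<omega>))"

definition exp_primal_gap :: "('a::real_vector, 'b, 'z) minimax \<Rightarrow> ('w, 'a, 'b, 'z) dama_run \<Rightarrow> real" where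
  "exp_primal_gap pb r = (LINT \<omega>|prob_sp r. primal_gap pb r \<omega>)"

definition exp_dual_gap ::
  "('a::real_vector, 'b::real_vector, 'z) minimax \<Rightarrow> ('w, 'a, 'b, 'z) dama_run \<Rightarrow> real" where
  "exp_dual_gap pb r = (LINT \<omega>|prob_sp r. dual_gap pb r \<omega>)"

definition zeta_sq ::
  "('a::real_inner, 'b::real_inner, 'z) minimax \<Rightarrow> dama_config \<Rightarrow> ('w, 'a, 'b, 'z) dama_run \<Rightarrow> real" where
  "zeta_sq pb c r =
     (LINT \<omega>|prob_sp r. zeta_x pb c r \<omega>) / real (agents pb) +
     (LINT \<omega>|prob_sp r. zeta_y pb c r \<omega>) / real (agents pb)"

definition finite_start ::
  "('a::real_inner, 'b::real_inner, 'z) minimax \<Rightarrow> dama_config \<Rightarrow> ('w, 'a, 'b, 'z) dama_run \<Rightarrow> bool" where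
  "finite_start pb c r \<longleftrightarrow>
     integrable (prob_sp r) (primal_gap pb r) \<and> integrable (prob_sp r) (dual_gap pb r) \<and>
     integrable (prob_sp r) (zeta_x pb c r) \<and> integrable (prob_sp r) (zeta_y pb c r)"

definition dama_grace_run ::
  "('a::real_inner, 'b::real_inner, 'z) minimax \<Rightarrow> dama_config \<Rightarrow> real \<Rightarrow> nat \<Rightarrow> ('w, 'a, 'b, 'z) dama_run \<Rightarrow> bool"
where
  "dama_grace_run pb c \<sigma> T r \<longleftrightarrow>
     random_model pb c r \<and> dama_start pb r \<and> dama_updates pb c r \<and> grace_estimates pb c r \<and>
     noise_condition pb \<sigma> T r \<and> finite_start pb c r"

text \<open>Extended nonnegative, so that a bound on it also asserts that the expectations are finite.\<close>

definition stationarity ::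
  "('a::real_inner, 'b::real_inner, 'z) minimax \<Rightarrow> ('w, 'a, 'b, 'z) dama_run \<Rightarrow> nat \<Rightarrow> ennreal" where
  "stationarity pb r T =
     (\<Sum>i<T. (\<integral>\<^sup>+\<omega>. ennreal ((norm (grad_x_risk pb (xc pb r i \<omega>) (yc pb r i \<omega>)))\<^sup>2) \<partial>prob_sp r)
            + (\<integral>\<^sup>+\<omega>. ennreal ((norm (grad_y_risk pb (xc pb r i \<omega>) (yc pb r i \<omega>)))\<^sup>2) \<partial>prob_sp r))
     / of_nat T"

record page_constants =
  const_B :: real
  const_b :: real
  const_p :: real
  const_x :: real
  const_y :: real

definition positive_constants :: "page_constants \<Rightarrow> bool" where
  "positive_constants cs \<longleftrightarrow>
     0 < const_B cs \<and> 0 < const_b cs \<and> 0 < const_p cs \<and> 0 < const_x cs \<and> 0 < const_y cs"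

text \<open>Batch sizes are rounded upwards, so that no batch is empty.\<close>

definition page_extra ::
  "page_constants \<Rightarrow> nat \<Rightarrow> real mat \<Rightarrow> real mat \<Rightarrow> real \<Rightarrow> nat \<Rightarrow> dama_config" where
  "page_extra cs K W V \<kappa> T =
     (let gap = 1 - second_eig W;
          b = nat \<lceil>const_b cs * (gap powr (3/4) * sqrt (real T) / real K)\<rceil>
      in \<lparr> mat_Ax = 1\<^sub>m K, mat_Bx = V, mat_Cx = W,
           mat_Ay = 1\<^sub>m K, mat_By = V, mat_Cy = W,
           step_x = const_x cs * (gap powr (3/2) / \<kappa>\<^sup>2),
           step_y = const_y cs * gap powr (3/2),
           beta_x = 0, beta_y = 0,
           coin_prob = const_p cs * (1 / (gap powr (3/4) * sqrt (real T))),
           big_batch = nat \<lceil>const_B cs * (gap powr (3/2) * real T / real K)\<rceil>,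
           small_batch = b, init_batch = b \<rparr>)"

definition rate_bound :: "nat \<Rightarrow> real \<Rightarrow> real \<Rightarrow> real \<Rightarrow> real \<Rightarrow> real \<Rightarrow> real \<Rightarrow> nat \<Rightarrow> real" where
  "rate_bound K \<kappa> gap G \<Delta> \<sigma>sq \<zeta>sq T =
     \<kappa>\<^sup>2 * G / (real T * gap powr (3/2))
   + \<kappa>\<^sup>2 * \<Delta> / (real T * gap powr (3/2))
   + \<kappa>\<^sup>2 * \<sigma>sq / (real T * gap powr (3/2))
   + \<kappa>\<^sup>2 * \<zeta>sq * gap / real T
   + \<kappa>\<^sup>2 * \<sigma>sq / real T
   + \<kappa>\<^sup>2 * real K * \<sigma>sq / (gap powr (9/4) * real T powr (3/2))
   + \<kappa>\<^sup>2 * real K * gap powr (5/4) * \<zeta>sq / real T powr (3/2)"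

definition expected_samples :: "dama_config \<Rightarrow> nat \<Rightarrow> real" where
  "expected_samples c T =
     real T * (1 - coin_prob c) * real (small_batch c) + real T * coin_prob c * real (big_batch c)
     + real (init_batch c)"

text \<open>
  The smoothness constant \<open>L\<close> and the PL constant \<open>\<nu>\<close> satisfy \<open>\<nu> \<le> L\<close>, that is, the condition
  number is at least 1.  This follows from the other conditions unless every \<open>risk pb x\<close> is constant,
  and then the PL condition holds for all \<open>\<nu>\<close>.
\<close>

definition extra_setting ::
  "('a::{real_inner,second_countable_topology}, 'b::{real_inner,second_countable_topology}, 'z) minimax
    \<Rightarrow> real mat \<Rightarrow> real mat \<Rightarrow> real \<Rightarrow> real \<Rightarrow> bool"
where
  "extra_setting pb W V L \<nu> \<longleftrightarrow>
     0 < \<nu> \<and> \<nu> \<le> L \<and> well_posed pb \<and> PL_condition pb \<nu> \<and> mean_square_smooth pb L \<and>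
     2 \<le> agents pb \<and> mixing_mat (agents pb) W \<and> psd_sqrt (agents pb) (1\<^sub>m (agents pb) - W) V"

end

theory Submission imports Defs begin

text \<open>
  Stack the two variables into blocks \<open>u k = (x k, y k)\<close>.  Their centroid moves by a two-timescale
  gradient step along the averaged estimate, so the merit function \<open>P + (P - J) / 2\<close> decreases by a
  multiple of the squared partial gradients, up to the squared error of the averaged estimate.
  Smoothness of \<open>P\<close> is never needed: the PL condition bounds the distance of \<open>y\<close> from near-maximisers
  of \<open>J x\<close> along gradient ascent paths, which gives a quadratic upper bound for \<open>P\<close>.

  Since the estimator uses no momentum, its error is a sum of conditionally centred terms between two
  restarts.  Its second moment therefore grows additively by the squared movement over \<open>b\<close>, contracts
  by \<open>1 - p\<close> in each round, and gains the factor \<open>1 / K\<close> in the average over the agents.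

  For the disagreement the dual variable is shifted to \<open>s = V d + h - c\<close>, with \<open>h\<close> the scaled estimates
  and \<open>c\<close> their centroid.  In the Lyapunov function
  \<open>\<langle>V u, W V u\<rangle> + \<langle>s, s\<rangle>\<close> the cross terms cancel, one step contracts it by \<open>\<lambda>\<close>, and up to a constant it
  dominates \<open>1 - \<lambda>\<close> times the squared disagreement of the next round.  A perturbation by the change of the estimates is thus
  amplified at most by \<open>(1 - \<lambda>)\<close> to the power \<open>-3\<close>, so the step size \<open>(1 - \<lambda>) powr (3/2)\<close> closes the loop
  of consensus, estimation and movement errors.
\<close>

section \<open>Quadratic forms on blocks\<close>

text \<open>Estimates and gradients at the random iterates are not known in advance to have finite
  second moments; of the start only the gaps and the spread of the estimates are integrable.
  Finiteness is therefore propagated along the run: the descent of the merit function holds path by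
  path and bounds the averaged estimate by the initial gaps and the errors so far, which makes the
  next round square integrable. The third power of \<open>1 - \<lambda>\<close> has three sources,
  one factor each: the disagreement of the next round against the Lyapunov function, Young's
  inequality for the perturbation, and the sum of a contraction. So the squared step must be a small
  multiple of \<open>(1 - \<lambda>)^3\<close>. Summing the estimator recursion divides its growth
  by \<open>p\<close>. For the averaged error the condition \<open>1 \<le> K b p\<close> undoes this
  division, which ties \<open>b\<close> to \<open>1 / (K p)\<close>; \<open>B\<close> is what keeps
  the accumulated restart variance of order \<open>\<sigma>^2 (1 - \<lambda>) powr (-3/2)\<close>.
  The movement of the centroid that remains is paid for by the squared averaged estimates that a
  merit step leaves over besides the squared gradients.\<close>

definition block_inner :: "nat \<Rightarrow> (nat \<Rightarrow> 'a::real_inner) \<Rightarrow> (nat \<Rightarrow> 'a) \<Rightarrow> real" where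
  "block_inner n u v = (\<Sum>k<n. inner (u k) (v k))"

lemma block_mult_add: "block_mult n A (\<lambda>k. u k + v k) = (\<lambda>k. block_mult n A u k + block_mult n A v k)"
  by (simp add: block_mult_def fun_eq_iff scaleR_add_right sum.distrib)

lemma block_mult_diff: "block_mult n A (\<lambda>k. u k - v k) = (\<lambda>k. block_mult n A u k - block_mult n A v k)"
  by (simp add: block_mult_def fun_eq_iff scaleR_diff_right sum_subtractf)

lemma block_mult_scaleR: "block_mult n A (\<lambda>k. c *\<^sub>R v k) = (\<lambda>k. c *\<^sub>R block_mult n A v k)"
  by (simp add: block_mult_def fun_eq_iff scaleR_sum_right mult.commute)

lemma block_mult_cong: "(\<And>l. l < n \<Longrightarrow> u l = v l) \<Longrightarrow> block_mult n A u k = block_mult n A v k"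
  by (simp add: block_mult_def)

lemma block_mult_one: "k < n \<Longrightarrow> block_mult n (1\<^sub>m n) v k = v k"
proof -
  assume "k < n"
  then have "block_mult n (1\<^sub>m n) v k = (\<Sum>l<n. if k = l then v l else 0)"
    unfolding block_mult_def by (intro sum.cong) auto
  also have "\<dots> = v k" using \<open>k < n\<close> by simp
  finally show ?thesis .
qed

lemma block_mult_mult:
  assumes "A \<in> carrier_mat n n" "B \<in> carrier_mat n n" "k < n"
  shows "block_mult n (A * B) v k = block_mult n A (block_mult n B v) k"
proof -
  have "block_mult n (A * B) v k = (\<Sum>l<n. (\<Sum>m<n. A $$ (k, m) * B $$ (m, l)) *\<^sub>R v l)"
    unfolding block_mult_def
    using assms by (intro sum.cong refl) (auto simp: scalar_prod_def lessThan_atLeast0)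
  also have "\<dots> = (\<Sum>l<n. \<Sum>m<n. (A $$ (k, m) * B $$ (m, l)) *\<^sub>R v l)"
    by (simp add: scaleR_sum_left)
  also have "\<dots> = (\<Sum>m<n. \<Sum>l<n. (A $$ (k, m) * B $$ (m, l)) *\<^sub>R v l)"
    by (rule sum.swap)
  finally show ?thesis
    unfolding block_mult_def by (simp add: scaleR_sum_right)
qed

lemma block_mult_minus:
  assumes "A \<in> carrier_mat n n" "B \<in> carrier_mat n n" "k < n"
  shows "block_mult n (A - B) v k = block_mult n A v k - block_mult n B v k"
  unfolding block_mult_def using assms
  by (simp add: scaleR_diff_left sum_subtractf)

lemma block_inner_commute: "block_inner n u v = block_inner n v u"
  by (simp add: block_inner_def inner_commute)

lemma block_inner_cong:
  "(\<And>k. k < n \<Longrightarrow> u k = u' k) \<Longrightarrow> (\<And>k. k < n \<Longrightarrow> v k = v' k) \<Longrightarrow> block_inner n u v = block_inner n u' v'"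
  by (simp add: block_inner_def)

lemma block_inner_add:
  "block_inner n (\<lambda>k. u k + v k) w = block_inner n u w + block_inner n v w"
  "block_inner n w (\<lambda>k. u k + v k) = block_inner n w u + block_inner n w v"
  by (simp_all add: block_inner_def inner_add_left inner_add_right sum.distrib)

lemma block_inner_diff:
  "block_inner n (\<lambda>k. u k - v k) w = block_inner n u w - block_inner n v w"
  "block_inner n w (\<lambda>k. u k - v k) = block_inner n w u - block_inner n w v"
  by (simp_all add: block_inner_def inner_diff_left inner_diff_right sum_subtractf)

lemma block_inner_scaleR:
  "block_inner n (\<lambda>k. c *\<^sub>R u k) w = c * block_inner n u w"
  "block_inner n w (\<lambda>k. c *\<^sub>R u k) = c * block_inner n w u"
  by (simp_all add: block_inner_def sum_distrib_left)

lemma block_inner_self: "block_inner n u u = (\<Sum>k<n. (norm (u k))\<^sup>2)"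
  by (simp add: block_inner_def power2_norm_eq_inner)

lemma block_inner_self_nonneg: "0 \<le> block_inner n u u"
  by (simp add: block_inner_self sum_nonneg)

lemma block_mult_selfadjoint:
  assumes "A \<in> carrier_mat n n" "transpose_mat A = A"
  shows "block_inner n u (block_mult n A v) = block_inner n (block_mult n A u) v"
proof -
  have sym: "A $$ (k, l) = A $$ (l, k)" if "k < n" "l < n" for k l
    using assms that by (metis carrier_matD index_transpose_mat(1))
  have "block_inner n u (block_mult n A v) = (\<Sum>k<n. \<Sum>l<n. A $$ (k, l) * inner (u k) (v l))"
    by (simp add: block_inner_def block_mult_def inner_sum_right)
  also have "\<dots> = (\<Sum>l<n. \<Sum>k<n. A $$ (k, l) * inner (u k) (v l))"
    by (rule sum.swap)
  also have "\<dots> = (\<Sum>l<n. \<Sum>k<n. A $$ (l, k) * inner (u k) (v l))"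
    by (intro sum.cong refl) (simp add: sym)
  also have "\<dots> = block_inner n (block_mult n A u) v"
    by (simp add: block_inner_def block_mult_def inner_sum_left)
  finally show ?thesis .
qed

text \<open>Normalise an orthogonal basis after discarding the zero vector, which has no direction.
  The expansion in \<open>C\<close> replaces a Euclidean basis of the type: both the Riesz
  representation of gradients and the coordinates of blocks rest on it.\<close>

lemma ex_orthonormal_basis:
  fixes A :: "'a::real_inner set"
  assumes "finite A"
  shows "\<exists>C. finite C \<and> span C = span A \<and> (\<forall>x\<in>span A. (\<Sum>b\<in>C. inner x b *\<^sub>R b) = x)"
proof -
  obtain C0 where C0: "finite C0" "span C0 = span A" "pairwise real_inner_class.orthogonal C0"
    using basis_orthogonal[OF assms] by auto
  define C where "C = (\<lambda>b. b /\<^sub>R norm b) ` (C0 - {0})"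
  have fin: "finite C" unfolding C_def using C0 by simp
  have nrm: "norm b = 1" if b: "b \<in> C" for b
  proof -
    obtain b' where "b' \<noteq> 0" "b = b' /\<^sub>R norm b'" using b unfolding C_def by blast
    then show ?thesis by simp
  qed
  have orth: "inner b c = 0" if bc: "b \<in> C" "c \<in> C" "b \<noteq> c" for b c
  proof -
    obtain b' c' where b': "b' \<in> C0" "b = b' /\<^sub>R norm b'" and c': "c' \<in> C0" "c = c' /\<^sub>R norm c'"
      using bc unfolding C_def by blast
    then have "b' \<noteq> c'" using bc(3) by metis
    then have "inner b' c' = 0"
      using pairwiseD[OF C0(3) b'(1) c'(1)] by (simp add: real_inner_class.orthogonal_def)
    then show ?thesis using b'(2) c'(2) by simp
  qed
  have sp: "span C = span A"
  proof -
    have "span C = span (C0 - {0})"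
    proof (rule span_eq[THEN iffD2], intro conjI subsetI)
      fix x assume "x \<in> C"
      then obtain b where "b \<in> C0 - {0}" "x = b /\<^sub>R norm b" unfolding C_def by auto
      then show "x \<in> span (C0 - {0})" by (simp add: span_base span_scale)
    next
      fix x assume x: "x \<in> C0 - {0}"
      then have "norm x *\<^sub>R (x /\<^sub>R norm x) \<in> span C"
        unfolding C_def by (intro span_scale span_base) auto
      then show "x \<in> span C" using x by simp
    qed
    then show ?thesis using C0(2) by (simp add: span_delete_0)
  qed
  have exp: "(\<Sum>b\<in>C. inner x b *\<^sub>R b) = x" if x: "x \<in> span C" for x
  proof -
    obtain u where u: "x = (\<Sum>b\<in>C. u b *\<^sub>R b)"
      using x unfolding span_finite[OF fin] by blast
    have "inner x c = u c" if "c \<in> C" for c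
    proof -
      have "inner x c = (\<Sum>b\<in>C. u b * inner b c)" by (subst u) (simp add: inner_sum_left)
      also have "\<dots> = (\<Sum>b\<in>C. if b = c then u c else 0)"
        using that nrm[OF that] by (intro sum.cong refl) (auto simp: orth dot_square_norm)
      also have "\<dots> = u c" using that fin by simp
      finally show ?thesis .
    qed
    then have "(\<Sum>b\<in>C. inner x b *\<^sub>R b) = (\<Sum>b\<in>C. u b *\<^sub>R b)" by simp
    then show ?thesis using u by metis
  qed
  show ?thesis using fin sp exp by blast
qed

text \<open>Parseval's identity on the span of the finitely many blocks, so the ambient inner
  product space may have any dimension.\<close>

lemma ex_coordinates:
  fixes v :: "nat \<Rightarrow> 'a::real_inner"
  shows "\<exists>C. finite C \<and> (\<forall>k<n. \<forall>l<n. inner (v k) (v l) = (\<Sum>b\<in>C. inner (v k) b * inner (v l) b))"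
proof -
  obtain C where fin: "finite C" and exp: "\<forall>x\<in>span (v ` {..<n}). (\<Sum>b\<in>C. inner x b *\<^sub>R b) = x"
    using ex_orthonormal_basis[OF finite_imageI[OF finite_lessThan, of v n]] by blast
  have "inner (v k) (v l) = (\<Sum>b\<in>C. inner (v k) b * inner (v l) b)" if "k < n" for k l
  proof -
    have "v k \<in> span (v ` {..<n})" using that by (auto intro: span_base)
    then have "inner (v k) (v l) = inner (\<Sum>b\<in>C. inner (v k) b *\<^sub>R b) (v l)"
      using bspec[OF exp] by metis
    also have "\<dots> = (\<Sum>b\<in>C. inner (v k) b * inner b (v l))" by (simp add: inner_sum_left)
    finally show ?thesis by (simp add: inner_commute[of _ "v l"])
  qed
  then show ?thesis using fin by blast
qed

text \<open>A quadratic inequality for scalar vectors passes to blocks coordinate by coordinate.\<close>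

lemma block_quadratic_form_coordinates:
  fixes v :: "nat \<Rightarrow> 'a::real_inner"
  shows "\<exists>C. finite C \<and>
    (\<forall>A. block_inner n v (block_mult n A v) =
      (\<Sum>b\<in>C. block_inner n (\<lambda>k. inner (v k) b) (block_mult n A (\<lambda>k. inner (v k) b)))) \<and>
    block_inner n v v = (\<Sum>b\<in>C. block_inner n (\<lambda>k. inner (v k) b) (\<lambda>k. inner (v k) b))"
proof -
  obtain C where C: "finite C"
    "\<And>k l. k < n \<Longrightarrow> l < n \<Longrightarrow> inner (v k) (v l) = (\<Sum>b\<in>C. inner (v k) b * inner (v l) b)"
    using ex_coordinates[of n v] by blast
  have "block_inner n v (block_mult n A v) =
      (\<Sum>b\<in>C. block_inner n (\<lambda>k. inner (v k) b) (block_mult n A (\<lambda>k. inner (v k) b)))" for A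
  proof -
    have "block_inner n v (block_mult n A v) = (\<Sum>k<n. \<Sum>l<n. \<Sum>b\<in>C. A $$ (k, l) * (inner (v k) b * inner (v l) b))"
      unfolding block_inner_def block_mult_def
      by (simp add: inner_sum_right sum_distrib_left[symmetric] C(2))
    also have "\<dots> = (\<Sum>k<n. \<Sum>b\<in>C. \<Sum>l<n. A $$ (k, l) * (inner (v k) b * inner (v l) b))"
      by (intro sum.cong refl sum.swap)
    also have "\<dots> = (\<Sum>b\<in>C. \<Sum>k<n. \<Sum>l<n. A $$ (k, l) * (inner (v k) b * inner (v l) b))"
      by (rule sum.swap)
    finally show ?thesis
      unfolding block_inner_def block_mult_def by (simp add: sum_distrib_left algebra_simps)
  qed
  moreover have "block_inner n v v = (\<Sum>b\<in>C. block_inner n (\<lambda>k. inner (v k) b) (\<lambda>k. inner (v k) b))"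
    unfolding block_inner_def by (subst sum.swap) (simp add: C(2))
  ultimately show ?thesis using C(1) by blast
qed

lemma psd_mat_block:
  fixes v :: "nat \<Rightarrow> 'a::real_inner"
  assumes "psd_mat n A"
  shows "0 \<le> block_inner n v (block_mult n A v)"
proof -
  have scalar: "0 \<le> block_inner n a (block_mult n A a)" for a :: "nat \<Rightarrow> real"
  proof -
    have A: "A \<in> carrier_mat n n" using assms by (simp add: psd_mat_def)
    have "0 \<le> scalar_prod (vec n a) (A *\<^sub>v vec n a)"
      using assms unfolding psd_mat_def by simp
    also have "\<dots> = block_inner n a (block_mult n A a)"
      using A by (simp add: scalar_prod_def block_inner_def block_mult_def lessThan_atLeast0)
    finally show ?thesis .
  qed
  show ?thesis
    using block_quadratic_form_coordinates[of n v] by (auto intro!: sum_nonneg scalar)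
qed

section \<open>Spectral gap of the mixing matrix\<close>

lemma mat_mult_vec_eq_block_mult:
  assumes "A \<in> carrier_mat n n"
  shows "A *\<^sub>v vec n a = vec n (block_mult n A (a :: nat \<Rightarrow> real))"
  using assms by (intro eq_vecI) (auto simp: block_mult_def scalar_prod_def lessThan_atLeast0)

text \<open>The bridge from eigenvectors of matrices to functions on indices. A function is
  arbitrary from \<open>n\<close> onwards, hence a nonzero entry is demanded below
  \<open>n\<close>.\<close>

lemma eigenvalue_iff_block_mult:
  assumes "A \<in> carrier_mat n n"
  shows "eigenvalue A e \<longleftrightarrow> (\<exists>a :: nat \<Rightarrow> real. (\<exists>k<n. a k \<noteq> 0) \<and> (\<forall>k<n. block_mult n A a k = e * a k))"
proof
  assume "eigenvalue A e"
  then obtain v where v: "v \<in> carrier_vec n" "v \<noteq> 0\<^sub>v n" "A *\<^sub>v v = e \<cdot>\<^sub>v v"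
    using assms by (auto simp: eigenvalue_def eigenvector_def)
  have veq: "v = vec n (\<lambda>k. v $ k)" using v(1) by auto
  have "vec n (block_mult n A (\<lambda>k. v $ k)) = e \<cdot>\<^sub>v v"
    using v(3) veq mat_mult_vec_eq_block_mult[OF assms] by metis
  then have "\<forall>k<n. block_mult n A (\<lambda>k. v $ k) k = e * v $ k"
    using v(1) by (metis carrier_vecD index_smult_vec(1) index_vec)
  moreover have "\<exists>k<n. v $ k \<noteq> 0"
    using v(1,2) by (metis carrier_vecD eq_vecI index_zero_vec)
  ultimately show "\<exists>a :: nat \<Rightarrow> real. (\<exists>k<n. a k \<noteq> 0) \<and> (\<forall>k<n. block_mult n A a k = e * a k)" by blast
next
  assume "\<exists>a :: nat \<Rightarrow> real. (\<exists>k<n. a k \<noteq> 0) \<and> (\<forall>k<n. block_mult n A a k = e * a k)"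
  then obtain a k where a: "k < n" "a k \<noteq> 0" "\<forall>k<n. block_mult n A a k = e * a k" by blast
  have "vec n a \<noteq> 0\<^sub>v n" using a(1,2) by (metis index_vec index_zero_vec(1))
  moreover have "A *\<^sub>v vec n a = e \<cdot>\<^sub>v vec n a"
    unfolding mat_mult_vec_eq_block_mult[OF assms] using a(3) by (intro eq_vecI) auto
  ultimately show "eigenvalue A e"
    unfolding eigenvalue_def eigenvector_def carrier_matD(1)[OF assms]
    by (intro exI[of _ "vec n a"]) simp
qed

lemma continuous_on_block_inner_mult:
  "continuous_on S (\<lambda>a :: nat \<Rightarrow> real. block_inner n a (block_mult n A a))"
  unfolding block_inner_def block_mult_def
  by (intro continuous_intros continuous_on_product_coordinates[THEN continuous_on_subset]) auto

text \<open>Vectors are functions on all naturals with the product topology. Zero entries from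
  \<open>n\<close> onwards and entries in \<open>[-1, 1]\<close> below it describe a product of
  compact sets, compact by Tychonoff, and the two equations cut out a closed subset.\<close>

lemma compact_unit_vectors:
  "compact {a :: nat \<Rightarrow> real. (\<forall>k\<ge>n. a k = 0) \<and> (\<Sum>k<n. a k) = 0 \<and> (\<Sum>k<n. (a k)\<^sup>2) = 1}"
    (is "compact ?S")
proof -
  let ?P = "PiE UNIV (\<lambda>k. if k < n then {-1..1} else {0 :: real})"
  have cont: "continuous_on UNIV (\<lambda>a :: nat \<Rightarrow> real. a k)" for k
    by (rule continuous_on_product_coordinates)
  have "compactin (product_topology (\<lambda>_. euclidean) UNIV) ?P"
    by (subst compactin_PiE) (auto simp: compactin_euclidean_iff)
  then have "compact ?P"
    by (simp add: euclidean_product_topology compactin_euclidean_iff)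
  moreover have "closed {a :: nat \<Rightarrow> real. (\<Sum>k<n. a k) = 0 \<and> (\<Sum>k<n. (a k)\<^sup>2) = 1}"
    by (intro closed_Collect_conj closed_Collect_eq continuous_on_sum continuous_on_power continuous_on_const cont)
  ultimately have "compact (?P \<inter> {a :: nat \<Rightarrow> real. (\<Sum>k<n. a k) = 0 \<and> (\<Sum>k<n. (a k)\<^sup>2) = 1})"
    by (rule compact_Int_closed)
  also have "?P \<inter> {a :: nat \<Rightarrow> real. (\<Sum>k<n. a k) = 0 \<and> (\<Sum>k<n. (a k)\<^sup>2) = 1} = ?S"
  proof -
    have "a k \<in> {-1..1}" if "(\<Sum>k<n. (a k)\<^sup>2) = 1" "k < n" for a :: "nat \<Rightarrow> real" and k
    proof -
      have "(a k)\<^sup>2 \<le> (\<Sum>k<n. (a k)\<^sup>2)" using that(2) by (intro member_le_sum) auto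
      then have "\<bar>a k\<bar> \<le> 1" using that(1) by (simp add: abs_square_le_1)
      then show ?thesis by auto
    qed
    moreover have "a \<in> ?P \<longleftrightarrow> (\<forall>k. (k < n \<longrightarrow> a k \<in> {-1..1}) \<and> (k \<ge> n \<longrightarrow> a k = 0))" for a
      unfolding PiE_UNIV_domain Pi_iff by (metis UNIV_I not_less singletonD singletonI)
    ultimately show ?thesis by blast
  qed
  finally show ?thesis .
qed

text \<open>A maximiser of the Rayleigh quotient on the vectors of mean zero is an eigenvector.\<close>

lemma rayleigh_eigenvector:
  assumes A: "A \<in> carrier_mat n n" "transpose_mat A = A" and n: "2 \<le> n"
    and col: "\<And>a :: nat \<Rightarrow> real. (\<Sum>k<n. a k) = 0 \<Longrightarrow> (\<Sum>k<n. block_mult n A a k) = 0"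
  obtains \<rho> v where "(\<Sum>k<n. v k) = 0" "\<exists>k<n. v k \<noteq> 0" "\<forall>k<n. block_mult n A v k = \<rho> * v k"
    "\<And>a :: nat \<Rightarrow> real. (\<Sum>k<n. a k) = 0 \<Longrightarrow> block_inner n a (block_mult n A a) \<le> \<rho> * block_inner n a a"
proof -
  let ?S = "{a :: nat \<Rightarrow> real. (\<forall>k\<ge>n. a k = 0) \<and> (\<Sum>k<n. a k) = 0 \<and> (\<Sum>k<n. (a k)\<^sup>2) = 1}"
  let ?q = "\<lambda>a :: nat \<Rightarrow> real. block_inner n a (block_mult n A a)"
  have "?S \<noteq> {}"
  proof -
    \<comment> \<open>The unit vector with entries \<open>1 / sqrt 2\<close> and
      \<open>- 1 / sqrt 2\<close>; two agents are enough for it.\<close>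
    define a :: "nat \<Rightarrow> real" where "a k = (if k = 0 then 1 / sqrt 2 else if k = 1 then - 1 / sqrt 2 else 0)" for k
    obtain m where m: "n = Suc (Suc m)" using n that[of "n - 2"] by simp
    have "a \<in> ?S"
      unfolding m by (simp add: sum.lessThan_Suc_shift a_def power_divide del: sum.lessThan_Suc)
    then show ?thesis by blast
  qed
  obtain v where v: "v \<in> ?S" "\<And>a. a \<in> ?S \<Longrightarrow> ?q a \<le> ?q v"
    using continuous_attains_sup[OF compact_unit_vectors \<open>?S \<noteq> {}\<close> continuous_on_block_inner_mult[of _ n A]] by blast
  define \<rho> where "\<rho> = ?q v"
  have bound: "?q a \<le> \<rho> * block_inner n a a" if sum0: "(\<Sum>k<n. a k) = 0" for a :: "nat \<Rightarrow> real"
  proof (cases "block_inner n a a = 0")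
    case True
    then have "\<forall>k<n. a k = 0"
      by (simp add: block_inner_self sum_nonneg_eq_0_iff)
    then have "?q a = 0" by (simp add: block_inner_def)
    then show ?thesis using True by simp
  next
    case False
    define s where "s = sqrt (block_inner n a a)"
    have s: "0 < s" "s\<^sup>2 = block_inner n a a"
      using False block_inner_self_nonneg[of n a] by (auto simp: s_def)
    define a' where "a' k = (if k < n then a k / s else 0)" for k
    have "(\<Sum>k<n. (a' k)\<^sup>2) = (\<Sum>k<n. (a k)\<^sup>2) / s\<^sup>2"
      by (simp add: a'_def power_divide sum_divide_distrib)
    also have "\<dots> = 1" using s False by (simp add: block_inner_self)
    finally have "a' \<in> ?S"
      using sum0 by (simp add: a'_def sum_divide_distrib[symmetric])
    then have "?q a' \<le> \<rho>" using v(2) \<rho>_def by blast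
    moreover have "?q a' = ?q (\<lambda>k. (1 / s) *\<^sub>R a k)"
      by (intro block_inner_cong block_mult_cong) (simp_all add: a'_def)
    ultimately have "?q a / s\<^sup>2 \<le> \<rho>"
      by (simp only: block_mult_scaleR block_inner_scaleR) (simp add: power2_eq_square)
    then have "?q a \<le> \<rho> * s\<^sup>2" using s(1) by (simp add: pos_divide_le_eq)
    then show ?thesis using s by simp
  qed
  have v0: "(\<Sum>k<n. v k) = 0" "block_inner n v v = 1"
    using v(1) by (auto simp: block_inner_self)
  define h where "h k = block_mult n A v k - \<rho> * v k" for k
  have h0: "(\<Sum>k<n. h k) = 0"
    using col[OF v0(1)] v0(1) by (simp add: h_def sum_subtractf sum_distrib_left[symmetric])
  \<comment> \<open>Optimality of \<open>v\<close> tested along the line \<open>v + t h\<close>. As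
    \<open>bound\<close> is homogeneous, no normalisation is due, and the coefficient of
    \<open>t\<close> is twice the squared norm of the residual \<open>h\<close>.\<close>
  have quad: "2 * t * block_inner n h h + t\<^sup>2 * (?q h - \<rho> * block_inner n h h) \<le> 0" for t
  proof -
    have "(\<Sum>k<n. v k + t *\<^sub>R h k) = 0"
      using v0 h0 by (simp add: sum.distrib sum_distrib_left[symmetric])
    from bound[OF this]
    have "?q v + t * block_inner n v (block_mult n A h) + (t * block_inner n h (block_mult n A v) + t\<^sup>2 * ?q h)
       \<le> \<rho> * (1 + 2 * t * block_inner n v h + t\<^sup>2 * block_inner n h h)"
      by (simp only: block_mult_add block_mult_scaleR block_inner_add block_inner_scaleR v0)
         (simp add: algebra_simps power2_eq_square block_inner_commute)
    moreover have "block_inner n v (block_mult n A h) = block_inner n h (block_mult n A v)"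
      using block_mult_selfadjoint[OF A] by (metis block_inner_commute)
    moreover have "block_inner n h (block_mult n A v) - \<rho> * block_inner n v h = block_inner n h h"
      unfolding h_def[abs_def] by (simp add: block_inner_def algebra_simps sum_subtractf sum.distrib sum_distrib_left)
    ultimately show ?thesis
      unfolding \<rho>_def[symmetric] by (simp add: algebra_simps)
  qed
  have "block_inner n h h = 0"
  proof (rule ccontr)
    assume "block_inner n h h \<noteq> 0"
    then have p: "0 < block_inner n h h" using block_inner_self_nonneg[of n h] by linarith
    \<comment> \<open>With \<open>c\<close> at least minus the quadratic coefficient,
      \<open>t = |h|^2 / c\<close> makes the quadratic term cost at most half of the linear term
      \<open>2 t |h|^2\<close>, so their sum stays positive, against \<open>quad\<close>.\<close>
    define c where "c = \<bar>?q h - \<rho> * block_inner n h h\<bar> + 1"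
    define t where "t = block_inner n h h / c"
    have c: "0 < c" "- c \<le> ?q h - \<rho> * block_inner n h h" by (auto simp: c_def)
    have t: "0 < t" using p c by (simp add: t_def)
    have "t\<^sup>2 * (- c) \<le> t\<^sup>2 * (?q h - \<rho> * block_inner n h h)"
      using c by (intro mult_left_mono) auto
    moreover have "t\<^sup>2 * c = t * block_inner n h h"
      using c by (simp add: t_def power2_eq_square)
    ultimately have "2 * t * block_inner n h h - t * block_inner n h h \<le> 0"
      using quad[of t] by simp
    then show False using mult_pos_pos[OF t p] by simp
  qed
  then have "\<forall>k<n. block_mult n A v k = \<rho> * v k"
    by (simp add: block_inner_self sum_nonneg_eq_0_iff h_def)
  moreover have "\<exists>k<n. v k \<noteq> 0"
  proof (rule ccontr)
    assume "\<not> (\<exists>k<n. v k \<noteq> 0)"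
    then have "block_inner n v v = 0" by (simp add: block_inner_def)
    then show False using v0(2) by simp
  qed
  ultimately show ?thesis using that v0(1) bound by blast
qed

lemma mixing_mat_sum:
  assumes "mixing_mat n W"
  shows "(\<Sum>k<n. block_mult n W v k) = (\<Sum>k<n. v k)"
proof -
  have "(\<Sum>k<n. block_mult n W v k) = (\<Sum>l<n. \<Sum>k<n. W $$ (k, l) *\<^sub>R v l)"
    unfolding block_mult_def by (rule sum.swap)
  also have "\<dots> = (\<Sum>l<n. (\<Sum>k<n. W $$ (k, l)) *\<^sub>R v l)"
    by (simp add: scaleR_sum_left)
  finally show ?thesis using assms by (simp add: mixing_mat_def)
qed

lemma mixing_mat_const:
  assumes "mixing_mat n W" "k < n"
  shows "block_mult n W (\<lambda>_. c) k = c"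
  using assms by (simp add: block_mult_def mixing_mat_def scaleR_sum_left[symmetric])

text \<open>A maximum principle: at an index where \<open>v\<close> is maximal, the average of
  \<open>M - v\<close> with the strictly positive weights of a power of \<open>W\<close> is zero, so
  \<open>v\<close> is constant, and the zero sum makes the constant zero.\<close>

lemma mixing_mat_fixed_vector:
  fixes v :: "nat \<Rightarrow> real"
  assumes W: "mixing_mat n W" and fx: "\<forall>k<n. block_mult n W v k = v k" and s: "(\<Sum>k<n. v k) = 0"
  shows "\<forall>k<n. v k = 0"
proof (cases "n = 0")
  case False
  have Wc: "W \<in> carrier_mat n n" using W by (simp add: mixing_mat_def psd_mat_def)
  obtain m where m: "\<forall>i<n. \<forall>j<n. 0 < (W ^\<^sub>m m) $$ (i, j)" using W by (auto simp: mixing_mat_def)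
  have pw: "block_mult n (W ^\<^sub>m j) u k = u k" if "\<forall>k<n. block_mult n W u k = u k" "k < n" for j k and u :: "nat \<Rightarrow> real"
    using that(2)
  proof (induction j arbitrary: k)
    case 0
    then show ?case using Wc by (simp add: block_mult_one)
  next
    case (Suc j)
    have "block_mult n (W ^\<^sub>m Suc j) u k = block_mult n (W ^\<^sub>m j) (block_mult n W u) k"
      using block_mult_mult[OF pow_carrier_mat[OF Wc] Wc Suc.prems] by simp
    also have "\<dots> = block_mult n (W ^\<^sub>m j) u k"
      using that(1) by (intro block_mult_cong) auto
    finally show ?case using Suc by simp
  qed
  define M where "M = Max (v ` {..<n})"
  have "M \<in> v ` {..<n}" unfolding M_def using False by (intro Max_in) auto
  then obtain k where k: "k < n" "v k = M" by auto
  have vM: "v l \<le> M" if "l < n" for l unfolding M_def using that by (intro Max_ge) auto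
  have "block_mult n (W ^\<^sub>m m) (\<lambda>l. M - v l) k = M - M"
  proof -
    have "block_mult n (W ^\<^sub>m m) (\<lambda>_. M) k = M"
      using mixing_mat_const[OF W] by (intro pw[OF _ k(1)]) blast
    then show ?thesis
      using pw[OF fx k(1), of m] k(2) by (simp add: block_mult_diff)
  qed
  then have "(\<Sum>l<n. (W ^\<^sub>m m) $$ (k, l) * (M - v l)) = 0"
    by (simp add: block_mult_def)
  then have "\<forall>l\<in>{..<n}. (W ^\<^sub>m m) $$ (k, l) * (M - v l) = 0"
    using m k(1) vM by (subst (asm) sum_nonneg_eq_0_iff) (auto intro!: mult_nonneg_nonneg simp: less_imp_le)
  then have "\<forall>l<n. v l = M" using m k(1) by force
  moreover from this s False have "M = 0" by simp
  ultimately show ?thesis by simp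
qed simp

text \<open>\<open>second_eig W\<close> is a \<open>Max\<close>, so its set must be finite and
  nonempty: eigenvalues are roots of the characteristic polynomial, and the Rayleigh maximiser
  \<open>\<rho>\<close> on vectors of mean zero is a member, different from 1 by primitivity. The
  inequality and the lower bound then follow from \<open>0 \<le> \<rho> \<le> second_eig W\<close>.
  For the upper bound, the eigenvector equation is read at an entry of largest modulus, where a row
  of nonnegative weights sums to one.\<close>

lemma mixing_mat_gap:
  assumes W: "mixing_mat n W" and n: "2 \<le> n"
  shows "0 \<le> second_eig W" "second_eig W < 1"
    "\<And>a :: nat \<Rightarrow> real. (\<Sum>k<n. a k) = 0 \<Longrightarrow>
      block_inner n a (block_mult n W a) \<le> second_eig W * block_inner n a a"
proof -
  have psd: "psd_mat n W" and Wc: "W \<in> carrier_mat n n" "transpose_mat W = W"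
    using W by (auto simp: mixing_mat_def psd_mat_def)
  obtain \<rho> and v :: "nat \<Rightarrow> real" where v: "(\<Sum>k<n. v k) = 0" "\<exists>k<n. v k \<noteq> 0" "\<forall>k<n. block_mult n W v k = \<rho> * v k"
    and bound: "\<And>a :: nat \<Rightarrow> real. (\<Sum>k<n. a k) = 0 \<Longrightarrow> block_inner n a (block_mult n W a) \<le> \<rho> * block_inner n a a"
    using rayleigh_eigenvector[OF Wc n] mixing_mat_sum[OF W] by metis
  let ?E = "{e. eigenvalue W e \<and> e \<noteq> 1}"
  have fin: "finite ?E"
  proof -
    have "char_poly W \<noteq> 0" using degree_monic_char_poly[OF Wc(1)] by auto
    from poly_roots_finite[OF this] show ?thesis
      by (rule finite_subset[rotated]) (auto simp: eigenvalue_root_char_poly[OF Wc(1)])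
  qed
  have "\<rho> \<noteq> 1" using mixing_mat_fixed_vector[OF W _ v(1)] v(2,3) by auto
  then have mem: "\<rho> \<in> ?E"
    using v eigenvalue_iff_block_mult[OF Wc(1)] by blast
  then have le: "\<rho> \<le> second_eig W" unfolding second_eig_def using fin by simp
  have vpos: "0 < block_inner n v v"
  proof -
    have "block_inner n v v \<noteq> 0"
      using v(2) by (auto simp: block_inner_self sum_nonneg_eq_0_iff)
    then show ?thesis using block_inner_self_nonneg[of n v] by linarith
  qed
  have "block_inner n v (block_mult n W v) = \<rho> * block_inner n v v"
    using v(3) by (simp add: block_inner_def sum_distrib_left algebra_simps)
  then have "0 \<le> \<rho> * block_inner n v v" using psd_mat_block[OF psd, of v] by simp
  then have "0 \<le> \<rho>" using vpos by (simp add: zero_le_mult_iff)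
  then show "0 \<le> second_eig W" using le by simp
  have "second_eig W \<in> ?E" unfolding second_eig_def using fin mem by (intro Max_in) auto
  then obtain u k where u: "k < n" "u k \<noteq> (0::real)" "\<forall>k<n. block_mult n W u k = second_eig W * u k"
      and ne: "second_eig W \<noteq> 1"
    using eigenvalue_iff_block_mult[OF Wc(1)] by blast
  define M where "M = Max ((\<lambda>k. \<bar>u k\<bar>) ` {..<n})"
  have "M \<in> (\<lambda>k. \<bar>u k\<bar>) ` {..<n}" unfolding M_def using n by (intro Max_in) (auto simp: lessThan_empty_iff)
  then obtain j where j: "j < n" "\<bar>u j\<bar> = M" by auto
  have uM: "\<bar>u l\<bar> \<le> M" if "l < n" for l unfolding M_def using that by (intro Max_ge) auto
  have Mpos: "0 < M" using uM[OF u(1)] u(2) by linarith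
  have "\<bar>second_eig W\<bar> * M = \<bar>\<Sum>l<n. W $$ (j, l) * u l\<bar>"
    using u(3) j by (simp add: block_mult_def abs_mult)
  also have "\<dots> \<le> (\<Sum>l<n. \<bar>W $$ (j, l) * u l\<bar>)" by (rule sum_abs)
  also have "\<dots> \<le> (\<Sum>l<n. W $$ (j, l) * M)"
    using W j uM by (intro sum_mono) (auto simp: abs_mult mixing_mat_def intro!: mult_left_mono)
  also have "\<dots> = 1 * M" using W j by (simp add: mixing_mat_def sum_distrib_right[symmetric])
  finally have "\<bar>second_eig W\<bar> \<le> 1" using Mpos by simp
  then show "second_eig W < 1" using ne by linarith
  show "block_inner n a (block_mult n W a) \<le> second_eig W * block_inner n a a"
    if "(\<Sum>k<n. a k) = 0" for a :: "nat \<Rightarrow> real"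
    using bound[OF that] mult_right_mono[OF le block_inner_self_nonneg[of n a]] by linarith
qed

lemma mixing_mat_block_gap:
  fixes v :: "nat \<Rightarrow> 'a::real_inner"
  assumes W: "mixing_mat n W" and n: "2 \<le> n" and s: "(\<Sum>k<n. v k) = 0"
  shows "block_inner n v (block_mult n W v) \<le> second_eig W * block_inner n v v"
proof -
  obtain C where C: "finite C"
    "block_inner n v (block_mult n W v) =
      (\<Sum>b\<in>C. block_inner n (\<lambda>k. inner (v k) b) (block_mult n W (\<lambda>k. inner (v k) b)))"
    "block_inner n v v = (\<Sum>b\<in>C. block_inner n (\<lambda>k. inner (v k) b) (\<lambda>k. inner (v k) b))"
    using block_quadratic_form_coordinates[of n v] by blast
  have "(\<Sum>k<n. inner (v k) b) = 0" for b
    using s by (simp add: inner_sum_left[symmetric])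
  then show ?thesis
    unfolding C(2,3) sum_distrib_left by (intro sum_mono mixing_mat_gap(3)[OF W n]) auto
qed

lemma block_inner_add_sq:
  "block_inner n (\<lambda>k. u k + v k) (\<lambda>k. u k + v k) = block_inner n u u + 2 * block_inner n u v + block_inner n v v"
  by (simp add: block_inner_add block_inner_commute[of n v u])

lemma block_inner_young:
  assumes "0 < t"
  shows "block_inner n (\<lambda>k. u k + v k) (\<lambda>k. u k + v k)
    \<le> (1 + t) * block_inner n u u + (1 + 1 / t) * block_inner n v v"
proof -
  have s: "sqrt t * (1 / sqrt t) = 1" "sqrt t * sqrt t = t" "(1 / sqrt t) * (1 / sqrt t) = 1 / t"
    using assms by (simp_all add: real_sqrt_mult[symmetric])
  have "0 \<le> block_inner n (\<lambda>k. sqrt t *\<^sub>R u k - (1 / sqrt t) *\<^sub>R v k) (\<lambda>k. sqrt t *\<^sub>R u k - (1 / sqrt t) *\<^sub>R v k)"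
    by (rule block_inner_self_nonneg)
  also have "\<dots> = (sqrt t * sqrt t) * block_inner n u u - 2 * (sqrt t * (1 / sqrt t)) * block_inner n u v
       + ((1 / sqrt t) * (1 / sqrt t)) * block_inner n v v"
    unfolding block_inner_diff block_inner_scaleR by (simp add: block_inner_commute[of n v u] algebra_simps)
  finally have "2 * block_inner n u v \<le> t * block_inner n u u + (1 / t) * block_inner n v v"
    unfolding s by linarith
  then show ?thesis by (simp add: block_inner_add_sq algebra_simps)
qed

lemma psd_mat_cauchy_schwarz:
  assumes "psd_mat n A"
  shows "(block_inner n u (block_mult n A v))\<^sup>2 \<le> block_inner n u (block_mult n A u) * block_inner n v (block_mult n A v)"
proof -
  let ?a = "block_inner n u (block_mult n A u)" and ?b = "block_inner n u (block_mult n A v)"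
    and ?c = "block_inner n v (block_mult n A v)"
  have A: "A \<in> carrier_mat n n" "transpose_mat A = A" using assms by (auto simp: psd_mat_def)
  have sym: "block_inner n v (block_mult n A u) = ?b"
    using block_mult_selfadjoint[OF A] by (metis block_inner_commute)
  have quad: "0 \<le> s\<^sup>2 * ?a + 2 * s * t * ?b + t\<^sup>2 * ?c" for s t
  proof -
    have "0 \<le> block_inner n (\<lambda>k. s *\<^sub>R u k + t *\<^sub>R v k) (block_mult n A (\<lambda>k. s *\<^sub>R u k + t *\<^sub>R v k))"
      using psd_mat_block[OF assms] .
    also have "\<dots> = s\<^sup>2 * ?a + 2 * s * t * ?b + t\<^sup>2 * ?c"
      unfolding block_mult_add block_mult_scaleR block_inner_add block_inner_scaleR sym
      by (simp add: algebra_simps power2_eq_square)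
    finally show ?thesis .
  qed
  have a: "0 \<le> ?a" and c: "0 \<le> ?c" using psd_mat_block[OF assms] by auto
  show ?thesis
  proof (cases "?c = 0")
    case True
    have "?b = 0"
    proof (rule ccontr)
      assume b: "?b \<noteq> 0"
      \<comment> \<open>For \<open>?c = 0\<close> the form is affine in \<open>t\<close>, and this
        \<open>t\<close> gives it the value \<open>- ?a - 2\<close>.\<close>
      have "0 \<le> 1\<^sup>2 * ?a + 2 * 1 * (- (?a + 1) / ?b) * ?b + (- (?a + 1) / ?b)\<^sup>2 * ?c" by (rule quad)
      then show False using b True a by simp
    qed
    then show ?thesis using True by simp
  next
    case False
    then have c: "0 < ?c" using c by simp
    have "0 \<le> ?c\<^sup>2 * ?a + 2 * ?c * (- ?b) * ?b + (- ?b)\<^sup>2 * ?c" by (rule quad)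
    then have "0 \<le> ?c * (?a * ?c - ?b\<^sup>2)" by (simp add: algebra_simps power2_eq_square)
    then show ?thesis using c by (simp add: zero_le_mult_iff)
  qed
qed

text \<open>The operator inequality \<open>W^2 \<le> \<lambda> W\<close> on vectors of mean zero,
  without diagonalisation: Cauchy-Schwarz for the form of \<open>W\<close>, applied to
  \<open>W v\<close> and \<open>v\<close>, bounds \<open>|W v|^4\<close> by the form at
  \<open>W v\<close> times the form at \<open>v\<close>; the gap bounds the former by
  \<open>\<lambda> |W v|^2\<close>, and one factor \<open>|W v|^2\<close> cancels.\<close>

lemma mixing_mat_square_le:
  assumes W: "mixing_mat n W" and n: "2 \<le> n" and s: "(\<Sum>k<n. v k) = 0"
  shows "block_inner n (block_mult n W v) (block_mult n W v) \<le> second_eig W * block_inner n v (block_mult n W v)"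
proof -
  let ?w = "block_mult n W v"
  have psd: "psd_mat n W" using W by (simp add: mixing_mat_def)
  then have A: "W \<in> carrier_mat n n" "transpose_mat W = W" by (auto simp: psd_mat_def)
  have s': "(\<Sum>k<n. ?w k) = 0" using mixing_mat_sum[OF W] s by metis
  have "(block_inner n ?w ?w)\<^sup>2 \<le> block_inner n ?w (block_mult n W ?w) * block_inner n v ?w"
    using psd_mat_cauchy_schwarz[OF psd, of ?w v] by simp
  also have "\<dots> \<le> (second_eig W * block_inner n ?w ?w) * block_inner n v ?w"
    by (intro mult_right_mono mixing_mat_block_gap[OF W n s'] psd_mat_block[OF psd])
  finally have le: "block_inner n ?w ?w * block_inner n ?w ?w \<le> block_inner n ?w ?w * (second_eig W * block_inner n v ?w)"
    by (simp add: power2_eq_square algebra_simps)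
  show ?thesis
  proof (cases "block_inner n ?w ?w = 0")
    case True
    then show ?thesis
      using mixing_mat_gap(1)[OF W n] psd_mat_block[OF psd, of v] by simp
  next
    case False
    then have "0 < block_inner n ?w ?w" using block_inner_self_nonneg[of n ?w] by linarith
    then show ?thesis using le by simp
  qed
qed

section \<open>Disagreement under the EXTRA recursion\<close>

text \<open>
  The Lyapunov function of one EXTRA step: up to the square root \<open>V\<close> of \<open>I - W\<close>, the disagreement
  \<open>u\<close> is weighted by \<open>W (I - W)\<close>, which makes the cross terms of the two updates cancel.
\<close>

definition extra_lyapunov :: "nat \<Rightarrow> real mat \<Rightarrow> real mat \<Rightarrow> (nat \<Rightarrow> 'a::real_inner) \<Rightarrow> (nat \<Rightarrow> 'a) \<Rightarrow> real" where
  "extra_lyapunov n W V u s =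
     block_inner n (block_mult n V u) (block_mult n W (block_mult n V u)) + block_inner n s s"

locale extra_matrices =
  fixes n :: nat and W V :: "real mat"
  assumes n: "2 \<le> n" and W: "mixing_mat n W" and V: "psd_sqrt n (1\<^sub>m n - W) V"
begin

lemma W_carrier: "W \<in> carrier_mat n n" "transpose_mat W = W" "psd_mat n W"
  using W by (auto simp: mixing_mat_def psd_mat_def)

lemma V_carrier: "V \<in> carrier_mat n n" "transpose_mat V = V"
  using V by (auto simp: psd_sqrt_def psd_mat_def)

lemma V_squared: "k < n \<Longrightarrow> block_mult n V (block_mult n V v) k = v k - block_mult n W v k"
  using block_mult_mult[OF V_carrier(1) V_carrier(1), of k v] V W_carrier(1)
  by (simp add: psd_sqrt_def block_mult_minus block_mult_one)

text \<open>\<open>V\<close> commutes with its own square \<open>I - W\<close>, hence with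
  \<open>W\<close>.\<close>

lemma V_W_commute:
  assumes "k < n"
  shows "block_mult n V (block_mult n W v) k = block_mult n W (block_mult n V v) k"
proof -
  have "block_mult n V (block_mult n W v) k = block_mult n V (\<lambda>k. v k - block_mult n V (block_mult n V v) k) k"
    by (intro block_mult_cong) (simp add: V_squared)
  also have "\<dots> = block_mult n W (block_mult n V v) k"
    using V_squared[OF assms, of "block_mult n V v"] by (simp add: block_mult_diff)
  finally show ?thesis .
qed

lemma V_const: "k < n \<Longrightarrow> block_mult n V (\<lambda>_. c :: 'a::real_inner) k = 0"
proof -
  assume k: "k < n"
  let ?c = "\<lambda>_ :: nat. c"
  have "block_inner n (block_mult n V ?c) (block_mult n V ?c) = block_inner n (block_mult n V (block_mult n V ?c)) ?c"
    by (rule block_mult_selfadjoint[OF V_carrier])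
  also have "\<dots> = 0"
    by (auto simp: block_inner_def V_squared mixing_mat_const[OF W])
  finally show ?thesis using k by (simp add: block_inner_self sum_nonneg_eq_0_iff)
qed

lemma V_sum: "(\<Sum>k<n. block_mult n V v k) = (0 :: 'a::real_inner)"
proof -
  have "inner (\<Sum>k<n. block_mult n V v k) c = 0" for c :: 'a
  proof -
    have "inner (\<Sum>k<n. block_mult n V v k) c = block_inner n (block_mult n V v) (\<lambda>_. c)"
      by (simp add: block_inner_def inner_sum_left)
    also have "\<dots> = block_inner n v (block_mult n V (\<lambda>_. c))"
      by (rule block_mult_selfadjoint[OF V_carrier, symmetric])
    also have "\<dots> = 0" by (simp add: block_inner_def V_const)
    finally show ?thesis .
  qed
  then show ?thesis using inner_eq_zero_iff by blast
qed

lemma V_inner: "block_inner n (block_mult n V u) (block_mult n V v) = block_inner n u (\<lambda>k. v k - block_mult n W v k)"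
proof -
  have "block_inner n (block_mult n V u) (block_mult n V v) = block_inner n u (block_mult n V (block_mult n V v))"
    by (rule block_mult_selfadjoint[OF V_carrier, symmetric])
  then show ?thesis by (simp add: V_squared cong: block_inner_cong)
qed

lemma extra_lyapunov_nonneg: "0 \<le> extra_lyapunov n W V u s"
  unfolding extra_lyapunov_def by (intro add_nonneg_nonneg psd_mat_block W_carrier block_inner_self_nonneg)

text \<open>Here the square root disappears: as \<open>V\<close> commutes with \<open>W\<close>, the
  first summand is the form of \<open>W - W^2\<close> at \<open>u\<close>.\<close>

lemma extra_lyapunov_eq:
  "extra_lyapunov n W V u s =
    block_inner n u (block_mult n W u) - block_inner n (block_mult n W u) (block_mult n W u) + block_inner n s s"
proof -
  have "block_inner n (block_mult n V u) (block_mult n W (block_mult n V u)) =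
     block_inner n (block_mult n V u) (block_mult n V (block_mult n W u))"
    by (intro block_inner_cong refl) (simp add: V_W_commute)
  also have "\<dots> = block_inner n u (block_mult n W u) - block_inner n u (block_mult n W (block_mult n W u))"
    by (simp add: V_inner block_inner_diff)
  also have "block_inner n u (block_mult n W (block_mult n W u)) = block_inner n (block_mult n W u) (block_mult n W u)"
    by (rule block_mult_selfadjoint[OF W_carrier(1,2)])
  finally show ?thesis by (simp add: extra_lyapunov_def)
qed

text \<open>The vector \<open>W u - s\<close> is the disagreement one round later. The disagreement
  \<open>u\<close> itself is out of reach, since \<open>W\<close> may be singular and the Lyapunov
  function is blind to its kernel. By \<open>mixing_mat_square_le\<close>,
  \<open>(1 - \<lambda>) W^2 \<le> W - W^2\<close> on vectors of mean zero, which costs the factor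
  \<open>1 / (1 - \<lambda>)\<close>; the 2 splits the difference.\<close>

lemma disagreement_le_lyapunov:
  assumes u: "(\<Sum>k<n. u k) = 0"
  shows "block_inner n (\<lambda>k. block_mult n W u k - s k) (\<lambda>k. block_mult n W u k - s k)
    \<le> 2 / (1 - second_eig W) * extra_lyapunov n W V u s"
proof -
  let ?g = "1 - second_eig W" and ?w = "block_inner n (block_mult n W u) (block_mult n W u)"
  have g: "0 < ?g" "?g \<le> 1" using mixing_mat_gap[OF W n] by auto
  have "?w \<le> second_eig W * block_inner n u (block_mult n W u)"
    by (rule mixing_mat_square_le[OF W n u])
  then have "?g * ?w \<le> second_eig W * (block_inner n u (block_mult n W u) - ?w)"
    by (simp add: algebra_simps)
  also have "\<dots> \<le> 1 * (block_inner n u (block_mult n W u) - ?w)"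
  proof (rule mult_right_mono)
    show "0 \<le> block_inner n u (block_mult n W u) - ?w"
      using extra_lyapunov_nonneg[of u "\<lambda>_. 0"] unfolding extra_lyapunov_eq by (simp add: block_inner_def)
  qed (use g in simp)
  finally have 1: "?g * ?w \<le> block_inner n u (block_mult n W u) - ?w" by simp
  have 2: "?g * block_inner n s s \<le> block_inner n s s"
    using mult_right_mono[OF g(2) block_inner_self_nonneg[of n s]] by simp
  have "block_inner n (\<lambda>k. block_mult n W u k - s k) (\<lambda>k. block_mult n W u k - s k) \<le> 2 * ?w + 2 * block_inner n s s"
    using block_inner_young[of 1 n "block_mult n W u" "\<lambda>k. - 1 *\<^sub>R s k"]
    unfolding block_inner_scaleR by simp
  then have "?g * block_inner n (\<lambda>k. block_mult n W u k - s k) (\<lambda>k. block_mult n W u k - s k) \<le> ?g * (2 * ?w + 2 * block_inner n s s)"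
    using g by (intro mult_left_mono) auto
  also have "\<dots> \<le> 2 * extra_lyapunov n W V u s"
    using 1 2 unfolding extra_lyapunov_eq by (simp add: algebra_simps)
  finally show ?thesis using g by (simp add: pos_le_divide_eq mult.commute)
qed

text \<open>Up to the last step this is an identity: the new value is
  \<open>|W y|^2 + <s, W s>\<close> with \<open>y = V u\<close>, where \<open><u, W s>\<close> and
  its relatives have cancelled. Both \<open>y\<close> and \<open>s\<close> have mean zero, so each
  summand is at most \<open>\<lambda>\<close> times its counterpart in the old value.\<close>

lemma extra_lyapunov_contract:
  fixes u s :: "nat \<Rightarrow> 'a::real_inner"
  assumes u: "(\<Sum>k<n. u k) = 0" and s: "(\<Sum>k<n. s k) = 0"
  shows "extra_lyapunov n W V (\<lambda>k. block_mult n W u k - s k)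
      (\<lambda>k. block_mult n W s k + (block_mult n W u k - block_mult n W (block_mult n W u) k))
    \<le> second_eig W * extra_lyapunov n W V u s"
proof -
  define y where "y = block_mult n V u"
  define Wm :: "(nat \<Rightarrow> 'a) \<Rightarrow> nat \<Rightarrow> 'a" where "Wm = block_mult n W"
  define Vm :: "(nat \<Rightarrow> 'a) \<Rightarrow> nat \<Rightarrow> 'a" where "Vm = block_mult n V"
  have y0: "(\<Sum>k<n. y k) = 0" by (simp add: y_def V_sum)
  let ?B = "block_inner n"
  have sa: "?B a (Wm b) = ?B (Wm a) b" for a b :: "nat \<Rightarrow> 'a"
    unfolding Wm_def by (rule block_mult_selfadjoint[OF W_carrier(1,2)])
  have Vc: "?B a (Vm (Wm b)) = ?B a (Wm (Vm b))" "?B (Vm (Wm b)) a = ?B (Wm (Vm b)) a" for a b :: "nat \<Rightarrow> 'a"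
    unfolding Vm_def Wm_def by (auto intro!: block_inner_cong simp: V_W_commute)
  have Wd: "Wm (\<lambda>k. a k - b k) = (\<lambda>k. Wm a k - Wm b k)" "Vm (\<lambda>k. a k - b k) = (\<lambda>k. Vm a k - Vm b k)" for a b :: "nat \<Rightarrow> 'a"
    by (simp_all add: Wm_def Vm_def block_mult_diff)
  have Vi: "?B (Vm a) (Vm b) = ?B a b - ?B a (Wm b)" for a b :: "nat \<Rightarrow> 'a"
    unfolding Vm_def Wm_def by (simp add: V_inner block_inner_diff)
  have key: "extra_lyapunov n W V a b = ?B a (Wm a) - ?B (Wm a) (Wm a) + ?B b b" for a b :: "nat \<Rightarrow> 'a"
    unfolding Wm_def by (rule extra_lyapunov_eq)
  have "extra_lyapunov n W V (\<lambda>k. Wm u k - s k) (\<lambda>k. Wm s k + (Wm u k - Wm (Wm u) k))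
     = ?B (Wm u) (Wm u) - ?B (Wm u) (Wm (Wm u)) + ?B s (Wm s)"
  proof -
    have c: "?B (Wm u) s = ?B s (Wm u)" "?B s (Wm (Wm u)) = ?B (Wm s) (Wm u)" "?B (Wm (Wm u)) (Wm s) = ?B (Wm s) (Wm (Wm u))"
      "?B (Wm u) (Wm s) = ?B (Wm s) (Wm u)" "?B (Wm (Wm u)) (Wm u) = ?B (Wm u) (Wm (Wm u))"
      using sa by (metis block_inner_commute)+
    show ?thesis unfolding key Wd block_inner_add block_inner_diff c by (simp add: c)
  qed
  also have "?B (Wm u) (Wm u) - ?B (Wm u) (Wm (Wm u)) = ?B (Wm y) (Wm y)"
  proof -
    have "?B (Wm y) (Wm y) = ?B (Vm (Wm u)) (Vm (Wm u))"
      unfolding y_def Vm_def[symmetric] by (simp only: Vc)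
    then show ?thesis by (simp add: Vi)
  qed
  also have "\<dots> \<le> second_eig W * ?B y (Wm y)"
    unfolding Wm_def by (rule mixing_mat_square_le[OF W n y0])
  also have "?B s (Wm s) \<le> second_eig W * ?B s s"
    unfolding Wm_def by (rule mixing_mat_block_gap[OF W n s])
  finally show ?thesis
    by (simp add: Wm_def y_def extra_lyapunov_def algebra_simps)
qed

lemma extra_lyapunov_perturb:
  assumes "0 < t"
  shows "extra_lyapunov n W V u (\<lambda>k. s k + r k) \<le> (1 + t) * extra_lyapunov n W V u s + (1 + 1 / t) * block_inner n r r"
proof -
  have "0 \<le> block_inner n (block_mult n V u) (block_mult n W (block_mult n V u))"
    by (intro psd_mat_block W_carrier)
  then have "block_inner n (block_mult n V u) (block_mult n W (block_mult n V u))
      \<le> (1 + t) * block_inner n (block_mult n V u) (block_mult n W (block_mult n V u))"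
    using assms by (simp add: mult_le_cancel_right1)
  then show ?thesis
    using block_inner_young[OF assms, of n s r] unfolding extra_lyapunov_def by (simp add: algebra_simps)
qed

end

lemma centroid_centred: "0 < n \<Longrightarrow> (\<Sum>k<n. v k - centroid n v) = 0"
  by (simp add: sum_subtractf centroid_def sum_constant_scaleR)

locale extra_recursion = extra_matrices +
  fixes u d h :: "nat \<Rightarrow> nat \<Rightarrow> 'c::real_inner"
  assumes start: "\<And>k. k < n \<Longrightarrow> u 0 k = u 0 0" "\<And>k. k < n \<Longrightarrow> d 0 k = d 0 0"
    and u_step: "\<And>i k. k < n \<Longrightarrow> u (Suc i) k = block_mult n W (u i) k - h i k - block_mult n V (d i) k"
    and d_step: "\<And>i k. k < n \<Longrightarrow> d (Suc i) k = d i k + block_mult n V (u (Suc i)) k"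
begin

definition dis :: "nat \<Rightarrow> nat \<Rightarrow> 'c" where "dis i k = u i k - centroid n (u i)"

text \<open>The shift absorbs the forcing of the primal update, so the disagreement recursion
  becomes homogeneous. The forcing reappears in the dual update only through its change between
  rounds, \<open>drift\<close>; persistent differences between the agents' gradients therefore do
  not accumulate.\<close>

definition shifted_dual :: "nat \<Rightarrow> nat \<Rightarrow> 'c" where
  "shifted_dual i k = block_mult n V (d i) k + (h i k - centroid n (h i))"

definition potential :: "nat \<Rightarrow> real" where
  "potential i = extra_lyapunov n W V (dis i) (shifted_dual i)"

definition disagreement :: "nat \<Rightarrow> real" where
  "disagreement i = block_inner n (dis i) (dis i)"

definition drift :: "nat \<Rightarrow> nat \<Rightarrow> 'c" where
  "drift i k = (h (Suc i) k - centroid n (h (Suc i))) - (h i k - centroid n (h i))"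

lemma n_pos: "0 < n" using n by simp

lemma centroid_step: "centroid n (u (Suc i)) = centroid n (u i) - centroid n (h i)"
  by (simp add: centroid_def u_step sum_subtractf V_sum mixing_mat_sum[OF W] scaleR_diff_right)

lemma dis_sum: "(\<Sum>k<n. dis i k) = 0"
  unfolding dis_def using n_pos by (rule centroid_centred)

lemma shifted_dual_sum: "(\<Sum>k<n. shifted_dual i k) = 0"
  unfolding shifted_dual_def using centroid_centred[OF n_pos, of "h i"] by (simp add: sum.distrib V_sum)

lemma W_dis: "k < n \<Longrightarrow> block_mult n W (dis i) k = block_mult n W (u i) k - centroid n (u i)"
  unfolding dis_def[abs_def] by (simp add: block_mult_diff mixing_mat_const[OF W])

lemma dis_step: "k < n \<Longrightarrow> dis (Suc i) k = block_mult n W (dis i) k - shifted_dual i k"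
  by (simp add: W_dis shifted_dual_def) (simp add: dis_def u_step centroid_step)

lemma shifted_dual_step:
  assumes k: "k < n"
  shows "shifted_dual (Suc i) k =
    (block_mult n W (shifted_dual i) k + (block_mult n W (dis i) k - block_mult n W (block_mult n W (dis i)) k)) + drift i k"
proof -
  have "block_mult n V (d (Suc i)) k = block_mult n V (\<lambda>k. d i k + block_mult n V (u (Suc i)) k) k"
    by (intro block_mult_cong) (simp add: d_step)
  also have "\<dots> = block_mult n V (d i) k + (u (Suc i) k - block_mult n W (u (Suc i)) k)"
    using k by (simp add: block_mult_add V_squared)
  also have "u (Suc i) k - block_mult n W (u (Suc i)) k = dis (Suc i) k - block_mult n W (dis (Suc i)) k"
    using k by (simp add: W_dis) (simp add: dis_def)
  also have "block_mult n W (dis (Suc i)) k = block_mult n W (\<lambda>k. block_mult n W (dis i) k - shifted_dual i k) k"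
    by (intro block_mult_cong) (simp add: dis_step)
  finally show ?thesis
    using k by (simp add: block_mult_diff dis_step drift_def) (simp add: shifted_dual_def)
qed

lemma disagreement_zero: "disagreement 0 = 0"
proof -
  have "(\<Sum>k<n. u 0 k) = (\<Sum>k<n. u 0 0)"
    by (intro sum.cong refl start) simp
  then have "centroid n (u 0) = u 0 0"
    using n_pos by (simp add: centroid_def sum_constant_scaleR)
  then have "dis 0 k = 0" if "k < n" for k
    using start(1)[OF that] by (simp add: dis_def)
  then show ?thesis by (simp add: disagreement_def block_inner_def)
qed

text \<open>The blocks start identical, so their disagreement vanishes, and \<open>V\<close>
  annihilates the common dual block. Only the spread of the first scaled estimates is left; this is
  where \<open>zeta_sq\<close> enters the bound.\<close>

lemma potential_zero: "potential 0 = (\<Sum>k<n. (norm (h 0 k - centroid n (h 0)))\<^sup>2)"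
proof -
  have d0: "dis 0 k = 0" if "k < n" for k
    using disagreement_zero that
    by (simp add: disagreement_def block_inner_self sum_nonneg_eq_0_iff)
  have "block_mult n W (dis 0) k = 0" for k
    using d0 by (simp add: block_mult_def)
  moreover have "block_mult n V (d 0) k = 0" if "k < n" for k
  proof -
    have "block_mult n V (d 0) k = block_mult n V (\<lambda>_. d 0 0) k"
      by (intro block_mult_cong) (rule start(2))
    then show ?thesis using that by (simp add: V_const)
  qed
  ultimately show ?thesis
    unfolding potential_def extra_lyapunov_eq
    by (simp add: block_inner_def shifted_dual_def power2_norm_eq_inner)
qed

lemma disagreement_step: "disagreement (Suc i) \<le> 2 / (1 - second_eig W) * potential i"
proof -
  have "disagreement (Suc i) = block_inner n (\<lambda>k. block_mult n W (dis i) k - shifted_dual i k) (\<lambda>k. block_mult n W (dis i) k - shifted_dual i k)"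
    unfolding disagreement_def by (intro block_inner_cong) (simp_all add: dis_step)
  then show ?thesis
    unfolding potential_def using disagreement_le_lyapunov[OF dis_sum] by simp
qed

lemma potential_step:
  "potential (Suc i) \<le> (1 - (1 - second_eig W) / 2) * potential i
     + 3 / (1 - second_eig W) * block_inner n (drift i) (drift i)"
proof -
  let ?g = "1 - second_eig W"
  have g: "0 < ?g" "?g \<le> 1" using mixing_mat_gap[OF W n] by auto
  \<comment> \<open>Young's inequality with weight \<open>?g / 2\<close> spends half of the
    contraction; these are the two resulting factors.\<close>
  have aux: "1 + 1 / (x / 2) \<le> 3 / x" "(1 + x / 2) * (1 - x) \<le> 1 - x / 2" if "0 < x" "x \<le> 1" for x :: real
    using that by (simp_all add: field_simps)
  let ?u = "\<lambda>k. block_mult n W (dis i) k - shifted_dual i k"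
  let ?s = "\<lambda>k. block_mult n W (shifted_dual i) k + (block_mult n W (dis i) k - block_mult n W (block_mult n W (dis i)) k)"
  have ext: "extra_lyapunov n W V a b = extra_lyapunov n W V a' b'"
    if "\<And>k. k < n \<Longrightarrow> a k = a' k" "\<And>k. k < n \<Longrightarrow> b k = b' k" for a b a' b' :: "nat \<Rightarrow> 'c"
  proof -
    have "block_mult n V a = block_mult n V a'" using that by (intro ext block_mult_cong)
    then show ?thesis unfolding extra_lyapunov_def using that by (simp cong: block_inner_cong)
  qed
  have "potential (Suc i) = extra_lyapunov n W V ?u (\<lambda>k. ?s k + drift i k)"
    unfolding potential_def by (intro ext) (simp_all add: dis_step shifted_dual_step)
  also have "\<dots> \<le> (1 + ?g / 2) * extra_lyapunov n W V ?u ?s + (1 + 1 / (?g / 2)) * block_inner n (drift i) (drift i)"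
    using g by (intro extra_lyapunov_perturb) simp
  also have "\<dots> \<le> (1 + ?g / 2) * (second_eig W * potential i) + 3 / ?g * block_inner n (drift i) (drift i)"
  proof (intro add_mono mult_left_mono mult_right_mono)
    show "extra_lyapunov n W V ?u ?s \<le> second_eig W * potential i"
      unfolding potential_def by (intro extra_lyapunov_contract dis_sum shifted_dual_sum)
    show "1 + 1 / (?g / 2) \<le> 3 / ?g" by (rule aux(1)[OF g])
  qed (use g block_inner_self_nonneg in auto)
  also have "(1 + ?g / 2) * (second_eig W * potential i) \<le> (1 - ?g / 2) * potential i"
  proof -
    have "(1 + ?g / 2) * second_eig W \<le> 1 - ?g / 2"
      using aux(2)[OF g] by simp
    then show ?thesis
      using mult_right_mono[OF _ extra_lyapunov_nonneg[of "dis i" "shifted_dual i"]]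
      unfolding potential_def by (metis mult.assoc)
  qed
  finally show ?thesis by simp
qed

end

section \<open>Gradients of expected losses\<close>

lemma fin_dim_subspace_imp_subspace: "fin_dim_subspace S \<Longrightarrow> subspace S"
  by (auto simp: fin_dim_subspace_def)

lemma has_real_derivative_along_line:
  assumes S: "subspace S" "x \<in> S" "h \<in> S"
    and f: "(f has_derivative (\<lambda>v. inner g v)) (at (x + t *\<^sub>R h) within S)"
  shows "((\<lambda>t. f (x + t *\<^sub>R h)) has_real_derivative inner g h) (at t)"
proof -
  have 1: "((\<lambda>t. x + t *\<^sub>R h) has_derivative (\<lambda>t. t *\<^sub>R h)) (at t within UNIV)"
    by (auto intro!: derivative_eq_intros)
  have "(\<lambda>t. x + t *\<^sub>R h) ` UNIV \<subseteq> S"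
    using S by (auto intro: subspace_add subspace_scale)
  then have "(f has_derivative (\<lambda>v. inner g v)) (at (x + t *\<^sub>R h) within (\<lambda>t. x + t *\<^sub>R h) ` UNIV)"
    using f has_derivative_subset by blast
  from has_derivative_in_compose[OF 1 this]
  moreover have "(\<lambda>t. inner g (t *\<^sub>R h)) = (*) (inner g h)" by (simp add: fun_eq_iff)
  ultimately show ?thesis by (simp add: has_field_derivative_def)
qed

text \<open>A derivative within \<open>S\<close> fixes its linear map only on \<open>S\<close>.
  Since both candidates lie in \<open>S\<close>, so does their difference, and the derivative along
  that direction separates them.\<close>

lemma grad_unique:
  assumes S: "subspace S" "x \<in> S" "g \<in> S" "(f has_derivative (\<lambda>v. inner g v)) (at x within S)"
  shows "grad S f x = g"
  unfolding grad_def
proof (rule the_equality)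
  fix g' assume g': "g' \<in> S \<and> (f has_derivative (\<lambda>v. inner g' v)) (at x within S)"
  have h: "g' - g \<in> S" using S g' by (auto intro: subspace_diff)
  have "((\<lambda>t. f (x + t *\<^sub>R (g' - g))) has_real_derivative inner g (g' - g)) (at 0)"
    using S h by (intro has_real_derivative_along_line) auto
  moreover have "((\<lambda>t. f (x + t *\<^sub>R (g' - g))) has_real_derivative inner g' (g' - g)) (at 0)"
    using S g' h by (intro has_real_derivative_along_line) auto
  ultimately have "inner g (g' - g) = inner g' (g' - g)" by (rule DERIV_unique)
  then have "inner (g' - g) (g' - g) = 0" by (simp add: inner_diff_left)
  then show "g' = g" by simp
qed (use assms in auto)

text \<open>Riesz representation in the orthonormal basis. The given derivative and the functional
  of \<open>g\<close> agree on \<open>S\<close> only; that suffices, because the difference quotient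
  is taken within \<open>S\<close>, where \<open>y - x\<close> stays in \<open>S\<close>.\<close>

lemma grad_props:
  assumes S: "fin_dim_subspace S" "x \<in> S" "f differentiable (at x within S)"
  shows "grad S f x \<in> S" "(f has_derivative (\<lambda>v. inner (grad S f x) v)) (at x within S)"
proof -
  obtain A where A: "finite A" "S = span A" using S(1) by (auto simp: fin_dim_subspace_def)
  obtain C where C: "finite C" "span C = span A" "\<forall>x\<in>span A. (\<Sum>b\<in>C. inner x b *\<^sub>R b) = x"
    using ex_orthonormal_basis[OF A(1)] by blast
  obtain f' where f': "(f has_derivative f') (at x within S)" using S(3) by (auto simp: differentiable_def)
  then have lin: "linear f'" by (rule has_derivative_linear)
  define g where "g = (\<Sum>b\<in>C. f' b *\<^sub>R b)"
  have gS: "g \<in> S" unfolding g_def A(2) C(2)[symmetric]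
    by (intro span_sum span_scale span_base)
  have eq: "f' h = inner g h" if "h \<in> S" for h
  proof -
    have "f' h = f' (\<Sum>b\<in>C. inner h b *\<^sub>R b)" using C(3) that A(2) by simp
    also have "\<dots> = (\<Sum>b\<in>C. inner h b * f' b)"
      by (simp add: linear_sum[OF lin] linear_scale[OF lin])
    also have "\<dots> = inner g h"
      by (simp add: g_def inner_sum_left mult.commute inner_commute[of h])
    finally show ?thesis .
  qed
  have "(f has_derivative (\<lambda>v. inner g v)) (at x within S)"
    using f' unfolding has_derivative_within
  proof (elim conjE, intro conjI)
    show "bounded_linear (inner g)" by (rule bounded_linear_inner_right)
    assume lim: "((\<lambda>y. (1 / norm (y - x)) *\<^sub>R (f y - (f x + f' (y - x)))) \<longlongrightarrow> 0) (at x within S)"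
    show "((\<lambda>y. (1 / norm (y - x)) *\<^sub>R (f y - (f x + inner g (y - x)))) \<longlongrightarrow> 0) (at x within S)"
    proof (rule Lim_transform_eventually[OF lim])
      show "\<forall>\<^sub>F y in at x within S. (1 / norm (y - x)) *\<^sub>R (f y - (f x + f' (y - x))) =
          (1 / norm (y - x)) *\<^sub>R (f y - (f x + inner g (y - x)))"
        unfolding eventually_at_filter
        using eq subspace_diff[OF fin_dim_subspace_imp_subspace[OF S(1)] _ S(2)]
        by (intro always_eventually) auto
    qed
  qed
  then have "grad S f x = g \<and> (f has_derivative (\<lambda>v. inner g v)) (at x within S)"
    using grad_unique[OF fin_dim_subspace_imp_subspace[OF S(1)] S(2) gS] by blast
  then show "grad S f x \<in> S" "(f has_derivative (\<lambda>v. inner (grad S f x) v)) (at x within S)"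
    using gS by auto
qed

text \<open>
  The derivative of a differentiable function need not be integrable; the bound is still true, since
  then the right-hand side is infinite.
\<close>

lemma increment_le_nn_integral_derivative:
  fixes \<phi> \<phi>' :: "real \<Rightarrow> real"
  assumes d: "\<And>s. (\<phi> has_real_derivative \<phi>' s) (at s)" and m: "\<phi>' \<in> borel_measurable borel" and t: "0 \<le> t"
  shows "ennreal \<bar>\<phi> t - \<phi> 0\<bar> \<le> (\<integral>\<^sup>+s. ennreal \<bar>\<phi>' s\<bar> * indicator {0..t} s \<partial>lborel)"
proof (cases "(\<integral>\<^sup>+s. ennreal \<bar>\<phi>' s\<bar> * indicator {0..t} s \<partial>lborel) < \<infinity>")
  case True
  have eq: "ennreal \<bar>\<phi>' s\<bar> * indicator {0..t} s = ennreal (norm (indicator {0..t} s *\<^sub>R \<phi>' s))" for s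
    by (auto simp: indicator_def)
  have si: "set_integrable lborel {0..t} \<phi>'"
    unfolding set_integrable_def using True m unfolding eq by (intro integrableI_bounded) auto
  have "(\<phi>' has_integral (\<phi> t - \<phi> 0)) {0..t}"
    using t d by (intro fundamental_theorem_of_calculus)
      (auto simp: has_real_derivative_iff_has_vector_derivative[symmetric] intro: has_field_derivative_at_within)
  then have "\<phi> t - \<phi> 0 = (LINT s:{0..t}|lborel. \<phi>' s)"
    using set_borel_integral_eq_integral(2)[OF si] by (metis integral_unique)
  then have "\<bar>\<phi> t - \<phi> 0\<bar> \<le> (LINT s|lborel. norm (indicator {0..t} s *\<^sub>R \<phi>' s))"
    unfolding set_lebesgue_integral_def by (metis integral_norm_bound real_norm_def)
  then have "ennreal \<bar>\<phi> t - \<phi> 0\<bar> \<le> ennreal (LINT s|lborel. norm (indicator {0..t} s *\<^sub>R \<phi>' s))"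
    by (rule ennreal_leI)
  also have "\<dots> = (\<integral>\<^sup>+s. ennreal (norm (indicator {0..t} s *\<^sub>R \<phi>' s)) \<partial>lborel)"
    using si unfolding set_integrable_def by (intro nn_integral_eq_integral[symmetric]) auto
  finally show ?thesis unfolding eq .
qed (metis infinity_ennreal_def less_top top_greatest)

text \<open>Integrate \<open>|f| \<le> f^2 / (2 c) + c / 2\<close>. Working with the extended
  integral yields finiteness of the first moment at the same time.\<close>

lemma (in prob_space) nn_integral_le_of_square_le:
  fixes f :: "'a \<Rightarrow> real"
  assumes f: "f \<in> borel_measurable M" and c: "0 < c"
    and sq: "(\<integral>\<^sup>+x. ennreal ((f x)\<^sup>2) \<partial>M) \<le> ennreal (c\<^sup>2)"
  shows "(\<integral>\<^sup>+x. ennreal \<bar>f x\<bar> \<partial>M) \<le> ennreal c"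
proof -
  have pt: "ennreal \<bar>f x\<bar> \<le> ennreal (1 / (2 * c)) * ennreal ((f x)\<^sup>2) + ennreal (c / 2)" for x
  proof -
    have "0 \<le> (\<bar>f x\<bar> - c)\<^sup>2" by simp
    then have "\<bar>f x\<bar> \<le> 1 / (2 * c) * (f x)\<^sup>2 + c / 2"
      using c by (simp add: field_simps power2_eq_square)
    then show ?thesis
      using c by (simp add: ennreal_mult[symmetric] ennreal_plus[symmetric] ennreal_leI del: ennreal_plus)
  qed
  have "(\<integral>\<^sup>+x. ennreal \<bar>f x\<bar> \<partial>M) \<le> (\<integral>\<^sup>+x. ennreal (1 / (2 * c)) * ennreal ((f x)\<^sup>2) + ennreal (c / 2) \<partial>M)"
    by (intro nn_integral_mono pt)
  also have "\<dots> = ennreal (1 / (2 * c)) * (\<integral>\<^sup>+x. ennreal ((f x)\<^sup>2) \<partial>M) + ennreal (c / 2)"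
    using f by (simp add: nn_integral_add nn_integral_cmult emeasure_space_1)
  also have "\<dots> \<le> ennreal (1 / (2 * c)) * ennreal (c\<^sup>2) + ennreal (c / 2)"
    by (intro add_mono mult_left_mono sq) auto
  also have "\<dots> = ennreal c"
    using c by (simp add: ennreal_mult[symmetric] ennreal_plus[symmetric] power2_eq_square del: ennreal_plus)
  finally show ?thesis .
qed

text \<open>
  Differentiation under the expectation.  The mean-square Lipschitz bound makes the expected error of the
  linearisation quadratic in the increment.
\<close>

lemma expectation_grad:
  fixes q :: "'a::{real_inner,second_countable_topology} \<Rightarrow> 'z \<Rightarrow> real"
  assumes S: "fin_dim_subspace S" and N: "prob_space N"
    and int: "\<And>u. u \<in> S \<Longrightarrow> integrable N (q u)"
    and diff: "\<And>u z. u \<in> S \<Longrightarrow> z \<in> space N \<Longrightarrow> (\<lambda>u. q u z) differentiable (at u within S)"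
    and diffF: "\<And>u. u \<in> S \<Longrightarrow> (\<lambda>u. LINT z|N. q u z) differentiable (at u within S)"
    and meas: "(\<lambda>(u, z). grad S (\<lambda>u. q u z) u) \<in> borel_measurable (restrict_space borel S \<Otimes>\<^sub>M N)"
    and lip: "\<And>u v. u \<in> S \<Longrightarrow> v \<in> S \<Longrightarrow>
      (\<integral>\<^sup>+z. ennreal ((norm (grad S (\<lambda>u. q u z) u - grad S (\<lambda>u. q u z) v))\<^sup>2) \<partial>N) \<le> ennreal (L\<^sup>2 * (norm (u - v))\<^sup>2)"
    and x: "x \<in> S" and h: "h \<in> S"
  shows "integrable N (\<lambda>z. inner (grad S (\<lambda>u. q u z) x) h)"
    and "(LINT z|N. inner (grad S (\<lambda>u. q u z) x) h) = inner (grad S (\<lambda>u. LINT z|N. q u z) x) h"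
proof -
  interpret N: prob_space N by (rule N)
  interpret P: pair_sigma_finite lborel N ..
  have sub: "subspace S" using S by (rule fin_dim_subspace_imp_subspace)
  define D where "D u z = grad S (\<lambda>u. q u z) u" for u z
  have Dm: "(\<lambda>(u, z). D u z) \<in> borel_measurable (restrict_space borel S \<Otimes>\<^sub>M N)" using meas by (simp add: D_def)
  have line: "x + s *\<^sub>R h \<in> S" for s using sub x h by (intro subspace_add subspace_scale)
  have linem: "(\<lambda>s. x + s *\<^sub>R h) \<in> measurable borel (restrict_space borel S)"
    using line by (intro measurable_restrict_space2) (auto intro!: borel_measurable_continuous_onI continuous_intros)
  have Dx: "D u \<in> borel_measurable N" if "u \<in> S" for u
  proof -
    have "(\<lambda>z. (u, z)) \<in> measurable N (restrict_space borel S \<Otimes>\<^sub>M N)"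
      using that by (intro measurable_Pair measurable_const measurable_ident_sets) (auto simp: space_restrict_space)
    from measurable_compose[OF this Dm] show ?thesis by simp
  qed
  have Dline: "(\<lambda>(s, z). D (x + s *\<^sub>R h) z) \<in> borel_measurable (lborel \<Otimes>\<^sub>M N)"
  proof -
    have "(\<lambda>(s, z). (x + s *\<^sub>R h, z)) \<in> measurable (lborel \<Otimes>\<^sub>M N) (restrict_space borel S \<Otimes>\<^sub>M N)"
      unfolding case_prod_beta
      by (intro measurable_Pair measurable_compose[OF measurable_fst] measurable_snd) (use linem in simp)
    from measurable_compose[OF this Dm] show ?thesis by (simp add: case_prod_beta)
  qed
  define e where "e s z = inner (D (x + s *\<^sub>R h) z - D x z) h" for s z
  have em: "(\<lambda>(s, z). e s z) \<in> borel_measurable (lborel \<Otimes>\<^sub>M N)"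
  proof -
    have "(\<lambda>p. D x (snd p)) \<in> borel_measurable (lborel \<Otimes>\<^sub>M N)"
      by (rule measurable_compose[OF measurable_snd Dx[OF x]])
    then show ?thesis
      using Dline unfolding e_def case_prod_beta by (intro borel_measurable_inner borel_measurable_diff) auto
  qed
  \<comment> \<open>The added 1 keeps \<open>K\<close> positive when \<open>h\<close> vanishes, as
    \<open>nn_integral_le_of_square_le\<close> divides by its constant.\<close>
  define K where "K = \<bar>L\<bar> * norm h + 1"
  have K: "0 < K" by (simp add: K_def add_nonneg_pos)
  have e_bound: "(\<integral>\<^sup>+z. ennreal \<bar>e s z\<bar> \<partial>N) \<le> ennreal (norm h * (t * K))" if "0 \<le> s" "s \<le> t" for s t
  proof (cases "s = 0")
    case True
    then show ?thesis by (simp add: e_def)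
  next
    case False
    then have s: "0 < s" using that by simp
    have m: "(\<lambda>z. norm (D (x + s *\<^sub>R h) z - D x z)) \<in> borel_measurable N"
      using Dx[OF line[of s]] Dx[OF x] by (intro borel_measurable_diff measurable_compose[OF _ borel_measurable_norm])
    have "(\<integral>\<^sup>+z. ennreal ((norm (D (x + s *\<^sub>R h) z - D x z))\<^sup>2) \<partial>N) \<le> ennreal (L\<^sup>2 * (norm (s *\<^sub>R h))\<^sup>2)"
      using lip[OF line[of s] x] by (simp add: D_def)
    also have "\<dots> \<le> ennreal ((s * K)\<^sup>2)"
    proof (rule ennreal_leI)
      have "\<bar>L\<bar> * norm (s *\<^sub>R h) \<le> s * K"
        using s by (simp add: K_def algebra_simps)
      then have "(\<bar>L\<bar> * norm (s *\<^sub>R h))\<^sup>2 \<le> (s * K)\<^sup>2" by (intro power_mono) auto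
      then show "L\<^sup>2 * (norm (s *\<^sub>R h))\<^sup>2 \<le> (s * K)\<^sup>2" by (simp add: power_mult_distrib)
    qed
    finally have a1: "(\<integral>\<^sup>+z. ennreal \<bar>norm (D (x + s *\<^sub>R h) z - D x z)\<bar> \<partial>N) \<le> ennreal (s * K)"
      using s K by (intro N.nn_integral_le_of_square_le m) auto
    have a2: "(\<integral>\<^sup>+z. ennreal \<bar>e s z\<bar> \<partial>N) \<le> (\<integral>\<^sup>+z. ennreal (norm h) * ennreal \<bar>norm (D (x + s *\<^sub>R h) z - D x z)\<bar> \<partial>N)"
      unfolding e_def by (intro nn_integral_mono)
        (simp add: ennreal_mult[symmetric] ennreal_leI Cauchy_Schwarz_ineq2 mult.commute[of "norm h"])
    also have "(\<integral>\<^sup>+z. ennreal (norm h) * ennreal \<bar>norm (D (x + s *\<^sub>R h) z - D x z)\<bar> \<partial>N)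
          = ennreal (norm h) * (\<integral>\<^sup>+z. ennreal \<bar>norm (D (x + s *\<^sub>R h) z - D x z)\<bar> \<partial>N)"
      using m by (intro nn_integral_cmult) auto
    also have "\<dots> \<le> ennreal (norm h) * ennreal (s * K)"
      by (intro mult_left_mono a1) simp
    also have "\<dots> = ennreal (norm h * (s * K))"
      using s K by (simp add: ennreal_mult[symmetric])
    also have "\<dots> \<le> ennreal (norm h * (t * K))"
      using that K by (intro ennreal_leI mult_left_mono mult_right_mono) auto
    finally show ?thesis .
  qed
  \<comment> \<open>The linearisation error of one sample. Its derivative along the line is
    \<open>e\<close>, whose first absolute moment is at most linear in the distance from
    \<open>x\<close>; exchanging the integrals makes the first absolute moment of \<open>r t\<close>
    of order \<open>t^2\<close>.\<close>
  define r where "r t z = q (x + t *\<^sub>R h) z - q x z - t * inner (D x z) h" for t z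
  have rm: "r t \<in> borel_measurable N" for t
    using int[OF line, of t] int[OF x] Dx[OF x] unfolding r_def
    by (intro borel_measurable_diff borel_measurable_times borel_measurable_inner) auto
  have r_bound: "(\<integral>\<^sup>+z. ennreal \<bar>r t z\<bar> \<partial>N) \<le> ennreal (t * (norm h * (t * K)))" if t: "0 \<le> t" for t
  proof -
    have "(\<integral>\<^sup>+z. ennreal \<bar>r t z\<bar> \<partial>N) \<le> (\<integral>\<^sup>+z. (\<integral>\<^sup>+s. ennreal \<bar>e s z\<bar> * indicator {0..t} s \<partial>lborel) \<partial>N)"
    proof (intro nn_integral_mono)
      fix z assume z: "z \<in> space N"
      have "ennreal \<bar>r t z - r 0 z\<bar> \<le> (\<integral>\<^sup>+s. ennreal \<bar>e s z\<bar> * indicator {0..t} s \<partial>lborel)"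
      proof (rule increment_le_nn_integral_derivative[OF _ _ t])
        fix s
        have "((\<lambda>t. q (x + t *\<^sub>R h) z) has_real_derivative inner (D (x + s *\<^sub>R h) z) h) (at s)"
          unfolding D_def
          by (rule has_real_derivative_along_line[OF sub x h grad_props(2)[OF S line diff[OF line z]]])
        then show "((\<lambda>t. r t z) has_real_derivative e s z) (at s)"
          unfolding r_def e_def inner_diff_left by (auto intro!: derivative_eq_intros)
      next
        have "(\<lambda>s. (s, z)) \<in> measurable borel (lborel \<Otimes>\<^sub>M N)"
          using z by (intro measurable_Pair) auto
        from measurable_compose[OF this em] show "(\<lambda>s. e s z) \<in> borel_measurable borel" by simp
      qed
      then show "ennreal \<bar>r t z\<bar> \<le> (\<integral>\<^sup>+s. ennreal \<bar>e s z\<bar> * indicator {0..t} s \<partial>lborel)"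
        by (simp add: r_def)
    qed
    also have "\<dots> = (\<integral>\<^sup>+s. (\<integral>\<^sup>+z. ennreal \<bar>e s z\<bar> * indicator {0..t} s \<partial>N) \<partial>lborel)"
    proof (rule P.Fubini')
      show "(\<lambda>(s, z). ennreal \<bar>e s z\<bar> * indicator {0..t} s) \<in> borel_measurable (lborel \<Otimes>\<^sub>M N)"
        using em unfolding case_prod_beta by measurable
    qed
    also have "\<dots> \<le> (\<integral>\<^sup>+s. ennreal (norm h * (t * K)) * indicator {0..t} s \<partial>lborel)"
      using e_bound by (intro nn_integral_mono) (auto simp: indicator_def)
    also have "\<dots> = ennreal (norm h * (t * K)) * ennreal t"
      using t by (simp add: nn_integral_cmult)
    also have "\<dots> = ennreal (t * (norm h * (t * K)))"
      using t K by (simp add: ennreal_mult[symmetric] mult.commute)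
    finally show ?thesis .
  qed
  have r_int: "integrable N (r t)" if "0 \<le> t" for t
    using r_bound[OF that] rm by (intro integrableI_bounded) (auto intro: order.strict_trans1)
  \<comment> \<open>Integrability of the sample gradient is a conclusion: the gradient is the
    increment of the integrable loss minus the remainder at \<open>t = 1\<close>.\<close>
  have "(\<lambda>z. inner (D x z) h) = (\<lambda>z. q (x + 1 *\<^sub>R h) z - q x z - r 1 z)" by (simp add: r_def)
  then show D_int: "integrable N (\<lambda>z. inner (grad S (\<lambda>u. q u z) x) h)"
    using int[OF line, of 1] int[OF x] r_int[of 1] unfolding D_def[symmetric] by simp
  define F where "F u = (LINT z|N. q u z)" for u
  define m where "m = (LINT z|N. inner (D x z) h)"
  have F_bound: "\<bar>F (x + t *\<^sub>R h) - F x - t * m\<bar> \<le> t * (norm h * (t * K))" if t: "0 \<le> t" for t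
  proof -
    have "F (x + t *\<^sub>R h) - F x - t * m = (LINT z|N. r t z)"
      using int[OF line, of t] int[OF x] D_int unfolding r_def F_def m_def D_def[symmetric] by simp
    also have "\<bar>\<dots>\<bar> \<le> (LINT z|N. \<bar>r t z\<bar>)"
      using integral_norm_bound[of N "r t"] by simp
    also have "\<dots> \<le> t * (norm h * (t * K))"
      using r_bound[OF t] nn_integral_eq_integral[OF integrable_abs[OF r_int[OF t]]] t K by simp
    finally show ?thesis .
  qed
  have "((\<lambda>t. F (x + t *\<^sub>R h)) has_real_derivative inner (grad S F x) h) (at 0)"
    using grad_props(2)[OF S x diffF[OF x]] unfolding F_def[symmetric]
    by (intro has_real_derivative_along_line[OF sub x h]) simp
  \<comment> \<open>Two limits of the same one-sided quotient are compared: one from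
    differentiability of the expected loss, the other from \<open>F_bound\<close>, which is stated
    for \<open>0 \<le> t\<close>.\<close>
  then have "((\<lambda>t. (F (x + t *\<^sub>R h) - F x) / t) \<longlongrightarrow> inner (grad S F x) h) (at_right 0)"
    unfolding has_field_derivative_iff by (auto intro: tendsto_mono at_le)
  moreover have "((\<lambda>t. (F (x + t *\<^sub>R h) - F x) / t) \<longlongrightarrow> m) (at_right 0)"
  proof (rule LIM_zero_cancel, rule Lim_null_comparison)
    show "\<forall>\<^sub>F t in at_right 0. norm ((F (x + t *\<^sub>R h) - F x) / t - m) \<le> norm h * (t * K)"
      unfolding eventually_at_right_field
    proof (intro exI[of _ 1] conjI allI impI)
      fix t :: real assume t: "0 < t" "t < 1"
      have "(F (x + t *\<^sub>R h) - F x) / t - m = (F (x + t *\<^sub>R h) - F x - t * m) / t"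
        using t by (simp add: field_simps)
      then show "norm ((F (x + t *\<^sub>R h) - F x) / t - m) \<le> norm h * (t * K)"
        using F_bound[of t] t by (simp add: abs_divide pos_divide_le_eq mult.commute)
    qed simp
    have "((\<lambda>t. norm h * (t * K)) \<longlongrightarrow> norm h * (0 * K)) (at_right 0)" by (intro tendsto_intros)
    then show "((\<lambda>t. norm h * (t * K)) \<longlongrightarrow> 0) (at_right 0)" by simp
  qed
  ultimately have "inner (grad S F x) h = m"
    using tendsto_unique trivial_limit_at_right_real by blast
  then show "(LINT z|N. inner (grad S (\<lambda>u. q u z) x) h) = inner (grad S (\<lambda>u. LINT z|N. q u z) x) h"
    by (simp add: m_def D_def F_def[abs_def])
qed

text \<open>The mean value theorem on the segment replaces the usual integral of the gradient. The
  gradient is compared at one intermediate point, which gives the constant \<open>L\<close> where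
  integration would give \<open>L / 2\<close>.\<close>

lemma mean_value_bound:
  fixes f :: "'a::real_inner \<Rightarrow> real"
  assumes S: "subspace S" and x: "x \<in> S" and h: "h \<in> S"
    and d: "\<And>u. u \<in> S \<Longrightarrow> (f has_derivative (\<lambda>v. inner (G u) v)) (at u within S)"
    and lip: "\<And>u v. u \<in> S \<Longrightarrow> v \<in> S \<Longrightarrow> norm (G u - G v) \<le> L * norm (u - v)" and L: "0 \<le> L"
  shows "\<bar>f (x + h) - f x - inner (G x) h\<bar> \<le> L * (norm h)\<^sup>2"
proof -
  have line: "x + t *\<^sub>R h \<in> S" for t using S x h by (intro subspace_add subspace_scale)
  have "\<exists>z::real. 0 < z \<and> z < 1 \<and> f (x + 1 *\<^sub>R h) - f (x + 0 *\<^sub>R h) = (1 - 0) * inner (G (x + z *\<^sub>R h)) h"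
    using S x h d line by (intro MVT2 has_real_derivative_along_line) auto
  then obtain z :: real where z: "0 < z" "z < 1" "f (x + h) - f x = inner (G (x + z *\<^sub>R h)) h" by auto
  then have "\<bar>f (x + h) - f x - inner (G x) h\<bar> = \<bar>inner (G (x + z *\<^sub>R h) - G x) h\<bar>"
    by (simp add: inner_diff_left)
  also have "\<dots> \<le> norm (G (x + z *\<^sub>R h) - G x) * norm h" by (rule Cauchy_Schwarz_ineq2)
  also have "\<dots> \<le> (L * norm (z *\<^sub>R h)) * norm h"
    using lip[OF line[of z] x] by (intro mult_right_mono) auto
  also have "\<dots> = z * (L * (norm h)\<^sup>2)" using z by (simp add: power2_eq_square)
  also have "\<dots> \<le> 1 * (L * (norm h)\<^sup>2)" using z L by (intro mult_right_mono) auto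
  finally show ?thesis by simp
qed

section \<open>Error bound under the Polyak-Lojasiewicz condition\<close>

text \<open>
  Gradient ascent from \<open>y\<close> approaches the maximum along a path of length at most a multiple of the
  root of the initial gap; with the PL condition this is an error bound.  Near-maximisers suffice
  below, so no limit of the path is needed.
\<close>

lemma PL_error_bound:
  fixes f :: "'a::real_inner \<Rightarrow> real"
  assumes S: "subspace S" and y: "y \<in> S"
    and GS: "\<And>u. u \<in> S \<Longrightarrow> G u \<in> S"
    and d: "\<And>u. u \<in> S \<Longrightarrow> (f has_derivative (\<lambda>v. inner (G u) v)) (at u within S)"
    and lip: "\<And>u v. u \<in> S \<Longrightarrow> v \<in> S \<Longrightarrow> norm (G u - G v) \<le> L * norm (u - v)"
    and nu: "0 < \<nu>" "\<nu> \<le> L"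
    and max: "\<And>u. u \<in> S \<Longrightarrow> f u \<le> m"
    and PL: "\<And>u. u \<in> S \<Longrightarrow> 2 * \<nu> * (m - f u) \<le> (norm (G u))\<^sup>2"
    and eps: "0 < \<epsilon>"
  shows "\<exists>u\<in>S. m - f u < \<epsilon> \<and> norm (u - y) \<le> 2 / \<nu> * norm (G y)"
proof -
  have L: "0 < L" using nu by simp
  \<comment> \<open>The step \<open>1 / (2 L)\<close> maximises the increase
    \<open>t |G|^2 - L t^2 |G|^2\<close> guaranteed by \<open>mean_value_bound\<close>; the maximum
    is \<open>|G|^2 / (4 L)\<close>.\<close>
  define step where "step u = u + (1 / (2 * L)) *\<^sub>R G u" for u
  define ys where "ys i = (step ^^ i) y" for i
  define c where "c = 4 / sqrt (2 * \<nu>)"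
  have sn: "0 < sqrt (2 * \<nu>)" using nu by simp
  have ysS: "ys i \<in> S" for i
    by (induction i) (use S y GS in \<open>auto simp: ys_def step_def intro!: subspace_add subspace_scale\<close>)
  have desc: "m - f (step u) \<le> m - f u - (norm (G u))\<^sup>2 / (4 * L)" if u: "u \<in> S" for u
  proof -
    have "\<bar>f (u + (1 / (2 * L)) *\<^sub>R G u) - f u - inner (G u) ((1 / (2 * L)) *\<^sub>R G u)\<bar> \<le> L * (norm ((1 / (2 * L)) *\<^sub>R G u))\<^sup>2"
      using S u GS d lip L by (intro mean_value_bound) (auto intro: subspace_scale)
    moreover have "L * (norm ((1 / (2 * L)) *\<^sub>R G u))\<^sup>2 = (norm (G u))\<^sup>2 / (4 * L)"
      using L by (simp add: power2_eq_square)
    moreover have "inner (G u) ((1 / (2 * L)) *\<^sub>R G u) = (norm (G u))\<^sup>2 / (2 * L)"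
      by (simp add: power2_norm_eq_inner)
    moreover have "(norm (G u))\<^sup>2 / (2 * L) = 2 * ((norm (G u))\<^sup>2 / (4 * L))" by simp
    ultimately show ?thesis unfolding step_def by linarith
  qed
  have stepS: "step u \<in> S" if "u \<in> S" for u
    using S GS that by (auto simp: step_def intro!: subspace_add subspace_scale)
  \<comment> \<open>The length of each step is paid for by the decrease of
    \<open>c sqrt (m - f)\<close>, so lengths telescope. With \<open>a\<close>, \<open>b\<close> the
    roots of the old and new gap, \<open>a^2 - b^2 \<ge> g^2 / (4 L)\<close>, while
    \<open>a + b \<le> 2 a \<le> 2 g / sqrt (2 \<nu>)\<close> by the PL condition. Dividing gives a
    multiple of \<open>a - b\<close> above the step length \<open>g / (2 L)\<close>, and that
    multiple is \<open>c\<close>.\<close>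
  have len: "norm (step u - u) + c * sqrt (m - f (step u)) \<le> c * sqrt (m - f u)" if u: "u \<in> S" for u
  proof -
    let ?a = "sqrt (m - f u)" and ?b = "sqrt (m - f (step u))" and ?g = "norm (G u)"
    have nn: "0 \<le> m - f u" "0 \<le> m - f (step u)" using max[OF u] max[OF stepS[OF u]] by auto
    have sq: "?a\<^sup>2 = m - f u" "?b\<^sup>2 = m - f (step u)" using nn by auto
    have n: "norm (step u - u) = ?g / (2 * L)" using L by (simp add: step_def)
    have ga: "sqrt (2 * \<nu>) * ?a \<le> ?g"
      using PL[OF u] by (simp add: real_sqrt_mult[symmetric] real_le_lsqrt)
    have ba: "?b \<le> ?a" 
    proof -
      have "0 \<le> ?g\<^sup>2 / (4 * L)" using L by simp
      then show ?thesis using desc[OF u] by simp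
    qed
    have diff: "?g\<^sup>2 / (4 * L) \<le> (?a - ?b) * (?a + ?b)"
      using desc[OF u] sq by (simp add: power2_eq_square algebra_simps)
    show ?thesis
    proof (cases "?g = 0")
      case True
      then show ?thesis using n ba sn by (simp add: c_def mult_left_mono)
    next
      case False
      then have g: "0 < ?g" by simp
      have "(?a - ?b) * (?a + ?b) \<le> (?a - ?b) * (2 * ?a)"
        using ba by (intro mult_left_mono) auto
      also have "\<dots> \<le> (?a - ?b) * (2 * (?g / sqrt (2 * \<nu>)))"
        using ba ga sn by (intro mult_left_mono) (auto simp: pos_le_divide_eq mult.commute)
      finally have gs: "?g\<^sup>2 / (4 * L) \<le> (?a - ?b) * (2 * (?g / sqrt (2 * \<nu>)))"
        using diff by linarith
      then have "?g * (?g / (4 * L)) \<le> ?g * ((?a - ?b) * (2 / sqrt (2 * \<nu>)))"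
      proof -
        have "(a - b) * (2 * (g / s)) = g * ((a - b) * (2 / s))" "g\<^sup>2 / l = g * (g / l)" for a b g s l :: real
          by (simp_all add: power2_eq_square)
        then show ?thesis using gs by metis
      qed
      then have "?g / (4 * L) \<le> (?a - ?b) * (2 / sqrt (2 * \<nu>))"
        by (rule mult_left_le_imp_le[OF _ g])
      then have "?g / (2 * L) \<le> c * (?a - ?b)" by (simp add: c_def algebra_simps)
      then show ?thesis using n by (simp add: algebra_simps)
    qed
  qed
  have path: "norm (ys i - y) + c * sqrt (m - f (ys i)) \<le> c * sqrt (m - f y)" for i
  proof (induction i)
    case 0
    then show ?case by (simp add: ys_def)
  next
    case (Suc i)
    have eq: "ys (Suc i) = step (ys i)" by (simp add: ys_def)
    have "norm (ys (Suc i) - y) \<le> norm (ys (Suc i) - ys i) + norm (ys i - y)"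
      using norm_triangle_ineq[of "ys (Suc i) - ys i" "ys i - y"] by simp
    then show ?case using len[OF ysS[of i]] Suc unfolding eq by linarith
  qed
  have "c * sqrt (m - f y) \<le> c * (norm (G y) / sqrt (2 * \<nu>))"
    using PL[OF y] sn by (intro mult_left_mono)
      (auto simp: c_def pos_le_divide_eq real_sqrt_mult[symmetric] real_le_lsqrt mult.commute)
  also have "\<dots> = 4 / (sqrt (2 * \<nu>) * sqrt (2 * \<nu>)) * norm (G y)" by (simp add: c_def)
  also have "sqrt (2 * \<nu>) * sqrt (2 * \<nu>) = 2 * \<nu>" using nu by simp
  also have "4 / (2 * \<nu>) * norm (G y) = 2 / \<nu> * norm (G y)" by simp
  finally have c: "c * sqrt (m - f y) \<le> 2 / \<nu> * norm (G y)" .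
  have close: "norm (ys i - y) \<le> 2 / \<nu> * norm (G y)" for i
  proof -
    have "0 \<le> c * sqrt (m - f (ys i))" using max[OF ysS[of i]] sn by (simp add: c_def)
    then show ?thesis using path[of i] c by linarith
  qed
  \<comment> \<open>The PL condition turns the increase of one step into a geometric decay of the
    gap with this factor; \<open>\<nu> \<le> L\<close> keeps it nonnegative.\<close>
  define \<rho> where "\<rho> = 1 - \<nu> / (2 * L)"
  have rho: "0 \<le> \<rho>" "\<rho> < 1" using nu L by (auto simp: \<rho>_def field_simps)
  have geo: "m - f (ys i) \<le> \<rho> ^ i * (m - f y)" for i
  proof (induction i)
    case 0
    then show ?case by (simp add: ys_def)
  next
    case (Suc i)
    have "m - f (ys (Suc i)) \<le> m - f (ys i) - (norm (G (ys i)))\<^sup>2 / (4 * L)"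
      using desc[OF ysS[of i]] by (simp add: ys_def)
    also have "\<dots> \<le> m - f (ys i) - 2 * \<nu> * (m - f (ys i)) / (4 * L)"
      using PL[OF ysS[of i]] L by (intro diff_left_mono divide_right_mono) auto
    also have "\<dots> = \<rho> * (m - f (ys i))" using L by (simp add: \<rho>_def field_simps)
    also have "\<dots> \<le> \<rho> * (\<rho> ^ i * (m - f y))" using Suc rho by (intro mult_left_mono) auto
    finally show ?case by simp
  qed
  have "(\<lambda>i. \<rho> ^ i * (m - f y)) \<longlonglongrightarrow> 0 * (m - f y)"
    using rho by (intro tendsto_mult LIMSEQ_realpow_zero) auto
  then have "eventually (\<lambda>i. \<rho> ^ i * (m - f y) < \<epsilon>) sequentially"
    using eps by (auto dest: order_tendstoD)
  then obtain i where "\<rho> ^ i * (m - f y) < \<epsilon>" by (auto simp: eventually_sequentially)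
  then show ?thesis using geo[of i] close[of i] ysS[of i] by (intro bexI[of _ "ys i"]) auto
qed

section \<open>Gradients of the risk and their Lipschitz bounds\<close>

locale risk_problem =
  fixes pb :: "('a::{real_inner,second_countable_topology}, 'b::{real_inner,second_countable_topology}, 'z) minimax"
    and L \<nu> :: real
  assumes wp: "well_posed pb" and PL: "PL_condition pb \<nu>" and ms: "mean_square_smooth pb L"
    and nu: "0 < \<nu>" "\<nu> \<le> L"
begin

abbreviation "X \<equiv> xspace pb"
abbreviation "Y \<equiv> yspace pb"
abbreviation "K \<equiv> agents pb"

lemma L_pos: "0 < L" using nu by simp
lemma K_pos: "0 < K" using wp by (simp add: well_posed_def)
lemma fd: "fin_dim_subspace X" "fin_dim_subspace Y" using wp by (auto simp: well_posed_def)
lemma subX: "subspace X" and subY: "subspace Y" using fd by (auto intro: fin_dim_subspace_imp_subspace)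
lemma law: "k < K \<Longrightarrow> prob_space (sample_law pb k)" using wp by (auto simp: well_posed_def)

lemma grad_x_loss_measurable: "k < K \<Longrightarrow> (\<lambda>(x, y, z). grad_x_loss pb k x y z) \<in>
    borel_measurable (restrict_space borel X \<Otimes>\<^sub>M (restrict_space borel Y \<Otimes>\<^sub>M sample_law pb k))"
  and grad_y_loss_measurable: "k < K \<Longrightarrow> (\<lambda>(x, y, z). grad_y_loss pb k x y z) \<in>
    borel_measurable (restrict_space borel X \<Otimes>\<^sub>M (restrict_space borel Y \<Otimes>\<^sub>M sample_law pb k))"
  using wp by (auto simp: well_posed_def)

lemma
  assumes "k < K" "x \<in> X" "y \<in> Y"
  shows loss_integrable: "integrable (sample_law pb k) (loss pb k x y)"
    and loss_diff: "z \<in> space (sample_law pb k) \<Longrightarrow> (\<lambda>u. loss pb k u y z) differentiable (at x within X)"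
      "z \<in> space (sample_law pb k) \<Longrightarrow> (\<lambda>v. loss pb k x v z) differentiable (at y within Y)"
    and local_diff: "(\<lambda>u. local_risk pb k u y) differentiable (at x within X)"
      "(\<lambda>v. local_risk pb k x v) differentiable (at y within Y)"
  using wp assms by (auto simp: well_posed_def)

lemma
  assumes "k < K" "x1 \<in> X" "x2 \<in> X" "y1 \<in> Y" "y2 \<in> Y"
  shows ms_x: "(\<integral>\<^sup>+z. ennreal ((norm (grad_x_loss pb k x1 y1 z - grad_x_loss pb k x2 y2 z))\<^sup>2) \<partial>sample_law pb k)
          \<le> ennreal (L\<^sup>2 * ((norm (x1 - x2))\<^sup>2 + (norm (y1 - y2))\<^sup>2))"
    and ms_y: "(\<integral>\<^sup>+z. ennreal ((norm (grad_y_loss pb k x1 y1 z - grad_y_loss pb k x2 y2 z))\<^sup>2) \<partial>sample_law pb k)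
          \<le> ennreal (L\<^sup>2 * ((norm (x1 - x2))\<^sup>2 + (norm (y1 - y2))\<^sup>2))"
  using ms assms unfolding mean_square_smooth_def by blast+

text \<open>Differentiation under the expectation at a fixed point. The mean-square bound with equal
  second arguments is the Lipschitz hypothesis of \<open>expectation_grad\<close> in the first
  variable.\<close>

lemma
  assumes k: "k < K" and x: "x \<in> X" and y: "y \<in> Y" and h: "h \<in> X"
  shows grad_x_integrable: "integrable (sample_law pb k) (\<lambda>z. inner (grad_x_loss pb k x y z) h)"
    and grad_x_expectation: "(LINT z|sample_law pb k. inner (grad_x_loss pb k x y z) h) = inner (grad_x_local pb k x y) h"
proof -
  let ?N = "sample_law pb k"
  have meas: "(\<lambda>(u, z). grad X (\<lambda>u. loss pb k u y z) u) \<in> borel_measurable (restrict_space borel X \<Otimes>\<^sub>M ?N)"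
  proof -
    have "(\<lambda>(u, z). (u, y, z)) \<in> measurable (restrict_space borel X \<Otimes>\<^sub>M ?N)
        (restrict_space borel X \<Otimes>\<^sub>M (restrict_space borel Y \<Otimes>\<^sub>M ?N))"
      unfolding case_prod_beta using y
      by (intro measurable_Pair measurable_fst measurable_snd measurable_const) (auto simp: space_restrict_space)
    from measurable_compose[OF this grad_x_loss_measurable[OF k]]
    show ?thesis by (simp add: case_prod_beta grad_x_loss_def)
  qed
  have lip: "(\<integral>\<^sup>+z. ennreal ((norm (grad X (\<lambda>u. loss pb k u y z) u - grad X (\<lambda>u. loss pb k u y z) v))\<^sup>2) \<partial>?N)
      \<le> ennreal (L\<^sup>2 * (norm (u - v))\<^sup>2)" if "u \<in> X" "v \<in> X" for u v
    using ms_x[OF k that y y] by (simp add: grad_x_loss_def)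
  note * = expectation_grad[OF fd(1) law[OF k] loss_integrable[OF k _ y] loss_diff(1)[OF k _ y]
      local_diff(1)[OF k _ y, unfolded local_risk_def[abs_def]] meas lip x h]
  show "integrable ?N (\<lambda>z. inner (grad_x_loss pb k x y z) h)"
    using *(1) by (simp add: grad_x_loss_def)
  show "(LINT z|?N. inner (grad_x_loss pb k x y z) h) = inner (grad_x_local pb k x y) h"
    using *(2) by (simp add: grad_x_loss_def grad_x_local_def local_risk_def)
qed

lemma
  assumes k: "k < K" and x: "x \<in> X" and y: "y \<in> Y" and h: "h \<in> Y"
  shows grad_y_integrable: "integrable (sample_law pb k) (\<lambda>z. inner (grad_y_loss pb k x y z) h)"
    and grad_y_expectation: "(LINT z|sample_law pb k. inner (grad_y_loss pb k x y z) h) = inner (grad_y_local pb k x y) h"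
proof -
  let ?N = "sample_law pb k"
  have meas: "(\<lambda>(u, z). grad Y (\<lambda>u. loss pb k x u z) u) \<in> borel_measurable (restrict_space borel Y \<Otimes>\<^sub>M ?N)"
  proof -
    have "(\<lambda>(u, z). (x, u, z)) \<in> measurable (restrict_space borel Y \<Otimes>\<^sub>M ?N)
        (restrict_space borel X \<Otimes>\<^sub>M (restrict_space borel Y \<Otimes>\<^sub>M ?N))"
      unfolding case_prod_beta using x
      by (intro measurable_Pair measurable_fst measurable_snd measurable_const) (auto simp: space_restrict_space)
    from measurable_compose[OF this grad_y_loss_measurable[OF k]]
    show ?thesis by (simp add: case_prod_beta grad_y_loss_def)
  qed
  have lip: "(\<integral>\<^sup>+z. ennreal ((norm (grad Y (\<lambda>u. loss pb k x u z) u - grad Y (\<lambda>u. loss pb k x u z) v))\<^sup>2) \<partial>?N)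
      \<le> ennreal (L\<^sup>2 * (norm (u - v))\<^sup>2)" if "u \<in> Y" "v \<in> Y" for u v
    using ms_y[OF k x x that] by (simp add: grad_y_loss_def)
  note * = expectation_grad[OF fd(2) law[OF k] loss_integrable[OF k x] loss_diff(2)[OF k x]
      local_diff(2)[OF k x, unfolded local_risk_def[abs_def]] meas lip y h]
  show "integrable ?N (\<lambda>z. inner (grad_y_loss pb k x y z) h)"
    using *(1) by (simp add: grad_y_loss_def)
  show "(LINT z|?N. inner (grad_y_loss pb k x y z) h) = inner (grad_y_local pb k x y) h"
    using *(2) by (simp add: grad_y_loss_def grad_y_local_def local_risk_def)
qed

definition stoch_grad :: "nat \<Rightarrow> 'a \<times> 'b \<Rightarrow> 'z \<Rightarrow> 'a \<times> 'b" where
  "stoch_grad k u z = (grad_x_loss pb k (fst u) (snd u) z, grad_y_loss pb k (fst u) (snd u) z)"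

definition local_grad :: "nat \<Rightarrow> 'a \<times> 'b \<Rightarrow> 'a \<times> 'b" where
  "local_grad k u = (grad_x_local pb k (fst u) (snd u), grad_y_local pb k (fst u) (snd u))"

definition risk_grad :: "'a \<times> 'b \<Rightarrow> 'a \<times> 'b" where
  "risk_grad u = (grad_x_risk pb (fst u) (snd u), grad_y_risk pb (fst u) (snd u))"

abbreviation "S \<equiv> X \<times> Y"

lemma subS: "subspace S" using subX subY by (rule subspace_Times)

lemma stoch_grad_in: "k < K \<Longrightarrow> u \<in> S \<Longrightarrow> z \<in> space (sample_law pb k) \<Longrightarrow> stoch_grad k u z \<in> S"
  by (cases u) (auto simp: stoch_grad_def grad_x_loss_def grad_y_loss_def intro!: grad_props fd loss_diff)

lemma local_grad_in: "k < K \<Longrightarrow> u \<in> S \<Longrightarrow> local_grad k u \<in> S"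
  by (cases u) (auto simp: local_grad_def grad_x_local_def grad_y_local_def intro!: grad_props fd local_diff)

lemma stoch_grad_measurable: "k < K \<Longrightarrow> (\<lambda>(u, z). stoch_grad k u z) \<in> borel_measurable (restrict_space borel S \<Otimes>\<^sub>M sample_law pb k)"
proof -
  assume k: "k < K"
  let ?N = "sample_law pb k"
  have m1: "fst \<in> measurable (restrict_space borel S) (restrict_space borel X)"
    by (intro measurable_restrict_space3) (auto intro!: borel_measurable_continuous_onI continuous_intros)
  have m2: "snd \<in> measurable (restrict_space borel S) (restrict_space borel Y)"
    by (intro measurable_restrict_space3) (auto intro!: borel_measurable_continuous_onI continuous_intros)
  have "(\<lambda>(u, z). (fst u, snd u, z)) \<in> measurable (restrict_space borel S \<Otimes>\<^sub>M ?N)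
        (restrict_space borel X \<Otimes>\<^sub>M (restrict_space borel Y \<Otimes>\<^sub>M ?N))"
    unfolding case_prod_beta
    by (intro measurable_Pair measurable_compose[OF measurable_fst m1] measurable_compose[OF measurable_fst m2] measurable_snd)
  from measurable_compose[OF this grad_x_loss_measurable[OF k]] measurable_compose[OF this grad_y_loss_measurable[OF k]]
  show ?thesis unfolding stoch_grad_def case_prod_beta
    by (intro borel_measurable_Pair) simp_all
qed

lemma
  assumes k: "k < K" and u: "u \<in> S" and h: "h \<in> S"
  shows stoch_grad_integrable: "integrable (sample_law pb k) (\<lambda>z. inner (stoch_grad k u z) h)"
    and stoch_grad_expectation: "(LINT z|sample_law pb k. inner (stoch_grad k u z) h) = inner (local_grad k u) h"
  using grad_x_integrable[OF k, of "fst u" "snd u" "fst h"] grad_y_integrable[OF k, of "fst u" "snd u" "snd h"]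
    grad_x_expectation[OF k, of "fst u" "snd u" "fst h"] grad_y_expectation[OF k, of "fst u" "snd u" "snd h"] u h
  by (auto simp: stoch_grad_def local_grad_def inner_prod_def)

lemma stoch_grad_section_measurable: "k < K \<Longrightarrow> u \<in> S \<Longrightarrow> stoch_grad k u \<in> borel_measurable (sample_law pb k)"
proof -
  assume k: "k < K" and u: "u \<in> S"
  have "(\<lambda>z. (u, z)) \<in> measurable (sample_law pb k) (restrict_space borel S \<Otimes>\<^sub>M sample_law pb k)"
    using u by (intro measurable_Pair measurable_const measurable_ident_sets) (auto simp: space_restrict_space)
  from measurable_compose[OF this stoch_grad_measurable[OF k]] show ?thesis by simp
qed

lemma stoch_grad_smooth:
  assumes k: "k < K" and u: "u \<in> S" and v: "v \<in> S"
  shows "(\<integral>\<^sup>+z. ennreal ((norm (stoch_grad k u z - stoch_grad k v z))\<^sup>2) \<partial>sample_law pb k)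
    \<le> ennreal (2 * L\<^sup>2 * (norm (u - v))\<^sup>2)"
proof -
  let ?N = "sample_law pb k"
  have "(\<lambda>z. fst (stoch_grad k u z)) \<in> borel_measurable ?N" "(\<lambda>z. snd (stoch_grad k u z)) \<in> borel_measurable ?N" if "u \<in> S" for u
    using stoch_grad_section_measurable[OF k that] by (auto simp: borel_prod[symmetric])
  note m = this[OF u] this[OF v]
  have "(\<integral>\<^sup>+z. ennreal ((norm (stoch_grad k u z - stoch_grad k v z))\<^sup>2) \<partial>?N) =
    (\<integral>\<^sup>+z. ennreal ((norm (fst (stoch_grad k u z) - fst (stoch_grad k v z)))\<^sup>2)
          + ennreal ((norm (snd (stoch_grad k u z) - snd (stoch_grad k v z)))\<^sup>2) \<partial>?N)"
    by (intro nn_integral_cong) (simp add: norm_prod_def ennreal_plus[symmetric] del: ennreal_plus)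
  also have "\<dots> = (\<integral>\<^sup>+z. ennreal ((norm (fst (stoch_grad k u z) - fst (stoch_grad k v z)))\<^sup>2) \<partial>?N)
          + (\<integral>\<^sup>+z. ennreal ((norm (snd (stoch_grad k u z) - snd (stoch_grad k v z)))\<^sup>2) \<partial>?N)"
    using m by (intro nn_integral_add) auto
  also have "\<dots> \<le> ennreal (L\<^sup>2 * ((norm (fst u - fst v))\<^sup>2 + (norm (snd u - snd v))\<^sup>2))
       + ennreal (L\<^sup>2 * ((norm (fst u - fst v))\<^sup>2 + (norm (snd u - snd v))\<^sup>2))"
    using u v k by (intro add_mono) (auto simp: stoch_grad_def intro!: ms_x ms_y)
  also have "\<dots> = ennreal (2 * L\<^sup>2 * (norm (u - v))\<^sup>2)"
    by (simp add: ennreal_plus[symmetric] norm_prod_def del: ennreal_plus)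
  finally show ?thesis .
qed

text \<open>Jensen's inequality in weak form: the mean \<open>w\<close> of \<open>D\<close> is known
  only through its inner products, and testing with \<open>w\<close> itself is enough. It carries
  the mean-square smoothness of samples over to the expected gradients.\<close>

lemma gradient_difference_le:
  assumes N: "prob_space N" and m: "D \<in> borel_measurable N"
    and i: "integrable N (\<lambda>z. inner (D z) w)" and e: "(LINT z|N. inner (D z) w) = inner w w"
    and b: "(\<integral>\<^sup>+z. ennreal ((norm (D z))\<^sup>2) \<partial>N) \<le> ennreal c" and c: "0 \<le> c"
  shows "(norm (w :: 'c :: {real_inner,second_countable_topology}))\<^sup>2 \<le> c"
proof -
  interpret prob_space N by (rule N)
  have sq: "integrable N (\<lambda>z. (norm (D z))\<^sup>2)"
    using b m by (intro integrableI_bounded) (auto intro: order.strict_trans1)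
  have le: "(LINT z|N. (norm (D z))\<^sup>2) \<le> c"
    using b nn_integral_eq_integral[OF sq] c by simp
  have "inner w w = (LINT z|N. inner (D z) w)" by (simp add: e)
  also have "\<dots> \<le> (LINT z|N. ((norm (D z))\<^sup>2 + inner w w) / 2)"
  proof (rule integral_mono[OF i])
    fix z
    have "0 \<le> inner (D z - w) (D z - w)" by simp
    then show "inner (D z) w \<le> ((norm (D z))\<^sup>2 + inner w w) / 2"
      by (simp add: inner_diff_left inner_diff_right inner_commute power2_norm_eq_inner)
  qed (use sq in simp)
  also have "\<dots> = ((LINT z|N. (norm (D z))\<^sup>2) + inner w w) / 2"
    using sq by (simp add: prob_space)
  finally show ?thesis using le by (simp add: power2_norm_eq_inner)
qed

lemma local_grad_lipschitz:
  assumes k: "k < K" and u: "u \<in> S" and v: "v \<in> S"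
  shows "(norm (local_grad k u - local_grad k v))\<^sup>2 \<le> 2 * L\<^sup>2 * (norm (u - v))\<^sup>2"
proof (rule gradient_difference_le[OF law[OF k]])
  let ?w = "local_grad k u - local_grad k v"
  have w: "?w \<in> S" using k u v subS by (intro subspace_diff local_grad_in)
  note i = stoch_grad_integrable[OF k u w] stoch_grad_integrable[OF k v w]
  show "integrable (sample_law pb k) (\<lambda>z. inner (stoch_grad k u z - stoch_grad k v z) ?w)"
    using i unfolding inner_diff_left by simp
  show "(LINT z|sample_law pb k. inner (stoch_grad k u z - stoch_grad k v z) ?w) = inner ?w ?w"
    using i stoch_grad_expectation[OF k u w] stoch_grad_expectation[OF k v w]
    unfolding inner_diff_left by (subst Bochner_Integration.integral_diff) auto
qed (use stoch_grad_section_measurable[OF k] stoch_grad_smooth[OF k u v] u v in auto)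

lemma risk_grad_eq: "u \<in> S \<Longrightarrow> risk_grad u = centroid K (\<lambda>k. local_grad k u)"
proof -
  assume u: "u \<in> S"
  obtain x y where xy: "u = (x, y)" "x \<in> X" "y \<in> Y" using u by (cases u) auto
  have "grad_x_risk pb x y = centroid K (\<lambda>k. grad_x_local pb k x y)"
    unfolding grad_x_risk_def
  proof (rule grad_unique[OF subX xy(2)])
    show "centroid K (\<lambda>k. grad_x_local pb k x y) \<in> X"
      unfolding centroid_def grad_x_local_def using subX fd local_diff xy
      by (intro subspace_scale subspace_sum grad_props) auto
    have "((\<lambda>u. local_risk pb k u y) has_derivative inner (grad_x_local pb k x y)) (at x within X)" if "k < K" for k
      unfolding grad_x_local_def by (rule grad_props(2)[OF fd(1) xy(2) local_diff(1)[OF that xy(2,3)]])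
    then have "((\<lambda>u. \<Sum>k<K. local_risk pb k u y) has_derivative (\<lambda>v. \<Sum>k<K. inner (grad_x_local pb k x y) v)) (at x within X)"
      by (intro has_derivative_sum) auto
    moreover have "inner (centroid K (\<lambda>k. grad_x_local pb k x y)) = (\<lambda>v. 1 / real K * (\<Sum>k<K. inner (grad_x_local pb k x y) v))"
      by (simp add: fun_eq_iff centroid_def inner_sum_left divide_inverse mult.commute)
    ultimately show "((\<lambda>u. risk pb u y) has_derivative inner (centroid K (\<lambda>k. grad_x_local pb k x y))) (at x within X)"
      using has_derivative_mult_right[where x = "1 / real K"] by (force simp: risk_def[abs_def])
  qed
  moreover have "grad_y_risk pb x y = centroid K (\<lambda>k. grad_y_local pb k x y)"
    unfolding grad_y_risk_def
  proof (rule grad_unique[OF subY xy(3)])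
    show "centroid K (\<lambda>k. grad_y_local pb k x y) \<in> Y"
      unfolding centroid_def grad_y_local_def using subY fd local_diff xy
      by (intro subspace_scale subspace_sum grad_props) auto
    have "((\<lambda>u. local_risk pb k x u) has_derivative inner (grad_y_local pb k x y)) (at y within Y)" if "k < K" for k
      unfolding grad_y_local_def by (rule grad_props(2)[OF fd(2) xy(3) local_diff(2)[OF that xy(2,3)]])
    then have "((\<lambda>u. \<Sum>k<K. local_risk pb k x u) has_derivative (\<lambda>v. \<Sum>k<K. inner (grad_y_local pb k x y) v)) (at y within Y)"
      by (intro has_derivative_sum) auto
    moreover have "inner (centroid K (\<lambda>k. grad_y_local pb k x y)) = (\<lambda>v. 1 / real K * (\<Sum>k<K. inner (grad_y_local pb k x y) v))"
      by (simp add: fun_eq_iff centroid_def inner_sum_left divide_inverse mult.commute)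
    ultimately show "((\<lambda>u. risk pb x u) has_derivative inner (centroid K (\<lambda>k. grad_y_local pb k x y))) (at y within Y)"
      using has_derivative_mult_right[where x = "1 / real K"] by (force simp: risk_def[abs_def])
  qed
  ultimately show ?thesis
    by (simp add: risk_grad_def local_grad_def xy centroid_def prod_eq_iff fst_sum snd_sum)
qed

lemma risk_differentiable:
  assumes "x \<in> X" "y \<in> Y"
  shows "(\<lambda>u. risk pb u y) differentiable (at x within X)" "(\<lambda>v. risk pb x v) differentiable (at y within Y)"
  unfolding risk_def using local_diff assms K_pos
  by (intro differentiable_divide differentiable_sum differentiable_const; auto)+

lemma risk_derivative:
  assumes "x \<in> X" "y \<in> Y"
  shows "((\<lambda>u. risk pb u y) has_derivative inner (grad_x_risk pb x y)) (at x within X)" "grad_x_risk pb x y \<in> X"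
    "((\<lambda>v. risk pb x v) has_derivative inner (grad_y_risk pb x y)) (at y within Y)" "grad_y_risk pb x y \<in> Y"
  unfolding grad_x_risk_def grad_y_risk_def
  by (intro grad_props fd assms risk_differentiable)+

end

lemma centroid_norm_square_le: "(norm (centroid n v))\<^sup>2 \<le> (\<Sum>k<n. (norm (v k))\<^sup>2) / real n"
  for v :: "nat \<Rightarrow> 'a::real_normed_vector"
proof (cases "n = 0")
  case False
  have "(norm (\<Sum>k<n. v k))\<^sup>2 \<le> (\<Sum>k<n. norm (v k))\<^sup>2"
    by (intro power_mono norm_sum norm_ge_zero)
  also have "\<dots> \<le> real n * (\<Sum>k<n. (norm (v k))\<^sup>2)"
    using Cauchy_Schwarz_ineq_sum[of "\<lambda>_. 1" "\<lambda>k. norm (v k)" "{..<n}"] by simp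
  finally have "(norm (\<Sum>k<n. v k))\<^sup>2 / (real n)\<^sup>2 \<le> real n * (\<Sum>k<n. (norm (v k))\<^sup>2) / (real n)\<^sup>2"
    by (intro divide_right_mono) auto
  then show ?thesis
    using False by (simp add: centroid_def power_divide divide_inverse power_mult_distrib power2_eq_square[of "real n"] power2_eq_square[of "inverse (real n)"] mult.commute)
      (simp add: field_simps)
qed (simp add: centroid_def)

lemma centroid_diff: "centroid n (\<lambda>k. u k - v k) = centroid n u - centroid n v"
  by (simp add: centroid_def sum_subtractf scaleR_diff_right)

lemma centroid_in_subspace: "subspace S \<Longrightarrow> (\<And>k. k < n \<Longrightarrow> v k \<in> S) \<Longrightarrow> centroid n v \<in> S"
  unfolding centroid_def by (intro subspace_scale subspace_sum) auto

context risk_problem begin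

text \<open>The Lipschitz constant of the pair of partial gradients: each of the two contributes
  \<open>L^2\<close> to the squared bound.\<close>

definition "M = sqrt 2 * L"

lemma M: "0 < M" "M\<^sup>2 = 2 * L\<^sup>2" "\<nu> \<le> M"
proof -
  show "0 < M" "M\<^sup>2 = 2 * L\<^sup>2" using L_pos by (auto simp: M_def power_mult_distrib)
  have "1 * L \<le> sqrt 2 * L" using L_pos by (intro mult_right_mono) auto
  then show "\<nu> \<le> M" using nu unfolding M_def by linarith
qed

lemma local_grad_lipschitz': 
  assumes "k < K" "u \<in> S" "v \<in> S"
  shows "norm (local_grad k u - local_grad k v) \<le> M * norm (u - v)"
proof (rule power2_le_imp_le)
  show "(norm (local_grad k u - local_grad k v))\<^sup>2 \<le> (M * norm (u - v))\<^sup>2"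
    unfolding power_mult_distrib M(2) by (rule local_grad_lipschitz[OF assms])
qed (use M in simp)

lemma risk_grad_lipschitz:
  assumes "u \<in> S" "v \<in> S"
  shows "norm (risk_grad u - risk_grad v) \<le> M * norm (u - v)"
proof (rule power2_le_imp_le)
  have "(norm (risk_grad u - risk_grad v))\<^sup>2 \<le> (\<Sum>k<K. (norm (local_grad k u - local_grad k v))\<^sup>2) / real K"
    using centroid_norm_square_le[of K "\<lambda>k. local_grad k u - local_grad k v"] assms
    by (simp add: risk_grad_eq centroid_diff)
  also have "\<dots> \<le> (\<Sum>k<K. 2 * L\<^sup>2 * (norm (u - v))\<^sup>2) / real K"
    using assms by (intro divide_right_mono sum_mono local_grad_lipschitz) auto
  also have "\<dots> = (M * norm (u - v))\<^sup>2" using K_pos M by (simp add: power_mult_distrib)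
  finally show "(norm (risk_grad u - risk_grad v))\<^sup>2 \<le> (M * norm (u - v))\<^sup>2" .
qed (use M in simp)

text \<open>The price of evaluating each local gradient at the agent's own point; with
  \<open>v\<close> the centroid, the right-hand side is the averaged squared disagreement.\<close>

lemma centroid_local_grad_error:
  assumes u: "\<And>k. k < K \<Longrightarrow> u k \<in> S" and v: "v \<in> S"
  shows "(norm (centroid K (\<lambda>k. local_grad k (u k)) - risk_grad v))\<^sup>2 \<le> M\<^sup>2 * ((\<Sum>k<K. (norm (u k - v))\<^sup>2) / real K)"
proof -
  have "(norm (centroid K (\<lambda>k. local_grad k (u k)) - risk_grad v))\<^sup>2 \<le> (\<Sum>k<K. (norm (local_grad k (u k) - local_grad k v))\<^sup>2) / real K"
    using centroid_norm_square_le[of K "\<lambda>k. local_grad k (u k) - local_grad k v"] v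
    by (simp add: risk_grad_eq centroid_diff)
  also have "\<dots> \<le> (\<Sum>k<K. 2 * L\<^sup>2 * (norm (u k - v))\<^sup>2) / real K"
    using u v by (intro divide_right_mono sum_mono local_grad_lipschitz) auto
  also have "\<dots> = M\<^sup>2 * ((\<Sum>k<K. (norm (u k - v))\<^sup>2) / real K)"
    using M by (simp add: sum_distrib_left)
  finally show ?thesis .
qed

lemma
  assumes "x1 \<in> X" "x2 \<in> X" "y1 \<in> Y" "y2 \<in> Y"
  shows grad_x_risk_lip: "norm (grad_x_risk pb x1 y1 - grad_x_risk pb x2 y2) \<le> M * norm ((x1, y1) - (x2, y2))"
    and grad_y_risk_lip: "norm (grad_y_risk pb x1 y1 - grad_y_risk pb x2 y2) \<le> M * norm ((x1, y1) - (x2, y2))"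
  using risk_grad_lipschitz[of "(x1, y1)" "(x2, y2)"] assms
    norm_fst_le[of "grad_x_risk pb x1 y1 - grad_x_risk pb x2 y2" "grad_y_risk pb x1 y1 - grad_y_risk pb x2 y2"]
    norm_snd_le[of "grad_y_risk pb x1 y1 - grad_y_risk pb x2 y2" "grad_x_risk pb x1 y1 - grad_x_risk pb x2 y2"]
  by (auto simp: risk_grad_def)

lemma risk_x_smooth:
  assumes "x \<in> X" "x' \<in> X" "y \<in> Y"
  shows "\<bar>risk pb x' y - risk pb x y - inner (grad_x_risk pb x y) (x' - x)\<bar> \<le> M * (norm (x' - x))\<^sup>2"
proof -
  have "\<bar>risk pb (x + (x' - x)) y - risk pb x y - inner (grad_x_risk pb x y) (x' - x)\<bar> \<le> M * (norm (x' - x))\<^sup>2"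
    using assms subX M
    by (intro mean_value_bound[OF subX assms(1)] risk_derivative(1) subspace_diff)
      (auto intro!: order_trans[OF grad_x_risk_lip] simp: norm_Pair)
  then show ?thesis by simp
qed

lemma risk_y_smooth:
  assumes "x \<in> X" "y \<in> Y" "y' \<in> Y"
  shows "\<bar>risk pb x y' - risk pb x y - inner (grad_y_risk pb x y) (y' - y)\<bar> \<le> M * (norm (y' - y))\<^sup>2"
proof -
  have "\<bar>risk pb x (y + (y' - y)) - risk pb x y - inner (grad_y_risk pb x y) (y' - y)\<bar> \<le> M * (norm (y' - y))\<^sup>2"
    using assms subY M
    by (intro mean_value_bound[OF subY assms(2)] risk_derivative(3) subspace_diff)
      (auto intro!: order_trans[OF grad_y_risk_lip] simp: norm_Pair)
  then show ?thesis by simp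
qed

section \<open>Growth of the primal function and descent of the merit function\<close>

lemma risk_le_primal: "x \<in> X \<Longrightarrow> y \<in> Y \<Longrightarrow> risk pb x y \<le> primal pb x"
proof -
  assume x: "x \<in> X" and y: "y \<in> Y"
  then obtain y0 where "\<forall>y'\<in>Y. risk pb x y' \<le> risk pb x y0" using PL unfolding PL_condition_def by blast
  then have "bdd_above (risk pb x ` Y)" by (intro bdd_aboveI2) blast
  then show ?thesis unfolding primal_def using y by (intro cSUP_upper)
qed

lemma primal_opt_le: "x \<in> X \<Longrightarrow> primal_opt pb \<le> primal pb x"
  using PL unfolding primal_opt_def PL_condition_def by (intro cINF_lower) auto

text \<open>One point \<open>u\<close>, nearly maximal for \<open>x'\<close>, is used at both ends:
  \<open>J(x', u)\<close> is almost \<open>P(x')\<close>, and \<open>J(x, u)\<close> never exceeds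
  \<open>P(x)\<close>. Smoothness in \<open>x\<close> at this \<open>u\<close> gives the increment,
  and replacing the gradient at \<open>u\<close> by the one at \<open>y\<close> costs
  \<open>M |u - y|\<close>, which \<open>PL_error_bound\<close> controls by the
  \<open>y\<close>-gradient at \<open>y\<close>. Of the factor 3, two parts come from moving that
  gradient from \<open>x'\<close> to \<open>x\<close>, one from the smoothness term with
  \<open>1 \<le> M / \<nu>\<close>.\<close>

lemma primal_increment:
  assumes x: "x \<in> X" and x': "x' \<in> X" and y: "y \<in> Y"
  shows "primal pb x' - primal pb x \<le> inner (grad_x_risk pb x y) (x' - x)
    + 2 * (M / \<nu>) * norm (grad_y_risk pb x y) * norm (x' - x) + 3 * (M / \<nu>) * M * (norm (x' - x))\<^sup>2"
proof (rule field_le_epsilon)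
  fix \<epsilon> :: real assume eps: "0 < \<epsilon>"
  let ?\<kappa> = "M / \<nu>" and ?\<delta> = "norm (x' - x)"
  have "\<exists>u\<in>Y. primal pb x' - risk pb x' u < \<epsilon> \<and> norm (u - y) \<le> 2 / \<nu> * norm (grad_y_risk pb x' y)"
  proof (rule PL_error_bound[OF subY y _ _ _ nu(1) M(3) _ _ eps])
    show "norm (grad_y_risk pb x' u - grad_y_risk pb x' v) \<le> M * norm (u - v)" if "u \<in> Y" "v \<in> Y" for u v
      using grad_y_risk_lip[OF x' x' that] by (simp add: norm_Pair)
    show "2 * \<nu> * (primal pb x' - risk pb x' u) \<le> (norm (grad_y_risk pb x' u))\<^sup>2" if "u \<in> Y" for u
      using PL x' that by (auto simp: PL_condition_def)
  qed (use x' risk_derivative risk_le_primal in auto)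
  then obtain u where u: "u \<in> Y" "primal pb x' - risk pb x' u < \<epsilon>" "norm (u - y) \<le> 2 / \<nu> * norm (grad_y_risk pb x' y)"
    by blast
  have gy: "norm (grad_y_risk pb x' y) \<le> norm (grad_y_risk pb x y) + M * ?\<delta>"
    using grad_y_risk_lip[OF x' x y y] norm_triangle_ineq[of "grad_y_risk pb x' y - grad_y_risk pb x y" "grad_y_risk pb x y"]
    by (simp add: norm_Pair)
  have uy: "norm (u - y) \<le> 2 / \<nu> * (norm (grad_y_risk pb x y) + M * ?\<delta>)"
    
  proof -
    have "2 / \<nu> * norm (grad_y_risk pb x' y) \<le> 2 / \<nu> * (norm (grad_y_risk pb x y) + M * ?\<delta>)"
      using nu by (intro mult_left_mono gy) auto
    then show ?thesis using u(3) by linarith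
  qed
  have "primal pb x' - primal pb x \<le> risk pb x' u + \<epsilon> - risk pb x u"
    using u(1,2) risk_le_primal[OF x u(1)] by linarith
  moreover have "risk pb x' u - risk pb x u \<le> inner (grad_x_risk pb x u) (x' - x) + M * ?\<delta>\<^sup>2"
    using risk_x_smooth[OF x x' u(1)] by linarith
  moreover have "inner (grad_x_risk pb x u) (x' - x) \<le> inner (grad_x_risk pb x y) (x' - x) + M * norm (u - y) * ?\<delta>"
  proof -
    have "inner (grad_x_risk pb x u - grad_x_risk pb x y) (x' - x) \<le> norm (grad_x_risk pb x u - grad_x_risk pb x y) * ?\<delta>"
      by (rule norm_cauchy_schwarz)
    also have "\<dots> \<le> (M * norm (u - y)) * ?\<delta>"
      using grad_x_risk_lip[OF x x u(1) y] by (intro mult_right_mono) (auto simp: norm_Pair)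
    finally show ?thesis by (simp add: inner_diff_left)
  qed
  moreover have "M * norm (u - y) * ?\<delta> \<le> M * (2 / \<nu> * (norm (grad_y_risk pb x y) + M * ?\<delta>)) * ?\<delta>"
    using uy M by (intro mult_right_mono mult_left_mono) auto
  moreover have "M * (2 / \<nu> * (norm (grad_y_risk pb x y) + M * ?\<delta>)) * ?\<delta>
      = 2 * ?\<kappa> * norm (grad_y_risk pb x y) * ?\<delta> + 2 * ?\<kappa> * M * ?\<delta>\<^sup>2"
    by (simp add: algebra_simps power2_eq_square)
  moreover have "M * ?\<delta>\<^sup>2 \<le> ?\<kappa> * M * ?\<delta>\<^sup>2"
  proof -
    have "1 * M \<le> ?\<kappa> * M" using M nu by (intro mult_right_mono) auto
    then show ?thesis by (intro mult_right_mono) auto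
  qed
  moreover have "3 * ?\<kappa> * M * ?\<delta>\<^sup>2 = 2 * ?\<kappa> * M * ?\<delta>\<^sup>2 + ?\<kappa> * M * ?\<delta>\<^sup>2" by simp
  ultimately show "primal pb x' - primal pb x \<le> inner (grad_x_risk pb x y) (x' - x)
    + 2 * ?\<kappa> * norm (grad_y_risk pb x y) * ?\<delta> + 3 * ?\<kappa> * M * ?\<delta>\<^sup>2 + \<epsilon>"
    by linarith
qed

definition merit :: "'a \<times> 'b \<Rightarrow> real" where
  "merit u = primal pb (fst u) + (primal pb (fst u) - risk pb (fst u) (snd u)) / 2"

lemma merit_ge: "u \<in> S \<Longrightarrow> primal_opt pb \<le> merit u"
proof -
  assume "u \<in> S"
  then have "risk pb (fst u) (snd u) \<le> primal pb (fst u)" "primal_opt pb \<le> primal pb (fst u)"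
    by (auto intro: risk_le_primal primal_opt_le)
  then show ?thesis by (simp add: merit_def field_simps)
qed

text \<open>The merit is \<open>3/2 P - 1/2 J\<close>. Three halves of the increment of
  \<open>P\<close> cost \<open>12 (M / \<nu>)^2 mx\<close> times the squared
  \<open>y\<close>-gradient, half of the ascent of \<open>J\<close> yields \<open>my / 4\<close>
  times it, and the separation of time scales \<open>96 (M / \<nu>)^2 mx \<le> my\<close> keeps half
  of that yield. The squared estimates stay on the left: they pay later for the movement of the
  agents.\<close>

lemma merit_step:
  assumes x: "x \<in> X" and y: "y \<in> Y" and g: "g \<in> X" and h: "h \<in> Y"
    and mx: "0 < mx" "96 * (M / \<nu>)\<^sup>2 * mx \<le> my" and my: "6 * M * my \<le> 1"
  shows "merit (x - mx *\<^sub>R g, y + my *\<^sub>R h)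
      + mx / 2 * (norm (grad_x_risk pb x y))\<^sup>2 + my / 8 * (norm (grad_y_risk pb x y))\<^sup>2
      + mx / 16 * (norm g)\<^sup>2 + my / 8 * (norm h)\<^sup>2
    \<le> merit (x, y) + my * ((norm (g - grad_x_risk pb x y))\<^sup>2 + (norm (h - grad_y_risk pb x y))\<^sup>2)"
proof -
  define \<kappa> where "\<kappa> = M / \<nu>"
  define a where "a = (norm (grad_x_risk pb x y))\<^sup>2"
  define b where "b = norm (grad_y_risk pb x y)"
  define G where "G = norm g"
  define H where "H = norm h"
  define ex where "ex = (norm (g - grad_x_risk pb x y))\<^sup>2"
  define ey where "ey = (norm (h - grad_y_risk pb x y))\<^sup>2"
  let ?x = "x - mx *\<^sub>R g" and ?y = "y + my *\<^sub>R h"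
  have S': "?x \<in> X" "?y \<in> Y" using x y g h subX subY by (auto intro: subspace_diff subspace_add subspace_scale)
  have \<kappa>: "1 \<le> \<kappa>" using M nu by (simp add: \<kappa>_def)
  have k2: "96 * \<kappa>\<^sup>2 * mx \<le> my" using mx by (simp add: \<kappa>_def)
  have my0: "0 < my"
    using mx \<kappa> by (intro less_le_trans[OF _ k2]) simp
  have mxmy: "96 * mx \<le> my"
  proof -
    have "1 \<le> \<kappa>\<^sup>2" using \<kappa> by simp
    then have "1 * (96 * mx) \<le> \<kappa>\<^sup>2 * (96 * mx)" using mx by (intro mult_right_mono) auto
    then show ?thesis using k2 by (simp add: algebra_simps)
  qed
  have kM: "24 * \<kappa> * M * mx \<le> 1"
  proof -
    have "96 * \<kappa> * mx \<le> 96 * \<kappa>\<^sup>2 * mx" using \<kappa> mx by (intro mult_right_mono) (auto simp: power2_eq_square)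
    then have "(96 * \<kappa> * mx) * M \<le> my * M" using k2 M by (intro mult_right_mono) auto
    then show ?thesis using my by (simp add: algebra_simps)
  qed
  have nonneg: "0 \<le> a" "0 \<le> b" "0 \<le> G" "0 \<le> H" "0 \<le> ex" "0 \<le> ey" by (auto simp: a_def b_def G_def H_def ex_def ey_def)
  \<comment> \<open>Polarisation: the inner product is traded for squares of the gradient and of the
    estimate, both of favourable sign, against the squared error.\<close>
  have ix: "inner (grad_x_risk pb x y) g = (a + G\<^sup>2 - ex) / 2"
    unfolding a_def G_def ex_def power2_norm_eq_inner by (simp add: inner_diff_left inner_diff_right inner_commute)
  have iy: "inner (grad_y_risk pb x y) h = (b\<^sup>2 + H\<^sup>2 - ey) / 2"
    unfolding b_def H_def ey_def power2_norm_eq_inner by (simp add: inner_diff_left inner_diff_right inner_commute)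
  have nx: "norm (?x - x) = mx * G" using mx by (simp add: G_def)
  have ny: "norm (?y - y) = my * H" using my0 by (simp add: H_def)
  have P: "primal pb ?x - primal pb x \<le> - mx / 2 * a - mx / 4 * G\<^sup>2 + mx / 2 * ex + 8 * \<kappa>\<^sup>2 * mx * b\<^sup>2"
  proof -
    have "primal pb ?x - primal pb x \<le> - mx * ((a + G\<^sup>2 - ex) / 2) + 2 * \<kappa> * b * (mx * G) + 3 * \<kappa> * M * (mx * G)\<^sup>2"
      using primal_increment[OF x S'(1) y] unfolding nx by (simp add: ix \<kappa>_def[symmetric] b_def)
    moreover have "2 * \<kappa> * b * (mx * G) \<le> mx / 8 * G\<^sup>2 + 8 * \<kappa>\<^sup>2 * mx * b\<^sup>2"
    proof -
      have "0 \<le> mx * (G / 2 - 4 * \<kappa> * b)\<^sup>2" using mx by simp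
      also have "\<dots> = 2 * ((mx / 8 * G\<^sup>2 + 8 * \<kappa>\<^sup>2 * mx * b\<^sup>2) - 2 * \<kappa> * b * (mx * G))"
        by (simp add: power2_eq_square algebra_simps)
      finally show ?thesis by simp
    qed
    moreover have "3 * \<kappa> * M * (mx * G)\<^sup>2 \<le> mx / 8 * G\<^sup>2"
    proof -
      have "(24 * \<kappa> * M * mx) * (mx / 8 * G\<^sup>2) \<le> 1 * (mx / 8 * G\<^sup>2)" using kM mx by (intro mult_right_mono) auto
      then show ?thesis by (simp add: power2_eq_square algebra_simps)
    qed
    ultimately show ?thesis by (simp add: field_simps)
  qed
  have Jx: "risk pb ?x y - risk pb x y \<ge> - mx / 2 * a - mx / 2 * G\<^sup>2 - M * (mx * G)\<^sup>2"
  proof -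
    have "risk pb ?x y - risk pb x y \<ge> - mx * ((a + G\<^sup>2 - ex) / 2) - M * (mx * G)\<^sup>2"
      using risk_x_smooth[OF x S'(1) y] unfolding nx by (simp add: ix)
    moreover have "0 \<le> mx * ex" using mx nonneg by simp
    ultimately show ?thesis by (simp add: field_simps)
  qed
  have Jy: "risk pb ?x ?y - risk pb ?x y \<ge> my / 2 * (b\<^sup>2 + H\<^sup>2 - ey) - M / 2 * ((mx * G)\<^sup>2 + (my * H)\<^sup>2) - M * (my * H)\<^sup>2"
  proof -
    have "inner (grad_y_risk pb x y - grad_y_risk pb ?x y) (my *\<^sub>R h) \<le> norm (grad_y_risk pb x y - grad_y_risk pb ?x y) * norm (my *\<^sub>R h)"
      by (rule norm_cauchy_schwarz)
    also have "\<dots> \<le> (M * (mx * G)) * (my * H)"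
      using grad_y_risk_lip[OF x S'(1) y y] mx my0 by (intro mult_mono) (auto simp: norm_Pair G_def H_def less_imp_le[OF M(1)])
    also have "\<dots> \<le> M / 2 * ((mx * G)\<^sup>2 + (my * H)\<^sup>2)"
    proof -
      have "0 \<le> M / 2 * (mx * G - my * H)\<^sup>2" using M by simp
      then show ?thesis by (simp add: power2_eq_square algebra_simps)
    qed
    finally have "inner (grad_y_risk pb x y - grad_y_risk pb ?x y) (my *\<^sub>R h) \<le> M / 2 * ((mx * G)\<^sup>2 + (my * H)\<^sup>2)" .
    moreover have "inner (grad_y_risk pb x y - grad_y_risk pb ?x y) (my *\<^sub>R h)
        = my * ((b\<^sup>2 + H\<^sup>2 - ey) / 2) - inner (grad_y_risk pb ?x y) (my *\<^sub>R h)"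
      by (simp only: inner_diff_left inner_scaleR_right iy right_diff_distrib)
    ultimately have "inner (grad_y_risk pb ?x y) (my *\<^sub>R h) \<ge> my * ((b\<^sup>2 + H\<^sup>2 - ey) / 2) - M / 2 * ((mx * G)\<^sup>2 + (my * H)\<^sup>2)"
      by linarith
    then show ?thesis
      using risk_y_smooth[OF S'(1) y S'(2)] unfolding ny by simp
  qed
  have q1: "3 / 4 * (M * (mx * G)\<^sup>2) \<le> mx / 16 * G\<^sup>2"
  proof -
    have "24 * 1 * M * mx \<le> 24 * \<kappa> * M * mx" using \<kappa> M mx by (intro mult_right_mono mult_left_mono) auto
    moreover have "0 \<le> M * mx" using M(1) mx by simp
    ultimately have "12 * M * mx \<le> 1" using kM by linarith
    then have "(12 * M * mx) * (mx / 16 * G\<^sup>2) \<le> 1 * (mx / 16 * G\<^sup>2)" using mx by (intro mult_right_mono) auto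
    then show ?thesis by (simp add: power2_eq_square algebra_simps)
  qed
  have q2: "3 / 4 * (M * (my * H)\<^sup>2) \<le> my / 8 * H\<^sup>2"
  proof -
    have "(6 * M * my) * (my / 8 * H\<^sup>2) \<le> 1 * (my / 8 * H\<^sup>2)" using my my0 by (intro mult_right_mono) auto
    then show ?thesis by (simp add: power2_eq_square algebra_simps)
  qed
  have q3: "12 * \<kappa>\<^sup>2 * mx * b\<^sup>2 \<le> my / 8 * b\<^sup>2"
  proof -
    have "(96 * \<kappa>\<^sup>2 * mx) * (b\<^sup>2 / 8) \<le> my * (b\<^sup>2 / 8)" using k2 by (intro mult_right_mono) auto
    then show ?thesis by (simp add: ac_simps)
  qed
  have q4: "3 / 4 * (mx * ex) \<le> my * ex" using mxmy mx nonneg mult_right_mono[of "3 / 4 * mx" my ex] by simp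
  have q5: "my / 4 * ey \<le> my * ey" using my0 nonneg by simp
  define A where "A = mx * a"
  define GG where "GG = mx * G\<^sup>2"
  define E where "E = mx * ex"
  define B where "B = my * b\<^sup>2"
  define HH where "HH = my * H\<^sup>2"
  define Ey where "Ey = my * ey"
  define KB where "KB = \<kappa>\<^sup>2 * mx * b\<^sup>2"
  define MG where "MG = M * (mx * G)\<^sup>2"
  define MH where "MH = M * (my * H)\<^sup>2"
  have "primal pb ?x - primal pb x \<le> - A / 2 - GG / 4 + E / 2 + 8 * KB"
    using P by (simp add: A_def GG_def E_def KB_def mult.assoc)
  moreover have "risk pb ?x y - risk pb x y \<ge> - A / 2 - GG / 2 - MG"
    using Jx by (simp add: A_def GG_def MG_def)
  moreover have "risk pb ?x ?y - risk pb ?x y \<ge> (B + HH - Ey) / 2 - (MG + MH) / 2 - MH"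
  proof -
    have "my / 2 * (b\<^sup>2 + H\<^sup>2 - ey) = (B + HH - Ey) / 2"
      by (simp add: B_def HH_def Ey_def distrib_left right_diff_distrib)
    moreover have "M / 2 * ((mx * G)\<^sup>2 + (my * H)\<^sup>2) = (MG + MH) / 2"
      unfolding MG_def MH_def by (simp add: distrib_left)
    ultimately show ?thesis using Jy by (simp add: MH_def)
  qed
  moreover have "3 / 4 * MG \<le> GG / 16" "3 / 4 * MH \<le> HH / 8" "12 * KB \<le> B / 8" "3 / 4 * E \<le> my * ex" "Ey / 4 \<le> my * ey"
    using q1 q2 q3 q4 q5 by (simp_all add: MG_def GG_def MH_def HH_def KB_def B_def E_def Ey_def mult.assoc)
  \<comment> \<open>The bookkeeping is linear once every product is an atom, so it is stated for
    free variables.\<close>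
  moreover have "p' + (p' - r'') / 2 + A / 2 + B / 8 + GG / 16 + HH / 8 \<le> p + (p - r) / 2 + ce + cy"
    if "p' - p \<le> - A / 2 - GG / 4 + E / 2 + 8 * KB" "r' - r \<ge> - A / 2 - GG / 2 - MG"
      "r'' - r' \<ge> (B + HH - Ey) / 2 - (MG + MH) / 2 - MH" "3 / 4 * MG \<le> GG / 16" "3 / 4 * MH \<le> HH / 8"
      "12 * KB \<le> B / 8" "3 / 4 * E \<le> ce" "Ey / 4 \<le> cy"
    for p p' r r' r'' A B GG HH E Ey KB MG MH ce cy :: real
    using that by (simp add: field_simps)
  ultimately have "merit (?x, ?y) + A / 2 + B / 8 + GG / 16 + HH / 8 \<le> merit (x, y) + my * ex + my * ey"
    unfolding merit_def fst_conv snd_conv add.assoc by blast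
  then show ?thesis
    by (simp add: A_def B_def GG_def HH_def a_def b_def G_def H_def ex_def ey_def distrib_left)
qed

end

section \<open>Independent sources of randomness\<close>

definition square_integrable :: "'w measure \<Rightarrow> ('w \<Rightarrow> 'c::{real_inner,second_countable_topology}) \<Rightarrow> bool" where
  "square_integrable P U \<longleftrightarrow> U \<in> borel_measurable P \<and> integrable P (\<lambda>\<omega>. (norm (U \<omega>))\<^sup>2)"

lemma square_integrableD:
  "square_integrable P U \<Longrightarrow> U \<in> borel_measurable P"
  "square_integrable P U \<Longrightarrow> integrable P (\<lambda>\<omega>. (norm (U \<omega>))\<^sup>2)"
  by (auto simp: square_integrable_def)

lemma square_integrable_dominated:
  assumes U: "U \<in> borel_measurable P" and f: "integrable P f"
    and le: "\<And>\<omega>. \<omega> \<in> space P \<Longrightarrow> (norm (U \<omega>))\<^sup>2 \<le> f \<omega>"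
  shows "square_integrable P U"
  unfolding square_integrable_def
proof (intro conjI U Bochner_Integration.integrable_bound[OF f])
  show "(\<lambda>\<omega>. (norm (U \<omega>))\<^sup>2) \<in> borel_measurable P"
    using U by (intro borel_measurable_power measurable_compose[OF _ borel_measurable_norm])
  have "norm ((norm (U \<omega>))\<^sup>2) \<le> norm (f \<omega>)" if "\<omega> \<in> space P" for \<omega>
    using le[OF that] by simp
  then show "AE \<omega> in P. norm ((norm (U \<omega>))\<^sup>2) \<le> norm (f \<omega>)" by (intro AE_I2)
qed

lemma norm_add_square_le: "(norm (a + b))\<^sup>2 \<le> 2 * (norm a)\<^sup>2 + 2 * (norm b)\<^sup>2"
  for a b :: "'c::real_inner"
proof -
  have "0 \<le> (norm (a - b))\<^sup>2" by simp
  moreover have "(norm (a + b))\<^sup>2 + (norm (a - b))\<^sup>2 = 2 * (norm a)\<^sup>2 + 2 * (norm b)\<^sup>2"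
    unfolding power2_norm_eq_inner by (simp add: inner_add_left inner_add_right inner_diff_left inner_diff_right)
  ultimately show ?thesis by linarith
qed

lemma norm_diff_square_le: "(norm (a - b))\<^sup>2 \<le> 2 * (norm a)\<^sup>2 + 2 * (norm b)\<^sup>2"
  for a b :: "'c::real_inner"
  using norm_add_square_le[of a "- b"] by simp

lemma square_integrable_add:
  assumes "square_integrable P U" "square_integrable P V"
  shows "square_integrable P (\<lambda>\<omega>. U \<omega> + V \<omega>)"
proof (rule square_integrable_dominated)
  show "integrable P (\<lambda>\<omega>. 2 * (norm (U \<omega>))\<^sup>2 + 2 * (norm (V \<omega>))\<^sup>2)"
    by (intro Bochner_Integration.integrable_add integrable_mult_right square_integrableD(2) assms)
  show "(\<lambda>\<omega>. U \<omega> + V \<omega>) \<in> borel_measurable P"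
    by (intro borel_measurable_add square_integrableD(1) assms)
qed (rule norm_add_square_le)

lemma square_integrable_scaleR:
  assumes "square_integrable P U"
  shows "square_integrable P (\<lambda>\<omega>. a *\<^sub>R U \<omega>)"
proof (rule square_integrable_dominated)
  show "integrable P (\<lambda>\<omega>. a\<^sup>2 * (norm (U \<omega>))\<^sup>2)"
    by (intro integrable_mult_right square_integrableD(2) assms)
  show "(\<lambda>\<omega>. a *\<^sub>R U \<omega>) \<in> borel_measurable P"
    by (intro borel_measurable_scaleR borel_measurable_const square_integrableD(1) assms)
qed (simp add: power_mult_distrib)

lemma square_integrable_diff:
  assumes "square_integrable P U" "square_integrable P V"
  shows "square_integrable P (\<lambda>\<omega>. U \<omega> - V \<omega>)"
  using square_integrable_add[OF assms(1) square_integrable_scaleR[OF assms(2), of "- 1"]] by simp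

lemma square_integrable_zero: "square_integrable P (\<lambda>_. 0)"
  by (simp add: square_integrable_def)

lemma square_integrable_sum:
  "(\<And>s. s \<in> D \<Longrightarrow> square_integrable P (U s)) \<Longrightarrow> square_integrable P (\<lambda>\<omega>. \<Sum>s\<in>D. U s \<omega>)"
  by (induction D rule: infinite_finite_induct) (auto intro: square_integrable_add square_integrable_zero)

lemma square_integrable_centroid:
  "(\<And>k. k < n \<Longrightarrow> square_integrable P (U k)) \<Longrightarrow> square_integrable P (\<lambda>\<omega>. centroid n (\<lambda>k. U k \<omega>))"
  unfolding centroid_def by (intro square_integrable_scaleR square_integrable_sum) auto

lemma square_integrable_block_mult:
  "(\<And>k. k < n \<Longrightarrow> square_integrable P (U k)) \<Longrightarrow> square_integrable P (\<lambda>\<omega>. block_mult n A (\<lambda>k. U k \<omega>) l)"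
  unfolding block_mult_def by (intro square_integrable_scaleR square_integrable_sum) auto

lemma square_integrable_cong:
  assumes "square_integrable P U" "\<And>\<omega>. \<omega> \<in> space P \<Longrightarrow> U \<omega> = V \<omega>"
  shows "square_integrable P V"
proof (rule square_integrable_dominated[OF _ square_integrableD(2)[OF assms(1)]])
  show "V \<in> borel_measurable P"
    using square_integrableD(1)[OF assms(1)] assms(2) measurable_cong[of P U V borel] by blast
qed (use assms in simp)

lemma square_integrable_inner:
  assumes "square_integrable P U" "square_integrable P V"
  shows "integrable P (\<lambda>\<omega>. inner (U \<omega>) (V \<omega>))"
proof (rule Bochner_Integration.integrable_bound)
  show "integrable P (\<lambda>\<omega>. (norm (U \<omega>))\<^sup>2 + (norm (V \<omega>))\<^sup>2)"
    by (intro Bochner_Integration.integrable_add square_integrableD(2) assms)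
  show "(\<lambda>\<omega>. inner (U \<omega>) (V \<omega>)) \<in> borel_measurable P"
    using assms by (intro borel_measurable_inner) (auto dest: square_integrableD(1))
  have "norm (inner a b) \<le> norm ((norm a)\<^sup>2 + (norm b)\<^sup>2)" for a b :: 'b
  proof -
    have "\<bar>inner a b\<bar> \<le> norm a * norm b" by (rule Cauchy_Schwarz_ineq2)
    also have "\<dots> \<le> (norm a)\<^sup>2 + (norm b)\<^sup>2"
      using sum_squares_bound[of "norm a" "norm b"] mult_nonneg_nonneg[OF norm_ge_zero[of a] norm_ge_zero[of b]] by linarith
    finally show ?thesis by simp
  qed
  then show "AE \<omega> in P. norm (inner (U \<omega>) (V \<omega>)) \<le> norm ((norm (U \<omega>))\<^sup>2 + (norm (V \<omega>))\<^sup>2)" by simp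
qed

section \<open>Freezing the past under independent sources\<close>

locale independent_sources = prob_space P for P :: "'w measure" +
  fixes E :: "'s \<Rightarrow> 'w set set" and A :: "'s set"
  assumes indep: "indep_sets E A" and stable: "\<And>s. s \<in> A \<Longrightarrow> Int_stable (E s)"
begin

definition F :: "'s set \<Rightarrow> 'w measure" where "F I = sigma (space P) (\<Union>s\<in>I. E s)"

lemma E_events: "s \<in> A \<Longrightarrow> E s \<subseteq> sets P"
  using indep by (auto simp: indep_sets_def)

lemma space_F: "space (F I) = space P"
  by (simp add: F_def space_measure_of_conv)

lemma sets_F: "I \<subseteq> A \<Longrightarrow> sets (F I) = sigma_sets (space P) (\<Union>s\<in>I. E s)"
  unfolding F_def using E_events sets.space_closed by (intro sets_measure_of) blast

lemma sets_F_subset: "I \<subseteq> A \<Longrightarrow> sets (F I) \<subseteq> sets P"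
  using E_events by (simp add: sets_F) (intro sets.sigma_sets_subset, blast)

lemma sets_F_mono: "I \<subseteq> J \<Longrightarrow> J \<subseteq> A \<Longrightarrow> sets (F I) \<subseteq> sets (F J)"
  by (subst (1 2) sets_F) (auto intro!: sigma_sets_mono')

lemma measurable_F_mono: "f \<in> measurable (F I) N \<Longrightarrow> I \<subseteq> J \<Longrightarrow> J \<subseteq> A \<Longrightarrow> f \<in> measurable (F J) N"
  using sets_F_mono[of I J] by (auto simp: measurable_def space_F)

lemma measurable_F_P: "f \<in> measurable (F I) N \<Longrightarrow> I \<subseteq> A \<Longrightarrow> f \<in> measurable P N"
  using sets_F_subset[of I] by (auto simp: measurable_def space_F)

lemma measurable_source:
  assumes "z \<in> measurable P N" "E s = {z -` B \<inter> space P |B. B \<in> sets N}" "s \<in> I" "I \<subseteq> A"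
  shows "z \<in> measurable (F I) N"
proof (rule measurableI)
  show "z x \<in> space N" if "x \<in> space (F I)" for x
    using assms(1) that by (auto simp: space_F measurable_def)
  show "z -` B \<inter> space (F I) \<in> sets (F I)" if "B \<in> sets N" for B
    unfolding sets_F[OF assms(4)] space_F using assms(2,3) that by (intro sigma_sets.Basic) auto
qed

text \<open>The whole past is one random element: the identity map into the same space with the
  coarser algebra \<open>F I\<close>. A fresh source \<open>s\<close> is independent of it, so the
  joint law is a product; equality is checked on rectangles.\<close>

lemma freeze_distr:
  assumes z: "z \<in> measurable P N" and E: "E s = {z -` B \<inter> space P |B. B \<in> sets N}"
    and s: "s \<in> A" "s \<notin> I" and I: "I \<subseteq> A"
  shows "distr P (F I \<Otimes>\<^sub>M N) (\<lambda>\<omega>. (\<omega>, z \<omega>)) = distr P (F I) (\<lambda>\<omega>. \<omega>) \<Otimes>\<^sub>M distr P N z"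
proof -
  let ?J = "\<lambda>b. if b then I else {s}"
  have idm: "(\<lambda>\<omega>. \<omega>) \<in> measurable P (F I)"
    by (rule measurable_F_P[OF _ I]) simp
  \<comment> \<open>Independence of the individual sources is regrouped into two blocks,
    \<open>I\<close> and the single source \<open>s\<close>.\<close>
  have ind: "indep_sets (\<lambda>b. sigma_sets (space P) (\<Union>i\<in>?J b. E i)) UNIV"
  proof (rule indep_sets_collect_sigma)
    have "(\<Union>b\<in>UNIV. ?J b) \<subseteq> A" using I s by (auto split: if_splits)
    then show "indep_sets E (\<Union>b\<in>UNIV. ?J b)" by (rule indep_sets_mono_index[OF _ indep])
    show "Int_stable (E i)" if "b \<in> UNIV" "i \<in> ?J b" for b i
      using that I s stable by (auto split: if_splits)
    show "disjoint_family_on ?J UNIV"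
      using s by (auto simp: disjoint_family_on_def)
  qed
  have ise: "indep_set (sigma_sets (space P) (\<Union>i\<in>I. E i)) (sigma_sets (space P) (E s))"
    unfolding indep_set_def by (rule indep_sets_mono_sets[OF ind]) (auto split: bool.split)
  interpret X: prob_space "distr P (F I) (\<lambda>\<omega>. \<omega>)" using idm by (rule prob_space_distr)
  interpret Z: prob_space "distr P N z" using z by (rule prob_space_distr)
  have pm: "(\<lambda>\<omega>. (\<omega>, z \<omega>)) \<in> measurable P (F I \<Otimes>\<^sub>M N)"
    using idm z by (rule measurable_Pair)
  show ?thesis
  proof (rule pair_measure_eqI[symmetric])
    fix C B assume "C \<in> sets (distr P (F I) (\<lambda>\<omega>. \<omega>))" "B \<in> sets (distr P N z)"
    then have C: "C \<in> sets (F I)" and B: "B \<in> sets N" by auto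
    have CP: "C \<in> sets P" "C \<inter> space P = C"
      using C sets_F_subset[OF I] sets.sets_into_space[OF C] by (auto simp: space_F)
    have zB: "z -` B \<inter> space P \<in> sets P" using z B by (rule measurable_sets)
    have "prob (C \<inter> (z -` B \<inter> space P)) = prob C * prob (z -` B \<inter> space P)"
      using C B by (intro indep_setD[OF ise]) (auto simp: sets_F[OF I] E)
    moreover have "(\<lambda>\<omega>. (\<omega>, z \<omega>)) -` (C \<times> B) \<inter> space P = C \<inter> (z -` B \<inter> space P)"
      using CP(2) by auto
    moreover have "(\<lambda>\<omega>. \<omega>) -` C \<inter> space P = C" using CP(2) by auto
    ultimately show "emeasure (distr P (F I) (\<lambda>\<omega>. \<omega>)) C * emeasure (distr P N z) B =
        emeasure (distr P (F I \<Otimes>\<^sub>M N) (\<lambda>\<omega>. (\<omega>, z \<omega>))) (C \<times> B)"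
      using C B by (simp add: emeasure_distr[OF idm] emeasure_distr[OF z] emeasure_distr[OF pm]
          emeasure_eq_measure ennreal_mult[symmetric])
  qed (simp_all add: X.sigma_finite_measure_axioms Z.sigma_finite_measure_axioms cong: sets_pair_measure_cong)
qed

lemma pair_measurable_F:
  assumes "z \<in> measurable P N" "I \<subseteq> A"
  shows "(\<lambda>\<omega>. (\<omega>, z \<omega>)) \<in> measurable P (F I \<Otimes>\<^sub>M N)"
  using assms measurable_F_P[OF measurable_ident assms(2)] by (intro measurable_Pair) (auto simp: id_def)

text \<open>Tonelli under the product law of \<open>freeze_distr\<close>: the past is held fixed and
  the fresh draw integrated out, in the manner of a conditional expectation but with an explicit
  kernel.\<close>

lemma freeze_nn_integral:
  assumes z: "z \<in> measurable P N" and E: "E s = {z -` B \<inter> space P |B. B \<in> sets N}"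
    and s: "s \<in> A" "s \<notin> I" and I: "I \<subseteq> A" and H: "H \<in> borel_measurable (F I \<Otimes>\<^sub>M N)"
  shows "(\<integral>\<^sup>+\<omega>. H (\<omega>, z \<omega>) \<partial>P) = (\<integral>\<^sup>+\<omega>. (\<integral>\<^sup>+x. H (\<omega>, x) \<partial>distr P N z) \<partial>P)"
proof -
  interpret Z: prob_space "distr P N z" using z by (rule prob_space_distr)
  have idm: "(\<lambda>\<omega>. \<omega>) \<in> measurable P (F I)"
    by (rule measurable_F_P[OF _ I]) simp
  have "(\<integral>\<^sup>+\<omega>. H (\<omega>, z \<omega>) \<partial>P) = (\<integral>\<^sup>+p. H p \<partial>distr P (F I \<Otimes>\<^sub>M N) (\<lambda>\<omega>. (\<omega>, z \<omega>)))"
    using H pair_measurable_F[OF z I] by (subst nn_integral_distr) auto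
  also have "\<dots> = (\<integral>\<^sup>+p. H p \<partial>(distr P (F I) (\<lambda>\<omega>. \<omega>) \<Otimes>\<^sub>M distr P N z))"
    by (simp add: freeze_distr[OF z E s I])
  also have "\<dots> = (\<integral>\<^sup>+\<omega>. (\<integral>\<^sup>+x. H (\<omega>, x) \<partial>distr P N z) \<partial>distr P (F I) (\<lambda>\<omega>. \<omega>))"
    by (intro Z.nn_integral_fst[symmetric]) (use H in simp)
  also have "\<dots> = (\<integral>\<^sup>+\<omega>. (\<integral>\<^sup>+x. H (\<omega>, x) \<partial>distr P N z) \<partial>P)"
    by (rule nn_integral_distr[OF idm]) (intro Z.borel_measurable_nn_integral_fst, use H in simp)
  finally show ?thesis .
qed

text \<open>The signed counterpart, for martingale differences. Integrability along the run
  transfers to the product law, which justifies the iterated integral; the inner one vanishes at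
  every point.\<close>

lemma freeze_integral_zero:
  fixes f :: "'w \<times> 'z \<Rightarrow> real"
  assumes z: "z \<in> measurable P N" and E: "E s = {z -` B \<inter> space P |B. B \<in> sets N}"
    and s: "s \<in> A" "s \<notin> I" and I: "I \<subseteq> A" and f: "f \<in> borel_measurable (F I \<Otimes>\<^sub>M N)"
    and int: "integrable P (\<lambda>\<omega>. f (\<omega>, z \<omega>))"
    and zero: "\<And>\<omega>. \<omega> \<in> space P \<Longrightarrow> (LINT x|distr P N z. f (\<omega>, x)) = 0"
  shows "(LINT \<omega>|P. f (\<omega>, z \<omega>)) = 0"
proof -
  interpret Z: prob_space "distr P N z" using z by (rule prob_space_distr)
  have idm: "(\<lambda>\<omega>. \<omega>) \<in> measurable P (F I)"
    by (rule measurable_F_P[OF _ I]) simp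
  interpret D: prob_space "distr P (F I) (\<lambda>\<omega>. \<omega>)" using idm by (rule prob_space_distr)
  interpret DZ: pair_sigma_finite "distr P (F I) (\<lambda>\<omega>. \<omega>)" "distr P N z" ..
  note pm = pair_measurable_F[OF z I]
  have "integrable (distr P (F I \<Otimes>\<^sub>M N) (\<lambda>\<omega>. (\<omega>, z \<omega>))) f"
    using int f pm by (simp add: integrable_distr_eq)
  then have fi: "integrable (distr P (F I) (\<lambda>\<omega>. \<omega>) \<Otimes>\<^sub>M distr P N z) f"
    by (simp add: freeze_distr[OF z E s I])
  have "(LINT \<omega>|P. f (\<omega>, z \<omega>)) = (LINT p|distr P (F I \<Otimes>\<^sub>M N) (\<lambda>\<omega>. (\<omega>, z \<omega>)). f p)"
    using f pm by (subst integral_distr) auto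
  also have "\<dots> = (LINT \<omega>|distr P (F I) (\<lambda>\<omega>. \<omega>). (LINT x|distr P N z. f (\<omega>, x)))"
    unfolding freeze_distr[OF z E s I] using DZ.integral_fst'[OF fi] by simp
  also have "\<dots> = (LINT \<omega>|distr P (F I) (\<lambda>\<omega>. \<omega>). 0)"
    by (intro Bochner_Integration.integral_cong refl) (auto simp: space_F zero)
  finally show ?thesis by simp
qed

text \<open>The indicator minus its probability has mean zero, so
  \<open>freeze_integral_zero\<close> yields the factorisation.\<close>

lemma freeze_indicator:
  assumes z: "z \<in> measurable P N" and E: "E s = {z -` B \<inter> space P |B. B \<in> sets N}"
    and s: "s \<in> A" "s \<notin> I" and I: "I \<subseteq> A" and B: "B \<in> sets N"
    and U: "U \<in> borel_measurable (F I)" and int: "integrable P U"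
  shows "integrable P (\<lambda>\<omega>. indicator B (z \<omega>) * U \<omega>)"
    "(LINT \<omega>|P. indicator B (z \<omega>) * U \<omega>) = measure P (z -` B \<inter> space P) * (LINT \<omega>|P. U \<omega> :: real)"
proof -
  have ev: "z -` B \<inter> space P \<in> sets P" using z B by (rule measurable_sets)
  have UP: "U \<in> borel_measurable P" by (rule measurable_F_P[OF U I])
  have eq: "indicator B (z \<omega>) * U \<omega> = indicator (z -` B \<inter> space P) \<omega> * U \<omega>" if "\<omega> \<in> space P" for \<omega>
    using that by (auto simp: indicator_def)
  have "integrable P (\<lambda>\<omega>. indicator (z -` B \<inter> space P) \<omega> * U \<omega>)"
    using integrable_mult_indicator[OF ev int] by simp
  then show i: "integrable P (\<lambda>\<omega>. indicator B (z \<omega>) * U \<omega>)"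
    by (subst Bochner_Integration.integrable_cong[OF refl eq])
  let ?p = "measure P (z -` B \<inter> space P)"
  have i2: "integrable P (\<lambda>\<omega>. indicator B (z \<omega>) * U \<omega> - ?p * U \<omega>)" using i int by simp
  have "(LINT \<omega>|P. (\<lambda>(\<omega>, x). (indicator B x - ?p) * U \<omega>) (\<omega>, z \<omega>)) = 0"
  proof (rule freeze_integral_zero[OF z E s I])
    show "(\<lambda>(\<omega>, x). (indicator B x - ?p) * U \<omega>) \<in> borel_measurable (F I \<Otimes>\<^sub>M N)"
      using U B by measurable
    show "integrable P (\<lambda>\<omega>. case (\<omega>, z \<omega>) of (\<omega>, x) \<Rightarrow> (indicator B x - ?p) * U \<omega>)"
      using i2 by (simp add: algebra_simps)
    fix \<omega>
    interpret Z: prob_space "distr P N z" using z by (rule prob_space_distr)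
    have "(LINT x|distr P N z. indicator B x - ?p) = 0"
    proof -
      have "integrable (distr P N z) (indicator B :: _ \<Rightarrow> real)"
        using B by (intro integrable_real_indicator) (auto simp: less_top[symmetric] Z.emeasure_finite)
      moreover have "measure (distr P N z) (B \<inter> space N) = ?p"
        using sets.sets_into_space[OF B] by (simp add: measure_distr[OF z B] Int_absorb2)
      ultimately show ?thesis
        using Z.prob_space by (subst Bochner_Integration.integral_diff) auto
    qed
    then show "(LINT x|distr P N z. (case (\<omega>, x) of (\<omega>, x) \<Rightarrow> (indicator B x - ?p) * U \<omega>)) = 0" by simp
  qed
  then have "(LINT \<omega>|P. indicator B (z \<omega>) * U \<omega> - ?p * U \<omega>) = 0" by (simp add: left_diff_distrib)
  then show "(LINT \<omega>|P. indicator B (z \<omega>) * U \<omega>) = ?p * (LINT \<omega>|P. U \<omega>)"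
    using i int by (subst (asm) Bochner_Integration.integral_diff) auto
qed

text \<open>
  Noise terms drawn from fresh sources are orthogonal to the past and to each other, so second
  moments add up.
\<close>

lemma second_moment_noise_sum:
  fixes z :: "'s \<Rightarrow> 'w \<Rightarrow> 'z" and h :: "'s \<Rightarrow> 'w \<Rightarrow> 'z \<Rightarrow> 'c::{real_inner,second_countable_topology}"
  assumes D: "finite D" "D \<subseteq> A" "I \<inter> D = {}" and I: "I \<subseteq> A" and S: "subspace S"
    and z: "\<And>s. s \<in> D \<Longrightarrow> z s \<in> measurable P (N s)"
    and E: "\<And>s. s \<in> D \<Longrightarrow> E s = {z s -` B \<inter> space P |B. B \<in> sets (N s)}"
    and h: "\<And>s. s \<in> D \<Longrightarrow> (\<lambda>(\<omega>, x). h s \<omega> x) \<in> borel_measurable (F I \<Otimes>\<^sub>M N s)"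
    and hS: "\<And>s \<omega> x. s \<in> D \<Longrightarrow> \<omega> \<in> space P \<Longrightarrow> x \<in> space (N s) \<Longrightarrow> h s \<omega> x \<in> S"
    and mean: "\<And>s \<omega> v. s \<in> D \<Longrightarrow> \<omega> \<in> space P \<Longrightarrow> v \<in> S \<Longrightarrow> (LINT x|distr P (N s) (z s). inner (h s \<omega> x) v) = 0"
    and sq: "\<And>s. s \<in> D \<Longrightarrow> square_integrable P (\<lambda>\<omega>. h s \<omega> (z s \<omega>))"
    and U: "U \<in> borel_measurable (F I)" "\<And>\<omega>. \<omega> \<in> space P \<Longrightarrow> U \<omega> \<in> S" "square_integrable P U"
  shows "(\<lambda>\<omega>. U \<omega> + (\<Sum>s\<in>D. h s \<omega> (z s \<omega>))) \<in> borel_measurable (F (I \<union> D)) \<and>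
    (LINT \<omega>|P. (norm (U \<omega> + (\<Sum>s\<in>D. h s \<omega> (z s \<omega>))))\<^sup>2)
      = (LINT \<omega>|P. (norm (U \<omega>))\<^sup>2) + (\<Sum>s\<in>D. LINT \<omega>|P. (norm (h s \<omega> (z s \<omega>)))\<^sup>2)"
  using D z E h hS mean sq
proof (induction D rule: finite_induct)
  case empty
  then show ?case using U by simp
next
  case (insert s D)
  let ?V = "\<lambda>\<omega>. U \<omega> + (\<Sum>s\<in>D. h s \<omega> (z s \<omega>))" and ?h = "\<lambda>\<omega>. h s \<omega> (z s \<omega>)"
  have IH: "?V \<in> borel_measurable (F (I \<union> D))"
    "(LINT \<omega>|P. (norm (?V \<omega>))\<^sup>2) = (LINT \<omega>|P. (norm (U \<omega>))\<^sup>2) + (\<Sum>s\<in>D. LINT \<omega>|P. (norm (h s \<omega> (z s \<omega>)))\<^sup>2)"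
    using insert by auto
  have ID: "I \<union> D \<subseteq> A" "I \<union> insert s D \<subseteq> A" using I insert.prems by auto
  have VS: "?V \<omega> \<in> S" if "\<omega> \<in> space P" for \<omega>
  proof (intro subspace_add subspace_sum S U(2) that)
    fix t assume t: "t \<in> D"
    then have "z t \<omega> \<in> space (N t)" using measurable_space[OF insert.prems(3)[of t] that] by simp
    then show "h t \<omega> (z t \<omega>) \<in> S" using t that by (intro insert.prems(6)) auto
  qed
  have Vsq: "square_integrable P ?V"
    using U(3) insert.prems by (intro square_integrable_add square_integrable_sum) auto
  have hsq: "square_integrable P ?h" using insert.prems by auto
  have hm: "(\<lambda>(\<omega>, x). h s \<omega> x) \<in> borel_measurable (F J \<Otimes>\<^sub>M N s)" if J: "I \<subseteq> J" "J \<subseteq> A" for J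
  proof -
    have "(\<lambda>p. (fst p, snd p)) \<in> measurable (F J \<Otimes>\<^sub>M N s) (F I \<Otimes>\<^sub>M N s)"
      using measurable_F_mono[OF measurable_ident J]
      by (intro measurable_Pair measurable_compose[OF measurable_fst] measurable_snd) (auto simp: id_def)
    from measurable_compose[OF this insert.prems(5)[OF insertI1]] show ?thesis by (simp add: case_prod_beta)
  qed
  have hF: "?h \<in> borel_measurable (F (I \<union> insert s D))"
  proof -
    have "z s \<in> measurable (F (I \<union> insert s D)) (N s)"
      using insert.prems(3,4)[of s] ID by (intro measurable_source[where s = s]) auto
    then have "(\<lambda>\<omega>. (\<omega>, z s \<omega>)) \<in> measurable (F (I \<union> insert s D)) (F (I \<union> insert s D) \<Otimes>\<^sub>M N s)"
      by (intro measurable_Pair) auto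
    from measurable_compose[OF this hm[OF Un_upper1 ID(2)]] show ?thesis by simp
  qed
  have VF: "?V \<in> borel_measurable (F (I \<union> insert s D))"
    by (rule measurable_F_mono[OF IH(1)]) (use ID in auto)
  \<comment> \<open>The terms already summed have joined the past \<open>I \<union> D\<close>, while
    \<open>s\<close> is still fresh; the partial sum takes values in \<open>S\<close> and can serve
    as the test vector in \<open>mean\<close>.\<close>
  have orth: "(LINT \<omega>|P. (\<lambda>(\<omega>, x). inner (h s \<omega> x) (?V \<omega>)) (\<omega>, z s \<omega>)) = 0"
  proof (rule freeze_integral_zero)
    show "z s \<in> measurable P (N s)" "E s = {z s -` B \<inter> space P |B. B \<in> sets (N s)}" "s \<in> A" "s \<notin> I \<union> D"
      using insert.prems insert.hyps by auto
    show "(\<lambda>(\<omega>, x). inner (h s \<omega> x) (?V \<omega>)) \<in> borel_measurable (F (I \<union> D) \<Otimes>\<^sub>M N s)"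
      using hm[OF _ ID(1)] measurable_compose[OF measurable_fst IH(1), of "N s"]
      unfolding case_prod_beta by (intro borel_measurable_inner) auto
    show "integrable P (\<lambda>\<omega>. case (\<omega>, z s \<omega>) of (\<omega>, x) \<Rightarrow> inner (h s \<omega> x) (?V \<omega>))"
      using square_integrable_inner[OF hsq Vsq] by simp
    show "(LINT x|distr P (N s) (z s). (case (\<omega>, x) of (\<omega>, x) \<Rightarrow> inner (h s \<omega> x) (?V \<omega>))) = 0" if "\<omega> \<in> space P" for \<omega>
      using insert.prems(7)[OF insertI1 that VS[OF that]] by simp
  qed (rule ID)
  have eq: "U \<omega> + (\<Sum>s\<in>insert s D. h s \<omega> (z s \<omega>)) = ?V \<omega> + ?h \<omega>" for \<omega>
    using insert.hyps by (simp add: algebra_simps)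
  have "(LINT \<omega>|P. (norm (?V \<omega> + ?h \<omega>))\<^sup>2) = (LINT \<omega>|P. (norm (?V \<omega>))\<^sup>2 + 2 * inner (?h \<omega>) (?V \<omega>) + (norm (?h \<omega>))\<^sup>2)"
    by (intro Bochner_Integration.integral_cong refl)
      (simp add: power2_norm_eq_inner inner_add_left inner_add_right inner_commute)
  also have "\<dots> = (LINT \<omega>|P. (norm (?V \<omega>))\<^sup>2) + 2 * (LINT \<omega>|P. inner (?h \<omega>) (?V \<omega>)) + (LINT \<omega>|P. (norm (?h \<omega>))\<^sup>2)"
    using square_integrableD(2)[OF Vsq] square_integrableD(2)[OF hsq] square_integrable_inner[OF hsq Vsq] by simp
  also have "\<dots> = (LINT \<omega>|P. (norm (?V \<omega>))\<^sup>2) + (LINT \<omega>|P. (norm (?h \<omega>))\<^sup>2)" using orth by simp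
  finally show ?case
    unfolding eq using IH(2) insert.hyps borel_measurable_add[OF VF hF] by simp
qed

end

section \<open>Runs of the algorithm\<close>

lemma block_mult_fst: "fst (block_mult n A v k) = block_mult n A (\<lambda>l. fst (v l)) k"
  and block_mult_snd: "snd (block_mult n A v k) = block_mult n A (\<lambda>l. snd (v l)) k"
  by (simp_all add: block_mult_def fst_sum snd_sum)

lemma block_mult_in_subspace: "subspace S \<Longrightarrow> (\<And>l. l < n \<Longrightarrow> v l \<in> S) \<Longrightarrow> block_mult n A v k \<in> S"
  unfolding block_mult_def by (intro subspace_sum subspace_scale) auto

lemma minibatch_in_subspace: "subspace S \<Longrightarrow> (\<And>j. j < n \<Longrightarrow> f (s j) \<in> S) \<Longrightarrow> minibatch n f s \<in> S"
  unfolding minibatch_def by (intro subspace_sum subspace_scale) auto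

lemma Int_stable_vimage:
  assumes "\<And>B C. Q B \<Longrightarrow> Q C \<Longrightarrow> Q (B \<inter> C)"
  shows "Int_stable {f -` B \<inter> X |B. Q B}"
proof (rule Int_stableI)
  fix a b assume "a \<in> {f -` B \<inter> X |B. Q B}" "b \<in> {f -` B \<inter> X |B. Q B}"
  then obtain B C where "a = f -` B \<inter> X" "b = f -` C \<inter> X" "Q B" "Q C" by blast
  then have "a \<inter> b = f -` (B \<inter> C) \<inter> X" "Q (B \<inter> C)" using assms by auto
  then show "a \<inter> b \<in> {f -` B \<inter> X |B. Q B}" by blast
qed

lemma minibatch_Pair: "(minibatch n f s, minibatch n g s) = minibatch n (\<lambda>z. (f z, g z)) s"
  by (simp add: minibatch_def prod_eq_iff fst_sum snd_sum)

locale extra_run = risk_problem pb L \<nu>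
  for pb :: "('a::{real_inner,second_countable_topology}, 'b::{real_inner,second_countable_topology}, 'z) minimax"
    and L \<nu> :: real +
  fixes W V :: "real mat" and c :: dama_config and r :: "('w, 'a, 'b, 'z) dama_run" and \<sigma> :: real and T :: nat
  assumes K2: "2 \<le> agents pb" and W: "mixing_mat (agents pb) W" and V: "psd_sqrt (agents pb) (1\<^sub>m (agents pb) - W) V"
    and mats: "mat_Ax c = 1\<^sub>m (agents pb)" "mat_Bx c = V" "mat_Cx c = W"
      "mat_Ay c = 1\<^sub>m (agents pb)" "mat_By c = V" "mat_Cy c = W" "beta_x c = 0" "beta_y c = 0"
    and batches: "0 < big_batch c" "0 < small_batch c" "0 < init_batch c"
    and coin_prob: "0 \<le> coin_prob c" "coin_prob c \<le> 1"
    and T: "1 \<le> T" and run: "dama_grace_run pb c \<sigma> T r"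
begin

abbreviation "\<Omega> \<equiv> prob_sp r"
abbreviation "sources \<equiv> {Start} \<union> range Coin \<union> {Draw k i j |k i j. k < K}"

lemma model: "random_model pb c r" "dama_start pb r" "dama_updates pb c r" "grace_estimates pb c r"
    "noise_condition pb \<sigma> T r" "finite_start pb c r"
  using run by (auto simp: dama_grace_run_def)

sublocale src: independent_sources \<Omega> "source_events pb r" sources
proof (rule independent_sources.intro)
  show "prob_space \<Omega>" using model(1) by (simp add: random_model_def)
  show "independent_sources_axioms \<Omega> (source_events pb r) sources"
  proof
    show "prob_space.indep_sets \<Omega> (source_events pb r) sources" using model(1) by (simp add: random_model_def)
    fix s assume "s \<in> sources"
    show "Int_stable (source_events pb r s)"
      by (cases s) (auto simp: source_events_def intro!: Int_stable_vimage Int_stable_vimage[where Q = "\<lambda>_. True", simplified])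
  qed
qed

definition u :: "nat \<Rightarrow> nat \<Rightarrow> 'w \<Rightarrow> 'a \<times> 'b" where "u i k \<omega> = (xit r k i \<omega>, yit r k i \<omega>)"
definition d :: "nat \<Rightarrow> nat \<Rightarrow> 'w \<Rightarrow> 'a \<times> 'b" where "d i k \<omega> = (dual_x r k i \<omega>, dual_y r k i \<omega>)"
definition g :: "nat \<Rightarrow> nat \<Rightarrow> 'w \<Rightarrow> 'a \<times> 'b" where "g i k \<omega> = (est_x r k i \<omega>, est_y r k i \<omega>)"
text \<open>The step sizes with the signs of descent in \<open>x\<close> and ascent in
  \<open>y\<close>; with them both variables follow one EXTRA recursion on pairs.\<close>

definition scal :: "'a \<times> 'b \<Rightarrow> 'a \<times> 'b" where "scal v = (step_x c *\<^sub>R fst v, - (step_y c *\<^sub>R snd v))"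
definition past_sources :: "nat \<Rightarrow> source set" where
  "past_sources i = {Start} \<union> {Coin l |l. l < i} \<union> {Draw k l j |k l j. k < K \<and> l < i}"

lemma past_eq: "past pb r i = src.F (past_sources i)"
  by (simp add: past_def src.F_def past_sources_def)

lemma past_sources_subset: "past_sources i \<subseteq> sources"
  by (auto simp: past_sources_def)

lemma past_sources_mono: "i \<le> j \<Longrightarrow> past_sources i \<subseteq> past_sources j"
  by (auto simp: past_sources_def)

lemma draw_measurable: "k < K \<Longrightarrow> draw r k i j \<in> measurable \<Omega> (sample_law pb k)"
  and draw_law: "k < K \<Longrightarrow> distr \<Omega> (sample_law pb k) (draw r k i j) = sample_law pb k"
  and coin_measurable: "coin r i \<in> measurable \<Omega> (count_space UNIV)"
  and coin_law: "distr \<Omega> (count_space UNIV) (coin r i) = measure_pmf (bernoulli_pmf (coin_prob c))"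
  using model(1) by (auto simp: random_model_def)

lemma draw_space: "k < K \<Longrightarrow> \<omega> \<in> space \<Omega> \<Longrightarrow> draw r k i j \<omega> \<in> space (sample_law pb k)"
  using draw_measurable by (rule measurable_space)

lemma draw_source:
  assumes "k < K" "Draw k i j \<in> J" "J \<subseteq> sources"
  shows "draw r k i j \<in> measurable (src.F J) (sample_law pb k)"
  using assms by (intro src.measurable_source[where s = "Draw k i j"] draw_measurable) (auto simp: source_events_def)

lemma coin_source:
  assumes "Coin i \<in> J" "J \<subseteq> sources"
  shows "coin r i \<in> measurable (src.F J) (count_space UNIV)"
  using assms by (intro src.measurable_source[where s = "Coin i"] coin_measurable) (auto simp: source_events_def)

lemma start_facts:
  assumes "\<omega> \<in> space \<Omega>"
  shows "u 0 0 \<omega> \<in> S" "d 0 0 \<omega> \<in> S"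
    and "k < K \<Longrightarrow> u 0 k \<omega> = u 0 0 \<omega>" "k < K \<Longrightarrow> d 0 k \<omega> = d 0 0 \<omega>"
proof -
  have *: "xit r 0 0 \<omega> \<in> X \<and> yit r 0 0 \<omega> \<in> Y \<and> dual_x r 0 0 \<omega> \<in> X \<and> dual_y r 0 0 \<omega> \<in> Y"
    "k < K \<Longrightarrow> xit r k 0 \<omega> = xit r 0 0 \<omega> \<and> yit r k 0 \<omega> = yit r 0 0 \<omega> \<and>
           dual_x r k 0 \<omega> = dual_x r 0 0 \<omega> \<and> dual_y r k 0 \<omega> = dual_y r 0 0 \<omega>"
    using model(2) assms unfolding dama_start_def by blast+
  show "u 0 0 \<omega> \<in> S" "d 0 0 \<omega> \<in> S" using *(1) by (simp_all add: u_def d_def)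
  show "u 0 k \<omega> = u 0 0 \<omega>" "d 0 k \<omega> = d 0 0 \<omega>" if "k < K"
    using *(2)[OF that] unfolding u_def d_def by (elim conjE, simp only:)+
qed

lemma u_zero: "k < K \<Longrightarrow> \<omega> \<in> space \<Omega> \<Longrightarrow> u 0 k \<omega> = u 0 0 \<omega>"
  and d_zero: "k < K \<Longrightarrow> \<omega> \<in> space \<Omega> \<Longrightarrow> d 0 k \<omega> = d 0 0 \<omega>"
  by (rule start_facts; assumption)+

lemma
  assumes k: "k < K" and w: "\<omega> \<in> space \<Omega>"
  shows u_Suc: "u (Suc i) k \<omega> = block_mult K W (\<lambda>l. u i l \<omega>) k - scal (g i k \<omega>) - block_mult K V (\<lambda>l. d i l \<omega>) k"
    and d_Suc: "d (Suc i) k \<omega> = d i k \<omega> + block_mult K V (\<lambda>l. u (Suc i) l \<omega>) k"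
  using model(3) k w
  by (simp_all add: dama_updates_def Let_def mats block_mult_one u_def d_def g_def scal_def prod_eq_iff
      block_mult_fst block_mult_snd)

lemma g_zero:
  "k < K \<Longrightarrow> \<omega> \<in> space \<Omega> \<Longrightarrow> g 0 k \<omega> = minibatch (init_batch c) (stoch_grad k (u 0 k \<omega>)) (\<lambda>j. draw r k 0 j \<omega>)"
  using model(4) by (simp add: grace_estimates_def g_def u_def stoch_grad_def[abs_def] minibatch_Pair)

lemma g_Suc:
  "k < K \<Longrightarrow> \<omega> \<in> space \<Omega> \<Longrightarrow> g (Suc i) k \<omega> =
    (if coin r (Suc i) \<omega> then minibatch (big_batch c) (stoch_grad k (u (Suc i) k \<omega>)) (\<lambda>j. draw r k (Suc i) j \<omega>)
     else g i k \<omega> - minibatch (small_batch c) (stoch_grad k (u i k \<omega>)) (\<lambda>j. draw r k (Suc i) j \<omega>)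
       + minibatch (small_batch c) (stoch_grad k (u (Suc i) k \<omega>)) (\<lambda>j. draw r k (Suc i) j \<omega>))"
  using model(4) by (simp add: grace_estimates_def g_def u_def stoch_grad_def[abs_def] minibatch_Pair[symmetric] grace_step_def mats)

lemma scal_in: "v \<in> S \<Longrightarrow> scal v \<in> S"
  using subX subY by (cases v) (auto simp: scal_def intro: subspace_scale subspace_neg)

text \<open>Gradients relative to a subspace have meaning only at its points, so membership of
  iterates, dual blocks and estimates is one joint induction: each new one draws on the
  others.\<close>

lemma in_S: "k < K \<Longrightarrow> \<omega> \<in> space \<Omega> \<Longrightarrow> u i k \<omega> \<in> S \<and> d i k \<omega> \<in> S \<and> g i k \<omega> \<in> S"
proof (induction i arbitrary: k)
  case 0
  have 1: "u 0 k \<omega> \<in> S" "d 0 k \<omega> \<in> S"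
    using start_facts(1,2)[OF 0(2)] unfolding u_zero[OF 0] d_zero[OF 0] .
  then show ?case
    unfolding g_zero[OF 0] using 0 by (intro conjI minibatch_in_subspace subS stoch_grad_in draw_space)
next
  case (Suc i)
  have us: "u (Suc i) k \<omega> \<in> S" if "k < K" for k
    unfolding u_Suc[OF that Suc.prems(2)] using Suc that
    by (intro subspace_diff subS block_mult_in_subspace scal_in) auto
  have ds: "d (Suc i) k \<omega> \<in> S"
    unfolding d_Suc[OF Suc.prems] using Suc us by (intro subspace_add subS block_mult_in_subspace) auto
  have "g (Suc i) k \<omega> \<in> S"
    unfolding g_Suc[OF Suc.prems] using Suc us
    by (auto intro!: subspace_add subspace_diff subS minibatch_in_subspace stoch_grad_in draw_space)
  then show ?case using us[OF Suc.prems(1)] ds by simp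
qed

lemma u_in: "k < K \<Longrightarrow> \<omega> \<in> space \<Omega> \<Longrightarrow> u i k \<omega> \<in> S"
  and g_in: "k < K \<Longrightarrow> \<omega> \<in> space \<Omega> \<Longrightarrow> g i k \<omega> \<in> S"
  using in_S by blast+

lemma recursion:
  assumes "\<omega> \<in> space \<Omega>"
  shows "extra_recursion K W V (\<lambda>i k. u i k \<omega>) (\<lambda>i k. d i k \<omega>) (\<lambda>i k. scal (g i k \<omega>))"
proof -
  have "extra_matrices K W V" using K2 W V by unfold_locales
  moreover have "extra_recursion_axioms K W V (\<lambda>i k. u i k \<omega>) (\<lambda>i k. d i k \<omega>) (\<lambda>i k. scal (g i k \<omega>))"
    by (unfold_locales; (rule u_zero d_zero u_Suc d_Suc, assumption, rule assms))
  ultimately show ?thesis by (rule extra_recursion.intro)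
qed

sublocale mat: extra_matrices K W V
  using K2 W V by unfold_locales

lemma measurable_into_S:
  assumes "f \<in> borel_measurable N" "\<And>\<omega>. \<omega> \<in> space N \<Longrightarrow> f \<omega> \<in> S"
  shows "f \<in> measurable N (restrict_space borel S)"
  using assms by (intro measurable_restrict_space2) auto

lemma local_grad_measurable: "k < K \<Longrightarrow> local_grad k \<in> borel_measurable (restrict_space borel S)"
proof (rule borel_measurable_continuous_on_restrict)
  assume "k < K"
  then have "M-lipschitz_on S (local_grad k)"
    using local_grad_lipschitz' M by (intro lipschitz_onI) (auto simp: dist_norm)
  then show "continuous_on S (local_grad k)" by (rule lipschitz_on_continuous_on)
qed

lemma risk_grad_measurable: "risk_grad \<in> borel_measurable (restrict_space borel S)"
proof (rule borel_measurable_continuous_on_restrict)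
  have "M-lipschitz_on S risk_grad"
    using risk_grad_lipschitz M by (intro lipschitz_onI) (auto simp: dist_norm)
  then show "continuous_on S risk_grad" by (rule lipschitz_on_continuous_on)
qed

lemma scal_measurable: "f \<in> borel_measurable N \<Longrightarrow> (\<lambda>\<omega>. scal (f \<omega>)) \<in> borel_measurable N"
proof -
  have "scal \<in> borel_measurable borel"
    unfolding scal_def[abs_def] by (intro borel_measurable_continuous_onI continuous_intros)
  then show "f \<in> borel_measurable N \<Longrightarrow> (\<lambda>\<omega>. scal (f \<omega>)) \<in> borel_measurable N"
    by (rule measurable_compose[rotated])
qed

lemma block_mult_measurable:
  "(\<And>l. l < n \<Longrightarrow> f l \<in> borel_measurable N) \<Longrightarrow> (\<lambda>\<omega>. block_mult n A (\<lambda>l. f l \<omega>) k) \<in> borel_measurable N"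
  for f :: "nat \<Rightarrow> 'w \<Rightarrow> 'a \<times> 'b"
  unfolding block_mult_def by (intro borel_measurable_sum borel_measurable_scaleR borel_measurable_const) auto

lemma stoch_grad_pair_measurable:
  assumes k: "k < K" and f: "f \<in> borel_measurable N" "\<And>\<omega>. \<omega> \<in> space N \<Longrightarrow> f \<omega> \<in> S"
  shows "(\<lambda>(\<omega>, x). stoch_grad k (f \<omega>) x) \<in> borel_measurable (N \<Otimes>\<^sub>M sample_law pb k)"
proof -
  have "(\<lambda>p. (f (fst p), snd p)) \<in> measurable (N \<Otimes>\<^sub>M sample_law pb k) (restrict_space borel S \<Otimes>\<^sub>M sample_law pb k)"
    by (intro measurable_Pair measurable_compose[OF measurable_fst measurable_into_S[OF f]] measurable_snd)
  from measurable_compose[OF this stoch_grad_measurable[OF k]] show ?thesis by (simp add: case_prod_beta)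
qed

lemma stoch_grad_compose_measurable:
  assumes k: "k < K" and f: "f \<in> borel_measurable N" "\<And>\<omega>. \<omega> \<in> space N \<Longrightarrow> f \<omega> \<in> S" and z: "z \<in> measurable N (sample_law pb k)"
  shows "(\<lambda>\<omega>. stoch_grad k (f \<omega>) (z \<omega>)) \<in> borel_measurable N"
  using measurable_compose[OF measurable_Pair[OF measurable_ident_sets[OF refl] z] stoch_grad_pair_measurable[OF k f]] by simp

lemma minibatch_measurable:
  fixes f :: "'w \<Rightarrow> 'z \<Rightarrow> 'a \<times> 'b"
  assumes "\<And>j. j < n \<Longrightarrow> (\<lambda>\<omega>. f \<omega> (s j \<omega>)) \<in> borel_measurable N"
  shows "(\<lambda>\<omega>. minibatch n (f \<omega>) (\<lambda>j. s j \<omega>)) \<in> borel_measurable N"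
  unfolding minibatch_def using assms by (intro borel_measurable_scaleR borel_measurable_const borel_measurable_sum) auto

text \<open>The primal update sees the dual blocks only through \<open>V\<close>. The random model
  makes no statement on the measurability of the initial dual block, but \<open>V\<close>
  annihilates a common block, so this process starts at zero and is measurable throughout.\<close>

definition dual :: "nat \<Rightarrow> nat \<Rightarrow> 'w \<Rightarrow> 'a \<times> 'b" where
  "dual i k \<omega> = block_mult K V (\<lambda>l. d i l \<omega>) k"

lemma dual_zero: "k < K \<Longrightarrow> \<omega> \<in> space \<Omega> \<Longrightarrow> dual 0 k \<omega> = 0"
proof -
  assume k: "k < K" and w: "\<omega> \<in> space \<Omega>"
  have "dual 0 k \<omega> = block_mult K V (\<lambda>_. d 0 0 \<omega>) k"
    unfolding dual_def using w by (intro block_mult_cong d_zero)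
  then show ?thesis using k by (simp add: mat.V_const)
qed

lemma dual_Suc:
  assumes k: "k < K" and w: "\<omega> \<in> space \<Omega>"
  shows "dual (Suc i) k \<omega> = dual i k \<omega> + (u (Suc i) k \<omega> - block_mult K W (\<lambda>l. u (Suc i) l \<omega>) k)"
proof -
  have "dual (Suc i) k \<omega> = block_mult K V (\<lambda>l. d i l \<omega> + block_mult K V (\<lambda>l. u (Suc i) l \<omega>) l) k"
    unfolding dual_def using w by (intro block_mult_cong d_Suc)
  then show ?thesis using k by (simp add: block_mult_add mat.V_squared dual_def)
qed

text \<open>Note the shift of index: iterates at \<open>i\<close> depend on coins and draws before
  \<open>i\<close>, whereas the estimate at \<open>i\<close> also uses those of iteration
  \<open>i\<close> itself.\<close>

lemma process_measurable:
  "k < K \<Longrightarrow> u i k \<in> borel_measurable (src.F (past_sources i)) \<and> dual i k \<in> borel_measurable (src.F (past_sources i))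
    \<and> g i k \<in> borel_measurable (src.F (past_sources (Suc i)))"
proof (induction i arbitrary: k)
  case 0
  let ?F = "src.F (past_sources 0)" and ?F1 = "src.F (past_sources (Suc 0))"
  have "(\<lambda>\<omega>. (xit r 0 0 \<omega>, yit r 0 0 \<omega>)) \<in> borel_measurable ?F"
    using model(1) by (intro src.measurable_source[where s = Start])
      (auto simp: random_model_def source_events_def past_sources_def)
  then have u0: "u 0 0 \<in> borel_measurable ?F" by (simp add: u_def[abs_def])
  have uk: "u 0 k \<in> borel_measurable ?F"
    by (rule measurable_cong[THEN iffD2, OF _ u0]) (simp add: src.space_F, rule u_zero[OF 0])
  have dk: "dual 0 k \<in> borel_measurable ?F"
    using measurable_cong[of ?F "dual 0 k" "\<lambda>_. 0" borel] dual_zero[OF 0] by (simp add: src.space_F)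
  have uk1: "u 0 k \<in> borel_measurable ?F1"
    by (rule src.measurable_F_mono[OF uk past_sources_mono past_sources_subset]) simp
  have "(\<lambda>\<omega>. minibatch (init_batch c) (stoch_grad k (u 0 k \<omega>)) (\<lambda>j. draw r k 0 j \<omega>)) \<in> borel_measurable ?F1"
    using 0 uk1 past_sources_subset
    by (intro minibatch_measurable stoch_grad_compose_measurable draw_source) (auto simp: src.space_F past_sources_def intro!: u_in)
  then have "g 0 k \<in> borel_measurable ?F1"
    using measurable_cong[of ?F1 "g 0 k" _ borel] g_zero[OF 0] by (simp add: src.space_F)
  then show ?case using uk dk by simp
next
  case (Suc i)
  let ?F = "src.F (past_sources (Suc i))" and ?F1 = "src.F (past_sources (Suc (Suc i)))"
  have up: "f \<in> borel_measurable ?F1" if "f \<in> borel_measurable ?F" for f :: "'w \<Rightarrow> 'a \<times> 'b"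
    by (rule src.measurable_F_mono[OF that past_sources_mono past_sources_subset]) simp
  have up0: "f \<in> borel_measurable ?F" if "f \<in> borel_measurable (src.F (past_sources i))" for f :: "'w \<Rightarrow> 'a \<times> 'b"
    by (rule src.measurable_F_mono[OF that past_sources_mono past_sources_subset]) simp
  have us: "u (Suc i) k \<in> borel_measurable ?F" if k: "k < K" for k
  proof -
    have "(\<lambda>\<omega>. block_mult K W (\<lambda>l. u i l \<omega>) k - scal (g i k \<omega>) - dual i k \<omega>) \<in> borel_measurable ?F"
      using Suc.IH k by (intro borel_measurable_diff block_mult_measurable scal_measurable) (auto intro: up0)
    then show ?thesis
      using measurable_cong[of ?F "u (Suc i) k" _ borel] u_Suc[OF k] by (simp add: src.space_F dual_def)
  qed
  have ds: "dual (Suc i) k \<in> borel_measurable ?F"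
  proof -
    have "(\<lambda>\<omega>. dual i k \<omega> + (u (Suc i) k \<omega> - block_mult K W (\<lambda>l. u (Suc i) l \<omega>) k)) \<in> borel_measurable ?F"
      using Suc us by (intro borel_measurable_add borel_measurable_diff block_mult_measurable) (auto intro: up0)
    then show ?thesis
      using measurable_cong[of ?F "dual (Suc i) k" _ borel] dual_Suc[OF Suc.prems] by (simp add: src.space_F)
  qed
  have mb: "(\<lambda>\<omega>. minibatch n (stoch_grad k (f \<omega>)) (\<lambda>j. draw r k (Suc i) j \<omega>)) \<in> borel_measurable ?F1"
    if "f \<in> borel_measurable ?F1" "\<And>\<omega>. \<omega> \<in> space \<Omega> \<Longrightarrow> f \<omega> \<in> S" for n f
    using that Suc.prems past_sources_subset
    by (intro minibatch_measurable stoch_grad_compose_measurable draw_source) (auto simp: src.space_F past_sources_def)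
  have cm: "{\<omega> \<in> space ?F1. coin r (Suc i) \<omega>} \<in> sets ?F1"
  proof -
    have "coin r (Suc i) -` {True} \<inter> space ?F1 \<in> sets ?F1"
      using coin_source[of "Suc i" "past_sources (Suc (Suc i))"] past_sources_subset
      by (intro measurable_sets[where A = "count_space UNIV"]) (auto simp: past_sources_def)
    moreover have "coin r (Suc i) -` {True} \<inter> space ?F1 = {\<omega> \<in> space ?F1. coin r (Suc i) \<omega>}" by auto
    ultimately show ?thesis by simp
  qed
  have "(\<lambda>\<omega>. if coin r (Suc i) \<omega> then minibatch (big_batch c) (stoch_grad k (u (Suc i) k \<omega>)) (\<lambda>j. draw r k (Suc i) j \<omega>)
     else g i k \<omega> - minibatch (small_batch c) (stoch_grad k (u i k \<omega>)) (\<lambda>j. draw r k (Suc i) j \<omega>)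
       + minibatch (small_batch c) (stoch_grad k (u (Suc i) k \<omega>)) (\<lambda>j. draw r k (Suc i) j \<omega>)) \<in> borel_measurable ?F1"
  proof (intro measurable_If borel_measurable_add borel_measurable_diff mb cm)
    show "g i k \<in> borel_measurable ?F1" using Suc by (intro up) blast
    show "u i k \<in> borel_measurable ?F1" using Suc by (intro up up0) blast
    show "u (Suc i) k \<in> borel_measurable ?F1" by (intro up us Suc)
  qed (use u_in Suc up[OF us[OF Suc.prems]] in auto)
  then have "g (Suc i) k \<in> borel_measurable ?F1"
    using measurable_cong[of ?F1 "g (Suc i) k" _ borel] g_Suc[OF Suc.prems] by (simp add: src.space_F)
  then show ?case using us[OF Suc.prems] ds by simp
qed

lemma u_meas: "k < K \<Longrightarrow> i \<le> l \<Longrightarrow> u i k \<in> borel_measurable (src.F (past_sources l))"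
  using process_measurable[of k i] by (auto intro: src.measurable_F_mono[OF _ past_sources_mono past_sources_subset])

lemma dual_meas: "k < K \<Longrightarrow> i \<le> l \<Longrightarrow> dual i k \<in> borel_measurable (src.F (past_sources l))"
  using process_measurable[of k i] by (auto intro: src.measurable_F_mono[OF _ past_sources_mono past_sources_subset])

lemma g_meas: "k < K \<Longrightarrow> i < l \<Longrightarrow> g i k \<in> borel_measurable (src.F (past_sources l))"
  using process_measurable[of k i] by (auto intro: src.measurable_F_mono[OF _ past_sources_mono past_sources_subset])

lemma local_grad_u_meas: "k < K \<Longrightarrow> i \<le> l \<Longrightarrow> (\<lambda>\<omega>. local_grad k (u i k \<omega>)) \<in> borel_measurable (src.F (past_sources l))"
  using u_in by (intro measurable_compose[OF measurable_into_S local_grad_measurable] u_meas) (auto simp: src.space_F)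

lemma past_P: "f \<in> borel_measurable (src.F (past_sources l)) \<Longrightarrow> f \<in> borel_measurable \<Omega>"
  by (rule src.measurable_F_P[OF _ past_sources_subset])

end

section \<open>Error of the gradient estimator\<close>

lemma minibatch_minus:
  assumes "0 < n"
  shows "minibatch n f s - m = (\<Sum>j<n. (1 / real n) *\<^sub>R (f (s j) - m))"
  using assms by (simp add: minibatch_def scaleR_diff_right sum_subtractf scaleR_sum_right[symmetric] sum_constant_scaleR
      divide_inverse)

context extra_run begin

text \<open>The sample remains an explicit argument, so that the past can be frozen while the sample
  is integrated out.\<close>

definition grad_noise :: "nat \<Rightarrow> nat \<Rightarrow> 'w \<Rightarrow> 'z \<Rightarrow> 'a \<times> 'b" where
  "grad_noise i k \<omega> x = stoch_grad k (u i k \<omega>) x - local_grad k (u i k \<omega>)"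

text \<open>One sample at two successive iterates. Both are determined before the draws of iteration
  \<open>Suc i\<close>, so the difference is centred given the past, and its size is governed by the
  movement.\<close>

definition diff_noise :: "nat \<Rightarrow> nat \<Rightarrow> 'w \<Rightarrow> 'z \<Rightarrow> 'a \<times> 'b" where
  "diff_noise i k \<omega> x = grad_noise (Suc i) k \<omega> x - grad_noise i k \<omega> x"

abbreviation "\<E> f \<equiv> LINT \<omega>|\<Omega>. f \<omega>"
abbreviation "msq U \<equiv> LINT \<omega>|\<Omega>. (norm (U \<omega>))\<^sup>2"
abbreviation "delta i k \<omega> \<equiv> u (Suc i) k \<omega> - u i k \<omega>"

lemma grad_noise_measurable:
  assumes "k < K" "i \<le> l"
  shows "(\<lambda>(\<omega>, x). grad_noise i k \<omega> x) \<in> borel_measurable (src.F (past_sources l) \<Otimes>\<^sub>M sample_law pb k)"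
proof -
  have "(\<lambda>(\<omega>, x). stoch_grad k (u i k \<omega>) x) \<in> borel_measurable (src.F (past_sources l) \<Otimes>\<^sub>M sample_law pb k)"
    using assms by (intro stoch_grad_pair_measurable u_meas) (auto simp: src.space_F intro: u_in)
  then show ?thesis
    using measurable_compose[OF measurable_fst local_grad_u_meas[OF assms]]
    unfolding grad_noise_def case_prod_beta by (intro borel_measurable_diff)
qed

lemma grad_noise_in: "k < K \<Longrightarrow> \<omega> \<in> space \<Omega> \<Longrightarrow> x \<in> space (sample_law pb k) \<Longrightarrow> grad_noise i k \<omega> x \<in> S"
  unfolding grad_noise_def by (intro subspace_diff subS stoch_grad_in local_grad_in u_in)

lemma grad_noise_mean:
  assumes "k < K" "\<omega> \<in> space \<Omega>" "v \<in> S"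
  shows "integrable (sample_law pb k) (\<lambda>x. inner (grad_noise i k \<omega> x) v)"
    and "(LINT x|sample_law pb k. inner (grad_noise i k \<omega> x) v) = 0"
proof -
  interpret N: prob_space "sample_law pb k" using law assms by simp
  note i = stoch_grad_integrable[OF assms(1) u_in[OF assms(1,2)] assms(3)]
  then show "integrable (sample_law pb k) (\<lambda>x. inner (grad_noise i k \<omega> x) v)"
    unfolding grad_noise_def inner_diff_left by simp
  show "(LINT x|sample_law pb k. inner (grad_noise i k \<omega> x) v) = 0"
    using i stoch_grad_expectation[OF assms(1) u_in[OF assms(1,2)] assms(3)]
    unfolding grad_noise_def inner_diff_left
    by (subst Bochner_Integration.integral_diff) (auto simp: N.prob_space)
qed

lemma diff_noise_measurable:
  "k < K \<Longrightarrow> (\<lambda>(\<omega>, x). diff_noise i k \<omega> x) \<in> borel_measurable (src.F (past_sources (Suc i)) \<Otimes>\<^sub>M sample_law pb k)"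
  using grad_noise_measurable[of k i "Suc i"] grad_noise_measurable[of k "Suc i" "Suc i"]
  unfolding diff_noise_def case_prod_beta by (intro borel_measurable_diff) auto

lemma diff_noise_in: "k < K \<Longrightarrow> \<omega> \<in> space \<Omega> \<Longrightarrow> x \<in> space (sample_law pb k) \<Longrightarrow> diff_noise i k \<omega> x \<in> S"
  unfolding diff_noise_def by (intro subspace_diff subS grad_noise_in)

lemma diff_noise_mean:
  assumes "k < K" "\<omega> \<in> space \<Omega>" "v \<in> S"
  shows "(LINT x|sample_law pb k. inner (diff_noise i k \<omega> x) v) = 0"
  using grad_noise_mean[OF assms] unfolding diff_noise_def inner_diff_left
  by (subst Bochner_Integration.integral_diff) auto

text \<open>The tower property: integrate the conditional second moment against the constant
  1.\<close>

lemma conditional_variance_bound: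
  fixes e :: "'w \<Rightarrow> 'c::{real_inner,second_countable_topology}"
  assumes "conditional_variance_le \<Omega> (src.F (past_sources l)) v e" "e \<in> borel_measurable \<Omega>" "0 \<le> v"
  shows "(\<integral>\<^sup>+\<omega>. ennreal ((norm (e \<omega>))\<^sup>2) \<partial>\<Omega>) \<le> ennreal v"
proof -
  let ?F = "src.F (past_sources l)"
  have "subalgebra \<Omega> ?F"
    using src.sets_F_subset[OF past_sources_subset] by (simp add: subalgebra_def src.space_F)
  then interpret sub: finite_measure_subalgebra \<Omega> ?F
    by unfold_locales
  have m: "(\<lambda>\<omega>. ennreal ((norm (e \<omega>))\<^sup>2)) \<in> borel_measurable \<Omega>"
    using assms(2) by (intro measurable_compose[OF _ measurable_ennreal] borel_measurable_power measurable_compose[OF _ borel_measurable_norm])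
  have "(\<integral>\<^sup>+\<omega>. ennreal ((norm (e \<omega>))\<^sup>2) \<partial>\<Omega>) = (\<integral>\<^sup>+\<omega>. 1 * nn_cond_exp \<Omega> ?F (\<lambda>\<omega>. ennreal ((norm (e \<omega>))\<^sup>2)) \<omega> \<partial>\<Omega>)"
    by (subst sub.nn_cond_exp_intg) (use m in auto)
  also have "\<dots> \<le> (\<integral>\<^sup>+\<omega>. ennreal v \<partial>\<Omega>)"
    using assms(1) unfolding conditional_variance_le_def by (intro nn_integral_mono_AE) auto
  also have "\<dots> = ennreal v" by (simp add: src.emeasure_space_1)
  finally show ?thesis .
qed

lemma grad_noise_draw_measurable:
  "k < K \<Longrightarrow> (\<lambda>\<omega>. grad_noise i k \<omega> (draw r k l j \<omega>)) \<in> borel_measurable \<Omega>"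
  unfolding grad_noise_def using u_in
  by (intro borel_measurable_diff stoch_grad_compose_measurable draw_measurable past_P[OF u_meas[OF _ order_refl]]
      past_P[OF local_grad_u_meas[OF _ order_refl]])

lemma grad_noise_variance:
  assumes i: "i < T" and k: "k < K"
  shows "square_integrable \<Omega> (\<lambda>\<omega>. grad_noise i k \<omega> (draw r k i j \<omega>))"
    and "msq (\<lambda>\<omega>. grad_noise i k \<omega> (draw r k i j \<omega>)) \<le> 2 * \<sigma>\<^sup>2"
proof -
  let ?e = "\<lambda>\<omega>. grad_noise i k \<omega> (draw r k i j \<omega>)"
  note m = grad_noise_draw_measurable[OF k, of i i j]
  have mf: "(\<lambda>\<omega>. fst (?e \<omega>)) \<in> borel_measurable \<Omega>" "(\<lambda>\<omega>. snd (?e \<omega>)) \<in> borel_measurable \<Omega>"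
    using m by (auto simp: borel_prod[symmetric])
  have cv: "conditional_variance_le \<Omega> (src.F (past_sources i)) (\<sigma>\<^sup>2) (\<lambda>\<omega>. fst (?e \<omega>))"
    "conditional_variance_le \<Omega> (src.F (past_sources i)) (\<sigma>\<^sup>2) (\<lambda>\<omega>. snd (?e \<omega>))"
    using model(5) i k unfolding noise_condition_def Let_def past_eq
    by (simp_all add: grad_noise_def stoch_grad_def local_grad_def u_def)
  have "(\<integral>\<^sup>+\<omega>. ennreal ((norm (?e \<omega>))\<^sup>2) \<partial>\<Omega>) =
    (\<integral>\<^sup>+\<omega>. ennreal ((norm (fst (?e \<omega>)))\<^sup>2) + ennreal ((norm (snd (?e \<omega>)))\<^sup>2) \<partial>\<Omega>)"
    by (intro nn_integral_cong) (simp add: norm_prod_def ennreal_plus[symmetric] del: ennreal_plus)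
  also have "\<dots> = (\<integral>\<^sup>+\<omega>. ennreal ((norm (fst (?e \<omega>)))\<^sup>2) \<partial>\<Omega>) + (\<integral>\<^sup>+\<omega>. ennreal ((norm (snd (?e \<omega>)))\<^sup>2) \<partial>\<Omega>)"
    using mf by (intro nn_integral_add) auto
  also have "\<dots> \<le> ennreal (\<sigma>\<^sup>2) + ennreal (\<sigma>\<^sup>2)"
    using cv mf by (intro add_mono conditional_variance_bound) auto
  also have "\<dots> = ennreal (2 * \<sigma>\<^sup>2)" by (simp add: ennreal_plus[symmetric] del: ennreal_plus)
  finally have le: "(\<integral>\<^sup>+\<omega>. ennreal ((norm (?e \<omega>))\<^sup>2) \<partial>\<Omega>) \<le> ennreal (2 * \<sigma>\<^sup>2)" .
  have int: "integrable \<Omega> (\<lambda>\<omega>. (norm (?e \<omega>))\<^sup>2)"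
    using le m by (intro integrableI_bounded) (auto intro: order.strict_trans1)
  then show "square_integrable \<Omega> ?e" using m by (simp add: square_integrable_def)
  show "msq ?e \<le> 2 * \<sigma>\<^sup>2" using le nn_integral_eq_integral[OF int] by simp
qed

text \<open>The draw is frozen out and mean-square smoothness is used at each outcome, since the two
  iterates are themselves random. Subtracting the expected gradients by the parallelogram bound
  doubles both contributions, hence \<open>2 M^2 + 2 M^2\<close>.\<close>

lemma diff_noise_variance:
  assumes k: "k < K" and sq: "square_integrable \<Omega> (delta i k)"
  shows "square_integrable \<Omega> (\<lambda>\<omega>. diff_noise i k \<omega> (draw r k (Suc i) j \<omega>))"
    and "msq (\<lambda>\<omega>. diff_noise i k \<omega> (draw r k (Suc i) j \<omega>)) \<le> 4 * M\<^sup>2 * msq (delta i k)"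
proof -
  let ?I = "past_sources (Suc i)" and ?z = "draw r k (Suc i) j"
  define a where "a \<omega> x = stoch_grad k (u (Suc i) k \<omega>) x - stoch_grad k (u i k \<omega>) x" for \<omega> x
  define b where "b \<omega> = local_grad k (u (Suc i) k \<omega>) - local_grad k (u i k \<omega>)" for \<omega>
  have am: "(\<lambda>(\<omega>, x). a \<omega> x) \<in> borel_measurable (src.F ?I \<Otimes>\<^sub>M sample_law pb k)"
    unfolding a_def case_prod_beta using k u_in
    by (intro borel_measurable_diff stoch_grad_pair_measurable[unfolded case_prod_beta] u_meas) (auto simp: src.space_F)
  have "(\<lambda>(\<omega>, x). ennreal ((norm (a \<omega> x))\<^sup>2)) \<in> borel_measurable (src.F ?I \<Otimes>\<^sub>M sample_law pb k)"
    using am unfolding case_prod_beta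
    by (intro measurable_compose[OF _ measurable_ennreal] borel_measurable_power measurable_compose[OF _ borel_measurable_norm])
  from src.freeze_nn_integral[OF draw_measurable[OF k] _ _ _ past_sources_subset this, of "Draw k (Suc i) j" "Suc i" j]
  have "(\<integral>\<^sup>+\<omega>. ennreal ((norm (a \<omega> (?z \<omega>)))\<^sup>2) \<partial>\<Omega>) = (\<integral>\<^sup>+\<omega>. (\<integral>\<^sup>+x. ennreal ((norm (a \<omega> x))\<^sup>2) \<partial>sample_law pb k) \<partial>\<Omega>)"
    using k by (simp add: source_events_def past_sources_def draw_law)
  also have "\<dots> \<le> (\<integral>\<^sup>+\<omega>. ennreal (M\<^sup>2 * (norm (delta i k \<omega>))\<^sup>2) \<partial>\<Omega>)"
    using stoch_grad_smooth[OF k] u_in k unfolding a_def M(2) by (intro nn_integral_mono) auto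
  also have "\<dots> = ennreal (M\<^sup>2 * msq (delta i k))"
    using square_integrableD(2)[OF sq] by (subst nn_integral_eq_integral) auto
  finally have le: "(\<integral>\<^sup>+\<omega>. ennreal ((norm (a \<omega> (?z \<omega>)))\<^sup>2) \<partial>\<Omega>) \<le> ennreal (M\<^sup>2 * msq (delta i k))" .
  have azm: "(\<lambda>\<omega>. a \<omega> (?z \<omega>)) \<in> borel_measurable \<Omega>"
    unfolding a_def using u_in k
    by (intro borel_measurable_diff stoch_grad_compose_measurable draw_measurable past_P[OF u_meas[OF _ order_refl]])
  have aint: "integrable \<Omega> (\<lambda>\<omega>. (norm (a \<omega> (?z \<omega>)))\<^sup>2)"
    using le azm by (intro integrableI_bounded) (auto intro: order.strict_trans1)
  have ale: "(LINT \<omega>|\<Omega>. (norm (a \<omega> (?z \<omega>)))\<^sup>2) \<le> M\<^sup>2 * msq (delta i k)"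
    using le nn_integral_eq_integral[OF aint] by (simp add: ennreal_le_iff)
  have pt: "(norm (diff_noise i k \<omega> (?z \<omega>)))\<^sup>2 \<le> 2 * (norm (a \<omega> (?z \<omega>)))\<^sup>2 + 2 * (M\<^sup>2 * (norm (delta i k \<omega>))\<^sup>2)"
    if w: "\<omega> \<in> space \<Omega>" for \<omega>
  proof -
    have "diff_noise i k \<omega> (?z \<omega>) = a \<omega> (?z \<omega>) - b \<omega>"
      by (simp add: diff_noise_def grad_noise_def a_def b_def)
    then have "(norm (diff_noise i k \<omega> (?z \<omega>)))\<^sup>2 \<le> 2 * (norm (a \<omega> (?z \<omega>)))\<^sup>2 + 2 * (norm (b \<omega>))\<^sup>2"
      using norm_diff_square_le by simp
    moreover have "(norm (b \<omega>))\<^sup>2 \<le> M\<^sup>2 * (norm (delta i k \<omega>))\<^sup>2"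
      unfolding b_def M(2) using local_grad_lipschitz[OF k u_in[OF k w] u_in[OF k w]] .
    ultimately show ?thesis by linarith
  qed
  have int: "integrable \<Omega> (\<lambda>\<omega>. 2 * (norm (a \<omega> (?z \<omega>)))\<^sup>2 + 2 * (M\<^sup>2 * (norm (delta i k \<omega>))\<^sup>2))"
    by (intro Bochner_Integration.integrable_add integrable_mult_right aint square_integrableD(2)[OF sq])
  have dm: "(\<lambda>\<omega>. diff_noise i k \<omega> (?z \<omega>)) \<in> borel_measurable \<Omega>"
    unfolding diff_noise_def by (intro borel_measurable_diff grad_noise_draw_measurable k)
  show dsq: "square_integrable \<Omega> (\<lambda>\<omega>. diff_noise i k \<omega> (?z \<omega>))"
    by (rule square_integrable_dominated[OF dm int pt])
  have "msq (\<lambda>\<omega>. diff_noise i k \<omega> (?z \<omega>)) \<le> (LINT \<omega>|\<Omega>. 2 * (norm (a \<omega> (?z \<omega>)))\<^sup>2 + 2 * (M\<^sup>2 * (norm (delta i k \<omega>))\<^sup>2))"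
    by (rule integral_mono[OF square_integrableD(2)[OF dsq] int pt])
  also have "\<dots> = 2 * (LINT \<omega>|\<Omega>. (norm (a \<omega> (?z \<omega>)))\<^sup>2) + 2 * (M\<^sup>2 * msq (delta i k))"
    using aint square_integrableD(2)[OF sq] by simp
  finally show "msq (\<lambda>\<omega>. diff_noise i k \<omega> (?z \<omega>)) \<le> 4 * M\<^sup>2 * msq (delta i k)" using ale by simp
qed

text \<open>The noise of one iteration over agents and batch entries, as an instance of
  \<open>second_moment_noise_sum\<close>. The set \<open>J\<close> without \<open>Coin l\<close>
  matters later: the sum is independent of the coin that decides whether it is used.\<close>

lemma noise_sum:
  fixes a :: real
  assumes Q: "finite Q" "Q \<subseteq> {..<K} \<times> UNIV"
    and H: "\<And>k. k < K \<Longrightarrow> (\<lambda>(\<omega>, x). H k \<omega> x) \<in> borel_measurable (src.F (past_sources l) \<Otimes>\<^sub>M sample_law pb k)"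
    and HS: "\<And>k \<omega> x. k < K \<Longrightarrow> \<omega> \<in> space \<Omega> \<Longrightarrow> x \<in> space (sample_law pb k) \<Longrightarrow> H k \<omega> x \<in> S"
    and mean: "\<And>k \<omega> v. k < K \<Longrightarrow> \<omega> \<in> space \<Omega> \<Longrightarrow> v \<in> S \<Longrightarrow> (LINT x|sample_law pb k. inner (H k \<omega> x) v) = 0"
    and sq: "\<And>k j. (k, j) \<in> Q \<Longrightarrow> square_integrable \<Omega> (\<lambda>\<omega>. H k \<omega> (draw r k l j \<omega>))"
    and U: "U \<in> borel_measurable (src.F (past_sources l))" "\<And>\<omega>. \<omega> \<in> space \<Omega> \<Longrightarrow> U \<omega> \<in> S" "square_integrable \<Omega> U"
  defines "Z \<equiv> \<lambda>\<omega>. U \<omega> + (\<Sum>(k, j)\<in>Q. a *\<^sub>R H k \<omega> (draw r k l j \<omega>))"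
  shows "\<exists>J. J \<subseteq> sources \<and> Coin l \<notin> J \<and> Z \<in> borel_measurable (src.F J)"
    and "square_integrable \<Omega> Z"
    and "msq Z = msq U + a\<^sup>2 * (\<Sum>(k, j)\<in>Q. msq (\<lambda>\<omega>. H k \<omega> (draw r k l j \<omega>)))"
proof -
  let ?D = "(\<lambda>(k, j). Draw k l j) ` Q" and ?I = "past_sources l"
  \<comment> \<open>Draws are spread over a datatype of sources and their laws depend on the agent;
    the three families are meaningful on \<open>Draw\<close> only, and \<open>?D\<close> contains
    nothing else.\<close>
  define z where "z s = (case s of Draw k i j \<Rightarrow> draw r k i j | _ \<Rightarrow> undefined)" for s
  define N where "N s = (case s of Draw k i j \<Rightarrow> sample_law pb k | _ \<Rightarrow> undefined)" for s
  define h where "h s \<omega> x = (case s of Draw k i j \<Rightarrow> a *\<^sub>R H k \<omega> x | _ \<Rightarrow> undefined)" for s \<omega> x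
  have inj: "inj_on (\<lambda>(k, j). Draw k l j) Q" by (auto simp: inj_on_def)
  have kK: "k < K" if "(k, j) \<in> Q" for k j using that Q by auto
  have DA: "?D \<subseteq> sources" using kK by auto
  have sqa: "square_integrable \<Omega> (\<lambda>\<omega>. a *\<^sub>R H k \<omega> (draw r k l j \<omega>))" if "(k, j) \<in> Q" for k j
    by (rule square_integrable_scaleR[OF sq[OF that]])
  have "(\<lambda>\<omega>. U \<omega> + (\<Sum>s\<in>?D. h s \<omega> (z s \<omega>))) \<in> borel_measurable (src.F (?I \<union> ?D)) \<and>
    msq (\<lambda>\<omega>. U \<omega> + (\<Sum>s\<in>?D. h s \<omega> (z s \<omega>))) = msq U + (\<Sum>s\<in>?D. msq (\<lambda>\<omega>. h s \<omega> (z s \<omega>)))"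
  proof (rule src.second_moment_noise_sum[OF _ DA _ past_sources_subset subS _ _ _ _ _ _ U, where N = N])
    show "finite ?D" using Q by simp
    show "?I \<inter> ?D = {}" by (auto simp: past_sources_def)
    fix s assume "s \<in> ?D"
    then obtain k j where s: "s = Draw k l j" "(k, j) \<in> Q" by auto
    note k = kK[OF s(2)]
    show "z s \<in> measurable \<Omega> (N s)" using draw_measurable[OF k] by (simp add: s z_def N_def)
    show "source_events pb r s = {z s -` B \<inter> space \<Omega> |B. B \<in> sets (N s)}" by (simp add: s z_def N_def source_events_def)
    show "(\<lambda>(\<omega>, x). h s \<omega> x) \<in> borel_measurable (src.F ?I \<Otimes>\<^sub>M N s)"
      using H[OF k] unfolding s h_def N_def case_prod_beta by simp
    show "h s \<omega> x \<in> S" if "\<omega> \<in> space \<Omega>" "x \<in> space (N s)" for \<omega> x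
      using HS[OF k that(1)] that(2) subspace_scale[OF subS] by (simp add: s h_def N_def)
    show "(LINT x|distr \<Omega> (N s) (z s). inner (h s \<omega> x) v) = 0" if "\<omega> \<in> space \<Omega>" "v \<in> S" for \<omega> v
      using mean[OF k that] by (simp add: s h_def N_def z_def draw_law[OF k])
    show "square_integrable \<Omega> (\<lambda>\<omega>. h s \<omega> (z s \<omega>))"
      using sqa[OF s(2)] by (simp add: s h_def z_def)
  qed
  moreover have "(\<lambda>\<omega>. U \<omega> + (\<Sum>s\<in>?D. h s \<omega> (z s \<omega>))) = Z"
    unfolding Z_def sum.reindex[OF inj] by (simp add: h_def z_def case_prod_beta fun_eq_iff)
  moreover have "(\<Sum>s\<in>?D. msq (\<lambda>\<omega>. h s \<omega> (z s \<omega>))) = a\<^sup>2 * (\<Sum>(k, j)\<in>Q. msq (\<lambda>\<omega>. H k \<omega> (draw r k l j \<omega>)))"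
    unfolding sum.reindex[OF inj] by (simp add: h_def z_def case_prod_beta power_mult_distrib sum_distrib_left)
  ultimately have *: "Z \<in> borel_measurable (src.F (?I \<union> ?D))"
    "msq Z = msq U + a\<^sup>2 * (\<Sum>(k, j)\<in>Q. msq (\<lambda>\<omega>. H k \<omega> (draw r k l j \<omega>)))" by auto
  show "\<exists>J. J \<subseteq> sources \<and> Coin l \<notin> J \<and> Z \<in> borel_measurable (src.F J)"
    using * DA past_sources_subset by (intro exI[of _ "?I \<union> ?D"]) (auto simp: past_sources_def)
  show "msq Z = msq U + a\<^sup>2 * (\<Sum>(k, j)\<in>Q. msq (\<lambda>\<omega>. H k \<omega> (draw r k l j \<omega>)))" by (rule *)
  show "square_integrable \<Omega> Z"
    unfolding Z_def using sqa by (intro square_integrable_add U(3) square_integrable_sum) auto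
qed

lemma prob_coin: "measure \<Omega> (coin r i -` {True} \<inter> space \<Omega>) = coin_prob c"
  "measure \<Omega> (coin r i -` {False} \<inter> space \<Omega>) = 1 - coin_prob c"
proof -
  have "measure \<Omega> (coin r i -` {b} \<inter> space \<Omega>) = pmf (bernoulli_pmf (coin_prob c)) b" for b
    using measure_distr[OF coin_measurable, of "{b}" i] by (simp add: coin_law measure_pmf_single)
  then show "measure \<Omega> (coin r i -` {True} \<inter> space \<Omega>) = coin_prob c"
    "measure \<Omega> (coin r i -` {False} \<inter> space \<Omega>) = 1 - coin_prob c"
    using coin_prob by simp_all
qed

text \<open>Both branches are generated by sources other than the coin, so their squared norms
  factor from its indicators, and exactly one indicator is 1.\<close>

lemma coin_mixture:
  fixes Z Z0 Z1 :: "'w \<Rightarrow> 'a \<times> 'b"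
  assumes Z1: "J1 \<subseteq> sources" "Coin i \<notin> J1" "Z1 \<in> borel_measurable (src.F J1)" "square_integrable \<Omega> Z1"
    and Z0: "J0 \<subseteq> sources" "Coin i \<notin> J0" "Z0 \<in> borel_measurable (src.F J0)" "square_integrable \<Omega> Z0"
    and Z: "Z \<in> borel_measurable \<Omega>" "\<And>\<omega>. \<omega> \<in> space \<Omega> \<Longrightarrow> Z \<omega> = (if coin r i \<omega> then Z1 \<omega> else Z0 \<omega>)"
  shows "square_integrable \<Omega> Z" and "msq Z = coin_prob c * msq Z1 + (1 - coin_prob c) * msq Z0"
proof -
  have part: "integrable \<Omega> (\<lambda>\<omega>. indicator {b} (coin r i \<omega>) * (norm (Y \<omega>))\<^sup>2)"
    "(LINT \<omega>|\<Omega>. indicator {b} (coin r i \<omega>) * (norm (Y \<omega>))\<^sup>2) = measure \<Omega> (coin r i -` {b} \<inter> space \<Omega>) * msq Y"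
    if "J \<subseteq> sources" "Coin i \<notin> J" "Y \<in> borel_measurable (src.F J)" "square_integrable \<Omega> Y" for J Y b
  proof -
    have "(\<lambda>\<omega>. (norm (Y \<omega>))\<^sup>2) \<in> borel_measurable (src.F J)"
      by (intro borel_measurable_power measurable_compose[OF that(3) borel_measurable_norm])
    note * = src.freeze_indicator[OF coin_measurable[of i], of "Coin i" J "{b}", OF _ _ that(2,1) _ this square_integrableD(2)[OF that(4)]]
    show "integrable \<Omega> (\<lambda>\<omega>. indicator {b} (coin r i \<omega>) * (norm (Y \<omega>))\<^sup>2)"
      "(LINT \<omega>|\<Omega>. indicator {b} (coin r i \<omega>) * (norm (Y \<omega>))\<^sup>2) = measure \<Omega> (coin r i -` {b} \<inter> space \<Omega>) * msq Y"
      using * by (auto simp: source_events_def)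
  qed
  have eq: "(norm (Z \<omega>))\<^sup>2 = indicator {True} (coin r i \<omega>) * (norm (Z1 \<omega>))\<^sup>2 + indicator {False} (coin r i \<omega>) * (norm (Z0 \<omega>))\<^sup>2"
    if "\<omega> \<in> space \<Omega>" for \<omega> using Z(2)[OF that] by (auto simp: indicator_def)
  have "integrable \<Omega> (\<lambda>\<omega>. (norm (Z \<omega>))\<^sup>2)"
    by (rule iffD2[OF Bochner_Integration.integrable_cong[OF refl eq]], assumption)
      (intro Bochner_Integration.integrable_add part(1)[OF Z1] part(1)[OF Z0])
  then show "square_integrable \<Omega> Z" using Z(1) by (simp add: square_integrable_def)
  have "msq Z = (LINT \<omega>|\<Omega>. indicator {True} (coin r i \<omega>) * (norm (Z1 \<omega>))\<^sup>2 + indicator {False} (coin r i \<omega>) * (norm (Z0 \<omega>))\<^sup>2)"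
    by (rule Bochner_Integration.integral_cong[OF refl eq], assumption)
  also have "\<dots> = coin_prob c * msq Z1 + (1 - coin_prob c) * msq Z0"
    using part[OF Z1, of True] part[OF Z0, of False] by (simp add: prob_coin)
  finally show "msq Z = coin_prob c * msq Z1 + (1 - coin_prob c) * msq Z0" .
qed

section \<open>Recursion of the estimation error\<close>

definition err :: "nat \<Rightarrow> nat \<Rightarrow> 'w \<Rightarrow> 'a \<times> 'b" where
  "err i k \<omega> = g i k \<omega> - local_grad k (u i k \<omega>)"

text \<open>A set of agents as parameter lets one recursion serve twice: a singleton gives the local
  error, all agents give the averaged error with its gain of \<open>1 / K\<close>.\<close>

definition mean_err :: "nat \<Rightarrow> nat set \<Rightarrow> 'w \<Rightarrow> 'a \<times> 'b" where
  "mean_err i Ks \<omega> = (1 / real (card Ks)) *\<^sub>R (\<Sum>k\<in>Ks. err i k \<omega>)"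

lemma err_zero:
  assumes "k < K" "\<omega> \<in> space \<Omega>"
  shows "err 0 k \<omega> = (\<Sum>j<init_batch c. (1 / real (init_batch c)) *\<^sub>R grad_noise 0 k \<omega> (draw r k 0 j \<omega>))"
  unfolding err_def g_zero[OF assms] minibatch_minus[OF batches(3)] grad_noise_def ..

lemma err_Suc:
  assumes "k < K" "\<omega> \<in> space \<Omega>"
  shows "err (Suc i) k \<omega> =
    (if coin r (Suc i) \<omega> then (\<Sum>j<big_batch c. (1 / real (big_batch c)) *\<^sub>R grad_noise (Suc i) k \<omega> (draw r k (Suc i) j \<omega>))
     else err i k \<omega> + (\<Sum>j<small_batch c. (1 / real (small_batch c)) *\<^sub>R diff_noise i k \<omega> (draw r k (Suc i) j \<omega>)))"
proof (cases "coin r (Suc i) \<omega>")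
  case True
  then show ?thesis
    unfolding err_def g_Suc[OF assms] by (simp add: minibatch_minus[OF batches(1)] grad_noise_def)
next
  case False
  let ?n = "small_batch c" and ?s = "\<lambda>j. draw r k (Suc i) j \<omega>"
  have "err (Suc i) k \<omega> = err i k \<omega> + ((minibatch ?n (stoch_grad k (u (Suc i) k \<omega>)) ?s - local_grad k (u (Suc i) k \<omega>))
     - (minibatch ?n (stoch_grad k (u i k \<omega>)) ?s - local_grad k (u i k \<omega>)))"
    using False unfolding err_def g_Suc[OF assms] by simp
  also have "(minibatch ?n (stoch_grad k (u (Suc i) k \<omega>)) ?s - local_grad k (u (Suc i) k \<omega>))
     - (minibatch ?n (stoch_grad k (u i k \<omega>)) ?s - local_grad k (u i k \<omega>))
     = (\<Sum>j<?n. (1 / real ?n) *\<^sub>R diff_noise i k \<omega> (?s j))"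
    unfolding minibatch_minus[OF batches(2)] diff_noise_def grad_noise_def
    by (simp add: sum_subtractf[symmetric] scaleR_diff_right)
  finally show ?thesis using False by simp
qed

lemma err_in: "k < K \<Longrightarrow> \<omega> \<in> space \<Omega> \<Longrightarrow> err i k \<omega> \<in> S"
  unfolding err_def by (intro subspace_diff subS g_in local_grad_in u_in)

lemma err_meas: "k < K \<Longrightarrow> i < l \<Longrightarrow> err i k \<in> borel_measurable (src.F (past_sources l))"
  unfolding err_def[abs_def] by (intro borel_measurable_diff g_meas local_grad_u_meas) auto


lemma double_average:
  fixes f :: "nat \<Rightarrow> nat \<Rightarrow> 'c::real_vector"
  shows "(1 / real m) *\<^sub>R (\<Sum>k\<in>Ks. \<Sum>j<n. (1 / real n) *\<^sub>R f k j)
    = (\<Sum>(k, j)\<in>Ks \<times> {..<n}. (1 / (real m * real n)) *\<^sub>R f k j)"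
  by (simp add: sum.cartesian_product[symmetric] scaleR_sum_right)

lemma mean_err_in: "Ks \<subseteq> {..<K} \<Longrightarrow> \<omega> \<in> space \<Omega> \<Longrightarrow> mean_err i Ks \<omega> \<in> S"
  unfolding mean_err_def by (intro subspace_scale subspace_sum subS err_in) auto

lemma mean_err_meas: "Ks \<subseteq> {..<K} \<Longrightarrow> i < l \<Longrightarrow> mean_err i Ks \<in> borel_measurable (src.F (past_sources l))"
  unfolding mean_err_def[abs_def] by (intro borel_measurable_scaleR borel_measurable_const borel_measurable_sum err_meas) auto

lemma sum_le_card: "(\<And>k j. k \<in> Ks \<Longrightarrow> f k j \<le> v) \<Longrightarrow> (\<Sum>(k, j)\<in>Ks \<times> {..<n}. f k j) \<le> real (card Ks) * real n * v"
  using sum_bounded_above[of "Ks \<times> {..<n}" "\<lambda>(k, j). f k j" v] by (auto simp: card_cartesian_product)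

lemma mean_err_zero:
  assumes Ks: "Ks \<subseteq> {..<K}" "Ks \<noteq> {}"
  shows "square_integrable \<Omega> (mean_err 0 Ks)"
    and "msq (mean_err 0 Ks) \<le> 2 * \<sigma>\<^sup>2 / (real (card Ks) * real (init_batch c))"
proof -
  let ?n = "real (card Ks)" and ?b = "real (init_batch c)"
  have fin: "finite Ks" using Ks(1) finite_subset by blast
  have n: "0 < ?n" "0 < ?b" using fin Ks(2) batches by (auto simp: card_gt_0_iff)
  let ?a = "1 / (?n * ?b)" and ?Q = "Ks \<times> {..<init_batch c}"
  let ?Z = "\<lambda>\<omega>. 0 + (\<Sum>(k, j)\<in>?Q. ?a *\<^sub>R grad_noise 0 k \<omega> (draw r k 0 j \<omega>))"
  have noise: "square_integrable \<Omega> (\<lambda>\<omega>. grad_noise 0 k \<omega> (draw r k 0 j \<omega>))"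
    "msq (\<lambda>\<omega>. grad_noise 0 k \<omega> (draw r k 0 j \<omega>)) \<le> 2 * \<sigma>\<^sup>2" if "k \<in> Ks" for k j
    using that Ks T by (auto intro!: grad_noise_variance)
  have Z: "square_integrable \<Omega> ?Z" "msq ?Z = msq (\<lambda>\<omega>. 0 :: 'a \<times> 'b) + ?a\<^sup>2 * (\<Sum>(k, j)\<in>?Q. msq (\<lambda>\<omega>. grad_noise 0 k \<omega> (draw r k 0 j \<omega>)))"
  proof -
    have Q: "finite ?Q" "?Q \<subseteq> {..<K} \<times> UNIV" using fin Ks(1) by auto
    have sq: "square_integrable \<Omega> (\<lambda>\<omega>. grad_noise 0 k \<omega> (draw r k 0 j \<omega>))" if "(k, j) \<in> ?Q" for k j
      using noise(1) that by auto
    note prems = grad_noise_measurable[OF _ order_refl] grad_noise_in grad_noise_mean(2) sq borel_measurable_const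
      subspace_0[OF subS] square_integrable_zero
    show "square_integrable \<Omega> ?Z" by (rule noise_sum(2)[OF Q]; (rule prems | assumption)+)
    show "msq ?Z = msq (\<lambda>\<omega>. 0 :: 'a \<times> 'b) + ?a\<^sup>2 * (\<Sum>(k, j)\<in>?Q. msq (\<lambda>\<omega>. grad_noise 0 k \<omega> (draw r k 0 j \<omega>)))"
      by (rule noise_sum(3)[OF Q]; (rule prems | assumption)+)
  qed
  have eq: "?Z \<omega> = mean_err 0 Ks \<omega>" if "\<omega> \<in> space \<Omega>" for \<omega>
  proof -
    have "mean_err 0 Ks \<omega> = (1 / ?n) *\<^sub>R (\<Sum>k\<in>Ks. \<Sum>j<init_batch c. (1 / ?b) *\<^sub>R grad_noise 0 k \<omega> (draw r k 0 j \<omega>))"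
      unfolding mean_err_def using Ks that by (intro arg_cong2[where f = scaleR] refl sum.cong err_zero) auto
    then show ?thesis by (simp add: double_average)
  qed
  show "square_integrable \<Omega> (mean_err 0 Ks)" by (rule square_integrable_cong[OF Z(1) eq])
  have "msq (mean_err 0 Ks) = msq ?Z" using eq by (intro Bochner_Integration.integral_cong refl) simp
  also have "\<dots> \<le> ?a\<^sup>2 * (?n * ?b * (2 * \<sigma>\<^sup>2))"
    unfolding Z(2) using noise(2) by (simp only: norm_zero) (simp add: mult_left_mono sum_le_card)
  also have "\<dots> = 2 * \<sigma>\<^sup>2 / (?n * ?b)" using n by (simp add: power2_eq_square)
  finally show "msq (mean_err 0 Ks) \<le> 2 * \<sigma>\<^sup>2 / (?n * ?b)" .
qed

text \<open>With the coin on, the new error is restart noise alone; with the coin off, it is the old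
  error plus difference noise. For the increment the old error appears, negated, only when the coin
  is on. In each of the four cases the noise is orthogonal to the old error and everything is
  independent of the coin, so variances add and the coin mixes them with weights \<open>p\<close>
  and \<open>1 - p\<close>.\<close>

lemma
  assumes Ks: "Ks \<subseteq> {..<K}" "Ks \<noteq> {}" and i: "Suc i < T"
    and e: "square_integrable \<Omega> (mean_err i Ks)"
    and dl: "\<And>k. k \<in> Ks \<Longrightarrow> square_integrable \<Omega> (delta i k)"
  defines "m \<equiv> real (card Ks)" and "p \<equiv> coin_prob c"
  defines "growth \<equiv> 4 * M\<^sup>2 / (m\<^sup>2 * real (small_batch c)) * (\<Sum>k\<in>Ks. msq (delta i k))"
    and "refresh \<equiv> 2 * \<sigma>\<^sup>2 / (m * real (big_batch c))"
  shows mean_err_Suc: "square_integrable \<Omega> (mean_err (Suc i) Ks)"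
    "msq (mean_err (Suc i) Ks) \<le> (1 - p) * (msq (mean_err i Ks) + growth) + p * refresh"
    and mean_err_increment:
    "msq (\<lambda>\<omega>. mean_err (Suc i) Ks \<omega> - mean_err i Ks \<omega>) \<le> (1 - p) * growth + p * (msq (mean_err i Ks) + refresh)"
proof -
  let ?B = "real (big_batch c)" and ?b = "real (small_batch c)"
  have fin: "finite Ks" using Ks(1) finite_subset by blast
  have n: "0 < m" "0 < ?B" "0 < ?b" using fin Ks(2) batches by (auto simp: card_gt_0_iff m_def)
  have p: "0 \<le> p" "p \<le> 1" using coin_prob by (auto simp: p_def)
  let ?Q1 = "Ks \<times> {..<big_batch c}" and ?Q0 = "Ks \<times> {..<small_batch c}"
  let ?a1 = "1 / (m * ?B)" and ?a0 = "1 / (m * ?b)"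
  let ?l = "Suc i"
  let ?s1 = "\<lambda>\<omega>. \<Sum>(k, j)\<in>?Q1. ?a1 *\<^sub>R grad_noise ?l k \<omega> (draw r k ?l j \<omega>)"
  let ?s0 = "\<lambda>\<omega>. \<Sum>(k, j)\<in>?Q0. ?a0 *\<^sub>R diff_noise i k \<omega> (draw r k ?l j \<omega>)"
  have noise1: "square_integrable \<Omega> (\<lambda>\<omega>. grad_noise ?l k \<omega> (draw r k ?l j \<omega>))"
    "msq (\<lambda>\<omega>. grad_noise ?l k \<omega> (draw r k ?l j \<omega>)) \<le> 2 * \<sigma>\<^sup>2" if "k \<in> Ks" for k j
    using that Ks i by (auto intro!: grad_noise_variance)
  have noise0: "square_integrable \<Omega> (\<lambda>\<omega>. diff_noise i k \<omega> (draw r k ?l j \<omega>))"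
    "msq (\<lambda>\<omega>. diff_noise i k \<omega> (draw r k ?l j \<omega>)) \<le> 4 * M\<^sup>2 * msq (delta i k)" if "k \<in> Ks" for k j
    using that Ks dl by (auto intro!: diff_noise_variance)
  have QK: "finite ?Q1" "?Q1 \<subseteq> {..<K} \<times> UNIV" "finite ?Q0" "?Q0 \<subseteq> {..<K} \<times> UNIV" using fin Ks(1) by auto
  have sq1: "square_integrable \<Omega> (\<lambda>\<omega>. grad_noise ?l k \<omega> (draw r k ?l j \<omega>))" if "(k, j) \<in> ?Q1" for k j
    using noise1(1) that by auto
  have sq0: "square_integrable \<Omega> (\<lambda>\<omega>. diff_noise i k \<omega> (draw r k ?l j \<omega>))" if "(k, j) \<in> ?Q0" for k j
    using noise0(1) that by auto
  have N1: "\<exists>J. J \<subseteq> sources \<and> Coin ?l \<notin> J \<and> (\<lambda>\<omega>. U \<omega> + ?s1 \<omega>) \<in> borel_measurable (src.F J)"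
    "square_integrable \<Omega> (\<lambda>\<omega>. U \<omega> + ?s1 \<omega>)"
    "msq (\<lambda>\<omega>. U \<omega> + ?s1 \<omega>) = msq U + ?a1\<^sup>2 * (\<Sum>(k, j)\<in>?Q1. msq (\<lambda>\<omega>. grad_noise ?l k \<omega> (draw r k ?l j \<omega>)))"
    if U: "U \<in> borel_measurable (src.F (past_sources ?l))" "\<And>\<omega>. \<omega> \<in> space \<Omega> \<Longrightarrow> U \<omega> \<in> S" "square_integrable \<Omega> U" for U
  proof -
    note prems = grad_noise_measurable[OF _ order_refl] grad_noise_in grad_noise_mean(2) sq1 U
    show "\<exists>J. J \<subseteq> sources \<and> Coin ?l \<notin> J \<and> (\<lambda>\<omega>. U \<omega> + ?s1 \<omega>) \<in> borel_measurable (src.F J)"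
      by (rule noise_sum(1)[OF QK(1,2)]; (rule prems | assumption)+)
    show "square_integrable \<Omega> (\<lambda>\<omega>. U \<omega> + ?s1 \<omega>)"
      by (rule noise_sum(2)[OF QK(1,2)]; (rule prems | assumption)+)
    show "msq (\<lambda>\<omega>. U \<omega> + ?s1 \<omega>) = msq U + ?a1\<^sup>2 * (\<Sum>(k, j)\<in>?Q1. msq (\<lambda>\<omega>. grad_noise ?l k \<omega> (draw r k ?l j \<omega>)))"
      by (rule noise_sum(3)[OF QK(1,2)]; (rule prems | assumption)+)
  qed
  have N0: "\<exists>J. J \<subseteq> sources \<and> Coin ?l \<notin> J \<and> (\<lambda>\<omega>. U \<omega> + ?s0 \<omega>) \<in> borel_measurable (src.F J)"
    "square_integrable \<Omega> (\<lambda>\<omega>. U \<omega> + ?s0 \<omega>)"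
    "msq (\<lambda>\<omega>. U \<omega> + ?s0 \<omega>) = msq U + ?a0\<^sup>2 * (\<Sum>(k, j)\<in>?Q0. msq (\<lambda>\<omega>. diff_noise i k \<omega> (draw r k ?l j \<omega>)))"
    if U: "U \<in> borel_measurable (src.F (past_sources ?l))" "\<And>\<omega>. \<omega> \<in> space \<Omega> \<Longrightarrow> U \<omega> \<in> S" "square_integrable \<Omega> U" for U
  proof -
    note prems = diff_noise_measurable diff_noise_in diff_noise_mean sq0 U
    show "\<exists>J. J \<subseteq> sources \<and> Coin ?l \<notin> J \<and> (\<lambda>\<omega>. U \<omega> + ?s0 \<omega>) \<in> borel_measurable (src.F J)"
      by (rule noise_sum(1)[OF QK(3,4)]; (rule prems | assumption)+)
    show "square_integrable \<Omega> (\<lambda>\<omega>. U \<omega> + ?s0 \<omega>)"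
      by (rule noise_sum(2)[OF QK(3,4)]; (rule prems | assumption)+)
    show "msq (\<lambda>\<omega>. U \<omega> + ?s0 \<omega>) = msq U + ?a0\<^sup>2 * (\<Sum>(k, j)\<in>?Q0. msq (\<lambda>\<omega>. diff_noise i k \<omega> (draw r k ?l j \<omega>)))"
      by (rule noise_sum(3)[OF QK(3,4)]; (rule prems | assumption)+)
  qed
  have em: "mean_err i Ks \<in> borel_measurable (src.F (past_sources ?l))" using mean_err_meas[OF Ks(1)] by simp
  have eS: "mean_err i Ks \<omega> \<in> S" if "\<omega> \<in> space \<Omega>" for \<omega> using that by (rule mean_err_in[OF Ks(1)])
  have nm: "(\<lambda>\<omega>. (- 1) *\<^sub>R mean_err i Ks \<omega>) \<in> borel_measurable (src.F (past_sources ?l))"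
    by (intro borel_measurable_scaleR borel_measurable_const em)
  have nS: "(- 1) *\<^sub>R mean_err i Ks \<omega> \<in> S" if "\<omega> \<in> space \<Omega>" for \<omega>
    using that by (intro subspace_scale[OF subS] eS)
  have ne: "square_integrable \<Omega> (\<lambda>\<omega>. (- 1) *\<^sub>R mean_err i Ks \<omega>)" by (rule square_integrable_scaleR[OF e])
  have zS: "0 \<in> S" using subspace_0[OF subS] .
  \<comment> \<open>\<open>A1\<close> and \<open>A0\<close> are the two branches of the new error,
    \<open>B1\<close> and \<open>B0\<close> those of the increment. The zero summands give them the
    common shape of \<open>noise_sum\<close>.\<close>
  have A1: "\<exists>J. J \<subseteq> sources \<and> Coin ?l \<notin> J \<and> (\<lambda>\<omega>. 0 + ?s1 \<omega>) \<in> borel_measurable (src.F J)"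
    "square_integrable \<Omega> (\<lambda>\<omega>. 0 + ?s1 \<omega>)"
    "msq (\<lambda>\<omega>. 0 + ?s1 \<omega>) = msq (\<lambda>\<omega>. 0 :: 'a \<times> 'b) + ?a1\<^sup>2 * (\<Sum>(k, j)\<in>?Q1. msq (\<lambda>\<omega>. grad_noise ?l k \<omega> (draw r k ?l j \<omega>)))"
    by (rule N1; rule borel_measurable_const zS square_integrable_zero)+
  have B0: "\<exists>J. J \<subseteq> sources \<and> Coin ?l \<notin> J \<and> (\<lambda>\<omega>. 0 + ?s0 \<omega>) \<in> borel_measurable (src.F J)"
    "square_integrable \<Omega> (\<lambda>\<omega>. 0 + ?s0 \<omega>)"
    "msq (\<lambda>\<omega>. 0 + ?s0 \<omega>) = msq (\<lambda>\<omega>. 0 :: 'a \<times> 'b) + ?a0\<^sup>2 * (\<Sum>(k, j)\<in>?Q0. msq (\<lambda>\<omega>. diff_noise i k \<omega> (draw r k ?l j \<omega>)))"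
    by (rule N0; rule borel_measurable_const zS square_integrable_zero)+
  have A0: "\<exists>J. J \<subseteq> sources \<and> Coin ?l \<notin> J \<and> (\<lambda>\<omega>. mean_err i Ks \<omega> + ?s0 \<omega>) \<in> borel_measurable (src.F J)"
    "square_integrable \<Omega> (\<lambda>\<omega>. mean_err i Ks \<omega> + ?s0 \<omega>)"
    "msq (\<lambda>\<omega>. mean_err i Ks \<omega> + ?s0 \<omega>) = msq (mean_err i Ks) + ?a0\<^sup>2 * (\<Sum>(k, j)\<in>?Q0. msq (\<lambda>\<omega>. diff_noise i k \<omega> (draw r k ?l j \<omega>)))"
    by (rule N0; (rule em e eS; assumption?))+
  have B1: "\<exists>J. J \<subseteq> sources \<and> Coin ?l \<notin> J \<and> (\<lambda>\<omega>. (- 1) *\<^sub>R mean_err i Ks \<omega> + ?s1 \<omega>) \<in> borel_measurable (src.F J)"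
    "square_integrable \<Omega> (\<lambda>\<omega>. (- 1) *\<^sub>R mean_err i Ks \<omega> + ?s1 \<omega>)"
    "msq (\<lambda>\<omega>. (- 1) *\<^sub>R mean_err i Ks \<omega> + ?s1 \<omega>) = msq (\<lambda>\<omega>. (- 1) *\<^sub>R mean_err i Ks \<omega>)
        + ?a1\<^sup>2 * (\<Sum>(k, j)\<in>?Q1. msq (\<lambda>\<omega>. grad_noise ?l k \<omega> (draw r k ?l j \<omega>)))"
    by (rule N1; (rule nm ne nS; assumption?))+
  have b1: "?a1\<^sup>2 * (\<Sum>(k, j)\<in>?Q1. msq (\<lambda>\<omega>. grad_noise ?l k \<omega> (draw r k ?l j \<omega>))) \<le> refresh"
  proof -
    have "?a1\<^sup>2 * (\<Sum>(k, j)\<in>?Q1. msq (\<lambda>\<omega>. grad_noise ?l k \<omega> (draw r k ?l j \<omega>))) \<le> ?a1\<^sup>2 * (m * ?B * (2 * \<sigma>\<^sup>2))"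
      unfolding m_def using noise1(2) by (intro mult_left_mono sum_le_card) auto
    also have "\<dots> = refresh" using n by (simp add: power2_eq_square refresh_def)
    finally show ?thesis .
  qed
  have b0: "?a0\<^sup>2 * (\<Sum>(k, j)\<in>?Q0. msq (\<lambda>\<omega>. diff_noise i k \<omega> (draw r k ?l j \<omega>))) \<le> growth"
  proof -
    have "(\<Sum>(k, j)\<in>?Q0. msq (\<lambda>\<omega>. diff_noise i k \<omega> (draw r k ?l j \<omega>))) \<le> (\<Sum>(k, j)\<in>?Q0. 4 * M\<^sup>2 * msq (delta i k))"
      using noise0(2) by (intro sum_mono) auto
    also have "\<dots> = 4 * M\<^sup>2 * ?b * (\<Sum>k\<in>Ks. msq (delta i k))"
      by (simp add: sum.cartesian_product[symmetric] sum_distrib_left ac_simps)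
    finally have "?a0\<^sup>2 * (\<Sum>(k, j)\<in>?Q0. msq (\<lambda>\<omega>. diff_noise i k \<omega> (draw r k ?l j \<omega>))) \<le> ?a0\<^sup>2 * (4 * M\<^sup>2 * ?b * (\<Sum>k\<in>Ks. msq (delta i k)))"
      by (rule mult_left_mono) simp
    also have "\<dots> = growth" using n by (simp add: power2_eq_square growth_def)
    finally show ?thesis .
  qed
  have coinT: "mean_err ?l Ks \<omega> = ?s1 \<omega>" if "\<omega> \<in> space \<Omega>" "coin r ?l \<omega>" for \<omega>
  proof -
    have "mean_err ?l Ks \<omega> = (1 / m) *\<^sub>R (\<Sum>k\<in>Ks. \<Sum>j<big_batch c. (1 / ?B) *\<^sub>R grad_noise ?l k \<omega> (draw r k ?l j \<omega>))"
      unfolding mean_err_def m_def using Ks that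
      by (intro arg_cong2[where f = scaleR] refl sum.cong) (auto simp: err_Suc)
    then show ?thesis unfolding m_def by (simp only: double_average)
  qed
  have coinF: "mean_err ?l Ks \<omega> = mean_err i Ks \<omega> + ?s0 \<omega>" if "\<omega> \<in> space \<Omega>" "\<not> coin r ?l \<omega>" for \<omega>
  proof -
    have "mean_err ?l Ks \<omega> = (1 / m) *\<^sub>R (\<Sum>k\<in>Ks. err i k \<omega> + (\<Sum>j<small_batch c. (1 / ?b) *\<^sub>R diff_noise i k \<omega> (draw r k ?l j \<omega>)))"
      unfolding mean_err_def m_def using Ks that
      by (intro arg_cong2[where f = scaleR] refl sum.cong) (auto simp: err_Suc)
    also have "\<dots> = mean_err i Ks \<omega> + (1 / m) *\<^sub>R (\<Sum>k\<in>Ks. \<Sum>j<small_batch c. (1 / ?b) *\<^sub>R diff_noise i k \<omega> (draw r k ?l j \<omega>))"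
      by (simp only: sum.distrib scaleR_add_right mean_err_def m_def)
    finally show ?thesis unfolding m_def by (simp only: double_average)
  qed
  obtain J1 where J1: "J1 \<subseteq> sources" "Coin ?l \<notin> J1" "(\<lambda>\<omega>. 0 + ?s1 \<omega>) \<in> borel_measurable (src.F J1)" using A1(1) by blast
  obtain J0 where J0: "J0 \<subseteq> sources" "Coin ?l \<notin> J0" "(\<lambda>\<omega>. mean_err i Ks \<omega> + ?s0 \<omega>) \<in> borel_measurable (src.F J0)" using A0(1) by blast
  obtain I1 where I1: "I1 \<subseteq> sources" "Coin ?l \<notin> I1" "(\<lambda>\<omega>. (- 1) *\<^sub>R mean_err i Ks \<omega> + ?s1 \<omega>) \<in> borel_measurable (src.F I1)" using B1(1) by blast
  obtain I0 where I0: "I0 \<subseteq> sources" "Coin ?l \<notin> I0" "(\<lambda>\<omega>. 0 + ?s0 \<omega>) \<in> borel_measurable (src.F I0)" using B0(1) by blast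
  have m1: "mean_err ?l Ks \<in> borel_measurable \<Omega>" by (rule past_P[OF mean_err_meas[OF Ks(1) lessI]])
  have m2: "(\<lambda>\<omega>. mean_err ?l Ks \<omega> - mean_err i Ks \<omega>) \<in> borel_measurable \<Omega>"
    by (intro borel_measurable_diff m1 past_P[OF mean_err_meas[OF Ks(1) lessI]])
  note X = coin_mixture[OF J1 A1(2) J0 A0(2) m1]
  have X': "square_integrable \<Omega> (mean_err ?l Ks)"
    "msq (mean_err ?l Ks) = p * msq (\<lambda>\<omega>. 0 + ?s1 \<omega>) + (1 - p) * msq (\<lambda>\<omega>. mean_err i Ks \<omega> + ?s0 \<omega>)"
    unfolding p_def by (rule X; simp add: coinT coinF)+
  show "square_integrable \<Omega> (mean_err ?l Ks)" by (rule X')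
  have v1: "msq (\<lambda>\<omega>. 0 + ?s1 \<omega>) \<le> refresh" using A1(3) b1 by simp
  have v0: "msq (\<lambda>\<omega>. mean_err i Ks \<omega> + ?s0 \<omega>) \<le> msq (mean_err i Ks) + growth" using A0(3) b0 by simp
  show "msq (mean_err ?l Ks) \<le> (1 - p) * (msq (mean_err i Ks) + growth) + p * refresh"
    using mult_left_mono[OF v1 p(1)] mult_left_mono[OF v0, of "1 - p"] p unfolding X'(2) by linarith
  note Y = coin_mixture[OF I1 B1(2) I0 B0(2) m2]
  have Y': "msq (\<lambda>\<omega>. mean_err ?l Ks \<omega> - mean_err i Ks \<omega>)
      = p * msq (\<lambda>\<omega>. (- 1) *\<^sub>R mean_err i Ks \<omega> + ?s1 \<omega>) + (1 - p) * msq (\<lambda>\<omega>. 0 + ?s0 \<omega>)"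
    unfolding p_def by (rule Y(2)) (simp add: coinT coinF)
  have w1: "msq (\<lambda>\<omega>. (- 1) *\<^sub>R mean_err i Ks \<omega> + ?s1 \<omega>) \<le> msq (mean_err i Ks) + refresh" using B1(3) b1 by simp
  have w0: "msq (\<lambda>\<omega>. 0 + ?s0 \<omega>) \<le> growth" using B0(3) b0 by simp
  show "msq (\<lambda>\<omega>. mean_err ?l Ks \<omega> - mean_err i Ks \<omega>) \<le> (1 - p) * growth + p * (msq (mean_err i Ks) + refresh)"
    using mult_left_mono[OF w1 p(1)] mult_left_mono[OF w0, of "1 - p"] p unfolding Y' by linarith
qed

end

section \<open>Mean-square recursions\<close>

text \<open>Centring is an orthogonal projection: the difference of the two sides is
  \<open>n\<close> times the squared centroid.\<close>

lemma block_inner_centred_le: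
  fixes v :: "nat \<Rightarrow> 'a::real_inner"
  assumes "0 < n"
  shows "(\<Sum>k<n. (norm (v k - centroid n v))\<^sup>2) \<le> (\<Sum>k<n. (norm (v k))\<^sup>2)"
proof -
  let ?c = "centroid n v"
  have "(\<Sum>k<n. (norm (v k - ?c))\<^sup>2) = (\<Sum>k<n. (norm (v k))\<^sup>2 - inner (v k) ?c - inner ?c (v k - ?c))"
    unfolding power2_norm_eq_inner by (intro sum.cong refl) (simp add: inner_diff_left inner_diff_right inner_commute)
  also have "\<dots> = (\<Sum>k<n. (norm (v k))\<^sup>2) - (\<Sum>k<n. inner (v k) ?c) - (\<Sum>k<n. inner ?c (v k - ?c))"
    by (simp only: sum_subtractf)
  also have "\<dots> = (\<Sum>k<n. (norm (v k))\<^sup>2) - inner (\<Sum>k<n. v k) ?c - inner ?c (\<Sum>k<n. v k - ?c)"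
    by (simp only: inner_sum_left inner_sum_right)
  also have "\<dots> = (\<Sum>k<n. (norm (v k))\<^sup>2) - real n * inner ?c ?c"
    using assms centroid_centred[OF assms, of v] by (simp add: centroid_def)
  also have "\<dots> \<le> (\<Sum>k<n. (norm (v k))\<^sup>2)" by simp
  finally show ?thesis .
qed

lemma block_mult_centring:
  assumes "k < n"
  shows "block_mult n (1\<^sub>m n - avg_mat n) v k = v k - centroid n v"
proof -
  have "block_mult n (avg_mat n) v k = centroid n v"
    using assms by (simp add: block_mult_def avg_mat_def centroid_def scaleR_sum_right divide_inverse)
  then show ?thesis
    using assms by (simp add: block_mult_minus block_mult_one avg_mat_def)
qed

section \<open>Disagreement and merit along the random run\<close>

locale extra_run_steps = extra_run pb L \<nu> W V c r \<sigma> T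
  for pb :: "('a::{real_inner,second_countable_topology}, 'b::{real_inner,second_countable_topology}, 'z) minimax"
    and L \<nu> W V c and r :: "('w, 'a, 'b, 'z) dama_run" and \<sigma> T +
  assumes steps: "0 < step_x c" "96 * (M / \<nu>)\<^sup>2 * step_x c \<le> step_y c" "6 * M * step_y c \<le> 1"
begin

abbreviation "mx \<equiv> step_x c"
abbreviation "my \<equiv> step_y c"
abbreviation "gap \<equiv> 1 - second_eig W"

lemma my_pos: "0 < my" and mx_le_my: "96 * mx \<le> my"
proof -
  have "1 \<le> M / \<nu>" using M nu by simp
  then have "1 \<le> (M / \<nu>)\<^sup>2" by simp
  then have "1 * (96 * mx) \<le> (M / \<nu>)\<^sup>2 * (96 * mx)" using steps by (intro mult_right_mono) auto
  then show "96 * mx \<le> my" using steps(2) by (simp add: ac_simps)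
  then show "0 < my" using steps(1) by linarith
qed

lemma gap_pos: "0 < gap" "gap \<le> 1" using mixing_mat_gap[OF W K2] by auto

definition uc :: "nat \<Rightarrow> 'w \<Rightarrow> 'a \<times> 'b" where "uc i \<omega> = centroid K (\<lambda>k. u i k \<omega>)"
definition gc :: "nat \<Rightarrow> 'w \<Rightarrow> 'a \<times> 'b" where "gc i \<omega> = centroid K (\<lambda>k. g i k \<omega>)"
definition dis :: "nat \<Rightarrow> nat \<Rightarrow> 'w \<Rightarrow> 'a \<times> 'b" where "dis i k \<omega> = u i k \<omega> - uc i \<omega>"
definition sdual :: "nat \<Rightarrow> nat \<Rightarrow> 'w \<Rightarrow> 'a \<times> 'b" where
  "sdual i k \<omega> = dual i k \<omega> + (scal (g i k \<omega>) - scal (gc i \<omega>))"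
definition drift :: "nat \<Rightarrow> nat \<Rightarrow> 'w \<Rightarrow> 'a \<times> 'b" where
  "drift i k \<omega> = (scal (g (Suc i) k \<omega>) - scal (gc (Suc i) \<omega>)) - (scal (g i k \<omega>) - scal (gc i \<omega>))"
definition pot :: "nat \<Rightarrow> 'w \<Rightarrow> real" where
  "pot i \<omega> = extra_lyapunov K W V (\<lambda>k. dis i k \<omega>) (\<lambda>k. sdual i k \<omega>)"

lemma scal_linear: "scal (a + b) = scal a + scal b" "scal (a - b) = scal a - scal b" "scal (t *\<^sub>R a) = t *\<^sub>R scal a"
  by (simp_all add: scal_def prod_eq_iff scaleR_add_right scaleR_diff_right)

lemma scal_centroid: "centroid n (\<lambda>k. scal (v k)) = scal (centroid n v)"
proof -
  have "scal (sum v F) = (\<Sum>k\<in>F. scal (v k))" for F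
    by (induction F rule: infinite_finite_induct) (simp_all add: scal_linear, simp_all add: scal_def zero_prod_def)
  then show ?thesis by (simp add: centroid_def scal_linear)
qed

lemma norm_scal: "(norm (scal v))\<^sup>2 = mx\<^sup>2 * (norm (fst v))\<^sup>2 + my\<^sup>2 * (norm (snd v))\<^sup>2"
  by (simp add: scal_def norm_prod_def power_mult_distrib)

lemma norm_scal_le: "(norm (scal v))\<^sup>2 \<le> my\<^sup>2 * (norm v)\<^sup>2"
proof -
  have "mx\<^sup>2 \<le> my\<^sup>2" using mx_le_my steps(1) by (intro power_mono) auto
  then show ?thesis unfolding norm_scal by (simp add: norm_prod_def distrib_left mult_right_mono)
qed

text \<open>The deterministic analysis holds for each fixed outcome; linearity of
  \<open>scal\<close> reconciles the centroid of the scaled estimates with the scaled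
  centroid.\<close>

lemma path_facts:
  assumes "\<omega> \<in> space \<Omega>"
  shows "uc (Suc i) \<omega> = uc i \<omega> - scal (gc i \<omega>)"
    and "k < K \<Longrightarrow> dis (Suc i) k \<omega> = block_mult K W (\<lambda>k. dis i k \<omega>) k - sdual i k \<omega>"
    and "k < K \<Longrightarrow> sdual (Suc i) k \<omega> = (block_mult K W (\<lambda>k. sdual i k \<omega>) k
        + (block_mult K W (\<lambda>k. dis i k \<omega>) k - block_mult K W (block_mult K W (\<lambda>k. dis i k \<omega>)) k)) + drift i k \<omega>"
    and "(\<Sum>k<K. (norm (dis 0 k \<omega>))\<^sup>2) = 0"
    and "pot 0 \<omega> = (\<Sum>k<K. (norm (scal (g 0 k \<omega>) - scal (gc 0 \<omega>)))\<^sup>2)"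
    and "(\<Sum>k<K. (norm (dis (Suc i) k \<omega>))\<^sup>2) \<le> 2 / gap * pot i \<omega>"
    and "pot (Suc i) \<omega> \<le> (1 - gap / 2) * pot i \<omega> + 3 / gap * (\<Sum>k<K. (norm (drift i k \<omega>))\<^sup>2)"
proof -
  interpret R: extra_recursion K W V "\<lambda>i k. u i k \<omega>" "\<lambda>i k. d i k \<omega>" "\<lambda>i k. scal (g i k \<omega>)"
    by (rule recursion[OF assms])
  have e1: "R.dis i = (\<lambda>k. dis i k \<omega>)" for i by (simp add: R.dis_def dis_def uc_def fun_eq_iff)
  have e2: "R.shifted_dual i = (\<lambda>k. sdual i k \<omega>)" for i
    by (simp add: R.shifted_dual_def sdual_def dual_def scal_centroid gc_def fun_eq_iff)
  have e3: "R.drift i = (\<lambda>k. drift i k \<omega>)" for i by (simp add: R.drift_def drift_def scal_centroid gc_def fun_eq_iff)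
  have e4: "R.potential i = pot i \<omega>" for i by (simp add: R.potential_def pot_def e1 e2)
  have e5: "R.disagreement i = (\<Sum>k<K. (norm (dis i k \<omega>))\<^sup>2)" for i
    by (simp add: R.disagreement_def e1 block_inner_self)
  show "uc (Suc i) \<omega> = uc i \<omega> - scal (gc i \<omega>)"
    using R.centroid_step[of i] by (simp add: uc_def gc_def scal_centroid)
  show "k < K \<Longrightarrow> dis (Suc i) k \<omega> = block_mult K W (\<lambda>k. dis i k \<omega>) k - sdual i k \<omega>"
    using R.dis_step[of k i] by (simp add: e1 e2)
  show "k < K \<Longrightarrow> sdual (Suc i) k \<omega> = (block_mult K W (\<lambda>k. sdual i k \<omega>) k
        + (block_mult K W (\<lambda>k. dis i k \<omega>) k - block_mult K W (block_mult K W (\<lambda>k. dis i k \<omega>)) k)) + drift i k \<omega>"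
    using R.shifted_dual_step[of k i] by (simp add: e1 e2 e3)
  show "(\<Sum>k<K. (norm (dis 0 k \<omega>))\<^sup>2) = 0" using R.disagreement_zero by (simp add: e5)
  show "pot 0 \<omega> = (\<Sum>k<K. (norm (scal (g 0 k \<omega>) - scal (gc 0 \<omega>)))\<^sup>2)"
    using R.potential_zero by (simp add: e4 scal_centroid gc_def)
  show "(\<Sum>k<K. (norm (dis (Suc i) k \<omega>))\<^sup>2) \<le> 2 / gap * pot i \<omega>"
    using R.disagreement_step[of i] by (simp add: e4 e5)
  show "pot (Suc i) \<omega> \<le> (1 - gap / 2) * pot i \<omega> + 3 / gap * (\<Sum>k<K. (norm (drift i k \<omega>))\<^sup>2)"
    using R.potential_step[of i] by (simp add: e3 e4 block_inner_self)
qed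

lemma uc_in: "\<omega> \<in> space \<Omega> \<Longrightarrow> uc i \<omega> \<in> S"
  unfolding uc_def by (intro centroid_in_subspace subS u_in)

lemma gc_in: "\<omega> \<in> space \<Omega> \<Longrightarrow> gc i \<omega> \<in> S"
  unfolding gc_def by (intro centroid_in_subspace subS g_in)

lemma u_P: "k < K \<Longrightarrow> u i k \<in> borel_measurable \<Omega>"
  and g_P: "k < K \<Longrightarrow> g i k \<in> borel_measurable \<Omega>"
  and dual_P: "k < K \<Longrightarrow> dual i k \<in> borel_measurable \<Omega>"
  by (rule past_P[OF u_meas[OF _ order_refl]] past_P[OF g_meas[OF _ lessI]] past_P[OF dual_meas[OF _ order_refl]]; assumption)+

lemma uc_P: "uc i \<in> borel_measurable \<Omega>"
  unfolding uc_def[abs_def] centroid_def by (intro borel_measurable_scaleR borel_measurable_const borel_measurable_sum u_P) auto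

lemma gc_P: "gc i \<in> borel_measurable \<Omega>"
  unfolding gc_def[abs_def] centroid_def by (intro borel_measurable_scaleR borel_measurable_const borel_measurable_sum g_P) auto

lemma risk_grad_P: "(\<lambda>\<omega>. risk_grad (uc i \<omega>)) \<in> borel_measurable \<Omega>"
  using uc_in by (intro measurable_compose[OF measurable_into_S risk_grad_measurable] uc_P)

lemma sdual_P: "k < K \<Longrightarrow> sdual i k \<in> borel_measurable \<Omega>"
  unfolding sdual_def[abs_def] by (intro borel_measurable_add borel_measurable_diff scal_measurable dual_P g_P gc_P)

definition gerr :: "nat \<Rightarrow> 'w \<Rightarrow> real" where "gerr i \<omega> = (norm (gc i \<omega> - risk_grad (uc i \<omega>)))\<^sup>2"

lemma mean_err_all: "mean_err i {..<K} \<omega> = gc i \<omega> - centroid K (\<lambda>k. local_grad k (u i k \<omega>))"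
  by (simp add: mean_err_def err_def gc_def centroid_def sum_subtractf scaleR_diff_right divide_inverse)

text \<open>Two sources of error: sampling, averaged over the agents, and the evaluation of local
  gradients away from the centroid.\<close>

lemma gerr_le:
  assumes "\<omega> \<in> space \<Omega>"
  shows "gerr i \<omega> \<le> 2 * (norm (mean_err i {..<K} \<omega>))\<^sup>2 + 2 * M\<^sup>2 * ((\<Sum>k<K. (norm (dis i k \<omega>))\<^sup>2) / real K)"
proof -
  have "gerr i \<omega> = (norm (mean_err i {..<K} \<omega> + (centroid K (\<lambda>k. local_grad k (u i k \<omega>)) - risk_grad (uc i \<omega>))))\<^sup>2"
    by (simp add: gerr_def mean_err_all)
  also have "\<dots> \<le> 2 * (norm (mean_err i {..<K} \<omega>))\<^sup>2 + 2 * (norm (centroid K (\<lambda>k. local_grad k (u i k \<omega>)) - risk_grad (uc i \<omega>)))\<^sup>2"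
    by (rule norm_add_square_le)
  finally show ?thesis
    using centroid_local_grad_error[of "\<lambda>k. u i k \<omega>" "uc i \<omega>"] u_in uc_in assms by (simp add: dis_def)
qed

definition progress :: "nat \<Rightarrow> 'w \<Rightarrow> real" where
  "progress i \<omega> = mx / 2 * (norm (fst (risk_grad (uc i \<omega>))))\<^sup>2 + my / 8 * (norm (snd (risk_grad (uc i \<omega>))))\<^sup>2
    + mx / 16 * (norm (fst (gc i \<omega>)))\<^sup>2 + my / 8 * (norm (snd (gc i \<omega>)))\<^sup>2"

lemma progress_step:
  assumes w: "\<omega> \<in> space \<Omega>"
  shows "merit (uc (Suc i) \<omega>) + progress i \<omega> \<le> merit (uc i \<omega>) + my * gerr i \<omega>"
proof -
  obtain x y where xy: "uc i \<omega> = (x, y)" by fastforce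
  obtain a b where ab: "gc i \<omega> = (a, b)" by fastforce
  have mem: "x \<in> X" "y \<in> Y" "a \<in> X" "b \<in> Y" using uc_in[OF w, of i] gc_in[OF w, of i] by (simp_all add: xy ab)
  have "uc (Suc i) \<omega> = (x - mx *\<^sub>R a, y + my *\<^sub>R b)"
    using path_facts(1)[OF w, of i] by (simp add: xy ab scal_def)
  then show ?thesis
    using merit_step[OF mem steps]
    by (simp add: progress_def gerr_def xy ab risk_grad_def norm_prod_def)
qed

lemma progress_nonneg: "0 \<le> progress i \<omega>"
  using steps(1) my_pos by (simp add: progress_def)

text \<open>The merit steps telescope. The merit never falls below \<open>primal_opt pb\<close>, and
  initially exceeds it by the primal gap plus half the dual gap. The inequality is pathwise, so it
  can prove integrability and not merely use it.\<close>

lemma progress_sum: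
  assumes w: "\<omega> \<in> space \<Omega>"
  shows "(\<Sum>i<n. progress i \<omega>) \<le> (primal_gap pb r \<omega> + dual_gap pb r \<omega> / 2) + my * (\<Sum>i<n. gerr i \<omega>)"
proof -
  have "merit (uc n \<omega>) + (\<Sum>i<n. progress i \<omega>) \<le> merit (uc 0 \<omega>) + my * (\<Sum>i<n. gerr i \<omega>)" for n
  proof (induction n)
    case (Suc n)
    then show ?case using progress_step[OF w, of n] by (simp add: distrib_left)
  qed simp
  moreover have "primal_opt pb \<le> merit (uc n \<omega>)" by (rule merit_ge[OF uc_in[OF w]])
  moreover have "uc 0 \<omega> = (xc pb r 0 \<omega>, yc pb r 0 \<omega>)"
    by (simp add: uc_def xc_def yc_def u_def centroid_def prod_eq_iff fst_sum snd_sum)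
  ultimately show ?thesis
    by (simp add: primal_gap_def dual_gap_def merit_def) (smt (verit))
qed

lemma progress_ge_gc: "mx / 16 * (norm (gc i \<omega>))\<^sup>2 \<le> progress i \<omega>"
  and progress_ge_grad: "mx / 8 * (norm (risk_grad (uc i \<omega>)))\<^sup>2 \<le> progress i \<omega>"
proof -
  have m: "mx / 16 \<le> my / 8" "mx / 8 \<le> my / 8" "mx / 8 \<le> mx / 2" using mx_le_my steps(1) by auto
  have "mx / 16 * (norm (snd (gc i \<omega>)))\<^sup>2 \<le> my / 8 * (norm (snd (gc i \<omega>)))\<^sup>2" by (intro mult_right_mono m) simp
  moreover have "mx / 8 * (norm (snd (risk_grad (uc i \<omega>))))\<^sup>2 \<le> my / 8 * (norm (snd (risk_grad (uc i \<omega>))))\<^sup>2" by (intro mult_right_mono m) simp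
  moreover have "mx / 8 * (norm (fst (risk_grad (uc i \<omega>))))\<^sup>2 \<le> mx / 2 * (norm (fst (risk_grad (uc i \<omega>))))\<^sup>2" by (intro mult_right_mono m) simp
  moreover have "0 \<le> mx / 2 * (norm (fst (risk_grad (uc i \<omega>))))\<^sup>2" "0 \<le> my / 8 * (norm (snd (risk_grad (uc i \<omega>))))\<^sup>2"
    "0 \<le> mx / 16 * (norm (fst (gc i \<omega>)))\<^sup>2" "0 \<le> my / 8 * (norm (snd (gc i \<omega>)))\<^sup>2"
    using steps(1) my_pos by auto
  moreover have "mx / 16 * (norm (gc i \<omega>))\<^sup>2 = mx / 16 * (norm (fst (gc i \<omega>)))\<^sup>2 + mx / 16 * (norm (snd (gc i \<omega>)))\<^sup>2"
    "mx / 8 * (norm (risk_grad (uc i \<omega>)))\<^sup>2 = mx / 8 * (norm (fst (risk_grad (uc i \<omega>))))\<^sup>2 + mx / 8 * (norm (snd (risk_grad (uc i \<omega>))))\<^sup>2"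
    by (simp_all add: norm_prod_def distrib_left)
  ultimately show "mx / 16 * (norm (gc i \<omega>))\<^sup>2 \<le> progress i \<omega>" "mx / 8 * (norm (risk_grad (uc i \<omega>)))\<^sup>2 \<le> progress i \<omega>"
    unfolding progress_def by linarith+
qed

section \<open>Finiteness of second moments\<close>

definition regular :: "nat \<Rightarrow> bool" where
  "regular i \<longleftrightarrow> (\<forall>k<K. square_integrable \<Omega> (err i k) \<and> square_integrable \<Omega> (dis i k) \<and> square_integrable \<Omega> (sdual i k))"

lemma regular_mean_err: "regular i \<Longrightarrow> Ks \<subseteq> {..<K} \<Longrightarrow> square_integrable \<Omega> (mean_err i Ks)"
  unfolding mean_err_def[abs_def] regular_def by (intro square_integrable_scaleR square_integrable_sum) auto

lemma gerr_integrable: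
  assumes "regular i"
  shows "integrable \<Omega> (gerr i)"
proof -
  have "square_integrable \<Omega> (\<lambda>\<omega>. gc i \<omega> - risk_grad (uc i \<omega>))"
  proof (rule square_integrable_dominated)
    show "integrable \<Omega> (\<lambda>\<omega>. 2 * (norm (mean_err i {..<K} \<omega>))\<^sup>2 + 2 * M\<^sup>2 * ((\<Sum>k<K. (norm (dis i k \<omega>))\<^sup>2) / real K))"
      using assms by (intro Bochner_Integration.integrable_add integrable_mult_right integrable_divide Bochner_Integration.integrable_sum
        square_integrableD(2) regular_mean_err) (auto simp: regular_def)
  qed (use gerr_le gc_P risk_grad_P in \<open>auto simp: gerr_def\<close>)
  then show ?thesis unfolding gerr_def[abs_def] by (rule square_integrableD(2))
qed

text \<open>Bounded noise variance says nothing about the size of the gradient at a random iterate.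
  The bound comes from the merit: along each path the progress of round \<open>i\<close>, and with
  it the squared averaged estimate and the squared gradient, is at most the initial gaps plus the
  errors up to \<open>i\<close>, all integrable.\<close>

lemma regular_gc:
  assumes "\<And>j. j \<le> i \<Longrightarrow> regular j"
  shows "square_integrable \<Omega> (gc i)" "square_integrable \<Omega> (\<lambda>\<omega>. risk_grad (uc i \<omega>))" "integrable \<Omega> (progress i)"
proof -
  let ?f = "\<lambda>\<omega>. (primal_gap pb r \<omega> + dual_gap pb r \<omega> / 2) + my * (\<Sum>j<Suc i. gerr j \<omega>)"
  have f: "integrable \<Omega> ?f"
    using model(6) assms
    by (intro Bochner_Integration.integrable_add integrable_mult_right integrable_divide Bochner_Integration.integrable_sum gerr_integrable)
      (auto simp: finite_start_def)
  have le: "progress i \<omega> \<le> ?f \<omega>" if "\<omega> \<in> space \<Omega>" for \<omega>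
  proof -
    have "0 \<le> (\<Sum>j<i. progress j \<omega>)" by (intro sum_nonneg progress_nonneg)
    then show ?thesis using progress_sum[OF that, of "Suc i"] by simp
  qed
  have "(norm (gc i \<omega>))\<^sup>2 \<le> 16 / mx * ?f \<omega>" if "\<omega> \<in> space \<Omega>" for \<omega>
    using le[OF that] progress_ge_gc[of i \<omega>] steps(1) by (simp add: field_simps)
  then show gs: "square_integrable \<Omega> (gc i)"
    by (intro square_integrable_dominated[OF gc_P integrable_mult_right[OF f]])
  have "(norm (risk_grad (uc i \<omega>)))\<^sup>2 \<le> 8 / mx * ?f \<omega>" if "\<omega> \<in> space \<Omega>" for \<omega>
    using le[OF that] progress_ge_grad[of i \<omega>] steps(1) by (simp add: field_simps)
  then show rs: "square_integrable \<Omega> (\<lambda>\<omega>. risk_grad (uc i \<omega>))"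
    by (intro square_integrable_dominated[OF risk_grad_P integrable_mult_right[OF f]])
  have m: "(\<lambda>\<omega>. (norm (fst (v \<omega>)))\<^sup>2) \<in> borel_measurable \<Omega>" "(\<lambda>\<omega>. (norm (snd (v \<omega>)))\<^sup>2) \<in> borel_measurable \<Omega>"
    if "v \<in> borel_measurable \<Omega>" for v :: "'w \<Rightarrow> 'a \<times> 'b"
    using that by (auto simp: borel_prod[symmetric] intro!: borel_measurable_power measurable_compose[OF _ borel_measurable_norm])
  have pm: "progress i \<in> borel_measurable \<Omega>"
    unfolding progress_def[abs_def]
    by (intro borel_measurable_add borel_measurable_times borel_measurable_const m risk_grad_P gc_P)
  show "integrable \<Omega> (progress i)"
  proof (rule Bochner_Integration.integrable_bound[OF f pm])
    show "AE \<omega> in \<Omega>. norm (progress i \<omega>) \<le> norm (?f \<omega>)"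
      using le progress_nonneg[of i] by (intro AE_I2) (auto intro: order_trans[OF _ abs_ge_self])
  qed
qed

lemma scal_sq:
  assumes "square_integrable \<Omega> U"
  shows "square_integrable \<Omega> (\<lambda>\<omega>. scal (U \<omega>))"
proof (rule square_integrable_dominated)
  show "(\<lambda>\<omega>. scal (U \<omega>)) \<in> borel_measurable \<Omega>" by (rule scal_measurable[OF square_integrableD(1)[OF assms]])
  show "integrable \<Omega> (\<lambda>\<omega>. my\<^sup>2 * (norm (U \<omega>))\<^sup>2)" by (intro integrable_mult_right square_integrableD(2) assms)
qed (rule norm_scal_le)

lemma delta_eq:
  "\<omega> \<in> space \<Omega> \<Longrightarrow> delta i k \<omega> = (dis (Suc i) k \<omega> - dis i k \<omega>) - scal (gc i \<omega>)"
  using path_facts(1)[of \<omega> i] by (simp add: dis_def)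

lemma delta_sq:
  assumes "regular i" "square_integrable \<Omega> (gc i)" "square_integrable \<Omega> (dis (Suc i) k)" "k < K"
  shows "square_integrable \<Omega> (delta i k)"
proof (rule square_integrable_cong)
  show "square_integrable \<Omega> (\<lambda>\<omega>. (dis (Suc i) k \<omega> - dis i k \<omega>) - scal (gc i \<omega>))"
    using assms by (intro square_integrable_diff scal_sq) (auto simp: regular_def)
qed (simp add: delta_eq)

lemma mean_err_single: "mean_err i {k} = err i k"
  by (simp add: mean_err_def fun_eq_iff)

lemma regular_dis_Suc:
  assumes "regular i" "k < K"
  shows "square_integrable \<Omega> (dis (Suc i) k)"
proof (rule square_integrable_cong)
  show "square_integrable \<Omega> (\<lambda>\<omega>. block_mult K W (\<lambda>k. dis i k \<omega>) k - sdual i k \<omega>)"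
    using assms by (intro square_integrable_diff square_integrable_block_mult) (auto simp: regular_def)
qed (simp add: path_facts(2) assms)

lemma zeta_eq: "(\<Sum>k<K. (norm (g 0 k \<omega> - gc 0 \<omega>))\<^sup>2) = zeta_x pb c r \<omega> + zeta_y pb c r \<omega>"
proof -
  have "zeta_x pb c r \<omega> = (\<Sum>k<K. (norm (fst (g 0 k \<omega> - gc 0 \<omega>)))\<^sup>2)"
    unfolding zeta_x_def sq_norm_stack_def mats
    by (intro sum.cong refl) (simp add: block_mult_centring g_def gc_def centroid_def fst_sum)
  moreover have "zeta_y pb c r \<omega> = (\<Sum>k<K. (norm (snd (g 0 k \<omega> - gc 0 \<omega>)))\<^sup>2)"
    unfolding zeta_y_def sq_norm_stack_def mats
    by (intro sum.cong refl) (simp add: block_mult_centring g_def gc_def centroid_def snd_sum)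
  ultimately show ?thesis by (simp add: norm_prod_def sum.distrib)
qed

text \<open>At the start the shifted dual is just the centred scaled estimate, whose square is
  dominated by the integrable \<open>zeta_x\<close> and \<open>zeta_y\<close>.\<close>

lemma regular_zero: "regular 0"
proof -
  have e: "square_integrable \<Omega> (err 0 k)" if "k < K" for k
    using mean_err_zero(1)[of "{k}"] that by (simp add: mean_err_single)
  have d0: "square_integrable \<Omega> (dis 0 k)" if k: "k < K" for k
  proof (rule square_integrable_cong[OF square_integrable_zero])
    fix \<omega> assume "\<omega> \<in> space \<Omega>"
    then show "0 = dis 0 k \<omega>"
      using path_facts(4)[of \<omega>] k by (simp add: sum_nonneg_eq_0_iff)
  qed
  have s0: "square_integrable \<Omega> (sdual 0 k)" if k: "k < K" for k
  proof (rule square_integrable_dominated[OF sdual_P[OF k]])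
    let ?f = "\<lambda>\<omega>. my\<^sup>2 * (zeta_x pb c r \<omega> + zeta_y pb c r \<omega>)"
    show "integrable \<Omega> ?f" using model(6) by (auto simp: finite_start_def)
    fix \<omega> assume w: "\<omega> \<in> space \<Omega>"
    have "(norm (sdual 0 k \<omega>))\<^sup>2 \<le> my\<^sup>2 * (norm (g 0 k \<omega> - gc 0 \<omega>))\<^sup>2"
      using norm_scal_le[of "g 0 k \<omega> - gc 0 \<omega>"] dual_zero[OF k w] by (simp add: sdual_def scal_linear)
    also have "\<dots> \<le> ?f \<omega>"
    proof (intro mult_left_mono)
      have "(norm (g 0 k \<omega> - gc 0 \<omega>))\<^sup>2 \<le> (\<Sum>k<K. (norm (g 0 k \<omega> - gc 0 \<omega>))\<^sup>2)"
        using k by (intro member_le_sum) auto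
      also have "\<dots> = zeta_x pb c r \<omega> + zeta_y pb c r \<omega>"
        by (rule zeta_eq)
      finally show "(norm (g 0 k \<omega> - gc 0 \<omega>))\<^sup>2 \<le> zeta_x pb c r \<omega> + zeta_y pb c r \<omega>" .
    qed simp
    finally show "(norm (sdual 0 k \<omega>))\<^sup>2 \<le> ?f \<omega>" .
  qed
  show ?thesis using e d0 s0 by (simp add: regular_def)
qed


definition dG :: "nat \<Rightarrow> nat \<Rightarrow> 'w \<Rightarrow> 'a \<times> 'b" where "dG i k \<omega> = g (Suc i) k \<omega> - g i k \<omega>"

text \<open>The estimate changes by the change of its error plus the change of the true local
  gradient; the latter is Lipschitz in the movement.\<close>

lemma dG_square_le:
  assumes "k < K" "\<omega> \<in> space \<Omega>"
  shows "(norm (dG i k \<omega>))\<^sup>2 \<le> 2 * (norm (err (Suc i) k \<omega> - err i k \<omega>))\<^sup>2 + 2 * M\<^sup>2 * (norm (delta i k \<omega>))\<^sup>2"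
proof -
  let ?l = "local_grad k (u (Suc i) k \<omega>) - local_grad k (u i k \<omega>)"
  have "dG i k \<omega> = (err (Suc i) k \<omega> - err i k \<omega>) + ?l" by (simp add: dG_def err_def)
  then have "(norm (dG i k \<omega>))\<^sup>2 \<le> 2 * (norm (err (Suc i) k \<omega> - err i k \<omega>))\<^sup>2 + 2 * (norm ?l)\<^sup>2"
    by (simp only: norm_add_square_le)
  moreover have "(norm ?l)\<^sup>2 \<le> M\<^sup>2 * (norm (delta i k \<omega>))\<^sup>2"
    unfolding M(2) using local_grad_lipschitz[OF assms(1) u_in[OF assms] u_in[OF assms]] .
  ultimately show ?thesis by linarith
qed

lemma drift_eq: "drift i k \<omega> = scal (dG i k \<omega> - centroid K (\<lambda>k. dG i k \<omega>))"
  by (simp add: drift_def dG_def centroid_diff gc_def scal_linear)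

lemma drift_sum_le: "(\<Sum>k<K. (norm (drift i k \<omega>))\<^sup>2) \<le> my\<^sup>2 * (\<Sum>k<K. (norm (dG i k \<omega>))\<^sup>2)"
proof -
  have "(\<Sum>k<K. (norm (drift i k \<omega>))\<^sup>2) \<le> (\<Sum>k<K. my\<^sup>2 * (norm (dG i k \<omega> - centroid K (\<lambda>k. dG i k \<omega>)))\<^sup>2)"
    unfolding drift_eq by (intro sum_mono norm_scal_le)
  also have "\<dots> \<le> my\<^sup>2 * (\<Sum>k<K. (norm (dG i k \<omega>))\<^sup>2)"
    unfolding sum_distrib_left[symmetric] by (intro mult_left_mono block_inner_centred_le K_pos) simp
  finally show ?thesis .
qed

lemma dG_sq:
  assumes "k < K" "square_integrable \<Omega> (err (Suc i) k)" "square_integrable \<Omega> (err i k)" "square_integrable \<Omega> (delta i k)"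
  shows "square_integrable \<Omega> (dG i k)"
    "msq (dG i k) \<le> 2 * msq (\<lambda>\<omega>. err (Suc i) k \<omega> - err i k \<omega>) + 2 * M\<^sup>2 * msq (delta i k)"
proof -
  note e = square_integrableD(2)[OF square_integrable_diff[OF assms(2,3)]] and dl = square_integrableD(2)[OF assms(4)]
  have f: "integrable \<Omega> (\<lambda>\<omega>. 2 * (norm (err (Suc i) k \<omega> - err i k \<omega>))\<^sup>2 + 2 * M\<^sup>2 * (norm (delta i k \<omega>))\<^sup>2)"
    by (intro Bochner_Integration.integrable_add integrable_mult_right e dl)
  have m: "dG i k \<in> borel_measurable \<Omega>"
    unfolding dG_def[abs_def] by (intro borel_measurable_diff g_P assms(1))
  show sq: "square_integrable \<Omega> (dG i k)"
    by (rule square_integrable_dominated[OF m f]) (rule dG_square_le[OF assms(1)])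
  have "msq (dG i k) \<le> (LINT \<omega>|\<Omega>. 2 * (norm (err (Suc i) k \<omega> - err i k \<omega>))\<^sup>2 + 2 * M\<^sup>2 * (norm (delta i k \<omega>))\<^sup>2)"
    by (rule integral_mono[OF square_integrableD(2)[OF sq] f]) (rule dG_square_le[OF assms(1)])
  also have "\<dots> = 2 * msq (\<lambda>\<omega>. err (Suc i) k \<omega> - err i k \<omega>) + 2 * M\<^sup>2 * msq (delta i k)"
    by (subst Bochner_Integration.integral_add) (use e dl in auto)
  finally show "msq (dG i k) \<le> 2 * msq (\<lambda>\<omega>. err (Suc i) k \<omega> - err i k \<omega>) + 2 * M\<^sup>2 * msq (delta i k)" .
qed

text \<open>The order of the steps is forced: the new disagreement depends on old quantities only;
  with the averaged estimate it gives the movement, the movement gives the new error, both give the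
  change of the estimates, and this drives the shifted dual.\<close>

lemma regular_Suc:
  assumes r: "regular i" and gc: "square_integrable \<Omega> (gc i)" and i: "Suc i < T"
  shows "regular (Suc i)"
proof -
  have ds: "square_integrable \<Omega> (dis (Suc i) k)" if "k < K" for k by (rule regular_dis_Suc[OF r that])
  have dl: "square_integrable \<Omega> (delta i k)" if "k < K" for k by (rule delta_sq[OF r gc ds[OF that] that])
  have e: "square_integrable \<Omega> (err (Suc i) k)" if "k < K" for k
    using mean_err_Suc(1)[of "{k}" i] regular_mean_err[OF r, of "{k}"] dl i that by (simp add: mean_err_single)
  have dg: "square_integrable \<Omega> (dG i k)" if "k < K" for k
    using r that by (intro dG_sq(1) e dl) (auto simp: regular_def)
  have dr: "square_integrable \<Omega> (drift i k)" if "k < K" for k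
    unfolding drift_eq[abs_def] using that by (intro scal_sq square_integrable_diff square_integrable_centroid dg) auto
  have "square_integrable \<Omega> (sdual (Suc i) k)" if k: "k < K" for k
  proof (rule square_integrable_cong)
    have d1: "square_integrable \<Omega> (\<lambda>\<omega>. block_mult K W (\<lambda>k. dis i k \<omega>) l)" for l
      using r by (intro square_integrable_block_mult) (auto simp: regular_def)
    show "square_integrable \<Omega> (\<lambda>\<omega>. (block_mult K W (\<lambda>k. sdual i k \<omega>) k
        + (block_mult K W (\<lambda>k. dis i k \<omega>) k - block_mult K W (block_mult K W (\<lambda>k. dis i k \<omega>)) k)) + drift i k \<omega>)"
      using r k by (intro square_integrable_add square_integrable_diff d1 dr square_integrable_block_mult) (auto simp: regular_def)
  qed (simp add: path_facts(3) k)
  then show ?thesis using e ds by (simp add: regular_def)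
qed

lemma regular_all: "i < T \<Longrightarrow> regular i"
proof (induction i rule: less_induct)
  case (less i)
  show ?case
  proof (cases i)
    case 0
    then show ?thesis using regular_zero by simp
  next
    case (Suc j)
    \<comment> \<open>All earlier rounds are called for, because the bound on the averaged estimate
      sums their errors.\<close>
    have "regular l" if "l \<le> j" for l using less that Suc by simp
    then show ?thesis
      using regular_gc(1)[of j] less.prems unfolding Suc by (intro regular_Suc) auto
  qed
qed

section \<open>Averaged second moments and their recursions\<close>

lemma
  assumes "i < T"
  shows gc_sq: "square_integrable \<Omega> (gc i)"
    and risk_grad_sq: "square_integrable \<Omega> (\<lambda>\<omega>. risk_grad (uc i \<omega>))"
    and progress_int: "integrable \<Omega> (progress i)"
  using regular_gc[of i] regular_all assms by auto

lemma regularD: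
  assumes "i < T" "k < K"
  shows "square_integrable \<Omega> (err i k)" "square_integrable \<Omega> (dis i k)" "square_integrable \<Omega> (sdual i k)"
  using regular_all[OF assms(1)] assms(2) by (auto simp: regular_def)

lemma delta_sq': "Suc i < T \<Longrightarrow> k < K \<Longrightarrow> square_integrable \<Omega> (delta i k)"
  by (intro delta_sq regular_all gc_sq regularD) auto

text \<open>Second moments, per agent where there are several: \<open>qv\<close> disagreement,
  \<open>lv\<close> local estimation error, \<open>mv\<close> error of the averaged estimate,
  \<open>dv\<close> movement of the agents, \<open>hv\<close> movement of the centroid,
  \<open>rv\<close> change of the local error, \<open>pv\<close> Lyapunov potential.\<close>

definition "qv i = (\<Sum>k<K. msq (dis i k)) / real K"
definition "lv i = (\<Sum>k<K. msq (err i k)) / real K"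
definition "mv i = msq (mean_err i {..<K})"
definition "dv i = (\<Sum>k<K. msq (delta i k)) / real K"
definition "hv i = msq (\<lambda>\<omega>. scal (gc i \<omega>))"
definition "rv i = (\<Sum>k<K. msq (\<lambda>\<omega>. err (Suc i) k \<omega> - err i k \<omega>)) / real K"
definition "pv i = \<E> (pot i) / real K"

abbreviation "p \<equiv> coin_prob c"
abbreviation "B \<equiv> real (big_batch c)"
abbreviation "b \<equiv> real (small_batch c)"
abbreviation "s \<equiv> 2 * \<sigma>\<^sup>2"

lemma values_nonneg: "0 \<le> qv i" "0 \<le> lv i" "0 \<le> mv i" "0 \<le> dv i" "0 \<le> hv i" "0 \<le> rv i" "0 \<le> pv i"
  unfolding qv_def lv_def mv_def dv_def hv_def rv_def pv_def pot_def
  by (intro divide_nonneg_nonneg sum_nonneg integral_nonneg_AE AE_I2 mat.extra_lyapunov_nonneg; simp)+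

lemma qv_zero: "qv 0 = 0"
proof -
  have "msq (dis 0 k) = 0" if "k < K" for k
  proof -
    have "msq (dis 0 k) = \<E> (\<lambda>_. 0)"
      using path_facts(4) that by (intro Bochner_Integration.integral_cong refl) (simp add: sum_nonneg_eq_0_iff)
    then show ?thesis by simp
  qed
  then show ?thesis by (simp add: qv_def)
qed

lemma mv_zero: "mv 0 \<le> s / (real K * real (init_batch c))"
  using mean_err_zero(2)[of "{..<K}"] K_pos by (simp add: mv_def lessThan_empty_iff)

lemma lv_zero: "lv 0 \<le> s / real (init_batch c)"
proof -
  have "msq (err 0 k) \<le> s / real (init_batch c)" if "k < K" for k
    using mean_err_zero(2)[of "{k}"] that by (simp add: mean_err_single)
  then have "(\<Sum>k<K. msq (err 0 k)) \<le> real K * (s / real (init_batch c))"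
    using sum_bounded_above[of "{..<K}" "\<lambda>k. msq (err 0 k)" "s / real (init_batch c)"] by simp
  then show ?thesis using K_pos by (simp add: lv_def field_simps)
qed

lemma mv_step:
  assumes "Suc i < T"
  shows "mv (Suc i) \<le> (1 - p) * (mv i + 4 * M\<^sup>2 / (real K * b) * dv i) + p * (s / (real K * B))"
proof -
  have ne: "{..<K} \<noteq> {}" using K_pos by (simp add: lessThan_empty_iff)
  have "msq (mean_err (Suc i) {..<K}) \<le> (1 - p) * (msq (mean_err i {..<K})
      + 4 * M\<^sup>2 / ((real K)\<^sup>2 * b) * (\<Sum>k<K. msq (delta i k))) + p * (s / (real K * B))"
    using mean_err_Suc(2)[OF subset_refl ne assms] regular_mean_err[OF regular_all subset_refl, of i] delta_sq'[OF assms] assms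
    by simp
  also have "4 * M\<^sup>2 / ((real K)\<^sup>2 * b) * (\<Sum>k<K. msq (delta i k)) = 4 * M\<^sup>2 / (real K * b) * dv i"
    by (simp add: dv_def power2_eq_square[of "real K"] mult.assoc)
  finally show ?thesis by (simp add: mv_def)
qed

lemma average_affine:
  fixes f h :: "nat \<Rightarrow> real"
  shows "(\<Sum>k<K. a * (f k + q * h k) + w) / real K = a * ((\<Sum>k<K. f k) / real K + q * ((\<Sum>k<K. h k) / real K)) + w"
proof -
  have "(\<Sum>k<K. a * (f k + q * h k) + w) = a * ((\<Sum>k<K. f k) + q * (\<Sum>k<K. h k)) + real K * w"
    by (simp add: sum.distrib sum_distrib_left distrib_left)
  then show ?thesis using K_pos by (simp add: add_divide_distrib distrib_left)
qed

lemma average_mono: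
  assumes "\<And>k. k < K \<Longrightarrow> f k \<le> h k"
  shows "(\<Sum>k<K. f k) / real K \<le> (\<Sum>k<K. h k) / real K"
  using assms by (intro divide_right_mono sum_mono) auto

lemma lv_step:
  assumes "Suc i < T"
  shows "lv (Suc i) \<le> (1 - p) * (lv i + 4 * M\<^sup>2 / b * dv i) + p * (s / B)"
proof -
  have "msq (err (Suc i) k) \<le> (1 - p) * (msq (err i k) + 4 * M\<^sup>2 / b * msq (delta i k)) + p * (s / B)" if "k < K" for k
    using mean_err_Suc(2)[of "{k}" i] assms that regularD[of i k] delta_sq' by (simp add: mean_err_single)
  then have "lv (Suc i) \<le> (\<Sum>k<K. (1 - p) * (msq (err i k) + 4 * M\<^sup>2 / b * msq (delta i k)) + p * (s / B)) / real K"
    unfolding lv_def by (rule average_mono)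
  then show ?thesis unfolding average_affine by (simp only: lv_def dv_def)
qed

lemma rv_step:
  assumes "Suc i < T"
  shows "rv i \<le> (1 - p) * (4 * M\<^sup>2 / b * dv i) + p * (lv i + s / B)"
proof -
  have "msq (\<lambda>\<omega>. err (Suc i) k \<omega> - err i k \<omega>) \<le> (1 - p) * (4 * M\<^sup>2 / b * msq (delta i k)) + p * (msq (err i k) + s / B)" if "k < K" for k
    using mean_err_increment[of "{k}" i] assms that regularD[of i k] delta_sq' by (simp add: mean_err_single)
  then have "rv i \<le> (\<Sum>k<K. (1 - p) * (4 * M\<^sup>2 / b * msq (delta i k)) + p * (msq (err i k) + s / B)) / real K"
    unfolding rv_def by (rule average_mono)
  also have "\<dots> = (\<Sum>k<K. 1 * (p * msq (err i k) + (1 - p) * (4 * M\<^sup>2 / b) * msq (delta i k)) + p * (s / B)) / real K"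
    by (simp add: distrib_left add_ac mult.assoc)
  also have "\<dots> = 1 * ((\<Sum>k<K. p * msq (err i k)) / real K + (1 - p) * (4 * M\<^sup>2 / b) * dv i) + p * (s / B)"
    unfolding average_affine by (simp only: dv_def)
  also have "(\<Sum>k<K. p * msq (err i k)) / real K = p * lv i"
    by (simp add: lv_def sum_distrib_left[symmetric])
  finally show ?thesis by (simp add: distrib_left mult.assoc)
qed

lemma dv_step:
  assumes i: "Suc i < T"
  shows "dv i \<le> 2 * hv i + 4 * qv (Suc i) + 4 * qv i"
proof -
  have hi: "integrable \<Omega> (\<lambda>\<omega>. (norm (scal (gc i \<omega>)))\<^sup>2)"
    using i by (intro square_integrableD(2) scal_sq gc_sq) auto
  have "msq (delta i k) \<le> 4 * msq (dis (Suc i) k) + 4 * msq (dis i k) + 2 * hv i" if k: "k < K" for k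
  proof -
    note d = square_integrableD(2)[OF regularD(2)[OF i k]] square_integrableD(2)[OF regularD(2)[OF Suc_lessD[OF i] k]]
    have f: "integrable \<Omega> (\<lambda>\<omega>. 4 * (norm (dis (Suc i) k \<omega>))\<^sup>2 + 4 * (norm (dis i k \<omega>))\<^sup>2 + 2 * (norm (scal (gc i \<omega>)))\<^sup>2)"
      by (intro Bochner_Integration.integrable_add integrable_mult_right d hi)
    have "msq (delta i k) \<le> (LINT \<omega>|\<Omega>. 4 * (norm (dis (Suc i) k \<omega>))\<^sup>2 + 4 * (norm (dis i k \<omega>))\<^sup>2 + 2 * (norm (scal (gc i \<omega>)))\<^sup>2)"
    proof (rule integral_mono[OF square_integrableD(2)[OF delta_sq'[OF i k]] f])
      fix \<omega> assume w: "\<omega> \<in> space \<Omega>"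
      have "(norm (delta i k \<omega>))\<^sup>2 \<le> 2 * (norm (dis (Suc i) k \<omega> - dis i k \<omega>))\<^sup>2 + 2 * (norm (scal (gc i \<omega>)))\<^sup>2"
        unfolding delta_eq[OF w] by (rule norm_diff_square_le)
      also have "(norm (dis (Suc i) k \<omega> - dis i k \<omega>))\<^sup>2 \<le> 2 * (norm (dis (Suc i) k \<omega>))\<^sup>2 + 2 * (norm (dis i k \<omega>))\<^sup>2"
        by (rule norm_diff_square_le)
      finally show "(norm (delta i k \<omega>))\<^sup>2 \<le> 4 * (norm (dis (Suc i) k \<omega>))\<^sup>2 + 4 * (norm (dis i k \<omega>))\<^sup>2 + 2 * (norm (scal (gc i \<omega>)))\<^sup>2"
        by simp
    qed
    also have "\<dots> = 4 * msq (dis (Suc i) k) + 4 * msq (dis i k) + 2 * hv i"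
      using d hi by (simp add: hv_def)
    finally show ?thesis .
  qed
  then have "dv i \<le> (\<Sum>k<K. 4 * msq (dis (Suc i) k) + 4 * msq (dis i k) + 2 * hv i) / real K"
    unfolding dv_def by (rule average_mono)
  also have "\<dots> = 2 * hv i + 4 * qv (Suc i) + 4 * qv i"
    using K_pos by (simp add: sum.distrib sum_distrib_left[symmetric] add_divide_distrib qv_def)
  finally show ?thesis .
qed

lemma pot_integrable: "i < T \<Longrightarrow> integrable \<Omega> (pot i)"
proof -
  assume i: "i < T"
  have d: "square_integrable \<Omega> (\<lambda>\<omega>. block_mult K W (\<lambda>k. dis i k \<omega>) l)" for l
    using i by (intro square_integrable_block_mult regularD)
  show "integrable \<Omega> (pot i)"
    unfolding pot_def[abs_def] mat.extra_lyapunov_eq block_inner_def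
    using i by (intro Bochner_Integration.integrable_add Bochner_Integration.integrable_diff Bochner_Integration.integrable_sum
        square_integrable_inner d regularD) auto
qed

lemma qv_step:
  assumes i: "Suc i < T"
  shows "qv (Suc i) \<le> 2 / gap * pv i"
proof -
  have int: "integrable \<Omega> (\<lambda>\<omega>. (norm (dis (Suc i) k \<omega>))\<^sup>2)" if "k < K" for k
    using regularD(2)[OF i that] by (rule square_integrableD(2))
  have "(\<Sum>k<K. msq (dis (Suc i) k)) = (LINT \<omega>|\<Omega>. (\<Sum>k<K. (norm (dis (Suc i) k \<omega>))\<^sup>2))"
    using int by (intro Bochner_Integration.integral_sum[symmetric]) auto
  also have "\<dots> \<le> (LINT \<omega>|\<Omega>. 2 / gap * pot i \<omega>)"
    using int i by (intro integral_mono path_facts(6) Bochner_Integration.integrable_sum integrable_mult_right pot_integrable) auto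
  also have "\<dots> = 2 / gap * \<E> (pot i)" by simp
  finally have "(\<Sum>k<K. msq (dis (Suc i) k)) / real K \<le> 2 / gap * \<E> (pot i) / real K"
    by (rule divide_right_mono) simp
  then show ?thesis by (simp add: qv_def pv_def)
qed

text \<open>Centring does not increase the change of the estimates, and scaling costs at most
  \<open>my^2\<close>. Here local errors enter without the averaging gain, which is why
  \<open>lv\<close> and \<open>rv\<close> are tracked beside \<open>mv\<close>.\<close>

lemma pv_step:
  assumes i: "Suc i < T"
  shows "pv (Suc i) \<le> (1 - gap / 2) * pv i + 3 / gap * (my\<^sup>2 * (2 * rv i + 2 * M\<^sup>2 * dv i))"
proof -
  have dg: "square_integrable \<Omega> (dG i k)"
    "msq (dG i k) \<le> 2 * msq (\<lambda>\<omega>. err (Suc i) k \<omega> - err i k \<omega>) + 2 * M\<^sup>2 * msq (delta i k)" if "k < K" for k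
    using dG_sq[OF that regularD(1)[OF i that] regularD(1)[OF Suc_lessD[OF i] that] delta_sq'[OF i that]] by auto
  have int: "integrable \<Omega> (\<lambda>\<omega>. my\<^sup>2 * (\<Sum>k<K. (norm (dG i k \<omega>))\<^sup>2))"
    using dg(1) by (intro integrable_mult_right Bochner_Integration.integrable_sum square_integrableD(2)) auto
  have pi: "integrable \<Omega> (pot i)" "integrable \<Omega> (pot (Suc i))" using i by (auto intro: pot_integrable)
  have "\<E> (pot (Suc i)) \<le> (LINT \<omega>|\<Omega>. (1 - gap / 2) * pot i \<omega> + 3 / gap * (my\<^sup>2 * (\<Sum>k<K. (norm (dG i k \<omega>))\<^sup>2)))"
  proof (rule integral_mono[OF pi(2)])
    show "integrable \<Omega> (\<lambda>\<omega>. (1 - gap / 2) * pot i \<omega> + 3 / gap * (my\<^sup>2 * (\<Sum>k<K. (norm (dG i k \<omega>))\<^sup>2)))"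
      by (intro Bochner_Integration.integrable_add integrable_mult_right[OF pi(1)] integrable_mult_right[OF int])
    fix \<omega> assume "\<omega> \<in> space \<Omega>"
    then have "pot (Suc i) \<omega> \<le> (1 - gap / 2) * pot i \<omega> + 3 / gap * (\<Sum>k<K. (norm (drift i k \<omega>))\<^sup>2)" by (rule path_facts(7))
    also have "3 / gap * (\<Sum>k<K. (norm (drift i k \<omega>))\<^sup>2) \<le> 3 / gap * (my\<^sup>2 * (\<Sum>k<K. (norm (dG i k \<omega>))\<^sup>2))"
      using gap_pos by (intro mult_left_mono drift_sum_le) simp
    finally show "pot (Suc i) \<omega> \<le> (1 - gap / 2) * pot i \<omega> + 3 / gap * (my\<^sup>2 * (\<Sum>k<K. (norm (dG i k \<omega>))\<^sup>2))" by simp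
  qed
  also have "\<dots> = (1 - gap / 2) * \<E> (pot i) + 3 / gap * (LINT \<omega>|\<Omega>. my\<^sup>2 * (\<Sum>k<K. (norm (dG i k \<omega>))\<^sup>2))"
    by (simp only: Bochner_Integration.integral_add[OF integrable_mult_right[OF pi(1)] integrable_mult_right[OF int]]
        integral_mult_right_zero)
  also have "(LINT \<omega>|\<Omega>. my\<^sup>2 * (\<Sum>k<K. (norm (dG i k \<omega>))\<^sup>2)) = my\<^sup>2 * (\<Sum>k<K. msq (dG i k))"
    using dg(1) by (subst integral_mult_right_zero) (subst Bochner_Integration.integral_sum, auto intro: square_integrableD(2))
  finally have 1: "\<E> (pot (Suc i)) / real K \<le> ((1 - gap / 2) * \<E> (pot i) + 3 / gap * (my\<^sup>2 * (\<Sum>k<K. msq (dG i k)))) / real K"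
    by (rule divide_right_mono) simp
  have 2: "(\<Sum>k<K. msq (dG i k)) / real K \<le> 2 * rv i + 2 * M\<^sup>2 * dv i"
  proof -
    have "(\<Sum>k<K. msq (dG i k)) / real K \<le> (\<Sum>k<K. 2 * msq (\<lambda>\<omega>. err (Suc i) k \<omega> - err i k \<omega>) + 2 * M\<^sup>2 * msq (delta i k)) / real K"
      by (rule average_mono[OF dg(2)])
    then show ?thesis by (simp add: sum.distrib sum_distrib_left[symmetric] add_divide_distrib rv_def dv_def)
  qed
  have "3 / gap * (my\<^sup>2 * ((\<Sum>k<K. msq (dG i k)) / real K)) \<le> 3 / gap * (my\<^sup>2 * (2 * rv i + 2 * M\<^sup>2 * dv i))"
    using gap_pos by (intro mult_left_mono 2) auto
  then show ?thesis using 1 by (simp add: pv_def add_divide_distrib)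
qed

lemma pv_zero: "pv 0 \<le> my\<^sup>2 * zeta_sq pb c r"
proof -
  have z: "integrable \<Omega> (zeta_x pb c r)" "integrable \<Omega> (zeta_y pb c r)" using model(6) by (auto simp: finite_start_def)
  have "\<E> (pot 0) \<le> (LINT \<omega>|\<Omega>. my\<^sup>2 * (zeta_x pb c r \<omega> + zeta_y pb c r \<omega>))"
  proof (rule integral_mono)
    show "integrable \<Omega> (pot 0)" using T by (intro pot_integrable) simp
    show "integrable \<Omega> (\<lambda>\<omega>. my\<^sup>2 * (zeta_x pb c r \<omega> + zeta_y pb c r \<omega>))" using z by auto
    fix \<omega> assume "\<omega> \<in> space \<Omega>"
    then have "pot 0 \<omega> = (\<Sum>k<K. (norm (scal (g 0 k \<omega> - gc 0 \<omega>)))\<^sup>2)" by (simp add: path_facts(5) scal_linear)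
    also have "\<dots> \<le> (\<Sum>k<K. my\<^sup>2 * (norm (g 0 k \<omega> - gc 0 \<omega>))\<^sup>2)" by (intro sum_mono norm_scal_le)
    also have "\<dots> = my\<^sup>2 * (zeta_x pb c r \<omega> + zeta_y pb c r \<omega>)"
      by (simp only: sum_distrib_left[symmetric] zeta_eq)
    finally show "pot 0 \<omega> \<le> my\<^sup>2 * (zeta_x pb c r \<omega> + zeta_y pb c r \<omega>)" .
  qed
  also have "\<dots> = my\<^sup>2 * ((LINT \<omega>|\<Omega>. zeta_x pb c r \<omega>) + (LINT \<omega>|\<Omega>. zeta_y pb c r \<omega>))"
    using z by simp
  finally have "\<E> (pot 0) / real K \<le> my\<^sup>2 * ((LINT \<omega>|\<Omega>. zeta_x pb c r \<omega>) + (LINT \<omega>|\<Omega>. zeta_y pb c r \<omega>)) / real K"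
    by (rule divide_right_mono) simp
  then show ?thesis by (simp add: pv_def zeta_sq_def add_divide_distrib[symmetric])
qed

lemma gerr_expectation:
  assumes i: "i < T"
  shows "\<E> (gerr i) \<le> 2 * mv i + 2 * M\<^sup>2 * qv i"
proof -
  have m: "integrable \<Omega> (\<lambda>\<omega>. (norm (mean_err i {..<K} \<omega>))\<^sup>2)"
    using i by (intro square_integrableD(2) regular_mean_err regular_all) auto
  have d: "integrable \<Omega> (\<lambda>\<omega>. (norm (dis i k \<omega>))\<^sup>2)" if "k < K" for k
    using regularD(2)[OF i that] by (rule square_integrableD(2))
  have ds: "integrable \<Omega> (\<lambda>\<omega>. (\<Sum>k<K. (norm (dis i k \<omega>))\<^sup>2) / real K)"
    using d by (intro integrable_divide Bochner_Integration.integrable_sum) auto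
  have f: "integrable \<Omega> (\<lambda>\<omega>. 2 * (norm (mean_err i {..<K} \<omega>))\<^sup>2 + 2 * M\<^sup>2 * ((\<Sum>k<K. (norm (dis i k \<omega>))\<^sup>2) / real K))"
    by (intro Bochner_Integration.integrable_add integrable_mult_right m ds)
  have "\<E> (gerr i) \<le> (LINT \<omega>|\<Omega>. 2 * (norm (mean_err i {..<K} \<omega>))\<^sup>2 + 2 * M\<^sup>2 * ((\<Sum>k<K. (norm (dis i k \<omega>))\<^sup>2) / real K))"
    using i by (intro integral_mono gerr_integrable regular_all f gerr_le)
  also have "\<dots> = 2 * mv i + 2 * M\<^sup>2 * (LINT \<omega>|\<Omega>. (\<Sum>k<K. (norm (dis i k \<omega>))\<^sup>2) / real K)"
    unfolding mv_def
    by (subst Bochner_Integration.integral_add) (use integrable_mult_right[OF m] integrable_mult_right[OF ds] in auto)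
  also have "(LINT \<omega>|\<Omega>. (\<Sum>k<K. (norm (dis i k \<omega>))\<^sup>2) / real K) = qv i"
    unfolding qv_def using d by (simp add: Bochner_Integration.integral_sum)
  finally show ?thesis .
qed

text \<open>The progress holds squared estimates weighted by the steps, \<open>hv\<close> weights
  them by squared steps. A multiple \<open>\<theta>\<close> of order up to \<open>1 / my\<close> of
  \<open>hv\<close> can thus be retained besides the gradients.\<close>

lemma progress_expectation:
  assumes i: "i < T" and th: "0 \<le> \<theta>" "\<theta> * mx \<le> 1 / 16" "\<theta> * my \<le> 1 / 8"
  shows "mx / 8 * msq (\<lambda>\<omega>. risk_grad (uc i \<omega>)) + \<theta> * hv i \<le> \<E> (progress i)"
proof -
  have rg: "integrable \<Omega> (\<lambda>\<omega>. (norm (risk_grad (uc i \<omega>)))\<^sup>2)" using i by (intro square_integrableD(2) risk_grad_sq)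
  have h: "integrable \<Omega> (\<lambda>\<omega>. (norm (scal (gc i \<omega>)))\<^sup>2)" using i by (intro square_integrableD(2) scal_sq gc_sq)
  have "mx / 8 * msq (\<lambda>\<omega>. risk_grad (uc i \<omega>)) + \<theta> * hv i = (LINT \<omega>|\<Omega>. mx / 8 * (norm (risk_grad (uc i \<omega>)))\<^sup>2 + \<theta> * (norm (scal (gc i \<omega>)))\<^sup>2)"
    unfolding hv_def by (subst Bochner_Integration.integral_add) (use integrable_mult_right[OF rg] integrable_mult_right[OF h] in auto)
  also have "\<dots> \<le> \<E> (progress i)"
  proof (rule integral_mono[OF _ progress_int[OF i]])
    show "integrable \<Omega> (\<lambda>\<omega>. mx / 8 * (norm (risk_grad (uc i \<omega>)))\<^sup>2 + \<theta> * (norm (scal (gc i \<omega>)))\<^sup>2)"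
      by (intro Bochner_Integration.integrable_add integrable_mult_right rg h)
    fix \<omega>
    have "mx / 8 * (norm (snd (risk_grad (uc i \<omega>))))\<^sup>2 \<le> my / 8 * (norm (snd (risk_grad (uc i \<omega>))))\<^sup>2"
      using mx_le_my steps(1) by (intro mult_right_mono) auto
    moreover have "mx / 8 * (norm (fst (risk_grad (uc i \<omega>))))\<^sup>2 \<le> mx / 2 * (norm (fst (risk_grad (uc i \<omega>))))\<^sup>2"
      using steps(1) by (intro mult_right_mono) auto
    moreover have "(\<theta> * mx) * (mx * (norm (fst (gc i \<omega>)))\<^sup>2) \<le> mx / 16 * (norm (fst (gc i \<omega>)))\<^sup>2"
      using mult_right_mono[OF th(2), of "mx * (norm (fst (gc i \<omega>)))\<^sup>2"] steps(1) by simp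
    moreover have "(\<theta> * my) * (my * (norm (snd (gc i \<omega>)))\<^sup>2) \<le> my / 8 * (norm (snd (gc i \<omega>)))\<^sup>2"
      using mult_right_mono[OF th(3), of "my * (norm (snd (gc i \<omega>)))\<^sup>2"] my_pos by simp
    moreover have "mx / 8 * (norm (risk_grad (uc i \<omega>)))\<^sup>2 = mx / 8 * (norm (fst (risk_grad (uc i \<omega>))))\<^sup>2 + mx / 8 * (norm (snd (risk_grad (uc i \<omega>))))\<^sup>2"
      by (simp add: norm_prod_def distrib_left)
    moreover have "\<theta> * (norm (scal (gc i \<omega>)))\<^sup>2 = (\<theta> * mx) * (mx * (norm (fst (gc i \<omega>)))\<^sup>2) + (\<theta> * my) * (my * (norm (snd (gc i \<omega>)))\<^sup>2)"
      unfolding norm_scal by (simp add: power2_eq_square algebra_simps)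
    ultimately show "mx / 8 * (norm (risk_grad (uc i \<omega>)))\<^sup>2 + \<theta> * (norm (scal (gc i \<omega>)))\<^sup>2 \<le> progress i \<omega>"
      unfolding progress_def by linarith
  qed
  finally show ?thesis .
qed

lemma progress_expectation_sum:
  "(\<Sum>i<T. \<E> (progress i)) \<le> (exp_primal_gap pb r + exp_dual_gap pb r / 2) + my * (\<Sum>i<T. 2 * mv i + 2 * M\<^sup>2 * qv i)"
proof -
  have pg: "integrable \<Omega> (primal_gap pb r)" "integrable \<Omega> (dual_gap pb r)" using model(6) by (auto simp: finite_start_def)
  have ge: "integrable \<Omega> (\<lambda>\<omega>. \<Sum>i<T. gerr i \<omega>)"
    using gerr_integrable[OF regular_all] by (intro Bochner_Integration.integrable_sum) auto
  have f: "integrable \<Omega> (\<lambda>\<omega>. primal_gap pb r \<omega> + dual_gap pb r \<omega> / 2)" using pg by simp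
  have "(\<Sum>i<T. \<E> (progress i)) = (LINT \<omega>|\<Omega>. (\<Sum>i<T. progress i \<omega>))"
    using progress_int by (intro Bochner_Integration.integral_sum[symmetric]) auto
  also have "\<dots> \<le> (LINT \<omega>|\<Omega>. (primal_gap pb r \<omega> + dual_gap pb r \<omega> / 2) + my * (\<Sum>i<T. gerr i \<omega>))"
  proof (rule integral_mono)
    show "integrable \<Omega> (\<lambda>\<omega>. \<Sum>i<T. progress i \<omega>)" using progress_int by (intro Bochner_Integration.integrable_sum) auto
    show "integrable \<Omega> (\<lambda>\<omega>. (primal_gap pb r \<omega> + dual_gap pb r \<omega> / 2) + my * (\<Sum>i<T. gerr i \<omega>))"
      by (intro Bochner_Integration.integrable_add[OF f] integrable_mult_right[OF ge])
  qed (rule progress_sum)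
  also have "\<dots> = (exp_primal_gap pb r + exp_dual_gap pb r / 2) + my * (LINT \<omega>|\<Omega>. (\<Sum>i<T. gerr i \<omega>))"
    unfolding exp_primal_gap_def exp_dual_gap_def
    by (subst Bochner_Integration.integral_add[OF f]) (use integrable_mult_right[OF ge] pg in auto)
  also have "(LINT \<omega>|\<Omega>. (\<Sum>i<T. gerr i \<omega>)) = (\<Sum>i<T. \<E> (gerr i))"
    using gerr_integrable[OF regular_all] by (intro Bochner_Integration.integral_sum) auto
  also have "my * (\<Sum>i<T. \<E> (gerr i)) \<le> my * (\<Sum>i<T. 2 * mv i + 2 * M\<^sup>2 * qv i)"
    using my_pos by (intro mult_left_mono sum_mono gerr_expectation) auto
  finally show ?thesis by simp
qed

lemma stationarity_eq:
  "stationarity pb r T = ennreal ((\<Sum>i<T. msq (\<lambda>\<omega>. risk_grad (uc i \<omega>))) / real T)"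
proof -
  have "(\<integral>\<^sup>+\<omega>. ennreal ((norm (grad_x_risk pb (xc pb r i \<omega>) (yc pb r i \<omega>)))\<^sup>2) \<partial>\<Omega>)
      + (\<integral>\<^sup>+\<omega>. ennreal ((norm (grad_y_risk pb (xc pb r i \<omega>) (yc pb r i \<omega>)))\<^sup>2) \<partial>\<Omega>)
      = ennreal (msq (\<lambda>\<omega>. risk_grad (uc i \<omega>)))" if i: "i < T" for i
  proof -
    have uc: "uc i \<omega> = (xc pb r i \<omega>, yc pb r i \<omega>)" for \<omega>
      by (simp add: uc_def xc_def yc_def u_def centroid_def prod_eq_iff fst_sum snd_sum)
    have m: "(\<lambda>\<omega>. fst (risk_grad (uc i \<omega>))) \<in> borel_measurable \<Omega>" "(\<lambda>\<omega>. snd (risk_grad (uc i \<omega>))) \<in> borel_measurable \<Omega>"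
      using risk_grad_P[of i] by (auto simp: borel_prod[symmetric])
    have "ennreal (msq (\<lambda>\<omega>. risk_grad (uc i \<omega>))) = (\<integral>\<^sup>+\<omega>. ennreal ((norm (risk_grad (uc i \<omega>)))\<^sup>2) \<partial>\<Omega>)"
      using square_integrableD(2)[OF risk_grad_sq[OF i]] by (intro nn_integral_eq_integral[symmetric]) auto
    also have "\<dots> = (\<integral>\<^sup>+\<omega>. ennreal ((norm (fst (risk_grad (uc i \<omega>))))\<^sup>2) + ennreal ((norm (snd (risk_grad (uc i \<omega>))))\<^sup>2) \<partial>\<Omega>)"
      by (intro nn_integral_cong) (simp add: norm_prod_def ennreal_plus[symmetric] del: ennreal_plus)
    also have "\<dots> = (\<integral>\<^sup>+\<omega>. ennreal ((norm (fst (risk_grad (uc i \<omega>))))\<^sup>2) \<partial>\<Omega>) + (\<integral>\<^sup>+\<omega>. ennreal ((norm (snd (risk_grad (uc i \<omega>))))\<^sup>2) \<partial>\<Omega>)"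
      using m by (intro nn_integral_add) auto
    finally show ?thesis by (simp add: risk_grad_def uc)
  qed
  then have "stationarity pb r T = (\<Sum>i<T. ennreal (msq (\<lambda>\<omega>. risk_grad (uc i \<omega>)))) / of_nat T"
    unfolding stationarity_def by simp
  also have "\<dots> = ennreal (\<Sum>i<T. msq (\<lambda>\<omega>. risk_grad (uc i \<omega>))) / ennreal (real T)"
    by (subst sum_ennreal) (auto simp: ennreal_of_nat_eq_real_of_nat)
  also have "\<dots> = ennreal ((\<Sum>i<T. msq (\<lambda>\<omega>. risk_grad (uc i \<omega>))) / real T)"
    using T by (intro divide_ennreal sum_nonneg) auto
  finally show ?thesis .
qed

end

section \<open>Summation of the coupled recursions\<close>

lemma geometric_recursion_sum:
  fixes x w :: "nat \<Rightarrow> real"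
  assumes "0 \<le> a" "a \<le> 1" "\<And>i. 0 \<le> x i" "\<And>i. i < n \<Longrightarrow> x (Suc i) \<le> (1 - a) * x i + w i"
  shows "a * (\<Sum>i<Suc n. x i) \<le> x 0 + (\<Sum>i<n. w i)"
proof -
  \<comment> \<open>The surplus \<open>(1 - a) * x m\<close> is what the next step of the recursion
    consumes.\<close>
  have partial: "a * (\<Sum>i<Suc m. x i) + (1 - a) * x m \<le> x 0 + (\<Sum>i<m. w i)" if "m \<le> n" for m
    using that
  proof (induction m)
    case (Suc m)
    have "a * (\<Sum>i<Suc (Suc m). x i) + (1 - a) * x (Suc m) = a * (\<Sum>i<Suc m. x i) + x (Suc m)"
      by (simp add: algebra_simps)
    then show ?case using Suc assms(4)[of m] by simp
  qed (simp add: algebra_simps)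
  have "0 \<le> (1 - a) * x n" using assms by simp
  then show ?thesis using partial[OF order_refl] by linarith
qed

text \<open>
  The coupled recursions of the consensus, estimation and movement errors.  The constant 3600 makes
  the consensus error contribute less than half of itself through the movement of the agents.
\<close>

lemma coupled_recursion_totals:
  fixes q l m d h r ph :: "nat \<Rightarrow> real"
  assumes nn: "\<And>i. 0 \<le> q i" "\<And>i. 0 \<le> l i" "\<And>i. 0 \<le> m i" "\<And>i. 0 \<le> d i" "\<And>i. 0 \<le> h i" "\<And>i. 0 \<le> ph i" "\<And>i. 0 \<le> r i"
    and par: "0 < p" "p \<le> 1" "1 \<le> b" "0 < K" "0 < B" "0 \<le> s" "0 \<le> M2" "0 < g" "g \<le> 1" "0 \<le> Z" "0 \<le> mysq"
    and Kbp: "1 \<le> K * b * p" and small: "3600 * (M2 * mysq) \<le> g ^ 3"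
    and rec_d: "\<And>i. i < n \<Longrightarrow> d i \<le> 2 * h i + 4 * q (Suc i) + 4 * q i"
    and rec_m: "\<And>i. i < n \<Longrightarrow> m (Suc i) \<le> (1 - p) * (m i + 4 * M2 / (K * b) * d i) + p * (s / (K * B))"
    and rec_l: "\<And>i. i < n \<Longrightarrow> l (Suc i) \<le> (1 - p) * (l i + 4 * M2 / b * d i) + p * (s / B)"
    and rec_r: "\<And>i. i < n \<Longrightarrow> r i \<le> (1 - p) * (4 * M2 / b * d i) + p * (l i + s / B)"
    and rec_ph: "\<And>i. i < n \<Longrightarrow> ph (Suc i) \<le> (1 - g / 2) * ph i + 3 / g * (mysq * (2 * r i + 2 * M2 * d i))"
    and rec_q: "\<And>i. i < n \<Longrightarrow> q (Suc i) \<le> 2 / g * ph i"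
    and init: "q 0 = 0" "ph 0 \<le> mysq * Z" "m 0 \<le> s / (K * b)" "l 0 \<le> s / b"
  shows "(\<Sum>i<Suc n. 2 * m i + 2 * M2 * q i)
    \<le> 33 * M2 * (\<Sum>i<Suc n. h i) + 10 * (g * Z + s / b + real n * p * (s / B)) + 2 * s + 2 * (real n * (s / (K * B)))"
proof -
  define D where "D = (\<Sum>i<n. d i)"
  define H where "H = (\<Sum>i<Suc n. h i)"
  define Q where "Q = (\<Sum>i<Suc n. q i)"
  define E where "E = (\<Sum>i<Suc n. l i)"
  define R where "R = (\<Sum>i<n. r i)"
  define F where "F = (\<Sum>i<Suc n. ph i)"
  define Mm where "Mm = (\<Sum>i<Suc n. m i)"
  define t where "t = real n * p * (s / B)"
  have pos: "0 \<le> D" "0 \<le> H" "0 \<le> Q" "0 \<le> E" "0 \<le> F" "0 \<le> t"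
    unfolding D_def H_def Q_def E_def F_def t_def using nn par by (simp_all add: sum_nonneg)
  have q1: "(\<Sum>i<n. q (Suc i)) = Q" unfolding Q_def using init(1) by (subst sum.lessThan_Suc_shift) simp
  have D: "D \<le> 2 * H + 8 * Q"
  proof -
    have "D \<le> (\<Sum>i<n. 2 * h i + 4 * q (Suc i) + 4 * q i)" unfolding D_def using rec_d by (intro sum_mono) auto
    also have "\<dots> = 2 * (\<Sum>i<n. h i) + 4 * Q + 4 * (\<Sum>i<n. q i)"
      by (simp add: sum.distrib sum_distrib_left[symmetric] q1)
    finally show ?thesis using nn(1)[of n] nn(5)[of n] unfolding H_def Q_def by simp
  qed
  \<comment> \<open>For local errors the division by \<open>b\<close> is given up: only the averaged
    error needs its gain.\<close>
  have w_le: "(1 - p) * (4 * M2 / b * x) \<le> 4 * M2 * x" if "0 \<le> x" for x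
  proof -
    have "4 * M2 / b * x \<le> 4 * M2 * x" using par that by (intro mult_right_mono) (auto simp: divide_le_eq mult_le_cancel_left1)
    moreover have "(1 - p) * (4 * M2 / b * x) \<le> 1 * (4 * M2 / b * x)" using par that by (intro mult_right_mono) auto
    ultimately show ?thesis by simp
  qed
  have E: "p * E \<le> s / b + 4 * M2 * D + t"
  proof -
    have "p * E \<le> l 0 + (\<Sum>i<n. 4 * M2 * d i + p * (s / B))"
      unfolding E_def
    proof (rule geometric_recursion_sum)
      fix i assume "i < n"
      then show "l (Suc i) \<le> (1 - p) * l i + (4 * M2 * d i + p * (s / B))"
        using rec_l[of i] w_le[OF nn(4)[of i]] by (simp add: distrib_left)
    qed (use par nn in auto)
    then show ?thesis using init(4) by (simp add: sum.distrib sum_distrib_left[symmetric] D_def t_def)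
  qed
  have R: "R \<le> 8 * M2 * D + s / b + 2 * t"
  proof -
    have "R \<le> (\<Sum>i<n. 4 * M2 * d i + p * l i + p * (s / B))"
      unfolding R_def
    proof (rule sum_mono)
      fix i assume "i \<in> {..<n}"
      then show "r i \<le> 4 * M2 * d i + p * l i + p * (s / B)"
        using rec_r[of i] w_le[OF nn(4)[of i]] by (simp add: distrib_left)
    qed
    also have "\<dots> = 4 * M2 * D + p * (\<Sum>i<n. l i) + t"
      by (simp add: sum.distrib sum_distrib_left[symmetric] D_def t_def)
    also have "p * (\<Sum>i<n. l i) \<le> p * E" using par nn(2)[of n] unfolding E_def by (intro mult_left_mono) auto
    finally show ?thesis using E by simp
  qed
  have F: "g / 2 * F \<le> mysq * Z + 3 / g * (mysq * (2 * R + 2 * M2 * D))"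
  proof -
    have "g / 2 * F \<le> ph 0 + (\<Sum>i<n. 3 / g * (mysq * (2 * r i + 2 * M2 * d i)))"
      unfolding F_def using par nn rec_ph by (intro geometric_recursion_sum) auto
    also have "(\<Sum>i<n. 3 / g * (mysq * (2 * r i + 2 * M2 * d i))) = 3 / g * (mysq * (2 * R + 2 * M2 * D))"
      unfolding R_def D_def by (simp add: sum_distrib_left sum.distrib distrib_left)
    finally show ?thesis using init(2) by simp
  qed
  have QF: "Q \<le> 2 / g * F"
  proof -
    have "Q \<le> (\<Sum>i<n. 2 / g * ph i)" unfolding q1[symmetric] using rec_q by (intro sum_mono) auto
    also have "\<dots> = 2 / g * (\<Sum>i<n. ph i)" by (simp add: sum_distrib_left)
    also have "\<dots> \<le> 2 / g * F" unfolding F_def using par nn(6)[of n] by (intro mult_left_mono) auto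
    finally show ?thesis .
  qed
  define Y where "Y = M2 * Q"
  define A where "A = M2 * H"
  define G where "G = M2 * D"
  have pos2: "0 \<le> Y" "0 \<le> A" "0 \<le> G" "0 \<le> g * Z" "0 \<le> s / b" using pos par by (auto simp: Y_def A_def G_def)
  have GY: "G \<le> 2 * A + 8 * Y"
    using mult_left_mono[OF D par(7)] by (simp add: G_def A_def Y_def algebra_simps)
  \<comment> \<open>Substituting \<open>F\<close> into \<open>QF\<close>: the bound
    \<open>2 / g\<close> on the disagreement, the factor \<open>2 / g\<close> of the summed
    contraction and \<open>3 / g\<close> from Young's inequality multiply to
    \<open>12 / g^3\<close>; the initial potential meets only the first two.\<close>
  have "Y \<le> (4 / g\<^sup>2) * (M2 * mysq * Z) + (12 / g ^ 3) * (M2 * mysq * (2 * R + 2 * G))"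
  proof -
    have "F \<le> 2 / g * (mysq * Z + 3 / g * (mysq * (2 * R + 2 * M2 * D)))"
      using F par by (simp add: field_simps)
    then have "2 / g * F \<le> 2 / g * (2 / g * (mysq * Z + 3 / g * (mysq * (2 * R + 2 * M2 * D))))"
      using par by (intro mult_left_mono) auto
    with QF have "M2 * Q \<le> M2 * (2 / g * (2 / g * (mysq * Z + 3 / g * (mysq * (2 * R + 2 * M2 * D)))))"
      using par by (intro mult_left_mono) auto
    also have "\<dots> = (4 / g\<^sup>2) * (M2 * mysq * Z) + (12 / g ^ 3) * (M2 * mysq * (2 * R + 2 * G))"
      using par by (simp add: G_def field_simps power2_eq_square power3_eq_cube)
    finally show ?thesis by (simp add: Y_def)
  qed
  also have "\<dots> \<le> (4 / g\<^sup>2) * (g ^ 3 / 3600 * Z) + (12 / g ^ 3) * (g ^ 3 / 3600 * (18 * G + 2 * (s / b) + 4 * t))"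
  proof -
    have c: "M2 * mysq \<le> g ^ 3 / 3600" using small by simp
    have "2 * R + 2 * G \<le> 18 * G + 2 * (s / b) + 4 * t" using R unfolding G_def by linarith
    then have "M2 * mysq * (2 * R + 2 * G) \<le> g ^ 3 / 3600 * (18 * G + 2 * (s / b) + 4 * t)"
      using c par pos2 nn(7) by (intro mult_mono) (simp_all add: R_def sum_nonneg)
    then show ?thesis
      using par by (intro add_mono mult_left_mono mult_right_mono[OF c]) auto
  qed
  also have "\<dots> = g * Z / 900 + (18 * G + 2 * (s / b) + 4 * t) / 300"
  proof -
    have *: "(4 / g\<^sup>2) * (g ^ 3 / 3600 * x) = g * x / 900" "(12 / g ^ 3) * (g ^ 3 / 3600 * x) = x / 300" for x
      using par by (simp_all add: power2_eq_square power3_eq_cube)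
    show ?thesis by (simp only: *)
  qed
  finally have Y: "Y \<le> g * Z / 900 + (18 * G + 2 * (s / b) + 4 * t) / 300" .
  \<comment> \<open>The loop closes here. Inserting \<open>G \<le> 2 A + 8 Y\<close> leaves
    \<open>144/300\<close> of \<open>Y\<close> on the right, which is absorbed on the left; the 18
    collects \<open>2 R\<close> with \<open>R \<le> 8 G + ...\<close> and
    \<open>2 G\<close>.\<close>
  have "4 * Y \<le> A + (w + q + t) \<and> G \<le> 4 * A + (w + q + t)"
    if "Y \<le> w / 900 + (18 * G + 2 * q + 4 * t) / 300" "G \<le> 2 * A + 8 * Y" "0 \<le> w" "0 \<le> q" "0 \<le> t" "0 \<le> A"
    for w q :: real
    using that by argo
  from this[OF Y GY] have Y': "4 * Y \<le> A + (g * Z + s / b + t)" and G': "G \<le> 4 * A + (g * Z + s / b + t)"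
    using pos pos2 by auto
  have Mm: "Mm \<le> s + 4 * G + real n * (s / (K * B))"
  proof -
    have "p * Mm \<le> m 0 + (\<Sum>i<n. 4 * M2 / (K * b) * d i + p * (s / (K * B)))"
      unfolding Mm_def
    proof (rule geometric_recursion_sum)
      fix i assume "i < n"
      have "(1 - p) * (4 * M2 / (K * b) * d i) \<le> 1 * (4 * M2 / (K * b) * d i)" using par nn(4)[of i] by (intro mult_right_mono) auto
      then show "m (Suc i) \<le> (1 - p) * m i + (4 * M2 / (K * b) * d i + p * (s / (K * B)))"
        using rec_m[OF \<open>i < n\<close>] by (simp add: distrib_left)
    qed (use par nn in auto)
    also have "\<dots> = m 0 + (4 * M2 / (K * b) * D + real n * (p * (s / (K * B))))"
      unfolding sum.distrib D_def sum_distrib_left by simp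
    also have "\<dots> \<le> s / (K * b) + 4 * G / (K * b) + p * (real n * (s / (K * B)))"
      using init(3) by (simp add: G_def ac_simps)
    \<comment> \<open>The two uses of \<open>1 \<le> K b p\<close>: the initial error and the growth
      by movement both gain a factor \<open>p\<close>, to be cancelled against the \<open>p\<close>
      in front of the sum.\<close>
    also have "s / (K * b) \<le> p * s"
      using mult_left_mono[OF Kbp par(6)] par by (simp add: divide_le_eq ac_simps)
    also have "4 * G / (K * b) \<le> p * (4 * G)"
      using mult_left_mono[OF Kbp, of "4 * G"] par pos2 by (simp add: divide_le_eq ac_simps)
    finally have "p * Mm \<le> p * (s + 4 * G + real n * (s / (K * B)))" by (simp add: distrib_left)
    then show ?thesis using par by simp
  qed
  have "(\<Sum>i<Suc n. 2 * m i + 2 * M2 * q i) = 2 * Mm + 2 * Y"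
    unfolding Mm_def Y_def Q_def by (simp only: sum.distrib sum_distrib_left mult.assoc)
  also have "\<dots> \<le> 33 * A + 10 * (g * Z + s / b + t) + 2 * s + 2 * (real n * (s / (K * B)))"
  proof -
    \<comment> \<open>\<open>8 G\<close> contributes \<open>32 A\<close> and \<open>2 Y\<close> half
      of \<open>A\<close>, rounded up to 33; likewise the remainder \<open>w\<close> gets
      \<open>8 + 1/2\<close>, rounded up to 10.\<close>
    have "2 * Mm + 2 * Y \<le> 33 * A + 10 * w + 2 * s + 2 * x"
      if "Mm \<le> s + 4 * G + x" "4 * Y \<le> A + w" "G \<le> 4 * A + w" "0 \<le> w" "0 \<le> A" for w x
      using that by argo
    then show ?thesis using Mm Y' G' pos pos2 by simp
  qed
  finally show ?thesis by (simp only: A_def H_def t_def mult.assoc)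
qed

section \<open>Stationarity summed over the horizon\<close>

context extra_run_steps begin

lemma gaps_nonneg: "0 \<le> exp_primal_gap pb r" "0 \<le> exp_dual_gap pb r" "0 \<le> zeta_sq pb c r"
proof -
  have mem: "xc pb r 0 \<omega> \<in> X" "yc pb r 0 \<omega> \<in> Y" if "\<omega> \<in> space \<Omega>" for \<omega>
  proof -
    have "uc 0 \<omega> = (xc pb r 0 \<omega>, yc pb r 0 \<omega>)"
      by (simp add: uc_def xc_def yc_def u_def centroid_def prod_eq_iff fst_sum snd_sum)
    then show "xc pb r 0 \<omega> \<in> X" "yc pb r 0 \<omega> \<in> Y" using uc_in[OF that, of 0] by auto
  qed
  show "0 \<le> exp_primal_gap pb r" "0 \<le> exp_dual_gap pb r"
    unfolding exp_primal_gap_def exp_dual_gap_def primal_gap_def dual_gap_def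
    using mem primal_opt_le risk_le_primal by (intro integral_nonneg_AE AE_I2; simp)+
  show "0 \<le> zeta_sq pb c r"
    unfolding zeta_sq_def zeta_x_def zeta_y_def sq_norm_stack_def
    by (intro add_nonneg_nonneg divide_nonneg_nonneg integral_nonneg_AE AE_I2 sum_nonneg) auto
qed

lemma total_stationarity:
  assumes ib: "init_batch c = small_batch c" and Kbp: "1 \<le> real K * b * p"
    and small: "3600 * (M\<^sup>2 * my\<^sup>2) \<le> gap ^ 3"
  shows "mx / 8 * (\<Sum>i<T. msq (\<lambda>\<omega>. risk_grad (uc i \<omega>))) \<le> exp_primal_gap pb r + exp_dual_gap pb r
    + my * (10 * (gap * zeta_sq pb c r + s / b + real T * p * (s / B)) + 2 * s + 2 * (real T * (s / (real K * B))))"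
proof -
  \<comment> \<open>\<open>T\<close> iterates are linked by \<open>T - 1\<close> transitions, and
    the noise condition covers exactly the iterations before \<open>T\<close>.\<close>
  obtain n where n: "T = Suc n" using T by (cases T) auto
  \<comment> \<open>This is the coefficient with which the merit inequality returns the movement of
    the centroid through the error bound; retaining \<open>\<theta>\<close> times \<open>hv\<close>
    on the left makes the two cancel. It is small enough because
    \<open>33 / 3600 < 1 / 16\<close>.\<close>
  define \<theta> where "\<theta> = 33 * M\<^sup>2 * my"
  have pp: "0 < p"
  proof -
    have "p \<noteq> 0" using Kbp by auto
    then show ?thesis using coin_prob by simp
  qed
  have pos: "0 < real K" "0 < B" "1 \<le> b" using K_pos batches by auto
  have "(\<Sum>i<Suc n. 2 * mv i + 2 * M\<^sup>2 * qv i)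
    \<le> 33 * M\<^sup>2 * (\<Sum>i<Suc n. hv i) + 10 * (gap * zeta_sq pb c r + s / b + real n * p * (s / B)) + 2 * s + 2 * (real n * (s / (real K * B)))"
    using values_nonneg gaps_nonneg(3) pp coin_prob pos gap_pos Kbp small n mv_zero lv_zero qv_zero pv_zero ib
    by (intro coupled_recursion_totals[where d = dv and r = rv and l = lv and ph = pv and mysq = "my\<^sup>2" and Z = "zeta_sq pb c r"]
        dv_step mv_step lv_step rv_step pv_step qv_step) auto
  also have "\<dots> \<le> 33 * M\<^sup>2 * (\<Sum>i<T. hv i) + (10 * (gap * zeta_sq pb c r + s / b + real T * p * (s / B)) + 2 * s + 2 * (real T * (s / (real K * B))))"
  proof -
    have "real n * p * (s / B) \<le> real T * p * (s / B)" "real n * (s / (real K * B)) \<le> real T * (s / (real K * B))"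
      using n pp pos by (auto intro!: mult_right_mono divide_right_mono)
    then show ?thesis using n by simp
  qed
  finally have tot: "(\<Sum>i<T. 2 * mv i + 2 * M\<^sup>2 * qv i) \<le> 33 * M\<^sup>2 * (\<Sum>i<T. hv i)
      + (10 * (gap * zeta_sq pb c r + s / b + real T * p * (s / B)) + 2 * s + 2 * (real T * (s / (real K * B))))"
    (is "_ \<le> _ + ?R") by (simp add: n)
  have g3: "gap ^ 3 \<le> 1" using gap_pos by (intro power_le_one) auto
  have th0: "0 \<le> \<theta>" using my_pos by (simp add: \<theta>_def)
  have thy: "\<theta> * my \<le> 1 / 16" using small g3 by (simp add: \<theta>_def power2_eq_square)
  have thx: "\<theta> * mx \<le> 1 / 16"
  proof -
    have "\<theta> * mx \<le> \<theta> * my" using th0 mx_le_my steps(1) by (intro mult_left_mono) auto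
    then show ?thesis using thy by simp
  qed
  have "(\<Sum>i<T. mx / 8 * msq (\<lambda>\<omega>. risk_grad (uc i \<omega>)) + \<theta> * hv i) \<le> (\<Sum>i<T. \<E> (progress i))"
    using th0 thx thy by (intro sum_mono progress_expectation) auto
  then have "mx / 8 * (\<Sum>i<T. msq (\<lambda>\<omega>. risk_grad (uc i \<omega>))) + \<theta> * (\<Sum>i<T. hv i)
      \<le> (exp_primal_gap pb r + exp_dual_gap pb r / 2) + my * (33 * M\<^sup>2 * (\<Sum>i<T. hv i) + ?R)"
    using progress_expectation_sum mult_left_mono[OF tot less_imp_le[OF my_pos]]
    by (simp only: sum.distrib sum_distrib_left[symmetric])
  also have "my * (33 * M\<^sup>2 * (\<Sum>i<T. hv i) + ?R) = \<theta> * (\<Sum>i<T. hv i) + my * ?R"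
    by (simp add: \<theta>_def distrib_left)
  finally show ?thesis using gaps_nonneg(2) by linarith
qed

end

section \<open>Choice of the hyperparameters\<close>

text \<open>Chosen so that \<open>M * (60 * step_constant L) = 1\<close>. As
  \<open>60^2 = 3600\<close>, the step \<open>my = step_constant L * gap powr (3/2)\<close> meets
  the smallness condition of the coupled recursions with equality.\<close>

definition step_constant :: "real \<Rightarrow> real" where
  "step_constant L = 1 / (60 * sqrt 2 * L)"

text \<open>The ratio 192 of the steps is \<open>96 * 2\<close>: the separation of time scales is
  stated for \<open>(M / \<nu>)^2\<close>, which is twice the square of
  \<open>\<kappa> = L / \<nu>\<close>.\<close>

definition page_constants_of :: "real \<Rightarrow> page_constants" where
  "page_constants_of L = \<lparr>const_B = 1, const_b = 1, const_p = 1,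
     const_x = step_constant L / 192, const_y = step_constant L\<rparr>"

text \<open>Dividing by \<open>mx / 8\<close> produces \<open>1536 = 8 * 192\<close>. The first
  summand is the inverse of \<open>step_constant L\<close>, which multiplies the initial gaps; the
  40 covers the noise terms and the initial spread.\<close>

definition rate_constant :: "real \<Rightarrow> real" where
  "rate_constant L = 1536 * (60 * sqrt 2 * L + 40)"

lemma powr_as_powers:
  fixes x :: real
  assumes "0 < x"
  shows "x powr (3/2) = (x powr (3/4))\<^sup>2" "x powr (9/4) = (x powr (3/4)) ^ 3" "(x powr (3/2))\<^sup>2 = x ^ 3"
  using assms by (simp_all add: powr_power powr_numeral)

lemma powr_three_halves_sqrt: "real T powr (3/2) = sqrt (real T) ^ 3"
proof (cases "T = 0")
  case False
  then show ?thesis by (simp add: powr_half_sqrt[symmetric] powr_power)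
qed simp

lemma coin_prob_le_one:
  assumes "0 < second_gap" "1 \<le> real T * second_gap powr (3/2)"
  shows "1 \<le> second_gap powr (3/4) * sqrt (real T)"
proof -
  have "1 \<le> (second_gap powr (3/4) * sqrt (real T))\<^sup>2"
    using assms by (simp add: power_mult_distrib powr_as_powers(1) mult.commute)
  then show ?thesis by (smt (verit, best) assms(1) mult_nonneg_nonneg one_le_power power2_le_imp_le powr_ge_zero real_sqrt_ge_zero of_nat_0_le_iff one_power2)
qed

lemma extra_run_rate:
  fixes pb :: "('a::{real_inner,second_countable_topology}, 'b::{real_inner,second_countable_topology}, 'z) minimax"
    and r :: "('w, 'a, 'b, 'z) dama_run"
  assumes L: "0 < L" and st: "extra_setting pb W V L \<nu>" and T: "1 \<le> T"
    and large: "1 \<le> real T * (1 - second_eig W) powr (3/2)"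
    and run: "dama_grace_run pb (page_extra (page_constants_of L) (agents pb) W V (L / \<nu>) T) \<sigma> T r"
  defines "c \<equiv> page_extra (page_constants_of L) (agents pb) W V (L / \<nu>) T"
  shows "stationarity pb r T \<le> ennreal (rate_constant L * rate_bound (agents pb) (L / \<nu>) (1 - second_eig W)
      (exp_primal_gap pb r) (exp_dual_gap pb r) (\<sigma>\<^sup>2) (zeta_sq pb c r) T)"
    and "0 \<le> exp_primal_gap pb r" "0 \<le> exp_dual_gap pb r" "0 \<le> zeta_sq pb c r"
proof -
  define K where "K = real (agents pb)"
  define gp where "gp = 1 - second_eig W"
  \<comment> \<open>In \<open>a\<close> and \<open>t = sqrt T\<close> all choices become monomials
    before rounding: \<open>p = 1 / (a t)\<close>, \<open>b = a t / K\<close>,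
    \<open>B = a^2 t^2 / K\<close>.\<close>
  define a where "a = gp powr (3/4)"
  define t where "t = sqrt (real T)"
  define \<kappa> where "\<kappa> = L / \<nu>"
  have set: "0 < \<nu>" "\<nu> \<le> L" "well_posed pb" "PL_condition pb \<nu>" "mean_square_smooth pb L" "2 \<le> agents pb"
    "mixing_mat (agents pb) W" "psd_sqrt (agents pb) (1\<^sub>m (agents pb) - W) V"
    using st by (auto simp: extra_setting_def)
  have K: "0 < K" using set by (simp add: K_def)
  have gp: "0 < gp" "gp \<le> 1" using mixing_mat_gap[OF set(7,6)] by (auto simp: gp_def)
  have a: "0 < a" "a \<le> 1" using gp by (auto simp: a_def powr_le1)
  have a2: "gp powr (3/2) = a\<^sup>2" "gp powr (9/4) = a ^ 3" "(a\<^sup>2)\<^sup>2 = gp ^ 3"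
    using powr_as_powers[OF gp(1)] by (simp_all add: a_def)
  have t: "0 < t" "t\<^sup>2 = real T" "real T powr (3/2) = t ^ 3" using T by (auto simp: t_def powr_three_halves_sqrt)
  have at: "1 \<le> a * t" using coin_prob_le_one[OF gp(1), of T] large by (simp add: a_def t_def gp_def)
  have \<kappa>: "1 \<le> \<kappa>" using set by (simp add: \<kappa>_def)
  define y where "y = step_constant L"
  have c: "mat_Ax c = 1\<^sub>m (agents pb)" "mat_Bx c = V" "mat_Cx c = W"
      "mat_Ay c = 1\<^sub>m (agents pb)" "mat_By c = V" "mat_Cy c = W" "beta_x c = 0" "beta_y c = 0"
      "step_x c = y / 192 * (a\<^sup>2 / \<kappa>\<^sup>2)" "step_y c = y * a\<^sup>2" "coin_prob c = 1 / (a * t)"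
      "small_batch c = nat \<lceil>a * t / K\<rceil>" "init_batch c = nat \<lceil>a * t / K\<rceil>" "big_batch c = nat \<lceil>a\<^sup>2 * t\<^sup>2 / K\<rceil>"
    unfolding c_def page_extra_def Let_def page_constants_of_def
    by (simp_all add: gp_def[symmetric] a_def[symmetric] a2 t(2) t_def[symmetric] K_def[symmetric] \<kappa>_def[symmetric] y_def[symmetric])
  have b: "a * t / K \<le> real (small_batch c)" and B: "a\<^sup>2 * t\<^sup>2 / K \<le> real (big_batch c)"
    unfolding c by (rule real_nat_ceiling_ge)+
  have bp: "0 < a * t / K" "0 < a\<^sup>2 * t\<^sup>2 / K" using a(1) t(1) K by simp_all
  have batches: "0 < big_batch c" "0 < small_batch c" "0 < init_batch c"
    using b B bp unfolding c(13) c(12)[symmetric] by (auto intro: gr0I)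
  interpret risk_problem pb L \<nu> using set by unfold_locales
  interpret extra_run pb L \<nu> W V c r \<sigma> T
    using set c batches at T run by unfold_locales (simp_all add: c_def)
  have My: "M * (60 * y) = 1" using L by (simp add: M_def y_def step_constant_def)
  have Mn: "(M / \<nu>)\<^sup>2 = 2 * \<kappa>\<^sup>2" using M(2) by (simp add: \<kappa>_def power_divide)
  have y: "0 < y" using L by (simp add: y_def step_constant_def)
  interpret extra_run_steps pb L \<nu> W V c r \<sigma> T
  proof
    show "0 < step_x c" using y a \<kappa> by (simp add: c)
    show "96 * (M / \<nu>)\<^sup>2 * step_x c \<le> step_y c" using \<kappa> unfolding Mn c(9,10) by simp
    have "6 * M * step_y c = a\<^sup>2 / 10 * (M * (60 * y))" unfolding c(10) by simp
    also have "\<dots> \<le> 1" unfolding My using a by (simp add: power_le_one order_trans[of _ 1])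
    finally show "6 * M * step_y c \<le> 1" .
  qed
  define b' where "b' = real (small_batch c)"
  define B' where "B' = real (big_batch c)"
  define p' where "p' = coin_prob c"
  have b': "a * t / K \<le> b'" "0 < b'" and B': "a\<^sup>2 * t\<^sup>2 / K \<le> B'" "0 < B'" using b B batches by (auto simp: b'_def B'_def)
  have p': "p' = 1 / (a * t)" by (simp add: p'_def c)
  have Kbp: "1 \<le> K * b' * p'"
    \<comment> \<open>Rounding upwards preserves \<open>K b \<ge> a t = 1 / p\<close>.\<close>
    using b' K a t by (simp add: p' divide_le_eq mult.commute pos_le_divide_eq)
  have small: "3600 * (M\<^sup>2 * (step_y c)\<^sup>2) \<le> gp ^ 3"
  proof -
    have "3600 * (M\<^sup>2 * (step_y c)\<^sup>2) = (M * (60 * y))\<^sup>2 * (a\<^sup>2)\<^sup>2" unfolding c(10) by (simp add: power_mult_distrib power_divide)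
    then show ?thesis unfolding My a2 by simp
  qed
  show nonneg: "0 \<le> exp_primal_gap pb r" "0 \<le> exp_dual_gap pb r" "0 \<le> zeta_sq pb c r" by (rule gaps_nonneg)+
  define Sm where "Sm = (\<Sum>i<T. msq (\<lambda>\<omega>. risk_grad (uc i \<omega>)))"
  define G where "G = exp_primal_gap pb r"
  define D where "D = exp_dual_gap pb r"
  define Z where "Z = zeta_sq pb c r"
  define v where "v = \<sigma>\<^sup>2"
  have nn: "0 \<le> G" "0 \<le> D" "0 \<le> Z" "0 \<le> v" using nonneg by (auto simp: G_def D_def Z_def v_def)
  have regroup: "10 * (x + 2 * u + 2 * u) = 10 * x + 40 * u" for x u :: real
    by simp
  have "step_x c / 8 * Sm \<le> G + D + step_y c * (10 * (gp * Z + 2 * v / b' + t\<^sup>2 * p' * (2 * v / B')) + 2 * (2 * v) + 2 * (t\<^sup>2 * (2 * v / (K * B'))))"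
    using total_stationarity[OF c(13)[folded c(12)] Kbp[unfolded K_def b'_def p'_def] small[unfolded gp_def]]
    unfolding Sm_def G_def D_def Z_def v_def gp_def b'_def B'_def p'_def K_def t(2) .
  also have "\<dots> \<le> G + D + step_y c * (10 * (gp * Z + 2 * (v * K / (a ^ 3 * t)) + 2 * (v * K / (a ^ 3 * t))) + 4 * v + 4 * (v / a\<^sup>2))"
  proof -
    \<comment> \<open>The initial batch error is of order \<open>v K / (a t)\<close>; it is weakened
      to the shape of the restart term \<open>e2\<close>, and both end in the term with
      \<open>gap powr (9/4)\<close>.\<close>
    have e1: "2 * v / b' \<le> 2 * (v * K / (a ^ 3 * t))"
    proof -
      have "v / b' \<le> v / (a * t / K)" using nn b' bp by (intro divide_left_mono mult_pos_pos) auto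
      also have "\<dots> = v * K / (a * t)" by simp
      also have "\<dots> \<le> v * K / (a ^ 3 * t)"
      proof (intro divide_left_mono mult_right_mono)
        show "a ^ 3 \<le> a" using power_decreasing[of 1 3 a] a by simp
      qed (use nn K a t in auto)
      finally show ?thesis by simp
    qed
    have e2: "t\<^sup>2 * p' * (2 * v / B') \<le> 2 * (v * K / (a ^ 3 * t))"
    proof -
      have "v / B' \<le> v / (a\<^sup>2 * t\<^sup>2 / K)" using nn B' bp by (intro divide_left_mono mult_pos_pos) auto
      then have "t\<^sup>2 * p' * (2 * (v / B')) \<le> t\<^sup>2 * p' * (2 * (v / (a\<^sup>2 * t\<^sup>2 / K)))"
        using a t by (intro mult_left_mono) (auto simp: p')
      also have "\<dots> = 2 * (v * K / (a ^ 3 * t))" using a t(1) by (simp add: p' power2_eq_square power3_eq_cube)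
      finally show ?thesis by simp
    qed
    \<comment> \<open>Restart variance of the averaged error: the gain from \<open>K\<close> agents
      makes up for batches divided by \<open>K\<close>, and the result does not depend on
      \<open>K\<close>.\<close>
    have e3: "t\<^sup>2 * (2 * v / (K * B')) \<le> 2 * (v / a\<^sup>2)"
    proof -
      have "a\<^sup>2 * t\<^sup>2 \<le> K * B'" using B' K by (simp add: pos_divide_le_eq mult.commute)
      then have "v / (K * B') \<le> v / (a\<^sup>2 * t\<^sup>2)" using nn a t(1) K B' by (intro divide_left_mono mult_pos_pos) auto
      then have "t\<^sup>2 * (2 * (v / (K * B'))) \<le> t\<^sup>2 * (2 * (v / (a\<^sup>2 * t\<^sup>2)))" by (intro mult_left_mono) auto
      also have "\<dots> = 2 * (v / a\<^sup>2)" using t(1) by simp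
      finally show ?thesis by simp
    qed
    have y0: "0 \<le> step_y c" using y by (simp add: c)
    have combine: "10 * (z + x1 + x2) + 2 * (2 * v) + 2 * x3 \<le> 10 * (z + 2 * x + 2 * x) + 4 * v + 4 * w"
      if "x1 \<le> 2 * x" "x2 \<le> 2 * x" "x3 \<le> 2 * w" for x x1 x2 x3 w z
      using that by argo
    show ?thesis by (intro add_left_mono mult_left_mono combine e1 e2 e3 y0)
  qed
  finally have S1: "step_x c / 8 * Sm \<le> G + D + step_y c * (10 * (gp * Z) + 40 * (v * K / (a ^ 3 * t)) + 4 * v + 4 * (v / a\<^sup>2))"
    by (simp only: regroup)
  have x0: "0 < step_x c" using y a \<kappa> by (simp add: c)
  have ratio: "8 / step_x c * step_y c = 1536 * \<kappa>\<^sup>2" "8 / step_x c = 1536 * (60 * sqrt 2 * L) * (\<kappa>\<^sup>2 / a\<^sup>2)"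
  proof -
    have yi: "60 * sqrt 2 * L = 1 / y" by (simp add: y_def step_constant_def)
    show "8 / step_x c * step_y c = 1536 * \<kappa>\<^sup>2" unfolding c(9,10) using y a \<kappa> by simp
    show "8 / step_x c = 1536 * (60 * sqrt 2 * L) * (\<kappa>\<^sup>2 / a\<^sup>2)" unfolding c(9,10) yi using y a \<kappa> by simp
  qed
  have "Sm = 8 / step_x c * (step_x c / 8 * Sm)" using x0 by simp
  also have "\<dots> \<le> 8 / step_x c * (G + D + step_y c * (10 * (gp * Z) + 40 * (v * K / (a ^ 3 * t)) + 4 * v + 4 * (v / a\<^sup>2)))"
    using x0 by (intro mult_left_mono S1) auto
  also have "\<dots> = 8 / step_x c * (G + D) + 8 / step_x c * step_y c * (10 * (gp * Z) + 40 * (v * K / (a ^ 3 * t)) + 4 * v + 4 * (v / a\<^sup>2))"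
    by (simp only: distrib_left mult.assoc)
  finally have "Sm \<le> 1536 * (60 * sqrt 2 * L) * (\<kappa>\<^sup>2 / a\<^sup>2) * (G + D)
      + 1536 * \<kappa>\<^sup>2 * (10 * (gp * Z) + 40 * (v * K / (a ^ 3 * t)) + 4 * v + 4 * (v / a\<^sup>2))"
    unfolding ratio(1) unfolding ratio(2) .
  also have "\<dots> \<le> rate_constant L * (\<kappa>\<^sup>2 / a\<^sup>2) * (G + D) + rate_constant L * \<kappa>\<^sup>2 * (gp * Z + v * K / (a ^ 3 * t) + v + v / a\<^sup>2)"
  proof (intro add_mono)
    show "1536 * (60 * sqrt 2 * L) * (\<kappa>\<^sup>2 / a\<^sup>2) * (G + D) \<le> rate_constant L * (\<kappa>\<^sup>2 / a\<^sup>2) * (G + D)"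
      using nn by (intro mult_right_mono) (auto simp: rate_constant_def)
    have q: "0 \<le> gp * Z" "0 \<le> v * K / (a ^ 3 * t)" "0 \<le> v" "0 \<le> v / a\<^sup>2" using nn gp a t K by auto
    have weights: "10 * x + 40 * y + 4 * z + 4 * w \<le> 40 * (x + y + z + w)"
      if "0 \<le> x" "0 \<le> y" "0 \<le> z" "0 \<le> w" for x y z w :: real
      using that by argo
    have "1536 * \<kappa>\<^sup>2 * (10 * (gp * Z) + 40 * (v * K / (a ^ 3 * t)) + 4 * v + 4 * (v / a\<^sup>2))
      \<le> 1536 * \<kappa>\<^sup>2 * (40 * (gp * Z + v * K / (a ^ 3 * t) + v + v / a\<^sup>2))"
      by (intro mult_left_mono weights q) auto
    also have "\<dots> = 1536 * 40 * (\<kappa>\<^sup>2 * (gp * Z + v * K / (a ^ 3 * t) + v + v / a\<^sup>2))" by simp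
    also have "\<dots> \<le> rate_constant L * (\<kappa>\<^sup>2 * (gp * Z + v * K / (a ^ 3 * t) + v + v / a\<^sup>2))"
      using q L by (intro mult_right_mono) (auto simp: rate_constant_def)
    finally show "1536 * \<kappa>\<^sup>2 * (10 * (gp * Z) + 40 * (v * K / (a ^ 3 * t)) + 4 * v + 4 * (v / a\<^sup>2))
      \<le> rate_constant L * \<kappa>\<^sup>2 * (gp * Z + v * K / (a ^ 3 * t) + v + v / a\<^sup>2)" by (simp only: mult.assoc)
  qed
  finally have "Sm / t\<^sup>2 \<le> (rate_constant L * (\<kappa>\<^sup>2 / a\<^sup>2) * (G + D) + rate_constant L * \<kappa>\<^sup>2 * (gp * Z + v * K / (a ^ 3 * t) + v + v / a\<^sup>2)) / t\<^sup>2"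
    by (rule divide_right_mono) simp
  also have "\<dots> = rate_constant L * (\<kappa>\<^sup>2 * G / (t\<^sup>2 * a\<^sup>2) + \<kappa>\<^sup>2 * D / (t\<^sup>2 * a\<^sup>2) + \<kappa>\<^sup>2 * v / (t\<^sup>2 * a\<^sup>2)
      + \<kappa>\<^sup>2 * Z * gp / t\<^sup>2 + \<kappa>\<^sup>2 * v / t\<^sup>2 + \<kappa>\<^sup>2 * K * v / (a ^ 3 * t ^ 3))"
    using a t(1) by (simp add: field_simps power2_eq_square power3_eq_cube)
  also have "\<dots> \<le> rate_constant L * (\<kappa>\<^sup>2 * G / (t\<^sup>2 * a\<^sup>2) + \<kappa>\<^sup>2 * D / (t\<^sup>2 * a\<^sup>2) + \<kappa>\<^sup>2 * v / (t\<^sup>2 * a\<^sup>2)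
      + \<kappa>\<^sup>2 * Z * gp / t\<^sup>2 + \<kappa>\<^sup>2 * v / t\<^sup>2 + \<kappa>\<^sup>2 * K * v / (a ^ 3 * t ^ 3) + \<kappa>\<^sup>2 * K * gp powr (5/4) * Z / t ^ 3)"
    using L nn K t by (intro mult_left_mono) (auto simp: rate_constant_def)
  finally have "Sm / real T \<le> rate_constant L * rate_bound (agents pb) \<kappa> gp G D v Z T"
    by (simp add: rate_bound_def a2 t K_def[symmetric])
  then show "stationarity pb r T \<le> ennreal (rate_constant L * rate_bound (agents pb) (L / \<nu>) (1 - second_eig W)
      (exp_primal_gap pb r) (exp_dual_gap pb r) (\<sigma>\<^sup>2) (zeta_sq pb c r) T)"
    unfolding stationarity_eq Sm_def G_def D_def v_def Z_def gp_def \<kappa>_def by (rule ennreal_leI)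
qed

text \<open>Once \<open>2 K \<le> a t\<close>, with \<open>a = g powr (3/4)\<close> and
  \<open>t = sqrt T\<close>, each term carrying \<open>K\<close> is at most half of the leading
  order \<open>1 / (T g powr (3/2))\<close>; five full terms and two halves make 6.\<close>

lemma rate_bound_le:
  assumes g: "0 < g" "g \<le> 1" and K: "0 < K" and T: "0 < T" "2 * real K \<le> g powr (3/4) * sqrt (real T)"
    and A: "0 \<le> A" "G \<le> A" "D \<le> A" "v \<le> A" "Z \<le> A" "0 \<le> G" "0 \<le> D" "0 \<le> v" "0 \<le> Z"
  shows "rate_bound K \<kappa> g G D v Z T \<le> 6 * A * \<kappa>\<^sup>2 / (real T * g powr (3/2))"
proof -
  define a where "a = g powr (3/4)"
  define t where "t = sqrt (real T)"
  have a: "0 < a" "a \<le> 1" using g by (auto simp: a_def powr_le1)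
  have a2: "g powr (3/2) = a\<^sup>2" "g powr (9/4) = a ^ 3" using powr_as_powers[OF g(1)] by (simp_all add: a_def)
  have t: "0 < t" "real T = t\<^sup>2" "real T powr (3/2) = t ^ 3" using T by (auto simp: t_def powr_three_halves_sqrt)
  have at: "2 * real K \<le> a * t" using T by (simp add: a_def t_def)
  define u where "u = 1 / (t\<^sup>2 * a\<^sup>2)"
  have u0: "0 < u" using a t by (simp add: u_def)
  have u1: "1 / t\<^sup>2 \<le> u" "g / t\<^sup>2 \<le> u"
  proof -
    have "a\<^sup>2 \<le> 1" using a by (simp add: power_le_one)
    then have "t\<^sup>2 * a\<^sup>2 \<le> t\<^sup>2 * 1" by (intro mult_left_mono) auto
    then show 1: "1 / t\<^sup>2 \<le> u" unfolding u_def using a t by (intro divide_left_mono) auto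
    have "g / t\<^sup>2 \<le> 1 / t\<^sup>2" using g by (intro divide_right_mono) auto
    then show "g / t\<^sup>2 \<le> u" using 1 by simp
  qed
  have u2: "real K / (a ^ 3 * t ^ 3) \<le> u / 2"
  proof -
    have "real K / (a ^ 3 * t ^ 3) \<le> (a * t / 2) / (a ^ 3 * t ^ 3)" using at a t by (intro divide_right_mono) auto
    also have "\<dots> = u / 2" using a t by (simp add: u_def power2_eq_square power3_eq_cube)
    finally show ?thesis .
  qed
  have u3: "real K * g powr (5/4) / t ^ 3 \<le> u / 2"
  proof -
    have "real K * g powr (5/4) / t ^ 3 \<le> real K * 1 / t ^ 3"
      using g t K by (intro divide_right_mono mult_left_mono) (auto simp: powr_le1)
    also have "\<dots> \<le> real K / (a ^ 3 * t ^ 3)"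
      using a t K by (simp, intro divide_left_mono) (auto simp: mult_le_cancel_right1 power_le_one)
    finally show ?thesis using u2 by linarith
  qed
  have "rate_bound K \<kappa> g G D v Z T = \<kappa>\<^sup>2 * (u * G + u * D + u * v + g / t\<^sup>2 * Z + 1 / t\<^sup>2 * v
      + real K / (a ^ 3 * t ^ 3) * v + real K * g powr (5/4) / t ^ 3 * Z)"
    unfolding rate_bound_def a2 t(2,3)[symmetric] by (simp add: t a2 u_def distrib_left ac_simps)
  also have "\<dots> \<le> \<kappa>\<^sup>2 * (u * A + u * A + u * A + u * A + u * A + u / 2 * A + u / 2 * A)"
    using u0 u1 u2 u3 A by (intro mult_left_mono add_mono mult_mono) auto
  also have "\<dots> = 6 * A * \<kappa>\<^sup>2 / (real T * g powr (3/2))" by (simp add: t a2 u_def ac_simps)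
  finally show ?thesis .
qed

text \<open>Small batches and restarts are balanced: before rounding, \<open>T b\<close> and
  \<open>T p B\<close> both equal \<open>a t^3 / K\<close>, and the initial batch is
  \<open>a t / K\<close>. Inserting \<open>t \<le> Q \<kappa> / (\<epsilon> a)\<close> gives the two
  summands. As \<open>a t / K\<close> is at least 1, rounding up at most doubles a batch.\<close>

lemma expected_samples_le:
  assumes g: "0 < 1 - second_eig W" "1 - second_eig W \<le> 1" and K: "0 < K" and \<kappa>: "0 < \<kappa>" and e: "0 < \<epsilon>" and Q: "1 \<le> Q"
    and N: "0 < N" "2 * real K \<le> (1 - second_eig W) powr (3/4) * sqrt (real N)"
      "real N \<le> Q * (\<kappa>\<^sup>2 / (\<epsilon>\<^sup>2 * (1 - second_eig W) powr (3/2)))"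
  shows "expected_samples (page_extra (page_constants_of L) K W V \<kappa> N) N
    \<le> 4 * Q\<^sup>2 * (\<kappa> ^ 3 / (\<epsilon> ^ 3 * (1 - second_eig W) powr (3/2) * real K) + \<kappa> / (\<epsilon> * real K))"
proof -
  define g where "g = 1 - second_eig W"
  define a where "a = g powr (3/4)"
  define t where "t = sqrt (real N)"
  have g: "0 < g" "g \<le> 1" using g by (auto simp: g_def)
  have a: "0 < a" "a \<le> 1" using g by (auto simp: a_def powr_le1)
  have a2: "g powr (3/2) = a\<^sup>2" using powr_as_powers[OF g(1)] by (simp_all add: a_def)
  have t: "0 < t" "t\<^sup>2 = real N" using N by (auto simp: t_def)
  have at: "2 * real K \<le> a * t" using N by (simp add: a_def t_def g_def)
  have K1: "1 \<le> real K" using K by simp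
  let ?c = "page_extra (page_constants_of L) K W V \<kappa> N"
  have c: "coin_prob ?c = 1 / (a * t)" "small_batch ?c = nat \<lceil>a * t / K\<rceil>" "init_batch ?c = nat \<lceil>a * t / K\<rceil>"
    "big_batch ?c = nat \<lceil>a\<^sup>2 * t\<^sup>2 / K\<rceil>"
    unfolding page_extra_def Let_def page_constants_of_def
    by (simp_all add: g_def[symmetric] a_def[symmetric] a2 t(2) t_def[symmetric])
  have ceil: "real (nat \<lceil>x\<rceil>) \<le> x + 1" if "0 \<le> x" for x :: real
    using that by linarith
  have one: "1 \<le> a * t / K" using at K1 by (simp add: le_divide_eq)
  have b: "real (nat \<lceil>a * t / K\<rceil>) \<le> 2 * (a * t / K)" using ceil[of "a * t / K"] one by linarith
  have B: "real (nat \<lceil>a\<^sup>2 * t\<^sup>2 / K\<rceil>) \<le> 2 * (a\<^sup>2 * t\<^sup>2 / K)"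
  proof -
    have "1 * (a * t / K) \<le> (a * t) * (a * t / K)" using at K1 one by (intro mult_right_mono) auto
    then have "1 \<le> a\<^sup>2 * t\<^sup>2 / K" using one by (simp add: power2_eq_square ac_simps)
    then show ?thesis using ceil[of "a\<^sup>2 * t\<^sup>2 / K"] by linarith
  qed
  have p: "0 \<le> 1 / (a * t)" "0 < a * t" using a t by auto
  have s1: "t\<^sup>2 * (1 - 1 / (a * t)) * real (nat \<lceil>a * t / K\<rceil>) \<le> t\<^sup>2 * 1 * (2 * (a * t / K))"
  proof (rule mult_mono[OF _ b])
    show "t\<^sup>2 * (1 - 1 / (a * t)) \<le> t\<^sup>2 * 1" using p by (intro mult_left_mono) auto
  qed (simp, rule of_nat_0_le_iff)
  have s2: "t\<^sup>2 * (1 / (a * t)) * real (nat \<lceil>a\<^sup>2 * t\<^sup>2 / K\<rceil>) \<le> t\<^sup>2 * (1 / (a * t)) * (2 * (a\<^sup>2 * t\<^sup>2 / K))"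
    using B p by (intro mult_left_mono) auto
  have "expected_samples ?c N \<le> t\<^sup>2 * 1 * (2 * (a * t / K)) + t\<^sup>2 * (1 / (a * t)) * (2 * (a\<^sup>2 * t\<^sup>2 / K)) + 2 * (a * t / K)"
    unfolding expected_samples_def c t(2)[symmetric] using s1 s2 b by linarith
  also have "\<dots> = 4 * (a * t ^ 3 / K) + 2 * (a * t / K)"
    using a t(1) by (simp add: power2_eq_square power3_eq_cube)
  also have "\<dots> \<le> 4 * (a * (Q\<^sup>2 * (\<kappa> ^ 3 / (\<epsilon> ^ 3 * a ^ 3))) / K) + 2 * (a * (Q\<^sup>2 * (\<kappa> / (\<epsilon> * a))) / K)"
  proof -
    define w where "w = \<kappa> / (\<epsilon> * a)"
    have w: "0 < w" using \<kappa> e a by (simp add: w_def)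
    have "t\<^sup>2 \<le> Q * w\<^sup>2"
      using N(3) unfolding t(2) g_def[symmetric] a2 by (simp add: w_def power_divide power_mult_distrib)
    also have "\<dots> \<le> Q\<^sup>2 * w\<^sup>2" using Q by (intro mult_right_mono) (auto simp: power2_eq_square)
    finally have "t\<^sup>2 \<le> (Q * w)\<^sup>2" by (simp add: power_mult_distrib)
    then have tQ: "t \<le> Q * w" by (rule power2_le_imp_le) (use Q w in simp)
    have t3: "t ^ 3 \<le> Q\<^sup>2 * w ^ 3"
    proof -
      have "t ^ 3 = t\<^sup>2 * t" by (simp add: power2_eq_square power3_eq_cube)
      also have "\<dots> \<le> (Q * w\<^sup>2) * (Q * w)" using \<open>t\<^sup>2 \<le> Q * w\<^sup>2\<close> tQ t Q w by (intro mult_mono) auto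
      finally show ?thesis by (simp add: power2_eq_square power3_eq_cube ac_simps)
    qed
    have "Q * w \<le> Q\<^sup>2 * w" using Q w by (intro mult_right_mono) (auto simp: power2_eq_square)
    then have t1: "t \<le> Q\<^sup>2 * w" using tQ by simp
    have w3: "w ^ 3 = \<kappa> ^ 3 / (\<epsilon> ^ 3 * a ^ 3)" by (simp add: w_def power_divide power_mult_distrib)
    show ?thesis
      unfolding w3[symmetric] w_def[symmetric] using t1 t3 a K1
      by (intro add_mono mult_left_mono divide_right_mono) auto
  qed
  also have "\<dots> \<le> 4 * Q\<^sup>2 * (\<kappa> ^ 3 / (\<epsilon> ^ 3 * a\<^sup>2 * K) + \<kappa> / (\<epsilon> * K))"
  proof -
    have "a * (Q\<^sup>2 * (\<kappa> ^ 3 / (\<epsilon> ^ 3 * a ^ 3))) / K = Q\<^sup>2 * (\<kappa> ^ 3 / (\<epsilon> ^ 3 * a\<^sup>2 * K))"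
      "a * (Q\<^sup>2 * (\<kappa> / (\<epsilon> * a))) / K = Q\<^sup>2 * (\<kappa> / (\<epsilon> * K))"
      using a by (simp_all add: power2_eq_square power3_eq_cube)
    moreover have "0 \<le> Q\<^sup>2 * (\<kappa> / (\<epsilon> * K))" using \<kappa> e by simp
    ultimately have "4 * (a * (Q\<^sup>2 * (\<kappa> ^ 3 / (\<epsilon> ^ 3 * a ^ 3))) / K) + 2 * (a * (Q\<^sup>2 * (\<kappa> / (\<epsilon> * a))) / K)
        \<le> 4 * (Q\<^sup>2 * (\<kappa> ^ 3 / (\<epsilon> ^ 3 * a\<^sup>2 * K))) + 4 * (Q\<^sup>2 * (\<kappa> / (\<epsilon> * K)))" by linarith
    then show ?thesis by (simp only: distrib_left mult.assoc)
  qed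
  finally show ?thesis by (simp add: g_def[symmetric] a2)
qed

text \<open>The hyperparameter constants and the constant of the rate are functions of
  \<open>L\<close> alone, fixed before \<open>\<nu>\<close> and the problem. The complexities follow
  from the rate: beyond a threshold on \<open>T\<close> its leading order dominates, and solving for
  \<open>\<epsilon>^2\<close> gives the number of rounds, where the samples are then
  counted.\<close>

theorem corollary8:
  fixes L w :: real
  assumes "0 < L" and "0 < w"
  shows "\<exists>cs C. positive_constants cs \<and> 0 < C \<and>
    (\<forall>\<nu>. 0 < \<nu> \<and> \<nu> \<le> L \<longrightarrow> (\<exists>\<delta>>0.
      \<forall>(pb :: ('a::{real_inner,second_countable_topology}, 'b::{real_inner,second_countable_topology}, 'z) minimax) W V \<sigma>.
        extra_setting pb W V L \<nu> \<and> least_nonzero_eig W = w \<and> 1 - second_eig W \<le> \<delta> \<and> 0 \<le> \<sigma> \<longrightarrow>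
        (\<exists>T0. \<forall>T\<ge>T0.
          (let c = page_extra cs (agents pb) W V (L / \<nu>) T in
             coin_prob c \<le> 1 \<and>
             (\<forall>r :: ('w, 'a, 'b, 'z) dama_run. dama_grace_run pb c \<sigma> T r \<longrightarrow>
                stationarity pb r T \<le> ennreal (C *
                  rate_bound (agents pb) (L / \<nu>) (1 - second_eig W)
                    (exp_primal_gap pb r) (exp_dual_gap pb r) (\<sigma>\<^sup>2) (zeta_sq pb c r) T)))))) \<and>
    (\<forall>G0 D0 S0 Z0. \<exists>C'>0. \<forall>\<nu>. 0 < \<nu> \<and> \<nu> \<le> L \<longrightarrow> (\<exists>\<delta>>0.
      \<forall>(pb :: ('a, 'b, 'z) minimax) W V \<sigma>.
        extra_setting pb W V L \<nu> \<and> least_nonzero_eig W = w \<and> 1 - second_eig W \<le> \<delta> \<and>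
        0 \<le> \<sigma> \<and> \<sigma>\<^sup>2 \<le> S0 \<longrightarrow>
        (let K = real (agents pb); \<kappa> = L / \<nu>; gap = 1 - second_eig W;
             cfg = page_extra cs (agents pb) W V \<kappa>
         in \<exists>\<epsilon>0>0. \<forall>\<epsilon>. 0 < \<epsilon> \<and> \<epsilon> < \<epsilon>0 \<longrightarrow>
           (\<exists>N. real N \<le> C' * (\<kappa>\<^sup>2 / (\<epsilon>\<^sup>2 * gap powr (3/2)) + \<kappa>\<^sup>2 / \<epsilon>\<^sup>2 + \<kappa>\<^sup>2 / \<epsilon>\<^sup>2 * gap) \<and>
                real N \<le> C' * (\<kappa>\<^sup>2 / (\<epsilon>\<^sup>2 * gap powr (3/2))) \<and>
                expected_samples (cfg N) N \<le> C' * (\<kappa>^3 / (\<epsilon>^3 * gap powr (3/2) * K) + \<kappa> / (\<epsilon> * K)) \<and>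
                (\<forall>T\<ge>N. coin_prob (cfg T) \<le> 1 \<and>
                  (\<forall>r :: ('w, 'a, 'b, 'z) dama_run.
                     dama_grace_run pb (cfg T) \<sigma> T r \<and> exp_primal_gap pb r \<le> G0 \<and>
                     exp_dual_gap pb r \<le> D0 \<and> zeta_sq pb (cfg T) r \<le> Z0 \<longrightarrow>
                     stationarity pb r T \<le> ennreal (\<epsilon>\<^sup>2)))))))"
proof -
  let ?cs = "page_constants_of L" and ?C = "rate_constant L"
  have L: "0 < L" by fact
  have pos: "positive_constants ?cs" using L by (simp add: positive_constants_def page_constants_of_def step_constant_def)
  have C1: "1 \<le> ?C" "0 < ?C"
  proof -
    have *: "0 \<le> 60 * sqrt 2 * L" using L by simp
    have "1 \<le> 1536 * (x + 40)" if "0 \<le> x" for x :: real using that by simp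
    then show "1 \<le> ?C" using * unfolding rate_constant_def by blast
    then show "0 < ?C" by linarith
  qed
  have gap: "0 < 1 - second_eig W" "1 - second_eig W \<le> 1" "0 < agents pb" "1 \<le> L / \<nu>"
    if "extra_setting pb W V L \<nu>" for pb :: "('a, 'b, 'z) minimax" and W V \<nu>
    using that mixing_mat_gap[of "agents pb" W] by (auto simp: extra_setting_def)
  have coin: "coin_prob (page_extra ?cs k W V \<kappa> T) \<le> 1"
    if "0 < 1 - second_eig W" "1 \<le> real T * (1 - second_eig W) powr (3/2)" for k W V \<kappa> T
    using coin_prob_le_one[OF that] by (simp add: page_extra_def page_constants_of_def Let_def divide_le_eq_1)
  show ?thesis
  proof (rule exI[of _ ?cs], rule exI[of _ ?C], intro conjI pos C1(2) allI impI)
    fix \<nu> assume "0 < \<nu> \<and> \<nu> \<le> L"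
    show "\<exists>\<delta>>0. \<forall>(pb :: ('a, 'b, 'z) minimax) W V \<sigma>.
        extra_setting pb W V L \<nu> \<and> least_nonzero_eig W = w \<and> 1 - second_eig W \<le> \<delta> \<and> 0 \<le> \<sigma> \<longrightarrow>
        (\<exists>T0. \<forall>T\<ge>T0.
          (let c = page_extra ?cs (agents pb) W V (L / \<nu>) T in
             coin_prob c \<le> 1 \<and>
             (\<forall>r :: ('w, 'a, 'b, 'z) dama_run. dama_grace_run pb c \<sigma> T r \<longrightarrow>
                stationarity pb r T \<le> ennreal (?C *
                  rate_bound (agents pb) (L / \<nu>) (1 - second_eig W)
                    (exp_primal_gap pb r) (exp_dual_gap pb r) (\<sigma>\<^sup>2) (zeta_sq pb c r) T))))"
    proof (intro exI[of _ "1 :: real"] conjI allI impI)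
      fix pb :: "('a, 'b, 'z) minimax" and W V and \<sigma> :: real
      assume "extra_setting pb W V L \<nu> \<and> least_nonzero_eig W = w \<and> 1 - second_eig W \<le> 1 \<and> 0 \<le> \<sigma>"
      then have st: "extra_setting pb W V L \<nu>" by simp
      let ?a = "(1 - second_eig W) powr (3/2)"
      have a: "0 < ?a" using gap(1)[OF st] by simp
      show "\<exists>T0. \<forall>T\<ge>T0.
          (let c = page_extra ?cs (agents pb) W V (L / \<nu>) T in
             coin_prob c \<le> 1 \<and>
             (\<forall>r :: ('w, 'a, 'b, 'z) dama_run. dama_grace_run pb c \<sigma> T r \<longrightarrow>
                stationarity pb r T \<le> ennreal (?C *
                  rate_bound (agents pb) (L / \<nu>) (1 - second_eig W)
                    (exp_primal_gap pb r) (exp_dual_gap pb r) (\<sigma>\<^sup>2) (zeta_sq pb c r) T)))"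
        unfolding Let_def
      \<comment> \<open>The quotient makes the coin probability at most 1; the added 1 excludes
        \<open>T = 0\<close>.\<close>
      proof (intro exI[of _ "nat \<lceil>1 / ?a\<rceil> + 1"] allI impI conjI)
        fix T assume T: "nat \<lceil>1 / ?a\<rceil> + 1 \<le> T"
        have "1 / ?a \<le> real T" using T real_nat_ceiling_ge[of "1 / ?a"] by linarith
        then have large: "1 \<le> real T * ?a" using a by (simp add: pos_divide_le_eq)
        show "coin_prob (page_extra ?cs (agents pb) W V (L / \<nu>) T) \<le> 1"
          by (rule coin[OF gap(1)[OF st] large])
        fix r :: "('w, 'a, 'b, 'z) dama_run"
        assume "dama_grace_run pb (page_extra ?cs (agents pb) W V (L / \<nu>) T) \<sigma> T r"
        from extra_run_rate(1)[OF L st _ large this] T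
        show "stationarity pb r T \<le> ennreal (?C *
                  rate_bound (agents pb) (L / \<nu>) (1 - second_eig W)
                    (exp_primal_gap pb r) (exp_dual_gap pb r) (\<sigma>\<^sup>2)
                    (zeta_sq pb (page_extra ?cs (agents pb) W V (L / \<nu>) T) r) T)"
          by simp
      qed
    qed simp
  next
    fix G0 D0 S0 Z0 :: real
    \<comment> \<open>The bounds \<open>G0\<close>, \<open>D0\<close>, \<open>S0\<close>,
      \<open>Z0\<close> may be negative, hence absolute values; the 1 keeps \<open>A\<close> away
      from zero.\<close>
    define A where "A = 1 + \<bar>G0\<bar> + \<bar>D0\<bar> + \<bar>S0\<bar> + \<bar>Z0\<bar>"
    have A: "1 \<le> A" "G0 \<le> A" "D0 \<le> A" "S0 \<le> A" "Z0 \<le> A" by (auto simp: A_def)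
    \<comment> \<open>The 6 of \<open>rate_bound_le\<close>, doubled for rounding the number of
      rounds upwards.\<close>
    define Q where "Q = 12 * ?C * A"
    have CA: "1 \<le> ?C * A" using mult_mono[of 1 ?C 1 A] C1 A by simp
    have Q: "1 \<le> Q" using CA by (simp add: Q_def)
    have QQ: "Q \<le> 4 * Q\<^sup>2"
    proof -
      have "Q * 1 \<le> Q * Q" using Q by (intro mult_left_mono) auto
      then show ?thesis using Q by (simp add: power2_eq_square)
    qed
    show "\<exists>C'>0. \<forall>\<nu>. 0 < \<nu> \<and> \<nu> \<le> L \<longrightarrow> (\<exists>\<delta>>0.
      \<forall>(pb :: ('a, 'b, 'z) minimax) W V \<sigma>.
        extra_setting pb W V L \<nu> \<and> least_nonzero_eig W = w \<and> 1 - second_eig W \<le> \<delta> \<and>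
        0 \<le> \<sigma> \<and> \<sigma>\<^sup>2 \<le> S0 \<longrightarrow>
        (let K = real (agents pb); \<kappa> = L / \<nu>; gap = 1 - second_eig W;
             cfg = page_extra ?cs (agents pb) W V \<kappa>
         in \<exists>\<epsilon>0>0. \<forall>\<epsilon>. 0 < \<epsilon> \<and> \<epsilon> < \<epsilon>0 \<longrightarrow>
           (\<exists>N. real N \<le> C' * (\<kappa>\<^sup>2 / (\<epsilon>\<^sup>2 * gap powr (3/2)) + \<kappa>\<^sup>2 / \<epsilon>\<^sup>2 + \<kappa>\<^sup>2 / \<epsilon>\<^sup>2 * gap) \<and>
                real N \<le> C' * (\<kappa>\<^sup>2 / (\<epsilon>\<^sup>2 * gap powr (3/2))) \<and>
                expected_samples (cfg N) N \<le> C' * (\<kappa>^3 / (\<epsilon>^3 * gap powr (3/2) * K) + \<kappa> / (\<epsilon> * K)) \<and>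
                (\<forall>T\<ge>N. coin_prob (cfg T) \<le> 1 \<and>
                  (\<forall>r :: ('w, 'a, 'b, 'z) dama_run.
                     dama_grace_run pb (cfg T) \<sigma> T r \<and> exp_primal_gap pb r \<le> G0 \<and>
                     exp_dual_gap pb r \<le> D0 \<and> zeta_sq pb (cfg T) r \<le> Z0 \<longrightarrow>
                     stationarity pb r T \<le> ennreal (\<epsilon>\<^sup>2))))))"
      unfolding Let_def
    \<comment> \<open>The factor of \<open>expected_samples_le\<close>; it also bounds the rounds,
      as \<open>Q \<le> 4 * Q\<^sup>2\<close> by \<open>QQ\<close>.\<close>
    proof (rule exI[of _ "4 * Q\<^sup>2"], intro conjI allI impI, goal_cases)
      case 1
      then show ?case using Q by simp
    next
      case (2 \<nu>)
      show ?case
      proof (rule exI[of _ "1 :: real"], intro conjI allI impI, goal_cases)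
        case 1
        then show ?case by simp
      next
        case (2 pb W V \<sigma>)
        then have st: "extra_setting pb W V L \<nu>" and \<sigma>: "\<sigma>\<^sup>2 \<le> S0" by auto
        let ?g = "1 - second_eig W" and ?\<kappa> = "L / \<nu>"
        let ?a = "?g powr (3/2)"
        \<comment> \<open>Three thresholds on \<open>T\<close>: at least one round, a coin
          probability of at most 1, and the condition \<open>2 K \<le> a t\<close> of
          \<open>rate_bound_le\<close>.\<close>
        define R where "R = max 1 (max (1 / ?a) (4 * (real (agents pb))\<^sup>2 / ?a))"
        have a: "0 < ?a" using gap(1)[OF st] by simp
        have \<kappa>: "1 \<le> ?\<kappa>" by (rule gap(4)[OF st])
        have R: "1 \<le> R" "1 / ?a \<le> R" "4 * (real (agents pb))\<^sup>2 / ?a \<le> R" by (auto simp: R_def)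
        \<comment> \<open>The value of \<open>\<epsilon>\<close> at which \<open>q\<close> equals
          \<open>R\<close>; below it, \<open>N\<close> exceeds every threshold.\<close>
        define \<epsilon>0 where "\<epsilon>0 = ?\<kappa> / sqrt (R * ?a)"
        have Ra: "0 < R * ?a" using R a by simp
        show ?case
        proof (rule exI[of _ \<epsilon>0], intro conjI allI impI, goal_cases)
          case 1
          have "0 < ?\<kappa>" using \<kappa> by linarith
          moreover have "0 < sqrt (R * ?a)" using Ra by simp
          ultimately show ?case unfolding \<epsilon>0_def by (rule divide_pos_pos)
        next
          case (2 \<epsilon>)
          then have e: "0 < \<epsilon>" "\<epsilon> < \<epsilon>0" by auto
          define q where "q = ?\<kappa>\<^sup>2 / (\<epsilon>\<^sup>2 * ?a)"
          have qR: "R \<le> q"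
          proof -
            have "\<epsilon>\<^sup>2 \<le> \<epsilon>0\<^sup>2" using e by (intro power_mono) auto
            also have "\<dots> = ?\<kappa>\<^sup>2 / (R * ?a)" using real_sqrt_pow2[OF less_imp_le[OF Ra]] unfolding \<epsilon>0_def power_divide[of ?\<kappa>] by (rule arg_cong)
            finally have "\<epsilon>\<^sup>2 * (R * ?a) \<le> ?\<kappa>\<^sup>2" using Ra by (simp add: pos_le_divide_eq)
            then show ?thesis using e a by (simp add: q_def pos_le_divide_eq ac_simps)
          qed
          define N where "N = nat \<lceil>6 * ?C * A * q\<rceil>"
          have q6: "q \<le> 6 * ?C * A * q"
          proof -
            have "1 * q \<le> (6 * (?C * A)) * q" using CA qR R by (intro mult_right_mono) auto
            then show ?thesis by (simp add: mult.assoc)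
          qed
          have N1: "6 * ?C * A * q \<le> real N" unfolding N_def by (rule real_nat_ceiling_ge)
          have N2: "real N \<le> Q * q"
          proof -
            have "real N \<le> 6 * ?C * A * q + 1" unfolding N_def using q6 qR R by linarith
            also have "\<dots> \<le> 6 * ?C * A * q + 6 * ?C * A * q" using q6 qR R by linarith
            finally show ?thesis by (simp add: Q_def ac_simps)
          qed
          have NR: "R \<le> real N" using N1 q6 qR by linarith
          have big: "1 \<le> T" "1 \<le> real T * ?a" "2 * real (agents pb) \<le> ?g powr (3/4) * sqrt (real T)" "6 * ?C * A * q \<le> real T"
            if "N \<le> T" for T
          proof -
            have RT: "R \<le> real T" "real N \<le> real T" using NR that by auto
            show "1 \<le> T" using RT R by linarith
            have "1 / ?a \<le> real T" using RT R by linarith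
            then show "1 \<le> real T * ?a" using a by (simp add: pos_divide_le_eq)
            have "4 * (real (agents pb))\<^sup>2 / ?a \<le> real T" using RT R by linarith
            then have "(2 * real (agents pb))\<^sup>2 \<le> (?g powr (3/4) * sqrt (real T))\<^sup>2"
              using a powr_as_powers(1)[OF gap(1)[OF st]] by (simp add: pos_divide_le_eq power_mult_distrib mult.commute)
            then show "2 * real (agents pb) \<le> ?g powr (3/4) * sqrt (real T)" by (rule power2_le_imp_le) simp
            show "6 * ?C * A * q \<le> real T" using N1 RT by linarith
          qed
          have q0: "0 \<le> q" using qR R by linarith
          have N3: "real N \<le> 4 * Q\<^sup>2 * q" using N2 mult_right_mono[OF QQ q0] by linarith
          show ?case
          proof (rule exI[of _ N], intro conjI allI impI, goal_cases)
            case 1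
            have "q \<le> ?\<kappa>\<^sup>2 / (\<epsilon>\<^sup>2 * ?a) + ?\<kappa>\<^sup>2 / \<epsilon>\<^sup>2 + ?\<kappa>\<^sup>2 / \<epsilon>\<^sup>2 * ?g" using gap(1)[OF st] by (simp add: q_def)
            then have "4 * Q\<^sup>2 * q \<le> 4 * Q\<^sup>2 * (?\<kappa>\<^sup>2 / (\<epsilon>\<^sup>2 * ?a) + ?\<kappa>\<^sup>2 / \<epsilon>\<^sup>2 + ?\<kappa>\<^sup>2 / \<epsilon>\<^sup>2 * ?g)"
              by (intro mult_left_mono) auto
            then show ?case using N3 by linarith
          next
            case 2
            then show ?case using N3 by (simp only: q_def)
          next
            case 3
            have "0 < N" using big(1)[OF order_refl] by simp
            then show ?case
              using \<kappa> by (intro expected_samples_le gap(1,2,3)[OF st] e(1) Q big(3)[OF order_refl] N2[unfolded q_def]) auto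
          next
            case (4 T)
            then show ?case using coin[OF gap(1)[OF st] big(2)] by simp
          next
            case (5 T r)
            then have T: "N \<le> T" and run: "dama_grace_run pb (page_extra ?cs (agents pb) W V ?\<kappa> T) \<sigma> T r"
              and bd: "exp_primal_gap pb r \<le> G0" "exp_dual_gap pb r \<le> D0" "zeta_sq pb (page_extra ?cs (agents pb) W V ?\<kappa> T) r \<le> Z0"
              by auto
            note B = big[OF T]
            note rate = extra_run_rate[OF L st B(1,2) run]
            have "rate_bound (agents pb) ?\<kappa> ?g (exp_primal_gap pb r) (exp_dual_gap pb r) (\<sigma>\<^sup>2)
                (zeta_sq pb (page_extra ?cs (agents pb) W V ?\<kappa> T) r) T \<le> 6 * A * ?\<kappa>\<^sup>2 / (real T * ?a)"
              using rate(2-4) bd A \<sigma> B(1) by (intro rate_bound_le gap[OF st] B(3)) auto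
            then have "?C * rate_bound (agents pb) ?\<kappa> ?g (exp_primal_gap pb r) (exp_dual_gap pb r) (\<sigma>\<^sup>2)
                (zeta_sq pb (page_extra ?cs (agents pb) W V ?\<kappa> T) r) T \<le> ?C * (6 * A * ?\<kappa>\<^sup>2 / (real T * ?a))"
              using C1 by (intro mult_left_mono) auto
            also have "\<dots> \<le> \<epsilon>\<^sup>2"
            proof -
              have "6 * ?C * A * ?\<kappa>\<^sup>2 \<le> real T * (\<epsilon>\<^sup>2 * ?a)"
                using B(4) e a by (simp add: q_def pos_divide_le_eq)
              then show ?thesis using a B(1) by (simp add: pos_divide_le_eq ac_simps)
            qed
            finally show ?case using rate(1) by (meson ennreal_leI order_trans)
          qed
        qed
      qed
    qed
  qed
qed

end
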